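(* Let $n\ge 6$ and let $\mu$ be a partition of $n$ with $(n-4,1^4)\le\mu\le(n)$ in reverse lexicographic order. Then $\psi_\mu=\sum_{\lambda\vdash n,\ (1^n)\le\lambda\le\mu}p_\lambda$ is Schur-positive.
   Context: $p_\lambda=\prod_i p_{\lambda_i}$ denotes the power sum symmetric function. Reverse lexicographic order on partitions of $n$ is the total order in which, for distinct partitions $\lambda,\mu$ of $n$, $\lambda>\mu$ iff $\lambda_j>\mu_j$ at the first index $j$ where they differ; $(1^n)$ is the minimum and $(n)$ the maximum. Schur-positive means a nonnegative integer combination of Schur functions. *)

theory Defs
  imports Main "HOL-Library.Poly_Mapping"
begin

(* Integer polynomials in the variables x_0, x_1, ...:
  monomials are finitely supported exponent vectors nat \<Rightarrow>\<^sub>0 nat. *)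
type_synonym mpoly = "(nat \<Rightarrow>\<^sub>0 nat) \<Rightarrow>\<^sub>0 int"

definition var :: "nat \<Rightarrow> mpoly" where
  "var i = Poly_Mapping.single (Poly_Mapping.single i 1) 1"

definition is_partition :: "nat \<Rightarrow> nat list \<Rightarrow> bool" where
  "is_partition n lam \<longleftrightarrow> sorted_wrt (\<ge>) lam \<and> (\<forall>a\<in>set lam. 0 < a) \<and> sum_list lam = n"

definition rlex_le :: "nat list \<Rightarrow> nat list \<Rightarrow> bool" where
  "rlex_le lam mu \<longleftrightarrow> lam = mu \<or>
     (\<exists>j < min (length lam) (length mu). take j lam = take j mu \<and> lam ! j < mu ! j)"

definition power_sum :: "nat \<Rightarrow> nat \<Rightarrow> mpoly" where
  "power_sum N k = (\<Sum>i<N. var i ^ k)"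

definition power_sum_part :: "nat \<Rightarrow> nat list \<Rightarrow> mpoly" where
  "power_sum_part N lam = prod_list (map (power_sum N) lam)"

definition cells :: "nat list \<Rightarrow> (nat \<times> nat) set" where
  "cells lam = {(i, j). i < length lam \<and> j < lam ! i}"

definition ssyt :: "nat \<Rightarrow> nat list \<Rightarrow> (nat \<times> nat \<Rightarrow> nat) set" where
  "ssyt N lam = {T. (\<forall>c. c \<notin> cells lam \<longrightarrow> T c = 0) \<and>
      (\<forall>c\<in>cells lam. T c < N) \<and>
      (\<forall>i j. (i, Suc j) \<in> cells lam \<longrightarrow> T (i, j) \<le> T (i, Suc j)) \<and>
      (\<forall>i j. (Suc i, j) \<in> cells lam \<longrightarrow> T (i, j) < T (Suc i, j))}"

definition schur :: "nat \<Rightarrow> nat list \<Rightarrow> mpoly" where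
  "schur N lam = (\<Sum>T\<in>ssyt N lam. \<Prod>c\<in>cells lam. var (T c))"

(* A homogeneous degree-n symmetric function (realised in N \<ge> n variables)
  is Schur-positive if it is a nonnegative integer combination of Schur functions. *)
definition schur_positive :: "nat \<Rightarrow> nat \<Rightarrow> mpoly \<Rightarrow> bool" where
  "schur_positive N n f \<longleftrightarrow>
     (\<exists>c :: nat list \<Rightarrow> nat. f = (\<Sum>nu\<in>{nu. is_partition n nu}. of_nat (c nu) * schur N nu))"

definition psi :: "nat \<Rightarrow> nat \<Rightarrow> nat list \<Rightarrow> mpoly" where
  "psi N n mu = (\<Sum>lam\<in>{lam. is_partition n lam \<and> rlex_le (replicate n 1) lam \<and> rlex_le lam mu}.
                   power_sum_part N lam)"

end

(*
  Idea.  Commuting pairs (g, h) of permutations turn the sum of all p_lambda, lambda a partition of n, into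
  a sum over lambda of the averages, over the centralizer of a permutation of cycle type lambda, of the
  power sums p_(cycle type h).  Each average is the Frobenius image of an induced trivial representation,
  hence Schur-positive.  Representations are avoided: in place of irreducible constituents, words are
  separated by a polynomial in the class sum of the transpositions (the Casimir operator), which turns a
  multiplicity into a sum of squares.

  If lambda = (j, rho) with j larger than all parts of rho, the centralizer is a product with a cyclic group C_j.
  Inducing the trivial character of C_j gives every hook with an even number r of rows below the first one at
  least once, because some r-subset of {1, ..., j-1} has sum divisible by j.  So psi_(n) dominates
  sum_j E_j psi_(n-j) over the large j, where p_j = E_j - O_j splits p_j into its even and odd hooks.  For n >= 11
  and first part m = n - k, k <= 4, removing the terms p_lambda with lambda > mu costs at most these terms, up to
  inequalities between symmetric functions of degree at most 5.  For n <= 10 the multiplicities are computed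
  by the Murnaghan-Nakayama rule.
*)
theory Submission
  imports Defs "HOL-Combinatorics.Combinatorics" "HOL-Computational_Algebra.Polynomial"
begin

section \<open>Alternating polynomials\<close>

text \<open>Nonnegativity is certified for one Schur function at a time. Multiplying by the
  Vandermonde alternant turns the multiplicity of \<open>schur N nu\<close> into the coefficient of
  one monomial, hence into a signed sum of traces over weight spaces of words, one for each
  permutation \<open>\<sigma>\<close>. The obstacle is to remove all terms but
  \<open>\<sigma> = id\<close>. Sorting the weight of any other term gives a partition with a
  strictly larger sum of squared beta numbers (\<open>level\<close>). This number is the Casimir
  eigenvalue, so the product of the factors Casimir - c over all larger levels c annihilates those
  terms and multiplies the multiplicity by a nonzero number. Applied twice, it makes the remaining
  trace a sum of squares. The bound 11 comes from the hooks. Where the removed terms have negative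
  multiplicities, O_m has to be covered, and E_m does not do it; p_1 E_(m-1) does. So j must run
  down to m - 1 and still exceed n - j, that is k + 2 < m, which for k \<le> 4 holds from n = 11
  on.\<close>

lemma adjacent_transpositions_induct [consumes 1, case_names id step]:
  assumes "\<sigma> permutes {..<N::nat}" and P_id: "P id"
    and step: "\<And>\<sigma> k. Suc k < N \<Longrightarrow> \<sigma> permutes {..<N} \<Longrightarrow> P \<sigma> \<Longrightarrow> P (\<sigma> \<circ> transpose k (Suc k))"
  shows "P \<sigma>"
proof -
  have transp: "P (\<sigma> \<circ> transpose a (a + d))"
    if "a + d < N" "\<sigma> permutes {..<N}" "P \<sigma>" for a d \<sigma>
    using that
  proof (induction d arbitrary: \<sigma>)
    case 0
    then show ?case by (simp add: comp_def)
  next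
    case (Suc d)
    let ?s = "transpose (a + d) (Suc (a + d))"
    have s: "?s permutes {..<N}" using Suc.prems by (intro permutes_swap_id) auto
    show ?case
    proof (cases "d = 0")
      case True
      then have eq: "transpose a (a + Suc d) = transpose a (Suc a)" by simp
      show ?thesis unfolding eq by (rule step) (use Suc.prems in auto)
    next
      case False
      have 1: "P (\<sigma> \<circ> ?s)" by (rule step) (use Suc.prems in auto)
      have p1: "\<sigma> \<circ> ?s permutes {..<N}" using s Suc.prems by (intro permutes_compose)
      have 2: "P (\<sigma> \<circ> ?s \<circ> transpose a (a + d))"
        by (rule Suc.IH[OF _ p1 1]) (use Suc.prems in auto)
      have p2: "\<sigma> \<circ> ?s \<circ> transpose a (a + d) permutes {..<N}"
        using p1 Suc.prems by (intro permutes_compose permutes_swap_id) auto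
      have 3: "P (\<sigma> \<circ> ?s \<circ> transpose a (a + d) \<circ> ?s)"
        by (rule step[OF _ p2 2]) (use Suc.prems in auto)
      \<comment> \<open>Conjugating by an adjacent swap lengthens a swap by one, so adjacent swaps
        generate. Only for these are the sign of the Vandermonde product and the Bender-Knuth
        involution easy to handle.\<close>
      have "?s \<circ> transpose a (a + d) \<circ> ?s = transpose a (a + Suc d)"
        using False by (auto simp: fun_eq_iff transpose_def)
      then show ?thesis using 3 by (metis comp_assoc)
    qed
  qed
  show ?thesis
    using finite_lessThan assms(1)
  proof (induction rule: permutes_rev_induct)
    case id
    then show ?case using P_id .
  next
    case (swap a b p)
    show ?case
    proof (cases "a \<le> b")
      case True
      then show ?thesis using transp[of a "b - a" p] swap by (simp add: comp_def)
    next
      case False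
      then show ?thesis using transp[of b "a - b" p] swap by (simp add: transpose_commute comp_def)
    qed
  qed
qed

section \<open>Monomials and alternants\<close>

definition expo :: "nat \<Rightarrow> (nat \<Rightarrow> nat) \<Rightarrow> (nat \<Rightarrow>\<^sub>0 nat)" where
  "expo N k = (\<Sum>i<N. Poly_Mapping.single i (k i))"

definition mon :: "nat \<Rightarrow> (nat \<Rightarrow> nat) \<Rightarrow> mpoly" where
  "mon N k = (\<Prod>i<N. var i ^ k i)"

lemma var_power: "var i ^ k = Poly_Mapping.single (Poly_Mapping.single i k) 1"
proof (induction k)
  case (Suc k)
  then show ?case by (simp add: var_def mult_single single_add[symmetric] add.commute)
qed simp

lemma mon_eq_single: "mon N k = Poly_Mapping.single (expo N k) 1"
  unfolding mon_def expo_def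
  by (induction N) (simp_all add: mult_single var_power add.commute)

lemma lookup_expo: "Poly_Mapping.lookup (expo N k) i = (if i < N then k i else 0)"
  unfolding expo_def by (auto simp: lookup_sum lookup_single when_def)

lemma expo_eq_iff: "expo N k = expo N l \<longleftrightarrow> (\<forall>i<N. k i = l i)"
  by (auto simp: poly_mapping_eq_iff fun_eq_iff lookup_expo)

lemma expo_add: "expo N (\<lambda>i. k i + l i) = expo N k + expo N l"
  by (simp add: expo_def single_add sum.distrib)

lemma mon_mult: "mon N k * mon N l = mon N (\<lambda>i. k i + l i)"
  by (simp add: mon_def prod.distrib power_add)

lemma mon_cong: "(\<And>i. i < N \<Longrightarrow> k i = l i) \<Longrightarrow> mon N k = mon N l"
  by (simp add: mon_def)

lemma lookup_mon: "Poly_Mapping.lookup (mon N k) (expo N l) = (if \<forall>i<N. k i = l i then 1 else 0)"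
  by (simp add: mon_eq_single lookup_single when_def expo_eq_iff)

lemma lookup_single_mult:
  fixes f :: mpoly
  shows "Poly_Mapping.lookup (Poly_Mapping.single a 1 * f) (a + b) = Poly_Mapping.lookup f b"
  by (rule frag_induction[of f UNIV])
    (simp_all add: mult_single lookup_single when_def right_diff_distrib lookup_minus)

lemma lookup_single_mult_0:
  fixes f :: mpoly
  assumes "\<And>c. b \<noteq> a + c"
  shows "Poly_Mapping.lookup (Poly_Mapping.single a 1 * f) b = 0"
  by (rule frag_induction[of f UNIV])
    (use assms in \<open>auto simp: mult_single lookup_single when_def right_diff_distrib lookup_minus\<close>)

lemma lookup_mon_mult:
  "Poly_Mapping.lookup (mon N k * f) (expo N b) =
    (if \<forall>i<N. k i \<le> b i then Poly_Mapping.lookup f (expo N (\<lambda>i. b i - k i)) else 0)"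
proof (cases "\<forall>i<N. k i \<le> b i")
  case True
  have "expo N b = expo N k + expo N (\<lambda>i. b i - k i)"
    unfolding expo_add[symmetric] using True by (simp add: expo_eq_iff)
  then show ?thesis using True by (simp add: mon_eq_single lookup_single_mult)
next
  case False
  then obtain i where i: "i < N" "b i < k i" by auto
  have "expo N b \<noteq> expo N k + c" for c
  proof
    assume "expo N b = expo N k + c"
    then have "Poly_Mapping.lookup (expo N b) i = Poly_Mapping.lookup (expo N k + c) i" by simp
    then show False using i by (simp add: lookup_add lookup_expo)
  qed
  then show ?thesis unfolding mon_eq_single if_not_P[OF False] by (rule lookup_single_mult_0)
qed

lemma sum_permutes_compose_left:
  fixes f :: "(nat \<Rightarrow> nat) \<Rightarrow> 'a::comm_monoid_add"
  assumes "\<tau> permutes A"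
  shows "(\<Sum>\<sigma> | \<sigma> permutes A. f (\<tau> \<circ> \<sigma>)) = (\<Sum>\<sigma> | \<sigma> permutes A. f \<sigma>)"
  by (rule setum_permutations_compose_left[OF assms, symmetric])

lemma sum_permutes_compose_right:
  fixes f :: "(nat \<Rightarrow> nat) \<Rightarrow> 'a::comm_monoid_add"
  assumes "\<tau> permutes A"
  shows "(\<Sum>\<sigma> | \<sigma> permutes A. f (\<sigma> \<circ> \<tau>)) = (\<Sum>\<sigma> | \<sigma> permutes A. f \<sigma>)"
  by (rule sum_permutations_compose_right[OF assms, symmetric])

text \<open>The determinant of the matrix of powers \<open>var i ^ k j\<close>, with exponents as a
  function, so that permuting them is composition.\<close>

definition alt :: "nat \<Rightarrow> (nat \<Rightarrow> nat) \<Rightarrow> mpoly" where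
  "alt N k = (\<Sum>\<sigma> | \<sigma> permutes {..<N}. of_int (sign \<sigma>) * mon N (k \<circ> \<sigma>))"

lemma alt_cong: "(\<And>i. i < N \<Longrightarrow> k i = l i) \<Longrightarrow> alt N k = alt N l"
  unfolding alt_def
proof (rule sum.cong[OF refl], goal_cases)
  case (1 \<sigma>)
  then have "\<sigma> i < N" if "i < N" for i using that permutes_in_image[of \<sigma> "{..<N}" i] by auto
  then have "mon N (k \<circ> \<sigma>) = mon N (l \<circ> \<sigma>)" using 1 by (intro mon_cong) auto
  then show ?case by simp
qed

lemma permutes_lessThan_sign:
  assumes "\<sigma> permutes {..<N::nat}" "\<tau> permutes {..<N}"
  shows "sign (\<sigma> \<circ> \<tau>) = sign \<sigma> * sign \<tau>"
  using assms by (intro sign_compose permutes_imp_permutation[of "{..<N}"]) auto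

lemma alt_permute:
  assumes "\<tau> permutes {..<N}"
  shows "alt N (k \<circ> \<tau>) = of_int (sign \<tau>) * alt N k"
proof -
  have "alt N k = (\<Sum>\<sigma> | \<sigma> permutes {..<N}. of_int (sign (\<tau> \<circ> \<sigma>)) * mon N (k \<circ> (\<tau> \<circ> \<sigma>)))"
    unfolding alt_def
    by (rule sum_permutes_compose_left[OF assms, symmetric, where f="\<lambda>\<sigma>. of_int (sign \<sigma>) * mon N (k \<circ> \<sigma>)"])
  also have "\<dots> = of_int (sign \<tau>) * alt N (k \<circ> \<tau>)"
    unfolding alt_def sum_distrib_left
    by (rule sum.cong) (auto simp: permutes_lessThan_sign[OF assms] comp_assoc mult.assoc)
  finally have "alt N k = of_int (sign \<tau>) * alt N (k \<circ> \<tau>)" .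
  moreover have "(of_int (sign \<tau>) :: mpoly) * of_int (sign \<tau>) = 1"
    by (metis of_int_1 of_int_mult sign_idempotent)
  ultimately have "of_int (sign \<tau>) * alt N k = 1 * alt N (k \<circ> \<tau>)"
    by (simp only: mult.assoc[symmetric])
  then show ?thesis by simp
qed

lemma alt_swap:
  assumes "i < N" "j < N" "i \<noteq> j"
  shows "alt N (k \<circ> transpose i j) = - alt N k"
  using alt_permute[OF permutes_swap_id, of i N j k] assms by (simp add: sign_swap_id)

lemma alt_eq_0:
  assumes "i < N" "j < N" "i \<noteq> j" "k i = k j"
  shows "alt N k = 0"
proof -
  have "k \<circ> transpose i j = k" using assms(4) by (auto simp: fun_eq_iff transpose_def)
  then have "alt N k = - alt N k" using alt_swap[OF assms(1-3), of k] by simp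
  then have "2 * alt N k = 0" by simp
  then show ?thesis by simp
qed

text \<open>In the summand of the alternant for \<open>\<sigma>\<close> the weights may be replaced
  by \<open>w T \<circ> \<sigma>\<close>, since the sum over \<open>S\<close> is symmetric. Then
  both exponents are composed with \<open>\<sigma>\<close> and add up inside a new
  alternant.\<close>

lemma alt_mult_symmetric:
  assumes sym: "\<And>\<tau>. \<tau> permutes {..<N} \<Longrightarrow> (\<Sum>T\<in>S. mon N (w T \<circ> \<tau>)) = (\<Sum>T\<in>S. mon N (w T))"
  shows "alt N k * (\<Sum>T\<in>S. mon N (w T)) = (\<Sum>T\<in>S. alt N (\<lambda>i. k i + w T i))"
proof -
  have "(\<Sum>T\<in>S. alt N (\<lambda>i. k i + w T i)) =
    (\<Sum>\<sigma> | \<sigma> permutes {..<N}. \<Sum>T\<in>S. of_int (sign \<sigma>) * mon N ((\<lambda>i. k i + w T i) \<circ> \<sigma>))"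
    unfolding alt_def by (rule sum.swap)
  also have "\<dots> = (\<Sum>\<sigma> | \<sigma> permutes {..<N}. of_int (sign \<sigma>) * mon N (k \<circ> \<sigma>) * (\<Sum>T\<in>S. mon N (w T \<circ> \<sigma>)))"
    by (simp add: sum_distrib_left mult.assoc mon_mult comp_def)
  also have "\<dots> = (\<Sum>\<sigma> | \<sigma> permutes {..<N}. of_int (sign \<sigma>) * mon N (k \<circ> \<sigma>) * (\<Sum>T\<in>S. mon N (w T)))"
    by (rule sum.cong) (auto simp: sym)
  also have "\<dots> = alt N k * (\<Sum>T\<in>S. mon N (w T))"
    by (simp add: alt_def sum_distrib_right)
  finally show ?thesis by simp
qed

definition sdec :: "nat \<Rightarrow> (nat \<Rightarrow> nat) \<Rightarrow> bool" where
  "sdec N k \<longleftrightarrow> (\<forall>i j. i < j \<longrightarrow> j < N \<longrightarrow> k j < k i)"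

text \<open>Both arrangements being decreasing, \<open>\<sigma>\<close> is increasing on
  \<open>{..<N}\<close>, and an increasing permutation lies pointwise above the identity.\<close>

lemma sdec_permute_id:
  assumes "sdec N k" "sdec N (k \<circ> \<sigma>)" "\<sigma> permutes {..<N}"
  shows "\<sigma> = id"
proof (rule permutes_natset_ge[OF assms(3)])
  have lt: "\<sigma> i < N" if "i < N" for i using that permutes_in_image[OF assms(3), of i] by auto
  have less: "\<sigma> i < \<sigma> j" if "i < j" "j < N" for i j
  proof -
    have *: "k (\<sigma> j) < k (\<sigma> i)" using assms(2) that unfolding sdec_def by auto
    have "k (\<sigma> i) < k (\<sigma> j)" if "\<sigma> j < \<sigma> i"
      using assms(1) lt[of i] that \<open>i < j\<close> \<open>j < N\<close> unfolding sdec_def by auto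
    then have "\<not> \<sigma> j < \<sigma> i" using * by auto
    moreover have "\<sigma> j \<noteq> \<sigma> i" using * by auto
    ultimately show ?thesis by linarith
  qed
  show "\<forall>i\<in>{..<N}. i \<le> \<sigma> i"
  proof
    fix i assume "i \<in> {..<N}"
    then show "i \<le> \<sigma> i"
    proof (induction i)
      case (Suc i)
      then show ?case using less[of i "Suc i"] by fastforce
    qed simp
  qed
qed

lemma lookup_of_int_mult:
  fixes f :: mpoly
  shows "Poly_Mapping.lookup (of_int c * f) m = c * Poly_Mapping.lookup f m"
proof -
  have "(of_int c :: mpoly) = Poly_Mapping.single 0 (of_int c)" by (rule single_of_int[symmetric])
  then have "of_int c * f = Poly_Mapping.map ((*) c) f" by (simp add: mult_map_scale_conv_mult)
  then show ?thesis by (simp add: map.rep_eq when_def)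
qed

lemma lookup_alt:
  "Poly_Mapping.lookup (alt N k) m =
     (\<Sum>\<sigma> | \<sigma> permutes {..<N}. sign \<sigma> * Poly_Mapping.lookup (mon N (k \<circ> \<sigma>)) m)"
proof -
  show ?thesis by (simp add: alt_def lookup_sum lookup_of_int_mult)
qed

text \<open>A decreasing rearrangement of a decreasing vector is the vector itself, so only the
  identity term can hit the monomial. Alternants with decreasing exponents are thus dual to these
  monomials.\<close>

lemma lookup_alt_sdec:
  assumes "sdec N k" "sdec N l"
  shows "Poly_Mapping.lookup (alt N k) (expo N l) = (if \<forall>i<N. k i = l i then 1 else 0)"
proof -
  have *: "(\<forall>i<N. (k \<circ> \<sigma>) i = l i) \<longleftrightarrow> \<sigma> = id \<and> (\<forall>i<N. k i = l i)" if "\<sigma> permutes {..<N}" for \<sigma>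
  proof
    assume A: "\<forall>i<N. (k \<circ> \<sigma>) i = l i"
    then have "sdec N (k \<circ> \<sigma>)" using assms(2) unfolding sdec_def by auto
    then have "\<sigma> = id" using sdec_permute_id[OF assms(1) _ that] by simp
    then show "\<sigma> = id \<and> (\<forall>i<N. k i = l i)" using A by simp
  qed simp
  have "Poly_Mapping.lookup (alt N k) (expo N l) =
     (\<Sum>\<sigma> | \<sigma> permutes {..<N}. if \<sigma> = id then (if \<forall>i<N. k i = l i then 1 else 0) else 0)"
    unfolding lookup_alt lookup_mon by (rule sum.cong) (auto simp: * simp del: comp_apply)
  then show ?thesis by (simp add: finite_permutations permutes_id)
qed

lemma lookup_alt_permute:
  assumes "\<tau> permutes {..<N}"
  shows "Poly_Mapping.lookup (alt N k) (expo N (b \<circ> \<tau>)) = sign \<tau> * Poly_Mapping.lookup (alt N k) (expo N b)"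
proof -
  have perm: "(\<forall>i<N. (k \<circ> (\<sigma> \<circ> \<tau>)) i = (b \<circ> \<tau>) i) \<longleftrightarrow> (\<forall>i<N. (k \<circ> \<sigma>) i = b i)" for \<sigma>
  proof -
    have "(\<forall>i\<in>{..<N}. (k \<circ> \<sigma>) (\<tau> i) = b (\<tau> i)) \<longleftrightarrow> (\<forall>i\<in>\<tau> ` {..<N}. (k \<circ> \<sigma>) i = b i)" by auto
    then show ?thesis unfolding permutes_image[OF assms] by (simp add: Ball_def)
  qed
  have "Poly_Mapping.lookup (alt N k) (expo N (b \<circ> \<tau>)) =
    (\<Sum>\<sigma> | \<sigma> permutes {..<N}. sign (\<sigma> \<circ> \<tau>) * Poly_Mapping.lookup (mon N (k \<circ> (\<sigma> \<circ> \<tau>))) (expo N (b \<circ> \<tau>)))"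
    unfolding lookup_alt by (rule sum_permutes_compose_right[OF assms, symmetric])
  also have "\<dots> = (\<Sum>\<sigma> | \<sigma> permutes {..<N}. sign \<tau> * (sign \<sigma> * Poly_Mapping.lookup (mon N (k \<circ> \<sigma>)) (expo N b)))"
    unfolding lookup_mon perm by (rule sum.cong) (simp_all add: permutes_lessThan_sign[OF _ assms])
  finally show ?thesis by (simp add: lookup_alt sum_distrib_left)
qed

text \<open>A polynomial is an element of the free abelian group on the monomials, so \<open>frag_extend\<close> defines
  additive operators by their values on monomials.\<close>

definition rename_vars :: "(nat \<Rightarrow> nat) \<Rightarrow> mpoly \<Rightarrow> mpoly" where
  "rename_vars s = frag_extend (\<lambda>m. frag_of (Poly_Mapping.map_key s m))"

lemma frag_of_mult: "(frag_of a :: 'a::comm_monoid_add \<Rightarrow>\<^sub>0 int) * frag_of b = frag_of (a + b)"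
  by (simp add: mult_single)

lemma rename_vars_mult:
  assumes "inj s"
  shows "rename_vars s (f * g) = rename_vars s f * rename_vars s g"
proof (rule frag_induction[of f UNIV])
  fix x
  show "rename_vars s (frag_of x * g) = rename_vars s (frag_of x) * rename_vars s g"
    by (rule frag_induction[of g UNIV])
      (simp_all add: rename_vars_def frag_of_mult map_key_plus[OF assms] right_diff_distrib frag_extend_diff)
qed (simp_all add: rename_vars_def left_diff_distrib frag_extend_diff)

lemma rename_vars_1: "inj s \<Longrightarrow> rename_vars s 1 = 1"
proof -
  assume "inj s"
  then have "Poly_Mapping.map_key s (0 :: nat \<Rightarrow>\<^sub>0 nat) = 0" by (simp add: map_key_zero)
  then have "rename_vars s (frag_of 0) = frag_of 0" by (simp only: rename_vars_def frag_extend_of)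
  then show ?thesis by simp
qed

lemma rename_vars_prod: "inj s \<Longrightarrow> rename_vars s (\<Prod>x\<in>A. f x) = (\<Prod>x\<in>A. rename_vars s (f x))"
  by (induction A rule: infinite_finite_induct) (simp_all add: rename_vars_1 rename_vars_mult)

lemma lookup_rename_vars:
  assumes "bij s"
  shows "Poly_Mapping.lookup (rename_vars s f) (Poly_Mapping.map_key s m) = Poly_Mapping.lookup f m"
proof -
  have inj: "Poly_Mapping.map_key s a = Poly_Mapping.map_key s b \<longleftrightarrow> a = b" for a b :: "nat \<Rightarrow>\<^sub>0 nat"
  proof
    assume eq: "Poly_Mapping.map_key s a = Poly_Mapping.map_key s b"
    show "a = b"
    proof (rule poly_mapping_eqI)
      fix j
      obtain i where i: "j = s i" using assms by (metis bij_pointE)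
      have "Poly_Mapping.lookup (Poly_Mapping.map_key s a) i = Poly_Mapping.lookup (Poly_Mapping.map_key s b) i"
        using eq by simp
      then show "Poly_Mapping.lookup a j = Poly_Mapping.lookup b j"
        using assms by (simp add: map_key.rep_eq bij_is_inj i)
    qed
  qed simp
  show ?thesis
    by (rule frag_induction[of f UNIV])
      (simp_all add: rename_vars_def lookup_single when_def inj frag_extend_diff lookup_minus)
qed

lemma map_key_expo:
  assumes "s permutes {..<N}"
  shows "Poly_Mapping.map_key s (expo N k) = expo N (k \<circ> s)"
  using assms permutes_in_image[OF assms]
  by (auto simp: poly_mapping_eq_iff map_key.rep_eq permutes_inj lookup_expo fun_eq_iff)

lemma rename_vars_var:
  assumes "s \<circ> s = id"
  shows "rename_vars s (var i) = var (s i)"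
proof -
  have ss: "s (s i) = i" for i using fun_cong[OF assms, of i] by simp
  then have "inj s" by (intro inj_on_inverseI[where g=s])
  moreover note ss
  ultimately show ?thesis
    using map_key_single[of s "s i" "1::nat"] by (simp add: var_def rename_vars_def)
qed

section \<open>The Vandermonde product\<close>

definition idx_pairs :: "nat \<Rightarrow> (nat \<times> nat) set" where
  "idx_pairs N = {(a, b). a < b \<and> b < N}"

lemma finite_idx_pairs [simp]: "finite (idx_pairs N)"
  by (rule finite_subset[of _ "{..<N} \<times> {..<N}"]) (auto simp: idx_pairs_def)

text \<open>The product form of the staircase alternant. Coefficients are read from the alternant,
  but the Casimir computation divides by single factors \<open>var a - var b\<close>, which only the
  product shows.\<close>

definition vand :: "nat \<Rightarrow> mpoly" where
  "vand N = (\<Prod>(a, b)\<in>idx_pairs N. var a - var b)"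

definition vand_quot :: "nat \<Rightarrow> nat \<Rightarrow> nat \<Rightarrow> mpoly" where
  "vand_quot N a b = (\<Prod>(c, d)\<in>idx_pairs N - {(a, b)}. var c - var d)"

lemma vand_quot: "(a, b) \<in> idx_pairs N \<Longrightarrow> vand N = (var a - var b) * vand_quot N a b"
  unfolding vand_def vand_quot_def by (subst prod.remove[of _ "(a, b)"]) auto

lemma rename_vars_diff: "rename_vars s (f - g) = rename_vars s f - rename_vars s g"
  by (simp add: rename_vars_def frag_extend_diff)

text \<open>An adjacent swap permutes the pairs \<open>a < b\<close> other than
  \<open>(k, Suc k)\<close> among themselves, so exactly one factor changes its sign.\<close>

lemma rename_vars_vand:
  assumes "Suc k < N"
  shows "rename_vars (transpose k (Suc k)) (vand N) = - vand N"
proof -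
  let ?s = "transpose k (Suc k)"
  have inj: "inj ?s" by simp
  have kk: "(k, Suc k) \<in> idx_pairs N" using assms by (simp add: idx_pairs_def)
  have "rename_vars ?s (vand_quot N k (Suc k)) = (\<Prod>(c, d)\<in>idx_pairs N - {(k, Suc k)}. var (?s c) - var (?s d))"
    unfolding vand_quot_def rename_vars_prod[OF inj]
    by (rule prod.cong) (auto simp: rename_vars_diff rename_vars_var)
  also have "\<dots> = vand_quot N k (Suc k)"
    unfolding vand_quot_def
    by (rule prod.reindex_bij_witness[of _ "\<lambda>(c, d). (?s c, ?s d)" "\<lambda>(c, d). (?s c, ?s d)"])
      (use assms in \<open>auto simp: idx_pairs_def transpose_def split: if_splits\<close>)
  finally have "rename_vars ?s (vand_quot N k (Suc k)) = vand_quot N k (Suc k)" .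
  moreover have "rename_vars ?s (var k - var (Suc k)) = - (var k - var (Suc k))"
    by (simp add: rename_vars_diff rename_vars_var)
  ultimately show ?thesis
    unfolding vand_quot[OF kk] rename_vars_mult[OF inj] by (simp only: mult_minus_left)
qed

lemma lookup_vand_permute:
  assumes "\<sigma> permutes {..<N}"
  shows "Poly_Mapping.lookup (vand N) (expo N (k \<circ> \<sigma>)) = sign \<sigma> * Poly_Mapping.lookup (vand N) (expo N k)"
  using assms
proof (induction rule: adjacent_transpositions_induct)
  case (step \<sigma> j)
  let ?s = "transpose j (Suc j)"
  have s: "?s permutes {..<N}" using step by (intro permutes_swap_id) auto
  have "Poly_Mapping.lookup (vand N) (expo N (k \<circ> (\<sigma> \<circ> ?s))) =
    - Poly_Mapping.lookup (rename_vars ?s (vand N)) (Poly_Mapping.map_key ?s (expo N (k \<circ> \<sigma>)))"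
    using step by (simp add: rename_vars_vand map_key_expo[OF s] comp_assoc)
  also have "\<dots> = - Poly_Mapping.lookup (vand N) (expo N (k \<circ> \<sigma>))" by (simp add: lookup_rename_vars)
  also have "\<dots> = sign (\<sigma> \<circ> ?s) * Poly_Mapping.lookup (vand N) (expo N k)"
    using step permutes_lessThan_sign[OF step(2) s] by (simp add: sign_swap_id comp_def)
  finally show ?case .
qed simp

lemma keys_prod_le:
  fixes f :: "'b \<Rightarrow> mpoly"
  assumes "finite A" "\<And>p m. p \<in> A \<Longrightarrow> m \<in> Poly_Mapping.keys (f p) \<Longrightarrow> Poly_Mapping.lookup m i \<le> c p"
    "m \<in> Poly_Mapping.keys (\<Prod>p\<in>A. f p)"
  shows "Poly_Mapping.lookup m i \<le> (\<Sum>p\<in>A. c p)"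
  using assms
proof (induction A arbitrary: m rule: finite_induct)
  case empty
  then show ?case by (simp split: if_splits)
next
  case (insert x F)
  then have "m \<in> Poly_Mapping.keys (f x * prod f F)" by simp
  then obtain a b where ab: "m = a + b" "a \<in> Poly_Mapping.keys (f x)" "b \<in> Poly_Mapping.keys (prod f F)"
    using keys_mult[of "f x" "prod f F"] by auto
  then have "Poly_Mapping.lookup a i \<le> c x" "Poly_Mapping.lookup b i \<le> sum c F"
    using insert by auto
  then show ?case using insert(1,2) ab(1) by (simp add: lookup_add add_mono)
qed

lemma keys_vand:
  assumes "m \<in> Poly_Mapping.keys (vand N)"
  shows "Poly_Mapping.lookup m i \<le> (if i < N then N - 1 else 0)"
proof -
  let ?c = "\<lambda>(a, b). if i = a \<or> i = b then 1 else 0 :: nat"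
  have "Poly_Mapping.lookup m i \<le> sum ?c (idx_pairs N)"
  proof (rule keys_prod_le[where f="\<lambda>(a, b). var a - var b"])
    fix p m assume "p \<in> idx_pairs N" "m \<in> Poly_Mapping.keys (case p of (a, b) \<Rightarrow> var a - var b)"
    then show "Poly_Mapping.lookup m i \<le> ?c p"
      by (cases p) (auto dest!: subsetD[OF keys_diff] simp: var_def lookup_single when_def)
  qed (use assms in \<open>auto simp: vand_def\<close>)
  also have "sum ?c (idx_pairs N) = card {p \<in> idx_pairs N. i = fst p \<or> i = snd p}"
    by (simp add: sum.inter_filter[symmetric] case_prod_beta card_eq_sum del: sum_constant One_nat_def)
  also have "\<dots> \<le> (if i < N then N - 1 else 0)"
  proof (cases "i < N")
    case True
    \<comment> \<open>For a pair that contains \<open>i\<close>, the number \<open>a + b - i\<close>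
      is its other member.\<close>
    have "card {p \<in> idx_pairs N. i = fst p \<or> i = snd p} \<le> card ({..<N} - {i})"
      by (rule card_inj_on_le[of "\<lambda>(a, b). a + b - i"]) (use True in \<open>auto simp: inj_on_def idx_pairs_def\<close>)
    then show ?thesis using True by simp
  next
    case False
    then have "{p \<in> idx_pairs N. i = fst p \<or> i = snd p} = {}" by (auto simp: idx_pairs_def)
    then show ?thesis using False by simp
  qed
  finally show ?thesis .
qed

definition stair :: "nat \<Rightarrow> nat \<Rightarrow> nat" where
  "stair N i = N - 1 - i"

lemma sdec_stair: "sdec N (stair N)"
  by (auto simp: sdec_def stair_def)

text \<open>An antisymmetric polynomial has only monomials with pairwise distinct exponents. Here
  they are at most \<open>N - 1\<close>, so they permute the staircase, and one coefficient
  determines all others. The constant stays anonymous because it is cancelled where the identity is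
  applied.\<close>

lemma vand_conv_alt: "\<exists>c. c \<noteq> 0 \<and> vand N = of_int c * alt N (stair N)"
proof (intro exI conjI)
  let ?c = "Poly_Mapping.lookup (vand N) (expo N (stair N))"
  have perm: "Poly_Mapping.lookup (vand N) (expo N (stair N \<circ> \<sigma>)) =
     ?c * Poly_Mapping.lookup (alt N (stair N)) (expo N (stair N \<circ> \<sigma>))" if "\<sigma> permutes {..<N}" for \<sigma>
    using lookup_vand_permute[OF that, of "stair N"] lookup_alt_permute[OF that, of "stair N" "stair N"]
    by (simp add: lookup_alt_sdec sdec_stair)
  show eq: "vand N = of_int ?c * alt N (stair N)"
  proof (rule poly_mapping_eqI)
    fix m
    show "Poly_Mapping.lookup (vand N) m = Poly_Mapping.lookup (of_int ?c * alt N (stair N)) m"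
    proof (cases "\<exists>\<sigma>. \<sigma> permutes {..<N} \<and> m = expo N (stair N \<circ> \<sigma>)")
      case True
      then show ?thesis using perm by (auto simp: lookup_of_int_mult)
    next
      case False
      then have "Poly_Mapping.lookup (alt N (stair N)) m = 0"
        by (auto simp: lookup_alt mon_eq_single lookup_single when_def intro!: sum.neutral)
      moreover have "Poly_Mapping.lookup (vand N) m = 0"
      proof (rule ccontr)
        assume nz: "Poly_Mapping.lookup (vand N) m \<noteq> 0"
        define k where "k = Poly_Mapping.lookup m"
        have le: "k i \<le> (if i < N then N - 1 else 0)" for i
          unfolding k_def by (rule keys_vand) (use nz in \<open>simp add: in_keys_iff\<close>)
        then have m: "m = expo N k"
        proof (intro poly_mapping_eqI)
          fix i
          show "Poly_Mapping.lookup m i = Poly_Mapping.lookup (expo N k) i"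
            using le[of i] by (simp add: lookup_expo k_def split: if_splits)
        qed
        have inj: "inj_on k {..<N}"
        proof (rule inj_onI, rule ccontr)
          fix i j assume ij: "i \<in> {..<N}" "j \<in> {..<N}" "k i = k j" "i \<noteq> j"
          have "k \<circ> transpose i j = k" using ij by (auto simp: fun_eq_iff transpose_def)
          then have "Poly_Mapping.lookup (vand N) m = - Poly_Mapping.lookup (vand N) m"
            using lookup_vand_permute[OF permutes_swap_id[of i "{..<N}" j], of k] ij
            by (simp add: m sign_swap_id)
          then show False using nz by simp
        qed
        define \<sigma> where "\<sigma> i = (if i < N then N - 1 - k i else i)" for i
        have "inj_on \<sigma> {..<N}"
        proof (rule inj_onI)
          fix i j assume ij: "i \<in> {..<N}" "j \<in> {..<N}" "\<sigma> i = \<sigma> j"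
          then have "k i = k j" using le[of i] le[of j] by (auto simp: \<sigma>_def)
          then show "i = j" using inj_onD[OF inj] ij by auto
        qed
        moreover have "\<sigma> ` {..<N} \<subseteq> {..<N}" by (auto simp: \<sigma>_def)
        ultimately have "\<sigma> permutes {..<N}"
          by (intro inj_imp_permutes) (auto simp: \<sigma>_def)
        moreover have "m = expo N (stair N \<circ> \<sigma>)"
          unfolding m expo_eq_iff
        proof (intro allI impI)
          fix i assume "i < N"
          then show "k i = (stair N \<circ> \<sigma>) i" using le[of i] by (simp add: \<sigma>_def stair_def)
        qed
        ultimately show False using False by blast
      qed
      ultimately show ?thesis by (simp add: lookup_of_int_mult)
    qed
  qed
  have "var a - var b \<noteq> 0" if "a < b" for a b
  proof
    assume "var a - var b = 0"
    then have "var a = var b" by simp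
    then have "Poly_Mapping.single a (1::nat) = Poly_Mapping.single b 1"
      unfolding var_def frag_of_eq .
    then have "Poly_Mapping.lookup (Poly_Mapping.single a (1::nat)) a = Poly_Mapping.lookup (Poly_Mapping.single b 1) a"
      by simp
    then show False using that by (simp add: lookup_single when_def)
  qed
  then have "vand N \<noteq> 0" unfolding vand_def by (subst prod_zero_iff) (auto simp: idx_pairs_def simp del: finite_idx_pairs intro: finite_idx_pairs[unfolded idx_pairs_def])
  then show "?c \<noteq> 0" using eq by auto
qed

lemma alt_stair_nonzero: "alt N (stair N) \<noteq> 0"
  using lookup_alt_sdec[OF sdec_stair sdec_stair, of N] by auto

section \<open>Euler operators and their conjugation by the Vandermonde alternant\<close>

definition weight_op :: "((nat \<Rightarrow>\<^sub>0 nat) \<Rightarrow> int) \<Rightarrow> mpoly \<Rightarrow> mpoly" where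
  "weight_op \<phi> = frag_extend (\<lambda>m. frag_cmul (\<phi> m) (frag_of m))"

lemma weight_op_diff: "weight_op \<phi> (f - g) = weight_op \<phi> f - weight_op \<phi> g"
  by (simp add: weight_op_def frag_extend_diff)

lemma weight_op_add: "weight_op \<phi> (f + g) = weight_op \<phi> f + weight_op \<phi> g"
  by (simp add: weight_op_def frag_extend_add)

lemma weight_op_0: "weight_op \<phi> 0 = 0"
  by (simp add: weight_op_def)

lemma weight_op_sum: "weight_op \<phi> (\<Sum>x\<in>A. f x) = (\<Sum>x\<in>A. weight_op \<phi> (f x))"
  by (induction A rule: infinite_finite_induct) (simp_all add: weight_op_add weight_op_0)

lemma frag_cmul_conv_mult: "frag_cmul c (f :: mpoly) = of_int c * f"
  by (rule poly_mapping_eqI) (simp add: lookup_of_int_mult)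

lemma weight_op_frag_of: "weight_op \<phi> (frag_of m) = of_int (\<phi> m) * frag_of m"
  by (simp add: weight_op_def frag_cmul_conv_mult)

lemma lookup_weight_op: "Poly_Mapping.lookup (weight_op \<phi> f) m = \<phi> m * Poly_Mapping.lookup f m"
  by (rule frag_induction[of f UNIV])
    (auto simp: weight_op_0 weight_op_diff weight_op_frag_of lookup_of_int_mult lookup_minus
      lookup_single when_def right_diff_distrib)

text \<open>The Euler operator x_i d/dx_i rather than the plain derivative: it is diagonal on
  monomials.\<close>

definition deriv_var :: "nat \<Rightarrow> mpoly \<Rightarrow> mpoly" where
  "deriv_var i = weight_op (\<lambda>m. int (Poly_Mapping.lookup m i))"

text \<open>The sum of the squared Euler operators. Conjugated by the Vandermonde alternant it
  becomes, up to a constant, the class sum of the transpositions.\<close>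

definition sq_op :: "nat \<Rightarrow> mpoly \<Rightarrow> mpoly" where
  "sq_op N = weight_op (\<lambda>m. \<Sum>i<N. (int (Poly_Mapping.lookup m i))\<^sup>2)"

lemma deriv_var_diff: "deriv_var i (f - g) = deriv_var i f - deriv_var i g"
  by (simp add: deriv_var_def weight_op_diff)

lemma deriv_var_mult: "deriv_var i (f * g) = deriv_var i f * g + f * deriv_var i g"
proof (rule frag_induction[of f UNIV])
  fix x
  show "deriv_var i (frag_of x * g) = deriv_var i (frag_of x) * g + frag_of x * deriv_var i g"
  proof (rule frag_induction[of g UNIV])
    fix y
    show "deriv_var i (frag_of x * frag_of y) = deriv_var i (frag_of x) * frag_of y + frag_of x * deriv_var i (frag_of y)"
      by (simp only: deriv_var_def frag_of_mult weight_op_frag_of lookup_add of_nat_add of_int_add)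
        (simp add: frag_of_mult[symmetric] algebra_simps)
  qed (simp_all add: deriv_var_def weight_op_diff weight_op_0 algebra_simps)
qed (simp_all add: deriv_var_def left_diff_distrib weight_op_diff weight_op_0)

lemma sq_op_mult:
  "sq_op N (f * g) = sq_op N f * g + f * sq_op N g + 2 * (\<Sum>i<N. deriv_var i f * deriv_var i g)"
proof (rule frag_induction[of f UNIV])
  fix x
  show "sq_op N (frag_of x * g) = sq_op N (frag_of x) * g + frag_of x * sq_op N g
      + 2 * (\<Sum>i<N. deriv_var i (frag_of x) * deriv_var i g)"
  proof (rule frag_induction[of g UNIV])
    fix y
    have "(\<Sum>i<N. (int (Poly_Mapping.lookup (x + y) i))\<^sup>2) =
      (\<Sum>i<N. (int (Poly_Mapping.lookup x i))\<^sup>2) + (\<Sum>i<N. (int (Poly_Mapping.lookup y i))\<^sup>2)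
      + 2 * (\<Sum>i<N. int (Poly_Mapping.lookup x i) * int (Poly_Mapping.lookup y i))"
      by (simp add: lookup_add power2_sum sum.distrib sum_distrib_left mult.assoc)
    moreover have "(\<Sum>i<N. deriv_var i (frag_of x) * deriv_var i (frag_of y)) =
      of_int (\<Sum>i<N. int (Poly_Mapping.lookup x i) * int (Poly_Mapping.lookup y i)) * frag_of (x + y)"
      by (simp add: deriv_var_def weight_op_frag_of frag_of_mult[symmetric] sum_distrib_left sum_distrib_right mult_ac del: of_int_of_nat_eq)
    ultimately show "sq_op N (frag_of x * frag_of y) = sq_op N (frag_of x) * frag_of y + frag_of x * sq_op N (frag_of y)
      + 2 * (\<Sum>i<N. deriv_var i (frag_of x) * deriv_var i (frag_of y))"
      by (simp only: sq_op_def frag_of_mult weight_op_frag_of of_int_add of_int_mult of_int_numeral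
          mult.assoc mult.left_commute[of "frag_of x"]) (simp add: frag_of_mult algebra_simps)
  qed (simp_all add: sq_op_def deriv_var_def weight_op_diff weight_op_0 right_diff_distrib sum_subtractf)
qed (simp_all add: sq_op_def deriv_var_def left_diff_distrib weight_op_diff weight_op_0 sum_subtractf right_diff_distrib)

lemma deriv_var_prod:
  assumes "finite A"
  shows "deriv_var i (\<Prod>x\<in>A. f x) = (\<Sum>x\<in>A. deriv_var i (f x) * (\<Prod>y\<in>A - {x}. f y))"
  using assms
proof (induction A rule: finite_induct)
  case empty
  have "deriv_var i (frag_of 0) = 0" unfolding deriv_var_def weight_op_frag_of by simp
  then show ?case by simp
next
  case (insert a A)
  have "(\<Prod>y\<in>insert a A - {x}. f y) = f a * (\<Prod>y\<in>A - {x}. f y)" if "x \<in> A" for x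
  proof -
    have "insert a A - {x} = insert a (A - {x})" using that insert by auto
    then show ?thesis using insert by simp
  qed
  moreover have "insert a A - {a} = A" using insert by auto
  ultimately show ?case using insert
    by (simp add: deriv_var_mult sum_distrib_left mult_ac)
qed

lemma deriv_var_var: "deriv_var i (var a) = (if i = a then var a else 0)"
  by (simp add: deriv_var_def var_def weight_op_frag_of lookup_single when_def)

text \<open>Logarithmic differentiation: the factor \<open>var a - var b\<close> is seen only by the
  Euler operators at \<open>a\<close> and \<open>b\<close>.\<close>

lemma sum_deriv_var_vand:
  "(\<Sum>c<N. deriv_var c (vand N) * Y c) =
    (\<Sum>(a, b)\<in>idx_pairs N. vand_quot N a b * (var a * Y a - var b * Y b))"
proof -
  have "deriv_var c (vand N) =
    (\<Sum>(a, b)\<in>idx_pairs N. deriv_var c (var a - var b) * vand_quot N a b)" for c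
    unfolding vand_def vand_quot_def by (simp add: deriv_var_prod case_prod_beta)
  then have "(\<Sum>c<N. deriv_var c (vand N) * Y c) =
    (\<Sum>c<N. \<Sum>(a, b)\<in>idx_pairs N. vand_quot N a b * (deriv_var c (var a - var b) * Y c))"
    by (simp add: sum_distrib_left sum_distrib_right case_prod_beta mult_ac)
  also have "\<dots> = (\<Sum>(a, b)\<in>idx_pairs N. vand_quot N a b * (\<Sum>c<N. deriv_var c (var a - var b) * Y c))"
    by (subst sum.swap) (simp add: sum_distrib_left case_prod_beta)
  also have "\<dots> = (\<Sum>(a, b)\<in>idx_pairs N. vand_quot N a b * (var a * Y a - var b * Y b))"
  proof (rule sum.cong[OF refl], clarify)
    fix a b assume "(a, b) \<in> idx_pairs N"
    then have ab: "a < N" "b < N" by (auto simp: idx_pairs_def)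
    have "(\<Sum>c<N. deriv_var c (var a - var b) * Y c) =
      (\<Sum>c<N. if c = a then var a * Y a else 0) - (\<Sum>c<N. if c = b then var b * Y b else 0)"
      unfolding sum_subtractf[symmetric]
      by (rule sum.cong) (auto simp: deriv_var_var deriv_var_diff left_diff_distrib)
    then show "vand_quot N a b * (\<Sum>c<N. deriv_var c (var a - var b) * Y c) = vand_quot N a b * (var a * Y a - var b * Y b)"
      using ab by simp
  qed
  finally show ?thesis .
qed

lemma sum_idx_pairs:
  fixes Y :: "nat \<Rightarrow> 'a::comm_ring_1"
  shows "(\<Sum>(a, b)\<in>idx_pairs N. Y a + Y b) = of_nat (N - 1) * (\<Sum>c<N. Y c)"
proof (induction N)
  case 0
  have "idx_pairs 0 = {}" by (auto simp: idx_pairs_def)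
  then show ?case by simp
next
  case (Suc N)
  have eq: "idx_pairs (Suc N) = idx_pairs N \<union> (\<lambda>a. (a, N)) ` {..<N}" by (auto simp: idx_pairs_def)
  have "(\<Sum>(a, b)\<in>idx_pairs (Suc N). Y a + Y b) =
    (\<Sum>(a, b)\<in>idx_pairs N. Y a + Y b) + (\<Sum>(a, b)\<in>(\<lambda>a. (a, N)) ` {..<N}. Y a + Y b)"
    unfolding eq by (rule sum.union_disjoint[OF finite_idx_pairs]) (auto simp: idx_pairs_def)
  also have "(\<Sum>(a, b)\<in>(\<lambda>a. (a, N)) ` {..<N}. Y a + Y b) = (\<Sum>a<N. Y a) + of_nat N * Y N"
    by (subst sum.reindex) (auto simp: inj_on_def sum.distrib)
  finally show ?case using Suc by (cases N) (simp_all add: algebra_simps)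
qed

text \<open>All monomials of the alternant have permuted staircase exponents, hence the same sum of
  squares.\<close>

lemma sq_op_alt_stair: "sq_op N (alt N (stair N)) = of_int (\<Sum>i<N. (int (stair N i))\<^sup>2) * alt N (stair N)"
proof (rule poly_mapping_eqI)
  fix m
  have "Poly_Mapping.lookup (alt N (stair N)) m = 0 \<or> (\<Sum>i<N. (int (Poly_Mapping.lookup m i))\<^sup>2) = (\<Sum>i<N. (int (stair N i))\<^sup>2)"
  proof (rule disjCI)
    assume "(\<Sum>i<N. (int (Poly_Mapping.lookup m i))\<^sup>2) \<noteq> (\<Sum>i<N. (int (stair N i))\<^sup>2)"
    moreover have "(\<Sum>i<N. (int (stair N (\<sigma> i)))\<^sup>2) = (\<Sum>i<N. (int (stair N i))\<^sup>2)" if "\<sigma> permutes {..<N}" for \<sigma>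
      using sum.permute[OF that, of "\<lambda>i. (int (stair N i))\<^sup>2"] by (simp add: comp_def)
    ultimately have "m \<noteq> expo N (stair N \<circ> \<sigma>)" if "\<sigma> permutes {..<N}" for \<sigma>
      using that by (auto simp: lookup_expo)
    then show "Poly_Mapping.lookup (alt N (stair N)) m = 0"
      by (auto simp: lookup_alt mon_eq_single lookup_single when_def intro!: sum.neutral)
  qed
  then show "Poly_Mapping.lookup (sq_op N (alt N (stair N))) m =
    Poly_Mapping.lookup (of_int (\<Sum>i<N. (int (stair N i))\<^sup>2) * alt N (stair N)) m"
    unfolding sq_op_def lookup_weight_op lookup_of_int_mult by auto
qed

text \<open>The cross terms of the product rule contain the quotients (x_a Y_a - x_b Y_b) / (x_a -
  x_b), where Y_c is the Euler derivative of \<open>G\<close> at c. Such a quotient equals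
  \<open>B a b\<close> + Y_a + Y_b, and homogeneity of degree \<open>n\<close> turns the sum of all
  Y_a + Y_b into (N - 1) n G. For \<open>G = fixpoly N n h\<close> the polynomials
  \<open>B a b\<close> will count exchanges of letters.\<close>

lemma sq_op_alt_mult:
  assumes B: "\<And>a b. (a, b) \<in> idx_pairs N \<Longrightarrow>
      (var a - var b) * B a b = var b * deriv_var a G - var a * deriv_var b G"
    and Y: "(\<Sum>c<N. deriv_var c G) = of_nat n * G"
  shows "sq_op N (alt N (stair N) * G) =
    alt N (stair N) * (sq_op N G + 2 * (\<Sum>(a, b)\<in>idx_pairs N. B a b) +
      of_int ((\<Sum>i<N. (int (stair N i))\<^sup>2) + 2 * int (N - 1) * int n) * G)"
proof -
  let ?Y = "\<lambda>c. deriv_var c G"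
  let ?V = "alt N (stair N)"
  \<comment> \<open>The computation takes place in the product form; the constant is cancelled at
    the end.\<close>
  obtain c where c: "c \<noteq> 0" "vand N = of_int c * ?V" using vand_conv_alt by blast
  have dV: "deriv_var d (vand N) = of_int c * deriv_var d ?V" for d
    unfolding c(2) by (rule poly_mapping_eqI) (simp add: deriv_var_def lookup_weight_op lookup_of_int_mult)
  have "vand N * (\<Sum>(a, b)\<in>idx_pairs N. B a b) = (\<Sum>(a, b)\<in>idx_pairs N. vand N * B a b)"
    by (simp add: sum_distrib_left case_prod_beta)
  also have "\<dots> = (\<Sum>(a, b)\<in>idx_pairs N. vand_quot N a b * (var a * ?Y a - var b * ?Y b) - vand N * (?Y a + ?Y b))"
  proof (rule sum.cong[OF refl], clarify)
    fix a b assume ab: "(a, b) \<in> idx_pairs N"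
    have "vand N * B a b = vand_quot N a b * ((var a - var b) * B a b)"
      unfolding vand_quot[OF ab] by (simp add: mult_ac)
    also have "\<dots> = vand_quot N a b * (var a * ?Y a - var b * ?Y b) - (var a - var b) * vand_quot N a b * (?Y a + ?Y b)"
      unfolding B[OF ab] by (simp add: algebra_simps)
    finally show "vand N * B a b = vand_quot N a b * (var a * ?Y a - var b * ?Y b) - vand N * (?Y a + ?Y b)"
      unfolding vand_quot[OF ab] .
  qed
  also have "\<dots> = (\<Sum>(a, b)\<in>idx_pairs N. vand_quot N a b * (var a * ?Y a - var b * ?Y b)) -
      vand N * (\<Sum>(a, b)\<in>idx_pairs N. ?Y a + ?Y b)"
    by (simp add: sum_subtractf sum_distrib_left case_prod_beta)
  also have "\<dots> = (\<Sum>c<N. deriv_var c (vand N) * ?Y c) - vand N * (of_nat (N - 1) * (of_nat n * G))"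
    by (simp only: sum_deriv_var_vand sum_idx_pairs Y)
  finally have "of_int c * (?V * (\<Sum>(a, b)\<in>idx_pairs N. B a b)) =
    of_int c * ((\<Sum>c<N. deriv_var c ?V * ?Y c) - ?V * (of_nat (N - 1) * (of_nat n * G)))"
    unfolding dV unfolding c(2) by (simp add: algebra_simps sum_distrib_left)
  then have "?V * (\<Sum>(a, b)\<in>idx_pairs N. B a b) =
    (\<Sum>c<N. deriv_var c ?V * ?Y c) - ?V * (of_nat (N - 1) * (of_nat n * G))"
    using c(1) by simp
  then have "(\<Sum>c<N. deriv_var c ?V * ?Y c) = ?V * (\<Sum>(a, b)\<in>idx_pairs N. B a b) + ?V * (of_nat (N - 1) * (of_nat n * G))"
    by simp
  then show ?thesis
    unfolding sq_op_mult sq_op_alt_stair by (simp add: algebra_simps)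
qed

section \<open>Products with Schur functions\<close>

lemma cells_down:
  assumes "sorted_wrt (\<ge>) la" "(i, c) \<in> cells la" "i' \<le> i" "c' \<le> c"
  shows "(i', c') \<in> cells la"
proof -
  have "la ! i \<le> la ! i'"
    using assms sorted_wrt_nth_less[OF assms(1), of i' i] by (cases "i' = i") (auto simp: cells_def)
  then show ?thesis using assms by (auto simp: cells_def)
qed

lemma finite_cells [simp]: "finite (cells la)"
proof -
  have "cells la = (SIGMA i:{..<length la}. {..<la ! i})" by (auto simp: cells_def)
  then show ?thesis by simp
qed

lemma cells_col_le: "(i, c) \<in> cells la \<Longrightarrow> c < sum_list la"
  using member_le_sum_list[of "la ! i" la] by (fastforce simp: cells_def)

lemma finite_ssyt [simp]: "finite (ssyt N la)"
  by (rule finite_subset[OF _ finite_set_of_finite_funs[of "cells la" "{..<N}" 0]])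
    (auto simp: ssyt_def)

section \<open>Weights of tableaux and the Bender-Knuth involution\<close>

definition wt :: "nat list \<Rightarrow> (nat \<times> nat \<Rightarrow> nat) \<Rightarrow> nat \<Rightarrow> nat" where
  "wt la T v = card {p \<in> cells la. T p = v}"

lemma prod_var_eq_mon:
  assumes "T \<in> ssyt N la"
  shows "(\<Prod>c\<in>cells la. var (T c)) = mon N (wt la T)"
proof -
  have "(\<Prod>c\<in>cells la. var (T c)) = (\<Prod>v\<in>{..<N}. \<Prod>c\<in>{c \<in> cells la. T c = v}. var (T c))"
    by (rule prod.group[symmetric]) (use assms in \<open>auto simp: ssyt_def\<close>)
  also have "\<dots> = mon N (wt la T)"
    unfolding mon_def wt_def by (rule prod.cong) (auto simp: prod_constant[symmetric] simp del: prod_constant)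
  finally show ?thesis .
qed

lemma schur_eq_sum_mon: "schur N la = (\<Sum>T\<in>ssyt N la. mon N (wt la T))"
  unfolding schur_def by (rule sum.cong) (simp_all add: prod_var_eq_mon)

text \<open>An entry \<open>k\<close> or \<open>Suc k\<close> is free if its column does not contain
  both values. As columns increase strictly, a partner can only be the cell directly below or
  above.\<close>

definition free :: "nat list \<Rightarrow> (nat \<times> nat \<Rightarrow> nat) \<Rightarrow> nat \<Rightarrow> nat \<Rightarrow> nat \<Rightarrow> bool" where
  "free la T k i c \<longleftrightarrow> (i, c) \<in> cells la \<and>
     (T (i, c) = k \<and> \<not> ((Suc i, c) \<in> cells la \<and> T (Suc i, c) = Suc k) \<or>
      T (i, c) = Suc k \<and> (\<forall>i'. i = Suc i' \<longrightarrow> T (i', c) \<noteq> k))"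

definition frees :: "nat list \<Rightarrow> (nat \<times> nat \<Rightarrow> nat) \<Rightarrow> nat \<Rightarrow> nat \<Rightarrow> nat \<Rightarrow> nat set" where
  "frees la T k j i = {c. c < j \<and> free la T k i c}"

text \<open>The involution exchanges this number with the number of free entries \<open>k\<close> in
  the row.\<close>

definition ups :: "nat list \<Rightarrow> (nat \<times> nat \<Rightarrow> nat) \<Rightarrow> nat \<Rightarrow> nat \<Rightarrow> nat \<Rightarrow> nat" where
  "ups la T k j i = card {c \<in> frees la T k j i. T (i, c) = Suc k}"

text \<open>The Bender-Knuth involution for the entries \<open>k\<close>, \<open>k + 1\<close>, restricted to the first \<open>j\<close> columns.\<close>

definition bk :: "nat list \<Rightarrow> nat \<Rightarrow> nat \<Rightarrow> (nat \<times> nat \<Rightarrow> nat) \<Rightarrow> nat \<times> nat \<Rightarrow> nat" where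
  "bk la k j T = (\<lambda>(i, c). if c \<in> frees la T k j i then
      (if card {c' \<in> frees la T k j i. c' < c} < ups la T k j i then k else Suc k) else T (i, c))"

lemma finite_frees [simp]: "finite (frees la T k j i)"
  by (rule finite_subset[of _ "{..<j}"]) (auto simp: frees_def)

text \<open>Counts the cells of a row into which \<open>bk\<close> writes \<open>k\<close>: those
  whose rank among the free cells is below \<open>ups\<close>.\<close>

lemma card_rank_less:
  fixes F :: "nat set"
  assumes "finite F" "u \<le> card F"
  shows "card {c \<in> F. card {c' \<in> F. c' < c} < u} = u"
  using assms
proof (induction F arbitrary: u rule: finite_linorder_max_induct)
  case (insert b A)
  have bA: "b \<notin> A" using insert by auto
  have r: "{c' \<in> insert b A. c' < c} = {c' \<in> A. c' < c}" if "c \<in> A" for c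
    using insert that by auto
  have rb: "{c' \<in> insert b A. c' < b} = A" using insert by auto
  show ?case
  proof (cases "u \<le> card A")
    case True
    have "{c \<in> insert b A. card {c' \<in> insert b A. c' < c} < u} = {c \<in> A. card {c' \<in> A. c' < c} < u}"
      using True r rb by auto
    then show ?thesis using insert True by simp
  next
    case False
    then have u: "u = Suc (card A)" using insert.prems insert.hyps bA by simp
    have "card {c' \<in> A. c' < c} \<le> card A" for c using insert by (intro card_mono) auto
    then have "{c \<in> insert b A. card {c' \<in> insert b A. c' < c} < u} = insert b A"
      using u r rb by (auto simp: less_Suc_eq_le)
    then show ?thesis using u insert.hyps bA by simp
  qed
qed simp

text \<open>The involution acts only in the columns left of \<open>j\<close>. At the border a
  changed entry \<open>Suc k\<close> could meet an unchanged \<open>k\<close> on its right; the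
  condition on column \<open>j\<close> excludes this.\<close>

locale tableau =
  fixes N :: nat and la :: "nat list" and T :: "nat \<times> nat \<Rightarrow> nat" and k j :: nat
  assumes sorted: "sorted_wrt (\<ge>) la" and T: "T \<in> ssyt N la"
    and k: "Suc k < N" and column: "\<And>i. (i, j) \<in> cells la \<Longrightarrow> T (i, j) \<noteq> k"
begin

abbreviation "T' \<equiv> bk la k j T"

lemma row_le: "c \<le> c' \<Longrightarrow> (i, c') \<in> cells la \<Longrightarrow> T (i, c) \<le> T (i, c')"
proof (induction c' rule: dec_induct)
  case (step d)
  have "(i, d) \<in> cells la" using cells_down[OF sorted step.prems] by simp
  then show ?case using step T by (force simp: ssyt_def)
qed simp

lemma col_less: "(Suc i, c) \<in> cells la \<Longrightarrow> T (i, c) < T (Suc i, c)"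
  using T by (simp add: ssyt_def)

lemma free_values: "free la T k i c \<Longrightarrow> T (i, c) = k \<or> T (i, c) = Suc k"
  by (auto simp: free_def)

lemma free_below: "free la T k i c \<Longrightarrow> (Suc i, c) \<in> cells la \<Longrightarrow> Suc k < T (Suc i, c)"
  using col_less[of i c] by (auto simp: free_def)

lemma free_above: "free la T k (Suc i) c \<Longrightarrow> T (i, c) < k"
  using col_less[of i c] by (auto simp: free_def)

lemma T'_free: "c \<in> frees la T k j i \<Longrightarrow> T' (i, c) = k \<or> T' (i, c) = Suc k"
  by (simp add: bk_def)

lemma T'_notfree: "c \<notin> frees la T k j i \<Longrightarrow> T' (i, c) = T (i, c)"
  by (simp add: bk_def)

lemma frees_values: "c \<in> frees la T k j i \<Longrightarrow> T (i, c) = k \<or> T (i, c) = Suc k"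
  by (simp add: frees_def free_values)

lemma not_free_of_value: "T (i, c) \<noteq> k \<Longrightarrow> T (i, c) \<noteq> Suc k \<Longrightarrow> c \<notin> frees la T k j i"
  using frees_values by blast

lemma T'_beyond: "j \<le> c \<Longrightarrow> T' (i, c) = T (i, c)"
  by (rule T'_notfree) (auto simp: frees_def)

lemma T'_col_less:
  assumes "(Suc i, c) \<in> cells la"
  shows "T' (i, c) < T' (Suc i, c)"
proof (cases "c \<in> frees la T k j i")
  case True
  then have "Suc k < T (Suc i, c)" using free_below assms by (auto simp: frees_def)
  then have "T' (Suc i, c) = T (Suc i, c)" "Suc k < T (Suc i, c)"
    using not_free_of_value[of "Suc i" c] T'_notfree by auto
  then show ?thesis using T'_free[OF True] by auto
next
  case False
  then have eq: "T' (i, c) = T (i, c)" by (rule T'_notfree)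
  show ?thesis
  proof (cases "c \<in> frees la T k j (Suc i)")
    case True
    then have "T (i, c) < k" using free_above by (auto simp: frees_def)
    then show ?thesis using eq T'_free[OF True] by auto
  next
    case False
    then show ?thesis using eq T'_notfree[OF False] col_less[OF assms] by simp
  qed
qed

text \<open>If the left cell were paired with a \<open>k\<close> above it, weak rows and strict
  columns would put a \<open>k\<close> above the right cell as well.\<close>

lemma free_step_left:
  assumes "free la T k i (Suc c)" "T (i, Suc c) = Suc k" "T (i, c) = Suc k"
  shows "free la T k i c"
proof -
  have sc: "(i, Suc c) \<in> cells la" using assms(1) by (simp add: free_def)
  then have c: "(i, c) \<in> cells la" by (rule cells_down[OF sorted]) auto
  have "T (i', c) \<noteq> k" if "i = Suc i'" for i'
  proof
    assume eq: "T (i', c) = k"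
    have "(i', Suc c) \<in> cells la" using cells_down[OF sorted sc] that by simp
    then have "k \<le> T (i', Suc c)" using row_le[of c "Suc c" i'] eq by simp
    moreover have "T (i', Suc c) < Suc k" using col_less[of i' "Suc c"] sc assms(2) that by simp
    ultimately show False using assms(1,2) that by (auto simp: free_def)
  qed
  then show ?thesis using c assms(3) by (simp add: free_def)
qed

lemma free_step_right:
  assumes "free la T k i c" "T (i, c) = k" "T (i, Suc c) = k" "(i, Suc c) \<in> cells la"
  shows "free la T k i (Suc c)"
proof -
  have "T (Suc i, Suc c) \<noteq> Suc k" if "(Suc i, Suc c) \<in> cells la"
  proof
    assume eq: "T (Suc i, Suc c) = Suc k"
    have sc: "(Suc i, c) \<in> cells la" by (rule cells_down[OF sorted that]) auto
    have "T (Suc i, c) \<le> Suc k" using row_le[of c "Suc c" "Suc i"] that eq by simp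
    moreover have "k < T (Suc i, c)" using col_less[OF sc] assms(2) by simp
    ultimately show False using assms(1,2) sc by (auto simp: free_def)
  qed
  then show ?thesis using assms by (auto simp: free_def)
qed

lemma T'_row_le:
  assumes "(i, Suc c) \<in> cells la"
  shows "T' (i, c) \<le> T' (i, Suc c)"
proof -
  have le: "T (i, c) \<le> T (i, Suc c)" using row_le[of c "Suc c" i] assms by simp
  consider (both) "c \<in> frees la T k j i" "Suc c \<in> frees la T k j i"
    | (left) "c \<in> frees la T k j i" "Suc c \<notin> frees la T k j i"
    | (right) "c \<notin> frees la T k j i" "Suc c \<in> frees la T k j i"
    | (none) "c \<notin> frees la T k j i" "Suc c \<notin> frees la T k j i" by blast
  then show ?thesis
  proof cases
    case both
    have "card {c' \<in> frees la T k j i. c' < c} \<le> card {c' \<in> frees la T k j i. c' < Suc c}"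
      by (rule card_mono) auto
    then show ?thesis using both by (auto simp: bk_def)
  next
    case left
    have "T (i, Suc c) \<noteq> k"
    proof
      assume eq: "T (i, Suc c) = k"
      then have "T (i, c) = k" using le frees_values[OF left(1)] by auto
      then have "free la T k i (Suc c)" using free_step_right eq assms left(1) by (auto simp: frees_def)
      \<comment> \<open>The cell in column \<open>Suc c\<close> is free, so it can be missing from
        \<open>frees\<close> only by lying in column \<open>j\<close>.\<close>
      then have "j = Suc c" using left by (auto simp: frees_def)
      then show False using column[of i] assms eq by simp
    qed
    then have "Suc k \<le> T (i, Suc c)" using le frees_values[OF left(1)] by auto
    then show ?thesis using T'_free[OF left(1)] T'_notfree[OF left(2)] by auto
  next
    case right
    have "T (i, c) \<noteq> Suc k"
    proof
      assume eq: "T (i, c) = Suc k"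
      then have "T (i, Suc c) = Suc k" using le frees_values[OF right(2)] by auto
      then have "free la T k i c" using free_step_left eq right(2) by (auto simp: frees_def)
      then show False using right by (auto simp: frees_def)
    qed
    then have "T (i, c) \<le> k" using le frees_values[OF right(2)] by auto
    then show ?thesis using T'_free[OF right(2)] T'_notfree[OF right(1)] by auto
  next
    case none
    then show ?thesis using le T'_notfree by simp
  qed
qed

lemma T'_ssyt: "T' \<in> ssyt N la"
proof -
  have "T' p = 0" if "p \<notin> cells la" for p
    using that T by (cases p) (auto simp: bk_def frees_def free_def ssyt_def)
  moreover have "T' p < N" if "p \<in> cells la" for p
    using that T k by (cases p) (auto simp: bk_def ssyt_def)
  ultimately show ?thesis using T'_row_le T'_col_less by (simp add: ssyt_def)
qed

text \<open>Paired entries are not moved and keep blocking the same cells. The set of free cells is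
  therefore stable, which is what makes the construction an involution.\<close>

lemma free_T': "free la T' k i c \<longleftrightarrow> free la T k i c"
proof (cases "j \<le> c")
  case True
  then show ?thesis by (simp add: free_def T'_beyond)
next
  case cj: False
  show ?thesis
  proof (cases "free la T k i c")
    case True
    then have f: "c \<in> frees la T k j i" using cj by (simp add: frees_def)
    have "T' (Suc i, c) \<noteq> Suc k" if "(Suc i, c) \<in> cells la"
    proof -
      have "Suc k < T (Suc i, c)" using free_below[OF True that] .
      then show ?thesis using T'_notfree not_free_of_value by (metis n_not_Suc_n less_irrefl not_less_eq Suc_lessD)
    qed
    moreover have "T' (i', c) \<noteq> k" if "i = Suc i'" for i'
    proof -
      have "T (i', c) < k" using free_above True that by simp
      then show ?thesis using T'_notfree[OF not_free_of_value[of i' c]] by simp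
    qed
    ultimately show ?thesis using True T'_free[OF f] by (auto simp: free_def)
  next
    case False
    then have eq: "T' (i, c) = T (i, c)" by (intro T'_notfree) (auto simp: frees_def)
    have "\<not> free la T' k i c" if cell: "(i, c) \<in> cells la"
    proof -
      consider "T (i, c) = k" | "T (i, c) = Suc k" | "T (i, c) \<noteq> k" "T (i, c) \<noteq> Suc k" by blast
      then show ?thesis
      proof cases
        case 1
        then have below: "(Suc i, c) \<in> cells la" "T (Suc i, c) = Suc k"
          using False cell by (auto simp: free_def)
        then have "c \<notin> frees la T k j (Suc i)" using 1 by (auto simp: frees_def free_def)
        then have "T' (Suc i, c) = Suc k" using T'_notfree below by simp
        then show ?thesis using 1 eq below by (simp add: free_def)
      next
        case 2
        then obtain i' where i': "i = Suc i'" "T (i', c) = k" using False cell by (auto simp: free_def)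
        then have "c \<notin> frees la T k j i'" using 2 cell by (auto simp: frees_def free_def)
        then have "T' (i', c) = k" using T'_notfree i' by simp
        then show ?thesis using 2 eq i' by (simp add: free_def)
      qed (use eq in \<open>auto simp: free_def\<close>)
    qed
    then show ?thesis using False by (auto simp: free_def)
  qed
qed

lemma frees_T': "frees la T' k j i = frees la T k j i"
  by (simp add: frees_def free_T')

lemma ups_le: "ups la T k j i \<le> card (frees la T k j i)"
  unfolding ups_def by (rule card_mono) auto

lemma card_T'_k: "card {c \<in> frees la T k j i. T' (i, c) = k} = ups la T k j i"
proof -
  have "{c \<in> frees la T k j i. T' (i, c) = k} =
    {c \<in> frees la T k j i. card {c' \<in> frees la T k j i. c' < c} < ups la T k j i}"
    by (auto simp: bk_def)
  then show ?thesis using card_rank_less[OF finite_frees ups_le] by simp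
qed

lemma card_T'_Suc: "ups la T' k j i = card (frees la T k j i) - ups la T k j i"
proof -
  have "{c \<in> frees la T k j i. T' (i, c) = Suc k} =
    frees la T k j i - {c \<in> frees la T k j i. T' (i, c) = k}"
    using T'_free by auto
  then show ?thesis
    unfolding ups_def[of la T'] frees_T' by (simp add: card_Diff_subset card_T'_k)
qed

lemma tableau_T': "tableau N la T' k j"
  using sorted T'_ssyt k column by (unfold_locales) (auto simp: T'_beyond)

lemma bk_bk: "bk la k j T' = T"
proof
  fix p :: "nat \<times> nat"
  obtain i c where p: "p = (i, c)" by force
  let ?F = "frees la T k j i"
  show "bk la k j T' p = T p"
  proof (cases "c \<in> ?F")
    case False
    then show ?thesis by (simp add: p bk_def[of la k j T'] frees_T' T'_notfree)
  next
    case True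
    define Z where "Z = {c \<in> ?F. T (i, c) = k}"
    have "?F = Z \<union> {c \<in> ?F. T (i, c) = Suc k}" using frees_values by (auto simp: Z_def)
    then have "card ?F = card Z + ups la T k j i"
      unfolding ups_def by (subst card_Un_disjoint[symmetric]) (auto simp: Z_def)
    then have Z: "ups la T' k j i = card Z" using card_T'_Suc by simp
    have cell: "(i, c) \<in> cells la" if "c \<in> ?F" for c using that by (auto simp: frees_def free_def)
    \<comment> \<open>Along a row the free entries \<open>k\<close> precede the free entries
      \<open>Suc k\<close>, so the cells of rank below \<open>card Z\<close> are exactly those of
      \<open>Z\<close>.\<close>
    have "card {c' \<in> ?F. c' < c} < card Z \<longleftrightarrow> T (i, c) = k"
    proof
      assume eq: "T (i, c) = k"
      have "{c' \<in> ?F. c' < c} \<subset> Z"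
      proof
        show "{c' \<in> ?F. c' < c} \<subseteq> Z"
        proof
          fix c' assume c': "c' \<in> {c' \<in> ?F. c' < c}"
          then have "T (i, c') \<le> k" using row_le[of c' c i] cell[OF True] eq by simp
          then show "c' \<in> Z" using c' frees_values[of c' i] by (auto simp: Z_def)
        qed
        show "{c' \<in> ?F. c' < c} \<noteq> Z" using True eq by (auto simp: Z_def)
      qed
      then show "card {c' \<in> ?F. c' < c} < card Z" by (intro psubset_card_mono) (auto simp: Z_def)
    next
      assume lt: "card {c' \<in> ?F. c' < c} < card Z"
      show "T (i, c) = k"
      proof (rule ccontr)
        assume "T (i, c) \<noteq> k"
        then have eq: "T (i, c) = Suc k" using frees_values[OF True] by simp
        have "Z \<subseteq> {c' \<in> ?F. c' < c}"
        proof
          fix c' assume c': "c' \<in> Z"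
          then have "c' \<in> ?F" "T (i, c') = k" by (auto simp: Z_def)
          then show "c' \<in> {c' \<in> ?F. c' < c}"
            using row_le[of c c' i] cell[of c'] eq by (cases "c \<le> c'") auto
        qed
        then have "card Z \<le> card {c' \<in> ?F. c' < c}" by (intro card_mono) auto
        then show False using lt by simp
      qed
    qed
    then show ?thesis using True frees_values[OF True] by (auto simp: p bk_def[of la k j T'] frees_T' Z)
  qed
qed

definition lw :: "(nat \<times> nat \<Rightarrow> nat) \<Rightarrow> nat \<Rightarrow> nat" where
  "lw S v = card {(i, c) \<in> cells la. c < j \<and> S (i, c) = v}"

lemma lw_T'_k: "lw T' k = lw T (Suc k)"
proof -
  let ?nf = "\<lambda>v. {(i, c) \<in> cells la. c < j \<and> c \<notin> frees la T k j i \<and> T (i, c) = v}"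
  let ?fr = "\<lambda>S v. {(i, c). c \<in> frees la T k j i \<and> S (i, c) = v}"
  have frc: "(i, c) \<in> cells la \<and> c < j" if "c \<in> frees la T k j i" for i c
    using that by (auto simp: frees_def free_def)
  have card_fr: "card (?fr S v) = (\<Sum>i<length la. card {c \<in> frees la T k j i. S (i, c) = v})" for S v
  proof -
    have "?fr S v = (SIGMA i:{..<length la}. {c \<in> frees la T k j i. S (i, c) = v})"
      using frc by (auto simp: cells_def)
    then show ?thesis by (simp add: card_SigmaI)
  qed
  have fin: "finite (?nf v)" "finite (?fr S v)" for S v
    by (rule finite_subset[of _ "cells la"]; use frc in auto)+
  have "lw T' k = card (?fr T' k \<union> ?nf k)"
    unfolding lw_def by (rule arg_cong[where f=card]) (use frc T'_notfree in auto)
  also have "\<dots> = card (?fr T' k) + card (?nf k)"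
    by (rule card_Un_disjoint) (use fin in auto)
  also have "card (?fr T' k) = card (?fr T (Suc k))"
    unfolding card_fr card_T'_k ups_def ..
  \<comment> \<open>The non-free entries \<open>k\<close> and \<open>Suc k\<close> form vertical
    dominoes; stepping down one row matches them.\<close>
  also have "card (?nf k) = card (?nf (Suc k))"
  proof (rule bij_betw_same_card[of "\<lambda>(i, c). (Suc i, c)"])
    show "bij_betw (\<lambda>(i, c). (Suc i, c)) (?nf k) (?nf (Suc k))"
    proof (rule bij_betw_byWitness[where f'="\<lambda>(i, c). (i - 1, c)"])
      show "(\<lambda>(i, c). (Suc i, c)) ` ?nf k \<subseteq> ?nf (Suc k)"
        by (auto simp: frees_def free_def)
      show "(\<lambda>(i, c). (i - 1, c)) ` ?nf (Suc k) \<subseteq> ?nf k"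
      proof (clarify, goal_cases)
        case (1 _ _ i c)
        from 1 obtain i' where i': "i = Suc i'" "T (i', c) = k" unfolding frees_def free_def by blast
        have "(i', c) \<in> cells la" by (rule cells_down[OF sorted 1(1)]) (simp_all add: i')
        then show ?case using 1 i' by (auto simp: frees_def free_def)
      qed
      show "\<forall>a\<in>?nf (Suc k). (case case a of (i, c) \<Rightarrow> (i - 1, c) of (i, c) \<Rightarrow> (Suc i, c)) = a"
        by (auto simp: frees_def free_def)
    qed auto
  qed
  also have "card (?fr T (Suc k)) + card (?nf (Suc k)) = card (?fr T (Suc k) \<union> ?nf (Suc k))"
    by (rule card_Un_disjoint[symmetric]) (use fin in auto)
  also have "\<dots> = lw T (Suc k)"
    unfolding lw_def by (rule arg_cong[where f=card]) (use frc in auto)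
  finally show ?thesis .
qed

end

lemma (in tableau) lw_T': "lw T' v = lw T (transpose k (Suc k) v)"
proof -
  interpret T': tableau N la T' k j by (rule tableau_T')
  consider "v = k" | "v = Suc k" | "v \<noteq> k" "v \<noteq> Suc k" by blast
  then show ?thesis
  proof cases
    case 1
    then show ?thesis using lw_T'_k by simp
  next
    case 2
    then show ?thesis using T'.lw_T'_k by (simp add: bk_bk T'.lw_def lw_def)
  next
    case 3
    then have "{(i, c) \<in> cells la. c < j \<and> T' (i, c) = v} = {(i, c) \<in> cells la. c < j \<and> T (i, c) = v}"
      using T'_free T'_notfree frees_values by (auto split: prod.splits) (metis, metis)
    then show ?thesis using 3 by (simp add: lw_def transpose_def)
  qed
qed

text \<open>The content of the columns from \<open>j\<close> on, for reading a tableau by columns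
  from the right. The involution left of \<open>j\<close> leaves it unchanged.\<close>

definition cw :: "nat list \<Rightarrow> nat \<Rightarrow> (nat \<times> nat \<Rightarrow> nat) \<Rightarrow> nat \<Rightarrow> nat" where
  "cw la j T v = card {(i, c) \<in> cells la. j \<le> c \<and> T (i, c) = v}"

lemma (in tableau) wt_split: "wt la S v = lw S v + cw la j S v"
proof -
  have "wt la S v = card ({(i, c) \<in> cells la. c < j \<and> S (i, c) = v} \<union> {(i, c) \<in> cells la. j \<le> c \<and> S (i, c) = v})"
    unfolding wt_def by (rule arg_cong[where f=card]) auto
  also have "\<dots> = lw S v + cw la j S v"
    unfolding lw_def cw_def
    by (rule card_Un_disjoint) (auto intro: finite_subset[OF _ finite_cells[of la]])
  finally show ?thesis .
qed

lemma (in tableau) cw_T': "j \<le> j' \<Longrightarrow> cw la j' T' v = cw la j' T v"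
  unfolding cw_def by (rule arg_cong[where f=card]) (auto simp: T'_beyond)

text \<open>For \<open>j = sum_list la\<close> no cell lies in column \<open>j\<close> or beyond, so
  the involution acts on the whole tableau and swaps the multiplicities of two neighbouring
  values.\<close>

lemma schur_weights_symmetric:
  fixes h :: "(nat \<Rightarrow> nat) \<Rightarrow> 'a::comm_monoid_add"
  assumes sorted: "sorted_wrt (\<ge>) la" and "\<tau> permutes {..<N}"
  shows "(\<Sum>T\<in>ssyt N la. h (wt la T \<circ> \<tau>)) = (\<Sum>T\<in>ssyt N la. h (wt la T))"
  using assms(2)
proof (induction arbitrary: h rule: adjacent_transpositions_induct)
  case (step \<sigma> k)
  let ?s = "transpose k (Suc k)"
  let ?b = "bk la k (sum_list la)"
  have tab: "tableau N la T k (sum_list la)" if "T \<in> ssyt N la" for T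
    using that sorted step(1) cells_col_le by unfold_locales (auto dest: cells_col_le)
  have wt: "wt la (?b T) = wt la T \<circ> ?s" if "T \<in> ssyt N la" for T
  proof
    fix v
    interpret tableau N la T k "sum_list la" by (rule tab[OF that])
    have cw0: "cw la (sum_list la) S v = 0" for S v
    proof -
      have "{(i, c) \<in> cells la. sum_list la \<le> c \<and> S (i, c) = v} = {}"
        by (auto dest!: cells_col_le)
      then show ?thesis by (simp only: cw_def card.empty)
    qed
    show "wt la (?b T) v = (wt la T \<circ> ?s) v" by (simp add: wt_split lw_T' cw0)
  qed
  have "(\<Sum>T\<in>ssyt N la. h (wt la T \<circ> (\<sigma> \<circ> ?s))) = (\<Sum>T\<in>ssyt N la. h (wt la T \<circ> ?s))"
    using step(3)[of "\<lambda>w. h (w \<circ> ?s)"] by (simp only: comp_assoc)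
  also have "\<dots> = (\<Sum>T\<in>ssyt N la. h (wt la T))"
    by (rule sum.reindex_bij_witness[of _ ?b ?b])
      (auto simp: wt tableau.bk_bk[OF tab] tableau.T'_ssyt[OF tab])
  finally show ?case .
qed simp

section \<open>Column reading and the Littlewood-Richardson rule\<close>

lemma cw_beyond: "sum_list la \<le> j \<Longrightarrow> cw la j T v = 0"
proof -
  assume "sum_list la \<le> j"
  then have "{(i, c) \<in> cells la. j \<le> c \<and> T (i, c) = v} = {}"
    by (auto dest!: cells_col_le)
  then show ?thesis by (simp only: cw_def card.empty)
qed

lemma cw_0: "cw la 0 T = wt la T"
  unfolding cw_def wt_def fun_eq_iff by (intro allI arg_cong[where f=card]) auto

definition colw :: "nat list \<Rightarrow> nat \<Rightarrow> (nat \<times> nat \<Rightarrow> nat) \<Rightarrow> nat \<Rightarrow> nat" where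
  "colw la j T v = card {i. (i, j) \<in> cells la \<and> T (i, j) = v}"

lemma finite_col: "finite {i. (i, j) \<in> cells la \<and> P i}"
  by (rule finite_subset[of _ "{..<length la}"]) (auto simp: cells_def)

lemma cw_Suc: "cw la j T v = colw la j T v + cw la (Suc j) T v"
proof -
  have "cw la j T v = card ((\<lambda>i. (i, j)) ` {i. (i, j) \<in> cells la \<and> T (i, j) = v} \<union>
      {(i, c) \<in> cells la. Suc j \<le> c \<and> T (i, c) = v})"
    unfolding cw_def by (rule arg_cong[where f=card]) (auto simp: le_eq_less_or_eq Suc_le_eq)
  also have "\<dots> = card ((\<lambda>i. (i, j)) ` {i. (i, j) \<in> cells la \<and> T (i, j) = v}) + cw la (Suc j) T v"
    unfolding cw_def
    by (rule card_Un_disjoint) (auto intro: finite_subset[OF _ finite_cells[of la]] simp: finite_col)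
  also have "card ((\<lambda>i. (i, j)) ` {i. (i, j) \<in> cells la \<and> T (i, j) = v}) = colw la j T v"
    unfolding colw_def by (rule card_image) (auto simp: inj_on_def)
  finally show ?thesis .
qed

lemma ssyt_col_less:
  assumes "sorted_wrt (\<ge>) la" "T \<in> ssyt N la"
  shows "(i + Suc d, c) \<in> cells la \<Longrightarrow> T (i, c) < T (i + Suc d, c)"
proof (induction d)
  case 0
  then show ?case using assms by (simp add: ssyt_def)
next
  case (Suc d)
  then have "(i + Suc d, c) \<in> cells la" using cells_down[OF assms(1) Suc.prems] by simp
  then have "T (i, c) < T (i + Suc d, c)" by (rule Suc.IH)
  also have "\<dots> < T (i + Suc (Suc d), c)" using Suc.prems assms by (simp add: ssyt_def)
  finally show ?case .
qed

lemma ssyt_row_le: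
  assumes "sorted_wrt (\<ge>) la" "T \<in> ssyt N la"
  shows "c \<le> c' \<Longrightarrow> (i, c') \<in> cells la \<Longrightarrow> T (i, c) \<le> T (i, c')"
proof (induction c' rule: dec_induct)
  case (step d)
  have "(i, d) \<in> cells la" using cells_down[OF assms(1) step.prems] by simp
  then show ?case using step assms(2) by (force simp: ssyt_def)
qed simp

lemma colw_le_1:
  assumes "sorted_wrt (\<ge>) la" "T \<in> ssyt N la"
  shows "colw la j T v \<le> 1"
proof -
  have "i = i'" if "(i, j) \<in> cells la" "(i', j) \<in> cells la" "T (i, j) = T (i', j)" for i i'
    using ssyt_col_less[OF assms, of i "i' - i - 1" j] ssyt_col_less[OF assms, of i' "i - i' - 1" j] that
    by (cases i i' rule: linorder_cases) auto
  then show ?thesis unfolding colw_def by (subst card_le_Suc0_iff_eq[unfolded One_nat_def[symmetric]]) (auto simp: finite_col)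
qed

text \<open>Adding the columns from \<open>j\<close> on to \<open>l\<close> fails to give a
  partition at \<open>k\<close>. The absence of violations is the lattice condition of the
  Littlewood-Richardson rule.\<close>

definition viol :: "nat \<Rightarrow> nat list \<Rightarrow> (nat \<Rightarrow> nat) \<Rightarrow> (nat \<times> nat \<Rightarrow> nat) \<Rightarrow> nat \<Rightarrow> nat \<Rightarrow> bool" where
  "viol N la l T j k \<longleftrightarrow> Suc k < N \<and> l k + cw la j T k < l (Suc k) + cw la j T (Suc k)"

text \<open>The choice depends only on the columns from \<open>j\<close> on, which the involution
  keeps; so a tableau and its flip have the same critical pair.\<close>

definition crit :: "nat \<Rightarrow> nat list \<Rightarrow> (nat \<Rightarrow> nat) \<Rightarrow> (nat \<times> nat \<Rightarrow> nat) \<Rightarrow> nat \<Rightarrow> nat \<Rightarrow> bool" where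
  "crit N la l T j k \<longleftrightarrow> viol N la l T j k \<and> (\<forall>j'>j. \<forall>k'. \<not> viol N la l T j' k') \<and> (\<forall>k'<k. \<not> viol N la l T j k')"

definition lr_good :: "nat \<Rightarrow> nat list \<Rightarrow> (nat \<Rightarrow> nat) \<Rightarrow> (nat \<times> nat \<Rightarrow> nat) set" where
  "lr_good N la l = {T \<in> ssyt N la. \<forall>j k. \<not> viol N la l T j k}"

text \<open>Stembridge's sign-reversing involution: it changes only the columns left of the last violation, so
  the violation persists. The choice is unique by \<open>crit_unique\<close>.\<close>

definition flip :: "nat \<Rightarrow> nat list \<Rightarrow> (nat \<Rightarrow> nat) \<Rightarrow> (nat \<times> nat \<Rightarrow> nat) \<Rightarrow> nat \<times> nat \<Rightarrow> nat" where
  "flip N la l T = (let p = (SOME p. crit N la l T (fst p) (snd p)) in bk la (snd p) (fst p) T)"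

lemma crit_unique:
  assumes "crit N la l T j k" "crit N la l T j' k'"
  shows "j = j'" "k = k'"
proof -
  show "j = j'" using assms unfolding crit_def by (metis linorder_neqE_nat)
  then show "k = k'" using assms unfolding crit_def by (metis linorder_neqE_nat)
qed

lemma flip_eq:
  assumes "crit N la l T j k"
  shows "flip N la l T = bk la k j T"
proof -
  have "(SOME p. crit N la l T (fst p) (snd p)) = (j, k)"
  proof (rule some_equality)
    fix p assume "crit N la l T (fst p) (snd p)"
    then show "p = (j, k)" using crit_unique[OF assms, of "fst p" "snd p"] by (simp add: prod_eq_iff)
  qed (use assms in simp)
  then show ?thesis by (simp add: flip_def)
qed

locale stembridge =
  fixes N :: nat and la :: "nat list" and l :: "nat \<Rightarrow> nat"
  assumes sorted: "sorted_wrt (\<ge>) la" and l: "\<And>i. l (Suc i) \<le> l i"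
begin

lemma viol_less: "viol N la l T j k \<Longrightarrow> j < sum_list la"
  using l[of k] cw_beyond[of la j T] by (cases "sum_list la \<le> j") (auto simp: viol_def)

lemma crit_exists:
  assumes "viol N la l T j k"
  shows "\<exists>j k. crit N la l T j k"
proof -
  define J where "J = {j. \<exists>k. viol N la l T j k}"
  have fin: "finite J" by (rule finite_subset[of _ "{..<sum_list la}"]) (auto simp: J_def dest: viol_less)
  have "J \<noteq> {}" using assms by (auto simp: J_def)
  then have "Max J \<in> J" using fin by simp
  then obtain k where k: "viol N la l T (Max J) k" by (auto simp: J_def)
  have "crit N la l T (Max J) (LEAST k. viol N la l T (Max J) k)"
    unfolding crit_def
  proof (intro conjI allI impI)
    fix j' k' assume "Max J < j'"
    then show "\<not> viol N la l T j' k'" using Max_ge[OF fin, of j'] by (auto simp: J_def)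
  qed (use k not_less_Least in \<open>auto intro: LeastI\<close>)
  then show ?thesis by blast
qed

text \<open>A column contains each value at most once. As there is no violation right of column
  \<open>j\<close>, this column contains \<open>Suc k\<close> but not \<open>k\<close>, and the
  excess is exactly one.\<close>

lemma crit_facts:
  assumes "T \<in> ssyt N la" "crit N la l T j k"
  shows "tableau N la T k j" "l (Suc k) + cw la j T (Suc k) = Suc (l k + cw la j T k)"
proof -
  have k: "Suc k < N" and v: "l k + cw la j T k < l (Suc k) + cw la j T (Suc k)"
    using assms(2) by (auto simp: crit_def viol_def)
  have "\<not> viol N la l T (Suc j) k" using assms(2) by (simp add: crit_def)
  then have nv: "l (Suc k) + cw la (Suc j) T (Suc k) \<le> l k + cw la (Suc j) T k"
    using k by (simp add: viol_def)
  have "colw la j T (Suc k) \<le> 1" "colw la j T k \<le> 1" using colw_le_1[OF sorted assms(1)] by auto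
  then have c: "colw la j T (Suc k) = 1" "colw la j T k = 0"
    using v nv unfolding cw_Suc[of la j] by auto
  then show "l (Suc k) + cw la j T (Suc k) = Suc (l k + cw la j T k)"
    using v nv unfolding cw_Suc[of la j] by auto
  have "{i. (i, j) \<in> cells la \<and> T (i, j) = k} = {}"
    using c(2) finite_col[of j la "\<lambda>i. T (i, j) = k"] by (simp add: colw_def)
  then show "tableau N la T k j" using sorted assms(1) k by unfold_locales auto
qed

lemma flip_props:
  assumes "T \<in> ssyt N la" "crit N la l T j k"
  shows "flip N la l T \<in> ssyt N la" "crit N la l (flip N la l T) j k" "flip N la l (flip N la l T) = T"
    "alt N (\<lambda>i. l i + stair N i + wt la (flip N la l T) i) = - alt N (\<lambda>i. l i + stair N i + wt la T i)"
proof -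
  interpret tableau N la T k j by (rule crit_facts[OF assms])
  have eq: "flip N la l T = bk la k j T" by (rule flip_eq[OF assms(2)])
  show "flip N la l T \<in> ssyt N la" unfolding eq by (rule T'_ssyt)
  have viol_eq: "viol N la l (bk la k j T) j' k' \<longleftrightarrow> viol N la l T j' k'" if "j \<le> j'" for j' k'
    by (simp add: viol_def cw_T'[OF that])
  show cr: "crit N la l (flip N la l T) j k"
    unfolding eq crit_def using assms(2) by (auto simp: viol_eq crit_def)
  show "flip N la l (flip N la l T) = T"
    unfolding flip_eq[OF cr] unfolding eq by (rule bk_bk)
  let ?s = "transpose k (Suc k)"
  define g where "g v = l v + stair N v + cw la j T v" for v
  \<comment> \<open>The excess of one at \<open>Suc k\<close> makes up for the staircase, which
    drops by one from \<open>k\<close> to \<open>Suc k\<close>.\<close>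
  have "g k = g (Suc k)"
    using crit_facts(2)[OF assms] k by (simp add: g_def stair_def)
  then have g: "g (?s v) = g v" for v by (auto simp: transpose_def)
  have "(\<lambda>i. l i + stair N i + wt la (flip N la l T) i) = (\<lambda>i. l i + stair N i + wt la T i) \<circ> ?s"
  proof
    fix v
    have "l v + stair N v + wt la (bk la k j T) v = g v + lw T (?s v)"
      by (simp add: wt_split lw_T' cw_T' g_def)
    also have "\<dots> = ((\<lambda>i. l i + stair N i + wt la T i) \<circ> ?s) v"
      unfolding g[symmetric, of v] by (simp add: g_def wt_split)
    finally show "l v + stair N v + wt la (flip N la l T) v = ((\<lambda>i. l i + stair N i + wt la T i) \<circ> ?s) v"
      unfolding eq .
  qed
  then show "alt N (\<lambda>i. l i + stair N i + wt la (flip N la l T) i) = - alt N (\<lambda>i. l i + stair N i + wt la T i)"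
    using alt_swap[of k N "Suc k" "\<lambda>i. l i + stair N i + wt la T i"] k by simp
qed

text \<open>Bad tableaux cancel in pairs, because the flip interchanges two exponents of their
  alternant. What remains is the Littlewood-Richardson expansion.\<close>

theorem alt_mult_schur:
  "alt N (\<lambda>i. l i + stair N i) * schur N la = (\<Sum>T\<in>lr_good N la l. alt N (\<lambda>i. l i + wt la T i + stair N i))"
proof -
  let ?f = "\<lambda>T. alt N (\<lambda>i. l i + stair N i + wt la T i)"
  let ?bad = "ssyt N la - lr_good N la l"
  have "alt N (\<lambda>i. l i + stair N i) * schur N la = (\<Sum>T\<in>ssyt N la. ?f T)"
    unfolding schur_eq_sum_mon
    by (rule alt_mult_symmetric) (rule schur_weights_symmetric[OF sorted])
  also have "\<dots> = (\<Sum>T\<in>lr_good N la l. ?f T) + (\<Sum>T\<in>?bad. ?f T)"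
    by (subst sum.subset_diff[of "lr_good N la l"]) (auto simp: lr_good_def add.commute)
  also have "(\<Sum>T\<in>?bad. ?f T) = 0"
  proof -
    have bad: "T \<in> ssyt N la \<and> (\<exists>j k. crit N la l T j k)" if "T \<in> ?bad" for T
      using that crit_exists by (fastforce simp: lr_good_def)
    have notgood: "T \<in> ?bad" if "T \<in> ssyt N la" "crit N la l T j k" for T j k
      using that by (auto simp: lr_good_def crit_def)
    have "(\<Sum>T\<in>?bad. ?f T) = (\<Sum>T\<in>?bad. ?f (flip N la l T))"
      by (rule sum.reindex_bij_witness[of _ "flip N la l" "flip N la l"])
        (use bad flip_props notgood in metis)+
    also have "\<dots> = (\<Sum>T\<in>?bad. - ?f T)"
      by (rule sum.cong) (use bad flip_props(4) in blast)+
    also have "\<dots> = - (\<Sum>T\<in>?bad. ?f T)" by (simp add: sum_negf)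
    finally have "2 * (\<Sum>T\<in>?bad. ?f T) = 0" by simp
    then show ?thesis by simp
  qed
  finally show ?thesis by (simp add: add_ac)
qed

end

definition part :: "nat list \<Rightarrow> nat \<Rightarrow> nat" where
  "part la i = (if i < length la then la ! i else 0)"

lemma cells_part: "(i, c) \<in> cells la \<longleftrightarrow> c < part la i"
  by (auto simp: cells_def part_def)

lemma part_antimono: "sorted_wrt (\<ge>) la \<Longrightarrow> i \<le> j \<Longrightarrow> part la j \<le> part la i"
  using sorted_wrt_nth_less[of "(\<ge>)" la i j] by (cases "i = j") (auto simp: part_def)

text \<open>Columns are treated from right to left. If the topmost entry that differs from its row
  number \<open>m\<close> is \<open>Suc u\<close>, then \<open>m \<le> u\<close>, and no
  \<open>u\<close> occurs in this column or to the right of it, which violates the lattice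
  condition.\<close>

lemma lr_good_0:
  assumes sorted: "sorted_wrt (\<ge>) la" and len: "length la \<le> N"
  shows "lr_good N la (\<lambda>_. 0) = {\<lambda>p. if p \<in> cells la then fst p else 0}"
proof (intro equalityI subsetI)
  fix T assume T: "T \<in> lr_good N la (\<lambda>_. 0)"
  then have ssyt: "T \<in> ssyt N la" and good: "\<And>j k. Suc k < N \<Longrightarrow> cw la j T (Suc k) \<le> cw la j T k"
    by (simp_all add: lr_good_def viol_def) (metis not_less)
  have ge: "i \<le> T (i, c)" if "(i, c) \<in> cells la" for i c
    using that
  proof (induction i)
    case (Suc i)
    then have "i \<le> T (i, c)" using cells_down[OF sorted Suc.prems] by simp
    moreover have "T (i, c) < T (Suc i, c)" using Suc.prems ssyt by (simp add: ssyt_def)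
    ultimately show ?case by simp
  qed simp
  have "\<forall>i c. sum_list la - d \<le> c \<longrightarrow> (i, c) \<in> cells la \<longrightarrow> T (i, c) = i" if "d \<le> sum_list la" for d
    using that
  proof (induction d)
    case 0
    then show ?case by (auto dest!: cells_col_le)
  next
    case (Suc d)
    define j where "j = sum_list la - Suc d"
    have IH: "T (i, c) = i" if "Suc j \<le> c" "(i, c) \<in> cells la" for i c
      using Suc that by (auto simp: j_def)
    have "T (i, j) = i" if "(i, j) \<in> cells la" for i
    proof (rule ccontr)
      assume neq: "T (i, j) \<noteq> i"
      define m where "m = (LEAST i. (i, j) \<in> cells la \<and> T (i, j) \<noteq> i)"
      have m: "(m, j) \<in> cells la" "T (m, j) \<noteq> m"
        using LeastI[of "\<lambda>i. (i, j) \<in> cells la \<and> T (i, j) \<noteq> i" i] that neq by (auto simp: m_def)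
      have less: "T (i', j) = i'" if "i' < m" for i'
        using not_less_Least[of i' "\<lambda>i. (i, j) \<in> cells la \<and> T (i, j) \<noteq> i"] that
          cells_down[OF sorted m(1), of i' j] by (auto simp: m_def)
      have v: "m < T (m, j)" using ge[OF m(1)] m(2) by simp
      then obtain u where u: "T (m, j) = Suc u" "m \<le> u" by (cases "T (m, j)") auto
      have "Suc u < N" using ssyt m(1) u(1) by (fastforce simp: ssyt_def)
      then have le: "cw la j T (Suc u) \<le> cw la j T u" by (rule good)
      have "(m, Suc j) \<notin> cells la"
        using ssyt_row_le[OF sorted ssyt, of j "Suc j" m] IH[of "Suc j" m] v by auto
      then have no: "(w, c) \<notin> cells la" if "m \<le> w" "Suc j \<le> c" for w c
        using cells_down[OF sorted, of w c m "Suc j"] that by auto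
      have "cw la (Suc j) T u = 0"
      proof -
        have "{(i, c) \<in> cells la. Suc j \<le> c \<and> T (i, c) = u} = {}"
          using IH no u(2) by auto
        then show ?thesis by (simp only: cw_def card.empty)
      qed
      moreover have "colw la j T u = 0"
      proof -
        have "T (i', j) \<noteq> u" if "(i', j) \<in> cells la" for i'
        proof (cases "i' < m")
          case True
          then show ?thesis using less u(2) by simp
        next
          case False
          then have "i' = m \<or> i' = m + Suc (i' - m - 1)" by auto
          then show ?thesis using ssyt_col_less[OF sorted ssyt, of m "i' - m - 1" j] that u(1) by auto
        qed
        then have "{i. (i, j) \<in> cells la \<and> T (i, j) = u} = {}" by auto
        then show ?thesis by (simp only: colw_def card.empty)
      qed
      moreover have "colw la j T (Suc u) \<noteq> 0"
        using m(1) u(1) finite_col[of j la "\<lambda>i. T (i, j) = Suc u"] by (auto simp: colw_def)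
      ultimately show False using le unfolding cw_Suc[of la j] by simp
    qed
    then have col: "(i, j) \<in> cells la \<Longrightarrow> T (i, j) = i" for i .
    show ?case
    proof (intro allI impI)
      fix i c assume c: "sum_list la - Suc d \<le> c" "(i, c) \<in> cells la"
      then have "c = j \<or> Suc j \<le> c" by (auto simp: j_def)
      then show "T (i, c) = i" using IH[of c i] col[of i] c(2) by blast
    qed
  qed
  then have "T (i, c) = i" if "(i, c) \<in> cells la" for i c
    using that by (metis diff_self_eq_0 le0 order_refl)
  then have "T p = (if p \<in> cells la then fst p else 0)" for p
    using ssyt by (cases p) (auto simp: ssyt_def)
  then show "T \<in> {\<lambda>p. if p \<in> cells la then fst p else 0}" by auto
next
  fix T assume "T \<in> {\<lambda>p. if p \<in> cells la then fst p else (0::nat)}"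
  then have T: "T = (\<lambda>p. if p \<in> cells la then fst p else 0)" by simp
  have "T \<in> ssyt N la"
    using len cells_down[OF sorted] unfolding ssyt_def T by (auto simp: cells_def)
  moreover have "\<not> viol N la (\<lambda>_. 0) T j k" for j k
  proof -
    have "cw la j T (Suc k) \<le> cw la j T k"
      unfolding cw_def
    proof (rule card_inj_on_le[of "\<lambda>(i, c). (k, c)"])
      show "(\<lambda>(i, c). (k, c)) ` {(i, c) \<in> cells la. j \<le> c \<and> T (i, c) = Suc k} \<subseteq> {(i, c) \<in> cells la. j \<le> c \<and> T (i, c) = k}"
        using cells_down[OF sorted] by (fastforce simp: T)
    qed (auto simp: inj_on_def T intro: finite_subset[OF _ finite_cells[of la]])
    then show ?thesis by (simp add: viol_def)
  qed
  ultimately show "T \<in> lr_good N la (\<lambda>_. 0)" by (simp add: lr_good_def)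
qed

text \<open>The bialternant formula, obtained from the Littlewood-Richardson expansion for
  \<open>l = 0\<close>, where a single tableau survives.\<close>

theorem alt_stair_mult_schur:
  assumes sorted: "sorted_wrt (\<ge>) la" and len: "length la \<le> N"
  shows "alt N (stair N) * schur N la = alt N (\<lambda>i. part la i + stair N i)"
proof -
  interpret stembridge N la "\<lambda>_. 0" using sorted by unfold_locales auto
  let ?T = "\<lambda>p. if p \<in> cells la then fst p else (0::nat)"
  have "wt la ?T i = part la i" for i
  proof -
    have "{p \<in> cells la. ?T p = i} = (\<lambda>c. (i, c)) ` {..<part la i}"
      by (auto simp: cells_part)
    then show ?thesis by (simp add: wt_def card_image inj_on_def)
  qed
  then show ?thesis using alt_mult_schur by (simp add: lr_good_0[OF assms])
qed

section \<open>Schur-positivity\<close>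

lemma is_partitionD:
  assumes "is_partition n la"
  shows "sorted_wrt (\<ge>) la" "\<And>a. a \<in> set la \<Longrightarrow> 0 < a" "sum_list la = n" "length la \<le> n"
proof -
  show 1: "sorted_wrt (\<ge>) la" "\<And>a. a \<in> set la \<Longrightarrow> 0 < a" "sum_list la = n"
    using assms by (auto simp: is_partition_def)
  have "length la \<le> sum_list la" if "\<forall>a\<in>set la. 0 < a" for la :: "nat list"
    using that by (induction la) auto
  then show "length la \<le> n" using 1 by auto
qed

lemma finite_partitions [simp]: "finite {la. is_partition n la}"
proof (rule finite_subset[OF _ finite_lists_length_le[of "{..n}" n]])
  show "{la. is_partition n la} \<subseteq> {xs. set xs \<subseteq> {..n} \<and> length xs \<le> n}"
    using member_le_sum_list is_partitionD by fastforce
qed simp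

lemma sum_part: "length la \<le> N \<Longrightarrow> (\<Sum>i<N. part la i) = sum_list la"
proof -
  assume len: "length la \<le> N"
  have "(\<Sum>i<N. part la i) = (\<Sum>i<length la. la ! i)"
    by (rule sum.mono_neutral_cong_right) (use len in \<open>auto simp: part_def\<close>)
  then show ?thesis by (simp add: sum_list_sum_nth atLeast0LessThan)
qed

lemma part_eq_imp_eq:
  assumes "is_partition n la" "is_partition m mu" "length la \<le> N" "length mu \<le> N"
    and eq: "\<And>i. i < N \<Longrightarrow> part la i = part mu i"
  shows "la = mu"
proof -
  have pos: "0 < part la i \<longleftrightarrow> i < length la" if "is_partition n la" for i n la
    using is_partitionD(2)[OF that, of "la ! i"] by (auto simp: part_def)
  have "i < length la \<longleftrightarrow> i < length mu" for i
    using pos[OF assms(1), of i] pos[OF assms(2), of i] eq[of i] assms(3,4) by (cases "i < N") auto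
  then have len: "length la = length mu" by (metis linorder_neqE_nat less_irrefl)
  show ?thesis
  proof (rule nth_equalityI[OF len])
    fix i assume "i < length la"
    then show "la ! i = mu ! i" using eq[of i] len assms(3) by (simp add: part_def)
  qed
qed

lemma partition_of_function:
  assumes anti: "\<And>i. Suc i < N \<Longrightarrow> g (Suc i) \<le> g i"
  obtains la where "is_partition (\<Sum>i<N. g i) la" "length la \<le> N" "\<And>i. i < N \<Longrightarrow> part la i = g i"
proof -
  define m where "m = (LEAST m. N \<le> m \<or> g m = 0)"
  have m: "N \<le> m \<or> g m = 0" unfolding m_def by (rule LeastI[of _ N]) simp
  have mN: "m \<le> N" unfolding m_def by (rule Least_le) simp
  have pos: "0 < g i" if "i < m" for i using not_less_Least[of i] that by (fastforce simp: m_def)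
  have mono: "g j \<le> g i" if "i \<le> j" "j < N" for i j
    using that
  proof (induction j rule: dec_induct)
    case (step n)
    then show ?case using anti[of n] by simp
  qed simp
  have zero: "g i = 0" if "m \<le> i" "i < N" for i using m mono[of m i] that by auto
  let ?la = "map g [0..<m]"
  have part: "part ?la i = g i" if "i < N" for i using zero that by (auto simp: part_def)
  have "sum_list ?la = (\<Sum>i<N. part ?la i)" using mN by (subst sum_part) auto
  then have "sum_list ?la = (\<Sum>i<N. g i)" by (simp add: part)
  moreover have "sorted_wrt (\<ge>) ?la"
    using mono mN by (auto simp: sorted_wrt_iff_nth_less)
  ultimately have "is_partition (\<Sum>i<N. g i) ?la" using pos by (auto simp: is_partition_def)
  then show ?thesis using that[of ?la] part mN by auto
qed

definition beta :: "nat \<Rightarrow> nat list \<Rightarrow> nat \<Rightarrow> nat" where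
  "beta N la i = part la i + stair N i"

lemma sdec_beta: "sorted_wrt (\<ge>) la \<Longrightarrow> sdec N (beta N la)"
  unfolding sdec_def
proof (intro allI impI)
  fix i j assume "sorted_wrt (\<ge>) la" "i < j" "j < N"
  then show "beta N la j < beta N la i"
    using part_antimono[of la i j] by (simp add: beta_def stair_def)
qed

lemma alt_stair_schur:
  "is_partition n la \<Longrightarrow> length la \<le> N \<Longrightarrow> alt N (stair N) * schur N la = alt N (beta N la)"
  using alt_stair_mult_schur[of la N] is_partitionD(1)[of n la] by (simp add: beta_def[abs_def])

text \<open>The coefficient of \<open>x\<close> to the power \<open>nu + stair\<close> in the product with the Vandermonde alternant is
  the multiplicity of the Schur function of \<open>nu\<close>.\<close>

definition mult :: "nat \<Rightarrow> nat list \<Rightarrow> mpoly \<Rightarrow> int" where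
  "mult N nu f = Poly_Mapping.lookup (alt N (stair N) * f) (expo N (beta N nu))"

lemma mult_add: "mult N nu (f + g) = mult N nu f + mult N nu g"
  and mult_diff: "mult N nu (f - g) = mult N nu f - mult N nu g"
  and mult_0 [simp]: "mult N nu 0 = 0"
  and mult_of_int: "mult N nu (of_int c * f) = c * mult N nu f"
proof -
  have "alt N (stair N) * (of_int c * f) = of_int c * (alt N (stair N) * f)" by (simp add: mult_ac)
  then show "mult N nu (of_int c * f) = c * mult N nu f" by (simp only: mult_def lookup_of_int_mult)
qed (simp_all add: mult_def distrib_left right_diff_distrib lookup_add lookup_minus)

lemma mult_sum: "mult N nu (\<Sum>x\<in>A. f x) = (\<Sum>x\<in>A. mult N nu (f x))"
  by (induction A rule: infinite_finite_induct) (simp_all add: mult_add)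

lemma mult_schur:
  assumes "is_partition n la" "is_partition m nu" "length la \<le> N" "length nu \<le> N"
  shows "mult N nu (schur N la) = (if la = nu then 1 else 0)"
proof -
  have "mult N nu (schur N la) = (if \<forall>i<N. beta N la i = beta N nu i then 1 else 0)"
    unfolding mult_def alt_stair_schur[OF assms(1,3)]
    using assms by (intro lookup_alt_sdec sdec_beta is_partitionD)
  moreover have "(\<forall>i<N. beta N la i = beta N nu i) \<longleftrightarrow> la = nu"
    using part_eq_imp_eq[OF assms] by (auto simp: beta_def)
  ultimately show ?thesis by simp
qed

text \<open>The numbers \<open>mult\<close> determine a polynomial only within the integral span of
  the Schur functions. Membership is therefore proved separately; positivity is then a matter of
  signs of multiplicities.\<close>

definition schur_span :: "nat \<Rightarrow> nat \<Rightarrow> mpoly \<Rightarrow> bool" where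
  "schur_span N n f \<longleftrightarrow> (\<exists>c :: nat list \<Rightarrow> int. f = (\<Sum>nu | is_partition n nu. of_int (c nu) * schur N nu))"

lemma schur_span_expand:
  assumes "schur_span N n f" "n \<le> N"
  shows "f = (\<Sum>nu | is_partition n nu. of_int (mult N nu f) * schur N nu)"
proof -
  obtain c where c: "f = (\<Sum>nu | is_partition n nu. of_int (c nu) * schur N nu)"
    using assms by (auto simp: schur_span_def)
  have "mult N nu f = c nu" if nu: "is_partition n nu" for nu
  proof -
    have "mult N nu f = (\<Sum>la | is_partition n la. c la * (if la = nu then 1 else 0))"
      unfolding c mult_sum mult_of_int
    proof (rule sum.cong[OF refl])
      fix la assume "la \<in> {la. is_partition n la}"
      then have "is_partition n la" by simp
      then show "c la * mult N nu (schur N la) = c la * (if la = nu then 1 else 0)"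
        using mult_schur[OF _ nu, of n la N] is_partitionD(4)[of n la] is_partitionD(4)[OF nu] assms(2) by simp
    qed
    then show ?thesis using nu by (simp add: if_distrib[of "(*) _"] cong: if_cong)
  qed
  then show ?thesis using c by simp
qed

lemma schur_positiveI:
  assumes "schur_span N n f" "n \<le> N" "\<And>nu. is_partition n nu \<Longrightarrow> 0 \<le> mult N nu f"
  shows "schur_positive N n f"
proof -
  have "f = (\<Sum>nu | is_partition n nu. of_nat (nat (mult N nu f)) * schur N nu)"
    by (subst schur_span_expand[OF assms(1,2)], rule sum.cong) (use assms(3) in auto)
  then show ?thesis unfolding schur_positive_def by (intro exI[of _ "\<lambda>nu. nat (mult N nu f)"])
qed

lemma schur_positive_span: "schur_positive N n f \<Longrightarrow> schur_span N n f"
  unfolding schur_positive_def schur_span_def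
proof (elim exE)
  fix c :: "nat list \<Rightarrow> nat"
  assume "f = (\<Sum>nu | is_partition n nu. of_nat (c nu) * schur N nu)"
  then show "\<exists>c :: nat list \<Rightarrow> int. f = (\<Sum>nu | is_partition n nu. of_int (c nu) * schur N nu)"
    by (intro exI[of _ "\<lambda>nu. int (c nu)"]) simp
qed

lemma schur_span_add: "schur_span N n f \<Longrightarrow> schur_span N n g \<Longrightarrow> schur_span N n (f + g)"
  unfolding schur_span_def
proof (elim exE)
  fix c d :: "nat list \<Rightarrow> int"
  assume "f = (\<Sum>nu | is_partition n nu. of_int (c nu) * schur N nu)"
    "g = (\<Sum>nu | is_partition n nu. of_int (d nu) * schur N nu)"
  then show "\<exists>c :: nat list \<Rightarrow> int. f + g = (\<Sum>nu | is_partition n nu. of_int (c nu) * schur N nu)"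
    by (intro exI[of _ "\<lambda>nu. c nu + d nu"]) (simp add: sum.distrib distrib_right)
qed

lemma schur_span_of_int: "schur_span N n f \<Longrightarrow> schur_span N n (of_int a * f)"
  unfolding schur_span_def
proof (elim exE)
  fix c :: "nat list \<Rightarrow> int"
  assume "f = (\<Sum>nu | is_partition n nu. of_int (c nu) * schur N nu)"
  then show "\<exists>c :: nat list \<Rightarrow> int. of_int a * f = (\<Sum>nu | is_partition n nu. of_int (c nu) * schur N nu)"
    by (intro exI[of _ "\<lambda>nu. a * c nu"]) (simp add: sum_distrib_left mult.assoc)
qed

lemma schur_span_0 [simp]: "schur_span N n 0"
  unfolding schur_span_def by (intro exI[of _ "\<lambda>_. 0"]) simp

lemma schur_span_minus: "schur_span N n f \<Longrightarrow> schur_span N n g \<Longrightarrow> schur_span N n (f - g)"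
  using schur_span_add[of N n f "of_int (-1) * g"] schur_span_of_int[of N n g "-1"] by simp

lemma schur_span_sum: "(\<And>x. x \<in> A \<Longrightarrow> schur_span N n (f x)) \<Longrightarrow> schur_span N n (\<Sum>x\<in>A. f x)"
  by (induction A rule: infinite_finite_induct) (simp_all add: schur_span_add)

lemma schur_span_schur: "is_partition n la \<Longrightarrow> schur_span N n (schur N la)"
  unfolding schur_span_def
  by (intro exI[of _ "\<lambda>nu. if nu = la then 1 else 0"]) (simp add: if_distrib[of "\<lambda>x. of_int x * _"] cong: if_cong)

lemma schur_positive_mult_ge_0:
  assumes "schur_positive N n f" "n \<le> N" "is_partition n nu"
  shows "0 \<le> mult N nu f"
proof -
  obtain c :: "nat list \<Rightarrow> nat" where c: "f = (\<Sum>nu | is_partition n nu. of_int (int (c nu)) * schur N nu)"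
    using assms by (auto simp: schur_positive_def)
  have "0 \<le> mult N nu (schur N la)" if "is_partition n la" for la
    using mult_schur[OF that assms(3)] is_partitionD(4)[OF that] is_partitionD(4)[OF assms(3)] assms(2) by simp
  then show ?thesis unfolding c mult_sum mult_of_int by (intro sum_nonneg mult_nonneg_nonneg) auto
qed

lemma schur_positive_0 [simp]: "schur_positive N n 0"
  unfolding schur_positive_def by (intro exI[of _ "\<lambda>_. 0"]) simp

lemma schur_positive_add: "schur_positive N n f \<Longrightarrow> schur_positive N n g \<Longrightarrow> schur_positive N n (f + g)"
  unfolding schur_positive_def
proof (elim exE)
  fix c d :: "nat list \<Rightarrow> nat"
  assume "f = (\<Sum>nu | is_partition n nu. of_nat (c nu) * schur N nu)"
    "g = (\<Sum>nu | is_partition n nu. of_nat (d nu) * schur N nu)"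
  then show "\<exists>c :: nat list \<Rightarrow> nat. f + g = (\<Sum>nu | is_partition n nu. of_nat (c nu) * schur N nu)"
    by (intro exI[of _ "\<lambda>nu. c nu + d nu"]) (simp add: sum.distrib distrib_right)
qed

lemma schur_positive_sum: "(\<And>x. x \<in> A \<Longrightarrow> schur_positive N n (f x)) \<Longrightarrow> schur_positive N n (\<Sum>x\<in>A. f x)"
  by (induction A rule: infinite_finite_induct) (simp_all add: schur_positive_add)

lemma schur_positive_of_nat: "schur_positive N n f \<Longrightarrow> schur_positive N n (of_nat a * f)"
  by (induction a) (simp_all add: schur_positive_add distrib_right)

lemma schur_positive_schur: "is_partition n la \<Longrightarrow> schur_positive N n (schur N la)"
  unfolding schur_positive_def
  by (intro exI[of _ "\<lambda>nu. if nu = la then 1 else 0"]) (simp add: if_distrib[of "\<lambda>x. of_nat x * _"] cong: if_cong)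

lemma schur_mult_schur_positive:
  assumes la: "is_partition a la" and mu: "is_partition b mu" and N: "a + b \<le> N"
  shows "schur_positive N (a + b) (schur N la * schur N mu)"
proof -
  let ?V = "alt N (stair N)"
  have len: "length la \<le> N" "length mu \<le> N" using is_partitionD(4)[OF la] is_partitionD(4)[OF mu] N by auto
  interpret stembridge N mu "part la"
    using is_partitionD(1)[OF mu] part_antimono[OF is_partitionD(1)[OF la]] by unfold_locales auto
  have *: "\<exists>nu. is_partition (a + b) nu \<and> alt N (\<lambda>i. part la i + wt mu T i + stair N i) = ?V * schur N nu"
    if T: "T \<in> lr_good N mu (part la)" for T
  proof -
    \<comment> \<open>The lattice condition at column 0, where the whole tableau is counted, makes
      the sum a partition.\<close>
    have anti: "part la (Suc i) + wt mu T (Suc i) \<le> part la i + wt mu T i" if "Suc i < N" for i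
      using T that by (simp add: lr_good_def viol_def cw_0[symmetric]) (metis not_less)
    obtain nu where nu: "is_partition (\<Sum>i<N. part la i + wt mu T i) nu" "length nu \<le> N"
      "\<And>i. i < N \<Longrightarrow> part nu i = part la i + wt mu T i"
      using partition_of_function[of N "\<lambda>i. part la i + wt mu T i"] anti by blast
    have "(\<Sum>i<N. wt mu T i) = card (cells mu)"
    proof -
      have "(\<Sum>i<N. \<Sum>p\<in>{p \<in> cells mu. T p = i}. 1) = (\<Sum>p\<in>cells mu. 1::nat)"
        by (rule sum.group) (use T in \<open>auto simp: lr_good_def ssyt_def\<close>)
      then show ?thesis by (simp add: wt_def)
    qed
    also have "card (cells mu) = sum_list mu"
    proof -
      have "cells mu = (SIGMA i:{..<length mu}. {..<mu ! i})" by (auto simp: cells_def)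
      then show ?thesis by (simp add: sum_list_sum_nth atLeast0LessThan)
    qed
    finally have "(\<Sum>i<N. part la i + wt mu T i) = a + b"
      using len is_partitionD(3)[OF la] is_partitionD(3)[OF mu] by (simp add: sum.distrib sum_part)
    moreover have "alt N (\<lambda>i. part la i + wt mu T i + stair N i) = ?V * schur N nu"
      unfolding alt_stair_schur[OF nu(1,2)] by (rule alt_cong) (simp add: nu(3) beta_def)
    ultimately show ?thesis using nu(1) by auto
  qed
  then obtain nu where nu: "\<And>T. T \<in> lr_good N mu (part la) \<Longrightarrow> is_partition (a + b) (nu T)"
    "\<And>T. T \<in> lr_good N mu (part la) \<Longrightarrow> alt N (\<lambda>i. part la i + wt mu T i + stair N i) = ?V * schur N (nu T)"
    by metis
  have "?V * (schur N la * schur N mu) = alt N (\<lambda>i. part la i + stair N i) * schur N mu"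
    using alt_stair_schur[OF la len(1)] by (simp add: beta_def[abs_def] mult.assoc[symmetric])
  also have "\<dots> = ?V * (\<Sum>T\<in>lr_good N mu (part la). schur N (nu T))"
    unfolding alt_mult_schur sum_distrib_left by (rule sum.cong) (simp_all add: nu(2))
  finally have "schur N la * schur N mu = (\<Sum>T\<in>lr_good N mu (part la). schur N (nu T))"
    using alt_stair_nonzero by simp
  then show ?thesis by (auto intro: schur_positive_sum schur_positive_schur nu(1))
qed

theorem schur_positive_mult:
  assumes "schur_positive N a f" "schur_positive N b g" "a + b \<le> N"
  shows "schur_positive N (a + b) (f * g)"
proof -
  obtain c d :: "nat list \<Rightarrow> nat" where f: "f = (\<Sum>nu | is_partition a nu. of_nat (c nu) * schur N nu)"
    and g: "g = (\<Sum>nu | is_partition b nu. of_nat (d nu) * schur N nu)"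
    using assms by (auto simp: schur_positive_def)
  have "f * g = (\<Sum>la | is_partition a la. \<Sum>mu | is_partition b mu.
      of_nat (c la) * (of_nat (d mu) * (schur N la * schur N mu)))"
    unfolding f g sum_product by (simp add: mult_ac)
  then show ?thesis
    using assms(3) by (auto intro!: schur_positive_sum schur_positive_of_nat schur_mult_schur_positive)
qed

section \<open>Straightening of alternants\<close>

lemma sorting_permutation:
  fixes \<beta> :: "nat \<Rightarrow> nat"
  assumes "inj_on \<beta> {..<N::nat}"
  obtains \<sigma> where "\<sigma> permutes {..<N}" "sdec N (\<beta> \<circ> \<sigma>)"
proof -
  \<comment> \<open>The position of \<open>i\<close> in decreasing order is the number of larger
    values; the sorting permutation is the inverse of this map.\<close>
  define \<tau> where "\<tau> i = (if i < N then card {j. j < N \<and> \<beta> i < \<beta> j} else i)" for i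
  have less: "\<tau> i < \<tau> j" if "i < N" "j < N" "\<beta> j < \<beta> i" for i j
    unfolding \<tau>_def using that by (auto intro!: psubset_card_mono)
  have "\<tau> i < N" if "i < N" for i
  proof -
    have "card {j. j < N \<and> \<beta> i < \<beta> j} < card {..<N}" using that by (intro psubset_card_mono) auto
    then show ?thesis using that by (simp add: \<tau>_def)
  qed
  moreover have "inj_on \<tau> {..<N}"
  proof (rule inj_onI, rule ccontr)
    fix i j assume "i \<in> {..<N}" "j \<in> {..<N}" "\<tau> i = \<tau> j" "i \<noteq> j"
    then show False using less[of i j] less[of j i] inj_onD[OF assms, of i j] by (cases "\<beta> i" "\<beta> j" rule: linorder_cases) auto
  qed
  ultimately have \<tau>: "\<tau> permutes {..<N}" by (intro inj_imp_permutes) (auto simp: \<tau>_def)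
  have \<sigma>: "inv \<tau> permutes {..<N}" using \<tau> by (rule permutes_inv)
  have "sdec N (\<beta> \<circ> inv \<tau>)"
    unfolding sdec_def
  proof (intro allI impI, rule ccontr)
    fix i j assume ij: "i < j" "j < N" "\<not> (\<beta> \<circ> inv \<tau>) j < (\<beta> \<circ> inv \<tau>) i"
    have N: "inv \<tau> i < N" "inv \<tau> j < N" using permutes_in_image[OF \<sigma>] ij by auto
    have inv: "\<tau> (inv \<tau> i) = i" "\<tau> (inv \<tau> j) = j" using permutes_inverses[OF \<tau>] by auto
    have "\<beta> (inv \<tau> i) \<le> \<beta> (inv \<tau> j)" using ij by simp
    then consider "\<beta> (inv \<tau> i) < \<beta> (inv \<tau> j)" | "\<beta> (inv \<tau> i) = \<beta> (inv \<tau> j)" by linarith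
    then show False
    proof cases
      case 1
      then show False using less[OF N(2,1)] inv ij by simp
    next
      case 2
      then have "inv \<tau> i = inv \<tau> j" using inj_onD[OF assms] N by auto
      then show False using inv ij by simp
    qed
  qed
  then show ?thesis using that \<sigma> by blast
qed

text \<open>A repeated exponent gives zero. Otherwise sorting costs a sign and produces the beta
  numbers of a partition, whose size is fixed by the hypothesis.\<close>

lemma alt_in_span:
  assumes "(\<Sum>i<N. \<beta> i) = n + (\<Sum>i<N. stair N i)"
  shows "\<exists>g. schur_span N n g \<and> alt N \<beta> = alt N (stair N) * g"
proof (cases "inj_on \<beta> {..<N}")
  case False
  then have "alt N \<beta> = 0" by (auto simp: inj_on_def intro: alt_eq_0)
  then show ?thesis by (intro exI[of _ 0]) simp
next
  case True
  then obtain \<sigma> where \<sigma>: "\<sigma> permutes {..<N}" "sdec N (\<beta> \<circ> \<sigma>)" by (rule sorting_permutation)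
  define g where "g i = \<beta> (\<sigma> i) - stair N i" for i
  have dec: "\<beta> (\<sigma> (Suc i)) < \<beta> (\<sigma> i)" if "Suc i < N" for i using \<sigma>(2) that by (auto simp: sdec_def)
  have ge: "stair N i \<le> \<beta> (\<sigma> i)" if "i < N" for i
    using that
  proof (induction "N - 1 - i" arbitrary: i)
    case (Suc x)
    then have si: "Suc i < N" by simp
    then have "stair N (Suc i) \<le> \<beta> (\<sigma> (Suc i))" using Suc.hyps(2) by (intro Suc.hyps(1)) auto
    then show ?case using dec[OF si] si by (simp add: stair_def)
  qed (simp add: stair_def)
  have anti: "g (Suc i) \<le> g i" if "Suc i < N" for i
    using dec[OF that] ge[OF that] that by (simp add: g_def stair_def)
  obtain nu where nu: "is_partition (\<Sum>i<N. g i) nu" "length nu \<le> N" "\<And>i. i < N \<Longrightarrow> part nu i = g i"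
    using partition_of_function[of N g, OF anti] by blast
  have "(\<Sum>i<N. \<beta> (\<sigma> i)) = (\<Sum>i<N. \<beta> i)"
    using sum.permute[OF \<sigma>(1), of \<beta>] by (simp add: comp_def)
  moreover have "(\<Sum>i<N. \<beta> (\<sigma> i)) = (\<Sum>i<N. g i) + (\<Sum>i<N. stair N i)"
    unfolding sum.distrib[symmetric] by (rule sum.cong) (auto simp: g_def ge)
  ultimately have n: "(\<Sum>i<N. g i) = n" using assms by simp
  have "alt N (\<beta> \<circ> \<sigma>) = alt N (beta N nu)"
    by (rule alt_cong) (simp add: beta_def nu(3) g_def ge)
  then have eq: "of_int (sign \<sigma>) * alt N \<beta> = alt N (stair N) * schur N nu"
    using alt_permute[OF \<sigma>(1), of \<beta>] alt_stair_schur[OF nu(1,2)] by simp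
  have "(of_int (sign \<sigma>) :: mpoly) * of_int (sign \<sigma>) = 1"
    by (metis of_int_1 of_int_mult sign_idempotent)
  then have "alt N \<beta> = of_int (sign \<sigma>) * (of_int (sign \<sigma>) * alt N \<beta>)" by (simp add: mult.assoc[symmetric])
  also have "\<dots> = alt N (stair N) * (of_int (sign \<sigma>) * schur N nu)" unfolding eq by (simp add: mult_ac)
  finally show ?thesis using schur_span_of_int[OF schur_span_schur] nu(1) n by blast
qed

lemma alt_mult_power_sum: "alt N \<beta> * power_sum N k = (\<Sum>i<N. alt N (\<beta>(i := \<beta> i + k)))"
proof -
  let ?w = "\<lambda>i v. if v = i then k else 0 :: nat"
  have pw: "power_sum N k = (\<Sum>i<N. mon N (?w i))"
    unfolding power_sum_def
  proof (rule sum.cong[OF refl])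
    fix i assume "i \<in> {..<N}"
    then show "var i ^ k = mon N (?w i)"
      by (simp add: mon_def if_distrib[of "(^) _"] cong: if_cong)
  qed
  have "alt N \<beta> * (\<Sum>i<N. mon N (?w i)) = (\<Sum>i<N. alt N (\<lambda>v. \<beta> v + ?w i v))"
  proof (rule alt_mult_symmetric)
    fix \<tau> assume \<tau>: "\<tau> permutes {..<N}"
    have "(\<Sum>i<N. mon N (?w i)) = (\<Sum>i<N. mon N (?w (\<tau> i)))"
      using sum.permute[OF \<tau>, of "\<lambda>i. mon N (?w i)"] by (simp add: comp_def)
    moreover have "?w (\<tau> i) \<circ> \<tau> = ?w i" for i
      using permutes_inj[OF \<tau>] by (auto simp: fun_eq_iff inj_eq)
    ultimately have "(\<Sum>i<N. mon N (?w i)) = (\<Sum>i<N. mon N (?w (\<tau> i)))" "\<And>i. mon N (?w i) = mon N (?w (\<tau> i) \<circ> \<tau>)" by auto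
    then have "(\<Sum>i<N. mon N (?w i)) = (\<Sum>i<N. mon N (?w (\<tau> i) \<circ> \<tau>))" by (auto intro: sum.cong)
    also have "\<dots> = (\<Sum>i<N. mon N (?w i \<circ> \<tau>))"
      using sum.permute[OF \<tau>, of "\<lambda>i. mon N (?w i \<circ> \<tau>)"] by (simp add: comp_def)
    finally show "(\<Sum>i<N. mon N (?w i \<circ> \<tau>)) = (\<Sum>i<N. mon N (?w i))" by simp
  qed
  also have "\<dots> = (\<Sum>i<N. alt N (\<beta>(i := \<beta> i + k)))"
    by (rule sum.cong) (auto intro!: alt_cong)
  finally show ?thesis unfolding pw .
qed

text \<open>Each term of \<open>alt_mult_power_sum\<close> raises one beta number by
  \<open>k\<close>; straightening turns it into a signed Schur function or zero.\<close>

lemma schur_span_mult_power_sum: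
  assumes "schur_span N n f" "n \<le> N"
  shows "schur_span N (n + k) (power_sum N k * f)"
proof -
  have "schur_span N (n + k) (power_sum N k * schur N la)" if la: "is_partition n la" for la
  proof -
    let ?b = "\<lambda>i. (beta N la)(i := beta N la i + k)"
    have len: "length la \<le> N" using is_partitionD(4)[OF la] assms(2) by simp
    have "(\<Sum>v<N. ?b i v) = n + k + (\<Sum>i<N. stair N i)" if "i < N" for i
    proof -
      have "(\<Sum>v<N. ?b i v) = (\<Sum>v<N. beta N la v + (if v = i then k else 0))" by (rule sum.cong) auto
      also have "\<dots> = n + k + (\<Sum>i<N. stair N i)"
        using that len is_partitionD(3)[OF la] by (simp add: sum.distrib beta_def sum_part)
      finally show ?thesis .
    qed
    then have "\<forall>i\<in>{..<N}. \<exists>g. schur_span N (n + k) g \<and> alt N (?b i) = alt N (stair N) * g"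
      using alt_in_span by auto
    then obtain g where g: "\<And>i. i < N \<Longrightarrow> schur_span N (n + k) (g i)"
      "\<And>i. i < N \<Longrightarrow> alt N (?b i) = alt N (stair N) * g i" by (auto simp: Ball_def) metis
    have "alt N (stair N) * (power_sum N k * schur N la) = alt N (beta N la) * power_sum N k"
      using alt_stair_schur[OF la len] by (simp add: mult_ac)
    also have "\<dots> = alt N (stair N) * (\<Sum>i<N. g i)"
      unfolding alt_mult_power_sum sum_distrib_left by (rule sum.cong) (auto simp: g(2))
    finally have "power_sum N k * schur N la = (\<Sum>i<N. g i)" using alt_stair_nonzero by simp
    then show ?thesis by (auto intro: schur_span_sum g(1))
  qed
  moreover have "power_sum N k * f = (\<Sum>nu | is_partition n nu. of_int (mult N nu f) * (power_sum N k * schur N nu))"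
    by (subst schur_span_expand[OF assms]) (simp add: sum_distrib_left mult_ac)
  ultimately show ?thesis by (auto intro!: schur_span_sum schur_span_of_int)
qed

lemma schur_Nil: "schur N [] = 1"
proof -
  have "ssyt N [] = {\<lambda>_. 0}" by (auto simp: ssyt_def cells_def)
  then show ?thesis by (simp add: schur_def cells_def)
qed

lemma schur_span_1: "schur_span N 0 1"
  using schur_span_schur[of 0 "[]" N] by (simp add: schur_Nil is_partition_def)

lemma power_sum_part_simps [simp]:
  "power_sum_part N [] = 1" "power_sum_part N (a # la) = power_sum N a * power_sum_part N la"
  by (simp_all add: power_sum_part_def)

lemma schur_span_power_sum_part: "sum_list la \<le> N \<Longrightarrow> schur_span N (sum_list la) (power_sum_part N la)"
proof (induction la)
  case (Cons a la)
  then show ?case using schur_span_mult_power_sum[of N "sum_list la" "power_sum_part N la" a]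
    by (simp add: add.commute)
qed (simp add: schur_span_1)

section \<open>The Casimir operator on words\<close>

definition words :: "nat \<Rightarrow> nat \<Rightarrow> (nat \<Rightarrow> nat) set" where
  "words N n = {..<n} \<rightarrow>\<^sub>E {..<N}"

definition content :: "nat \<Rightarrow> (nat \<Rightarrow> nat) \<Rightarrow> nat \<Rightarrow> nat" where
  "content n w a = card {i. i < n \<and> w i = a}"

text \<open>The trace on the tensor power of a diagonal matrix with entries x_i composed with the
  place permutation \<open>h\<close>. By \<open>fixpoly_canon\<close> and
  \<open>fixpoly_conj\<close> it is the power sum product of the cycle type of
  \<open>h\<close>.\<close>

definition fixpoly :: "nat \<Rightarrow> nat \<Rightarrow> (nat \<Rightarrow> nat) \<Rightarrow> mpoly" where
  "fixpoly N n h = (\<Sum>w | w \<in> words N n \<and> w \<circ> h = w. mon N (content n w))"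

lemma finite_words [simp]: "finite (words N n)"
  unfolding words_def by (rule finite_PiE) auto

lemma words_comp:
  assumes "h permutes {..<n}" "w \<in> words N n"
  shows "w \<circ> h \<in> words N n"
  using assms permutes_in_image[OF assms(1)] permutes_not_in[OF assms(1)]
  by (auto simp: words_def PiE_iff extensional_def)

lemma content_comp:
  assumes "h permutes {..<n}"
  shows "content n (w \<circ> h) a = content n w a"
proof -
  have "bij_betw h {i. i < n \<and> (w \<circ> h) i = a} {i. i < n \<and> w i = a}"
    using assms permutes_in_image[OF assms] permutes_inverses[OF assms] permutes_in_image[OF permutes_inv[OF assms]]
    by (intro bij_betw_byWitness[where f'="inv h"]) (auto simp: image_subset_iff)
  then show ?thesis unfolding content_def by (rule bij_betw_same_card)
qed

lemma sum_content: "w \<in> words N n \<Longrightarrow> (\<Sum>a<N. content n w a) = n"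
proof -
  assume "w \<in> words N n"
  then have "(\<Sum>a<N. \<Sum>i\<in>{i \<in> {..<n}. w i = a}. 1) = (\<Sum>i<n. 1::nat)"
    by (intro sum.group) (auto simp: words_def PiE_iff)
  then show ?thesis by (simp add: content_def)
qed

lemma deriv_var_mon: "a < N \<Longrightarrow> deriv_var a (mon N k) = of_nat (k a) * mon N k"
  by (simp add: mon_eq_single deriv_var_def weight_op_frag_of lookup_expo)

lemma sq_op_mon: "sq_op N (mon N k) = of_nat (\<Sum>a<N. (k a)\<^sup>2) * mon N k"
  by (simp add: mon_eq_single sq_op_def weight_op_frag_of lookup_expo)

lemma deriv_var_sum: "deriv_var a (\<Sum>x\<in>A. f x) = (\<Sum>x\<in>A. deriv_var a (f x))"
  by (simp add: deriv_var_def weight_op_sum)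

lemma mon_content_update:
  assumes "j < n" "w j = a" "a \<noteq> b" "a < N" "b < N"
  shows "var b * mon N (content n w) = var a * mon N (content n (w(j := b)))"
proof -
  have var: "var c = mon N (\<lambda>v. if v = c then 1 else 0)" if "c < N" for c
    using that by (simp add: mon_def if_distrib[of "(^) _"] cong: if_cong)
  have a: "content n w a = Suc (content n (w(j := b)) a)"
  proof -
    have "{i. i < n \<and> w i = a} = insert j {i. i < n \<and> (w(j := b)) i = a}" using assms by auto
    then show ?thesis using assms by (simp add: content_def)
  qed
  have b: "content n (w(j := b)) b = Suc (content n w b)"
  proof -
    have "{i. i < n \<and> (w(j := b)) i = b} = insert j {i. i < n \<and> w i = b}" using assms by auto
    then show ?thesis using assms by (simp add: content_def)
  qed
  have c: "content n (w(j := b)) c = content n w c" if "c \<noteq> a" "c \<noteq> b" for c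
    unfolding content_def using that assms by (intro arg_cong[where f=card]) auto
  have "(if v = b then 1 else 0) + content n w v = (if v = a then 1 else 0) + content n (w(j := b)) v" for v
    using a b c[of v] assms(3) by auto
  then show ?thesis by (simp add: var assms mon_mult)
qed

definition exchange :: "nat \<Rightarrow> nat \<Rightarrow> (nat \<Rightarrow> nat) \<Rightarrow> nat \<Rightarrow> nat \<Rightarrow> mpoly" where
  "exchange N n h a b = (\<Sum>w\<in>words N n.
     of_nat (card {(i, j). i < n \<and> j < n \<and> w i = a \<and> w j = b \<and> w \<circ> transpose i j \<circ> h = w}) * mon N (content n w))"

text \<open>Diagonal entries of a product of two root operators of gl_N followed by
  \<open>h\<close>: the letter \<open>a\<close> at place \<open>j\<close> becomes \<open>b\<close>,
  then a letter \<open>b\<close> at place \<open>i\<close> becomes \<open>a\<close>.\<close>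

definition hops :: "nat \<Rightarrow> nat \<Rightarrow> (nat \<Rightarrow> nat) \<Rightarrow> nat \<Rightarrow> nat \<Rightarrow> ((nat \<Rightarrow> nat) \<times> nat \<times> nat) set" where
  "hops N n h a b = {(w, i, j). w \<in> words N n \<and> i < n \<and> j < n \<and> w j = a \<and> (w(j := b)) i = b \<and>
     w(j := b, i := a) \<circ> h = w}"

text \<open>For \<open>i = j\<close> the two replacements undo each other, which leaves a fixed word
  with a marked letter \<open>a\<close>; for \<open>i \<noteq> j\<close> together they exchange the
  letters at two places.\<close>

lemma sum_hops:
  assumes "a < N" "b < N" "a \<noteq> b"
  shows "(\<Sum>(w, i, j)\<in>hops N n h a b. mon N (content n w)) =
    deriv_var a (fixpoly N n h) + exchange N n h a b"
proof -
  have fin: "finite {(i, j). i < n \<and> j < n \<and> Q i j}" for Q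
    by (rule finite_subset[of _ "{..<n} \<times> {..<n}"]) auto
  have eq: "hops N n h a b = (SIGMA w:words N n. {(i, j). i < n \<and> j < n \<and> w j = a \<and> (w(j := b)) i = b \<and>
     w(j := b, i := a) \<circ> h = w})"
    by (auto simp: hops_def)
  have "(\<Sum>(w, i, j)\<in>hops N n h a b. mon N (content n w)) =
     (\<Sum>w\<in>words N n. \<Sum>(i, j)\<in>{(i, j). i < n \<and> j < n \<and> w j = a \<and> (w(j := b)) i = b \<and>
     w(j := b, i := a) \<circ> h = w}. mon N (content n w))"
    unfolding eq by (subst sum.Sigma) (auto simp: fin)
  also have "\<dots> = (\<Sum>w\<in>words N n. of_nat (card {(i, j). i < n \<and> j < n \<and> w j = a \<and> (w(j := b)) i = b \<and>
     w(j := b, i := a) \<circ> h = w}) * mon N (content n w))"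
    by (simp add: case_prod_beta)
  also have "\<dots> = (\<Sum>w\<in>words N n. (if w \<circ> h = w then of_nat (content n w a) * mon N (content n w) else 0) +
     of_nat (card {(i, j). i < n \<and> j < n \<and> w i = a \<and> w j = b \<and> w \<circ> transpose i j \<circ> h = w}) * mon N (content n w))"
  proof (rule sum.cong[OF refl])
    fix w assume "w \<in> words N n"
    have "{(i, j). i < n \<and> j < n \<and> w j = a \<and> (w(j := b)) i = b \<and> w(j := b, i := a) \<circ> h = w} =
      (\<lambda>i. (i, i)) ` {i. i < n \<and> w i = a \<and> w \<circ> h = w} \<union>
      prod.swap ` {(i, j). i < n \<and> j < n \<and> w i = a \<and> w j = b \<and> w \<circ> transpose i j \<circ> h = w}" (is "?L = ?A \<union> ?B")
    proof -
      have 1: "w(i := b, i := a) = w" if "w i = a" for i using that by auto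
      have 2: "w(j := b, i := a) = w \<circ> transpose j i" if "w i = b" "w j = a" for i j
        using that assms(3) by (auto simp: fun_eq_iff transpose_def)
      show ?thesis
      proof (intro equalityI subsetI, goal_cases)
        case (1 p)
        then obtain i j where p: "p = (i, j)" "i < n" "j < n" "w j = a" "(w(j := b)) i = b" "w(j := b, i := a) \<circ> h = w"
          by auto
        then show ?case using 1 2[of i j] by (cases "i = j") auto
      next
        case (2 p)
        then show ?case using \<open>\<And>i j. w i = b \<Longrightarrow> w j = a \<Longrightarrow> w(j := b, i := a) = w \<circ> transpose j i\<close> assms(3)
          by (auto simp: \<open>\<And>i. w i = a \<Longrightarrow> w(i := b, i := a) = w\<close>)
      qed
    qed
    moreover have "card (?A \<union> ?B) = card ?A + card ?B"
      by (rule card_Un_disjoint) (use assms(3) fin in \<open>auto simp: fin\<close>)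
    moreover have "card ?A = (if w \<circ> h = w then content n w a else 0)"
      by (subst card_image) (auto simp: inj_on_def content_def)
    moreover have "card ?B = card {(i, j). i < n \<and> j < n \<and> w i = a \<and> w j = b \<and> w \<circ> transpose i j \<circ> h = w}"
      by (rule card_image) (auto simp: inj_on_def)
    ultimately have "card {(i, j). i < n \<and> j < n \<and> w j = a \<and> (w(j := b)) i = b \<and> w(j := b, i := a) \<circ> h = w} =
      (if w \<circ> h = w then content n w a else 0) +
      card {(i, j). i < n \<and> j < n \<and> w i = a \<and> w j = b \<and> w \<circ> transpose i j \<circ> h = w}" by (simp only:)
    then show "of_nat (card {(i, j). i < n \<and> j < n \<and> w j = a \<and> (w(j := b)) i = b \<and> w(j := b, i := a) \<circ> h = w}) * mon N (content n w) =
      (if w \<circ> h = w then of_nat (content n w a) * mon N (content n w) else 0) +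
     of_nat (card {(i, j). i < n \<and> j < n \<and> w i = a \<and> w j = b \<and> w \<circ> transpose i j \<circ> h = w}) * mon N (content n w)"
      by (simp only: of_nat_add distrib_right) simp
  qed
  also have "\<dots> = (\<Sum>w | w \<in> words N n \<and> w \<circ> h = w. of_nat (content n w a) * mon N (content n w)) + exchange N n h a b"
    by (simp add: sum.distrib exchange_def sum.inter_filter)
  also have "\<dots> = deriv_var a (fixpoly N n h) + exchange N n h a b"
    unfolding fixpoly_def deriv_var_sum by (simp add: deriv_var_mon assms(1))
  finally show ?thesis .
qed

lemma exchange_commute: "exchange N n h a b = exchange N n h b a"
proof -
  have "{(i, j). i < n \<and> j < n \<and> w i = a \<and> w j = b \<and> w \<circ> transpose i j \<circ> h = w} =
    prod.swap ` {(i, j). i < n \<and> j < n \<and> w i = b \<and> w j = a \<and> w \<circ> transpose i j \<circ> h = w}" for w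
    by (auto simp: transpose_commute image_iff)
  then show ?thesis unfolding exchange_def by (simp add: card_image)
qed

text \<open>Cyclicity of the trace: moving the raising operator past the permutation.\<close>

lemma sum_hops_cyclic:
  assumes h: "h permutes {..<n}" and ab: "a < N" "b < N" "a \<noteq> b"
  shows "var b * (\<Sum>(w, i, j)\<in>hops N n h a b. mon N (content n w)) =
    var a * (\<Sum>(w, i, j)\<in>hops N n h b a. mon N (content n w))"
proof -
  have hn: "h i < n \<longleftrightarrow> i < n" "inv h i < n \<longleftrightarrow> i < n" for i
    using permutes_in_image[OF h, of i] permutes_in_image[OF permutes_inv[OF h], of i] by auto
  have hinv: "h (inv h i) = i" "inv h (h i) = i" for i using permutes_inverses[OF h] by auto
  have upd: "u(h j := x) \<circ> h = (u \<circ> h)(j := x)" for u :: "nat \<Rightarrow> nat" and j x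
    using permutes_inj[OF h] by (auto simp: fun_eq_iff inj_eq)
  have "(\<Sum>(w, i, j)\<in>hops N n h a b. var b * mon N (content n w)) =
    (\<Sum>(w, i, j)\<in>hops N n h b a. var a * mon N (content n w))"
  proof (rule sum.reindex_bij_witness[of _ "\<lambda>(v, i', j'). (v(inv h i' := a), j', inv h i')"
        "\<lambda>(w, i, j). (w(j := b), h j, i)"])
    fix p assume "p \<in> hops N n h a b"
    then obtain w i j where p: "p = (w, i, j)" and w: "w \<in> words N n" "i < n" "j < n" "w j = a" "(w(j := b)) i = b"
      "w(j := b, i := a) \<circ> h = w" by (auto simp: hops_def)
    show "(case case p of (w, i, j) \<Rightarrow> (w(j := b), h j, i) of (v, i', j') \<Rightarrow> (v(inv h i' := a), j', inv h i')) = p"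
      using w(4) by (auto simp: p hinv)
    have "(w(j := b, i := a)) (h j) = a" using fun_cong[OF w(6), of j] w(4) by simp
    moreover have "w(j := b, i := a, h j := b) \<circ> h = w(j := b)" unfolding upd w(6) ..
    moreover have "w(j := b) \<in> words N n" using w(1,3) ab by (auto simp: words_def PiE_iff extensional_def)
    ultimately show "(case p of (w, i, j) \<Rightarrow> (w(j := b), h j, i)) \<in> hops N n h b a"
      using w by (auto simp: p hops_def hn)
    show "(case case p of (w, i, j) \<Rightarrow> (w(j := b), h j, i) of (w, i, j) \<Rightarrow> var a * mon N (content n w)) =
      (case p of (w, i, j) \<Rightarrow> var b * mon N (content n w))"
      using mon_content_update[of j n w a b N, OF w(3,4) ab(3,1,2)] by (simp add: p)
  next
    fix p assume "p \<in> hops N n h b a"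
    then obtain v i' j' where p: "p = (v, i', j')" and v: "v \<in> words N n" "i' < n" "j' < n" "v j' = b" "(v(j' := a)) i' = a"
      "v(j' := a, i' := b) \<circ> h = v" by (auto simp: hops_def)
    define j where "j = inv h i'"
    have i': "i' = h j" by (simp add: j_def hinv)
    have v2: "(v(j' := a) \<circ> h)(j := b) = v" using v(6) unfolding i' upd .
    have vj: "v j = b" using fun_cong[OF v2, of j] by simp
    have "(v(j' := a) \<circ> h) j = a" using v(5) i' by simp
    then have v3: "v(j' := a) \<circ> h = v(j := a)" using v2 by (metis fun_upd_triv fun_upd_upd)
    show "(case case p of (v, i', j') \<Rightarrow> (v(inv h i' := a), j', inv h i') of (w, i, j) \<Rightarrow> (w(j := b), h j, i)) = p"
      using vj by (auto simp: p hinv j_def[symmetric] i')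
    have "v(j := a, j := b, j' := a) \<circ> h = v(j := a)" using vj v3 by (simp add: fun_upd_idem)
    moreover have "v(j := a) \<in> words N n" using v(1,2) ab hn(2)[of i'] by (auto simp: words_def PiE_iff extensional_def j_def)
    moreover have "(v(j := a, j := b)) j' = b" using vj v(4) by simp
    ultimately show "(case p of (v, i', j') \<Rightarrow> (v(inv h i' := a), j', inv h i')) \<in> hops N n h a b"
      using v hn(2)[of i'] by (simp add: p hops_def j_def[symmetric])
  qed
  then show ?thesis by (simp add: sum_distrib_left case_prod_beta)
qed

text \<open>Both sides of the cyclic trace identity are evaluated by \<open>sum_hops\<close>. The
  result is the divided difference relation that \<open>sq_op_alt_mult\<close> asks of
  \<open>B\<close>.\<close>

lemma exchange_relation:
  assumes h: "h permutes {..<n}" and ab: "a < N" "b < N" "a \<noteq> b"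
  shows "(var a - var b) * exchange N n h a b =
    var b * deriv_var a (fixpoly N n h) - var a * deriv_var b (fixpoly N n h)"
proof -
  have "var b * (deriv_var a (fixpoly N n h) + exchange N n h a b) =
    var a * (deriv_var b (fixpoly N n h) + exchange N n h a b)"
    using sum_hops_cyclic[OF assms] sum_hops[OF ab] sum_hops[OF ab(2,1)] ab(3)
    by (simp add: exchange_commute[of N n h b a])
  then show ?thesis by (simp add: algebra_simps)
qed

text \<open>Ordered pairs, so each transposition is counted twice; this matches the factor 2 of the
  cross terms in \<open>sq_op_mult\<close>.\<close>

definition offdiag :: "nat \<Rightarrow> (nat \<times> nat) set" where
  "offdiag n = {(i, j). i < n \<and> j < n \<and> i \<noteq> j}"

lemma finite_offdiag [simp]: "finite (offdiag n)"
  by (rule finite_subset[of _ "{..<n} \<times> {..<n}"]) (auto simp: offdiag_def)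

lemma card_offdiag_equal:
  "int (card {(i, j) \<in> offdiag n. w i = a \<and> w j = a}) = (int (content n w a))\<^sup>2 - int (content n w a)"
proof -
  let ?C = "{i. i < n \<and> w i = a}"
  have eq: "?C \<times> ?C = {(i, j) \<in> offdiag n. w i = a \<and> w j = a} \<union> (\<lambda>i. (i, i)) ` ?C"
    by (auto simp: offdiag_def)
  have fin: "finite {(i, j) \<in> offdiag n. w i = a \<and> w j = a}"
    by (rule finite_subset[OF _ finite_offdiag[of n]]) auto
  have "{(i, j) \<in> offdiag n. w i = a \<and> w j = a} \<inter> (\<lambda>i. (i, i)) ` ?C = {}"
    by (auto simp: offdiag_def)
  then have "card (?C \<times> ?C) = card {(i, j) \<in> offdiag n. w i = a \<and> w j = a} + card ((\<lambda>i. (i, i)) ` ?C)"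
    unfolding eq using fin by (intro card_Un_disjoint) auto
  moreover have "card ((\<lambda>i. (i, i)) ` ?C) = card ?C" by (rule card_image) (auto simp: inj_on_def)
  ultimately have "content n w a * content n w a = card {(i, j) \<in> offdiag n. w i = a \<and> w j = a} + content n w a"
    unfolding content_def card_cartesian_product by simp
  then have "int (content n w a) * int (content n w a) = int (card {(i, j) \<in> offdiag n. w i = a \<and> w j = a}) + int (content n w a)"
    unfolding of_nat_add[symmetric] of_nat_mult[symmetric] by (rule arg_cong)
  then show ?thesis unfolding power2_eq_square by linarith
qed

text \<open>Transposing two places with equal letters does nothing to a word; such pairs are counted
  by the squares of the contents. Places with different letters give the exchange terms, twice for
  each unordered pair of letters.\<close>

lemma sum_transpositions_fixpoly:
  assumes h: "h permutes {..<n}"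
  shows "(\<Sum>(i, j)\<in>offdiag n. fixpoly N n (transpose i j \<circ> h)) =
    sq_op N (fixpoly N n h) - of_nat n * fixpoly N n h + 2 * (\<Sum>(a, b)\<in>idx_pairs N. exchange N n h a b)"
proof -
  let ?m = "\<lambda>w. mon N (content n w)"
  let ?S = "\<lambda>w. {p \<in> offdiag n. w \<circ> transpose (fst p) (snd p) \<circ> h = w}"
  let ?E = "\<lambda>w a b. {(i, j). i < n \<and> j < n \<and> w i = a \<and> w j = b \<and> w \<circ> transpose i j \<circ> h = w}"
  have finE: "finite (?E w a b)" for w a b
    by (rule finite_subset[of _ "{..<n} \<times> {..<n}"]) auto
  have "(\<Sum>(i, j)\<in>offdiag n. fixpoly N n (transpose i j \<circ> h)) =
    (\<Sum>p\<in>offdiag n. \<Sum>w\<in>words N n. if w \<circ> transpose (fst p) (snd p) \<circ> h = w then ?m w else 0)"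
    unfolding fixpoly_def by (simp add: case_prod_beta sum.inter_filter[symmetric] comp_assoc)
  also have "\<dots> = (\<Sum>w\<in>words N n. \<Sum>p\<in>offdiag n. if w \<circ> transpose (fst p) (snd p) \<circ> h = w then ?m w else 0)"
    by (rule sum.swap)
  also have "\<dots> = (\<Sum>w\<in>words N n. of_nat (card (?S w)) * ?m w)"
    by (simp add: sum.inter_filter[symmetric] case_prod_beta)
  also have "\<dots> = (\<Sum>w\<in>words N n. (if w \<circ> h = w then of_int ((\<Sum>a<N. (int (content n w a))\<^sup>2) - int n) * ?m w else 0) +
      (\<Sum>(a, b)\<in>idx_pairs N. 2 * (of_nat (card (?E w a b)) * ?m w)))"
  proof (rule sum.cong[OF refl])
    fix w assume w: "w \<in> words N n"
    have lt: "w i < N" if "i < n" for i using w that by (auto simp: words_def PiE_iff)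
    have tr: "w \<circ> transpose i j = w" if "w i = w j" for i j
      using that by (auto simp: fun_eq_iff transpose_def)
    let ?D = "\<lambda>a. {(i, j) \<in> offdiag n. w i = a \<and> w j = a \<and> w \<circ> h = w}"
    let ?U = "(\<Union>a<N. ?D a)" and ?V = "(\<Union>p\<in>idx_pairs N. ?E w (fst p) (snd p) \<union> ?E w (snd p) (fst p))"
    have finD: "finite (?D a)" for a by (rule finite_subset[OF _ finite_offdiag[of n]]) auto
    have "?S w = ?U \<union> ?V"
    proof (intro equalityI subsetI)
      fix p assume p: "p \<in> ?S w"
      then obtain i j where ij: "p = (i, j)" "i < n" "j < n" "i \<noteq> j" "w \<circ> transpose i j \<circ> h = w"
        by (auto simp: offdiag_def)
      consider "w i = w j" | "w i < w j" | "w j < w i" by linarith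
      then show "p \<in> ?U \<union> ?V"
      proof cases
        case 1
        then show ?thesis using ij lt tr[OF 1] by (auto simp: offdiag_def)
      next
        case 2
        then have "(w i, w j) \<in> idx_pairs N" using ij lt by (simp add: idx_pairs_def)
        then show ?thesis by (intro UnI2, rule UN_I) (use ij in simp)
      next
        case 3
        then have "(w j, w i) \<in> idx_pairs N" using ij lt by (simp add: idx_pairs_def)
        then show ?thesis by (intro UnI2, rule UN_I) (use ij in simp)
      qed
    next
      fix p assume "p \<in> ?U \<union> ?V"
      then show "p \<in> ?S w" using tr by (fastforce simp: offdiag_def idx_pairs_def)
    qed
    moreover have "card (?U \<union> ?V) = card ?U + card ?V"
    proof (rule card_Un_disjoint)
      show "?U \<inter> ?V = {}" by (auto simp: idx_pairs_def)
    qed (auto simp: finD finE)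
    moreover have "card ?U = (\<Sum>a<N. card (?D a))"
      by (rule card_UN_disjoint) (auto simp: finD)
    moreover have "card ?V = (\<Sum>p\<in>idx_pairs N. card (?E w (fst p) (snd p) \<union> ?E w (snd p) (fst p)))"
    proof (rule card_UN_disjoint)
      show "\<forall>p\<in>idx_pairs N. \<forall>q\<in>idx_pairs N. p \<noteq> q \<longrightarrow>
        (?E w (fst p) (snd p) \<union> ?E w (snd p) (fst p)) \<inter> (?E w (fst q) (snd q) \<union> ?E w (snd q) (fst q)) = {}"
        by (auto simp: idx_pairs_def)
    qed (auto simp: finE)
    moreover have "card (?E w (fst p) (snd p) \<union> ?E w (snd p) (fst p)) = 2 * card (?E w (fst p) (snd p))"
      if "p \<in> idx_pairs N" for p
    proof -
      have "?E w (snd p) (fst p) = prod.swap ` ?E w (fst p) (snd p)"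
        by (auto simp: transpose_commute image_iff)
      then have "card (?E w (snd p) (fst p)) = card (?E w (fst p) (snd p))" by (simp add: card_image)
      moreover have "card (?E w (fst p) (snd p) \<union> ?E w (snd p) (fst p)) = card (?E w (fst p) (snd p)) + card (?E w (snd p) (fst p))"
        by (rule card_Un_disjoint) (use that in \<open>auto simp: finE idx_pairs_def\<close>)
      ultimately show ?thesis by simp
    qed
    ultimately have card: "card (?S w) = (\<Sum>a<N. card (?D a)) + (\<Sum>p\<in>idx_pairs N. 2 * card (?E w (fst p) (snd p)))"
      by simp
    have "int (\<Sum>a<N. card (?D a)) = (if w \<circ> h = w then (\<Sum>a<N. (int (content n w a))\<^sup>2) - int n else 0)"
    proof (cases "w \<circ> h = w")
      case True
      then have "int (\<Sum>a<N. card (?D a)) = (\<Sum>a<N. (int (content n w a))\<^sup>2 - int (content n w a))"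
        by (simp add: card_offdiag_equal)
      also have "\<dots> = (\<Sum>a<N. (int (content n w a))\<^sup>2) - int (\<Sum>a<N. content n w a)"
        by (simp add: sum_subtractf)
      finally show ?thesis unfolding sum_content[OF w] if_P[OF True] .
    qed simp
    then have "(of_nat (\<Sum>a<N. card (?D a)) :: mpoly) = of_int (if w \<circ> h = w then (\<Sum>a<N. (int (content n w a))\<^sup>2) - int n else 0)"
      by (subst of_int_of_nat_eq[symmetric]) (rule arg_cong)
    then show "of_nat (card (?S w)) * ?m w =
      (if w \<circ> h = w then of_int ((\<Sum>a<N. (int (content n w a))\<^sup>2) - int n) * ?m w else 0) +
      (\<Sum>(a, b)\<in>idx_pairs N. 2 * (of_nat (card (?E w a b)) * ?m w))"
      unfolding card of_nat_add distrib_right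
      by (simp add: case_prod_beta sum_distrib_right mult.assoc)
  qed
  also have "\<dots> = (\<Sum>w | w \<in> words N n \<and> w \<circ> h = w. of_int ((\<Sum>a<N. (int (content n w a))\<^sup>2) - int n) * ?m w) +
      (\<Sum>w\<in>words N n. \<Sum>(a, b)\<in>idx_pairs N. 2 * (of_nat (card (?E w a b)) * ?m w))"
    by (simp only: sum.distrib sum.inter_filter[OF finite_words])
  also have "(\<Sum>w\<in>words N n. \<Sum>(a, b)\<in>idx_pairs N. 2 * (of_nat (card (?E w a b)) * ?m w)) =
     2 * (\<Sum>(a, b)\<in>idx_pairs N. exchange N n h a b)"
    unfolding exchange_def sum_distrib_left case_prod_beta by (subst sum.swap) simp
  also have "(\<Sum>w | w \<in> words N n \<and> w \<circ> h = w. of_int ((\<Sum>a<N. (int (content n w a))\<^sup>2) - int n) * ?m w) =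
    sq_op N (fixpoly N n h) - of_nat n * fixpoly N n h"
    unfolding fixpoly_def sq_op_def weight_op_sum
    unfolding sq_op_def[symmetric] sq_op_mon sum_distrib_left sum_subtractf[symmetric]
    by (rule sum.cong) (simp_all add: left_diff_distrib)
  finally show ?thesis .
qed

text \<open>The shift for which the sum of transpositions over ordered pairs has eigenvalue
  \<open>level N nu\<close> at \<open>nu\<close>, see \<open>mult_casimir\<close>.\<close>

definition casimir_const :: "nat \<Rightarrow> nat \<Rightarrow> int" where
  "casimir_const N n = (\<Sum>i<N. (int (stair N i))\<^sup>2) + 2 * int (N - 1) * int n + int n"

text \<open>\<open>sq_op_alt_mult\<close> applies with \<open>exchange\<close> as the quotient
  \<open>B\<close>, and \<open>sum_transpositions_fixpoly\<close> recognizes the outcome: the second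
  order operator has become the class sum of transpositions acting on \<open>h\<close>.\<close>

theorem sq_op_alt_fixpoly:
  assumes h: "h permutes {..<n}"
  shows "sq_op N (alt N (stair N) * fixpoly N n h) =
    alt N (stair N) * ((\<Sum>(i, j)\<in>offdiag n. fixpoly N n (transpose i j \<circ> h)) + of_int (casimir_const N n) * fixpoly N n h)"
proof -
  have "(\<Sum>c<N. deriv_var c (fixpoly N n h)) = (\<Sum>w | w \<in> words N n \<and> w \<circ> h = w. of_nat (\<Sum>c<N. content n w c) * mon N (content n w))"
    unfolding fixpoly_def deriv_var_sum by (subst sum.swap) (simp add: deriv_var_mon sum_distrib_right)
  also have "\<dots> = of_nat n * fixpoly N n h"
    unfolding fixpoly_def sum_distrib_left by (rule sum.cong) (auto simp: sum_content simp del: of_nat_sum)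
  finally have Y: "(\<Sum>c<N. deriv_var c (fixpoly N n h)) = of_nat n * fixpoly N n h" .
  have "sq_op N (alt N (stair N) * fixpoly N n h) =
    alt N (stair N) * (sq_op N (fixpoly N n h) + 2 * (\<Sum>(a, b)\<in>idx_pairs N. exchange N n h a b) +
      of_int ((\<Sum>i<N. (int (stair N i))\<^sup>2) + 2 * int (N - 1) * int n) * fixpoly N n h)"
    by (rule sq_op_alt_mult[OF _ Y]) (use exchange_relation[OF h] in \<open>auto simp: idx_pairs_def\<close>)
  then show ?thesis
    unfolding sum_transpositions_fixpoly[OF h] casimir_const_def by (simp add: algebra_simps)
qed

section \<open>Polynomials in the Casimir operator on a weight space\<close>

definition words_of :: "nat \<Rightarrow> nat \<Rightarrow> (nat \<Rightarrow> nat) \<Rightarrow> (nat \<Rightarrow> nat) set" where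
  "words_of N n \<kappa> = {w \<in> words N n. \<forall>a<N. content n w a = \<kappa> a}"

lemma finite_words_of [simp]: "finite (words_of N n \<kappa>)"
  by (simp add: words_of_def)

lemma words_of_comp: "h permutes {..<n} \<Longrightarrow> w \<in> words_of N n \<kappa> \<Longrightarrow> w \<circ> h \<in> words_of N n \<kappa>"
  by (auto simp: words_of_def words_comp content_comp)

lemma comp_permutes_cancel:
  assumes "h permutes A"
  shows "(w \<circ> h) \<circ> inv h = w" "(w \<circ> inv h) \<circ> h = w"
  using permutes_inv_o[OF assms] by (simp_all add: comp_assoc)

lemma words_of_comp_iff:
  assumes "h permutes {..<n}"
  shows "w \<circ> h \<in> words_of N n \<kappa> \<longleftrightarrow> w \<in> words_of N n \<kappa>"
  using words_of_comp[OF assms] words_of_comp[OF permutes_inv[OF assms], of "w \<circ> h"]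
    comp_permutes_cancel[OF assms, of w] by auto

lemma sum_words_of_comp:
  assumes "h permutes {..<n}"
  shows "(\<Sum>w\<in>words_of N n \<kappa>. f (w \<circ> h)) = (\<Sum>w\<in>words_of N n \<kappa>. f w)"
  by (rule sum.reindex_bij_witness[of _ "\<lambda>w. w \<circ> inv h" "\<lambda>w. w \<circ> h"])
    (auto simp: comp_permutes_cancel[OF assms] words_of_comp assms permutes_inv)

lemma transpose_permutes: "(i, j) \<in> offdiag n \<Longrightarrow> transpose i j permutes {..<n}"
  by (intro permutes_swap_id) (auto simp: offdiag_def)

text \<open>Up to an additive constant, the sum of all transpositions acting on functions of words is the
  Casimir operator of \<open>gl\<^sub>N\<close> on the tensor power.\<close>

definition cas :: "nat \<Rightarrow> nat \<Rightarrow> real \<Rightarrow> ((nat \<Rightarrow> nat) \<Rightarrow> real) \<Rightarrow> (nat \<Rightarrow> nat) \<Rightarrow> real" where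
  "cas N n c f = (\<lambda>w. (\<Sum>(i, j)\<in>offdiag n. f (w \<circ> transpose i j)) + (real_of_int (casimir_const N n) - c) * f w)"

text \<open>A polynomial given by its list of roots, as eigenvalues only have to be cancelled or
  kept.\<close>

primrec cas_poly :: "nat \<Rightarrow> nat \<Rightarrow> real list \<Rightarrow> ((nat \<Rightarrow> nat) \<Rightarrow> real) \<Rightarrow> (nat \<Rightarrow> nat) \<Rightarrow> real" where
  "cas_poly N n [] f = f"
| "cas_poly N n (c # cs) f = cas N n c (cas_poly N n cs f)"

lemma cas_add: "cas N n c (\<lambda>w. f w + g w) = (\<lambda>w. cas N n c f w + cas N n c g w)"
  by (simp add: cas_def case_prod_beta sum.distrib algebra_simps)

lemma cas_scale: "cas N n c (\<lambda>w. a * f w) = (\<lambda>w. a * cas N n c f w)"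
  by (simp add: cas_def case_prod_beta sum_distrib_left algebra_simps)

lemma cas_0: "cas N n c (\<lambda>w. 0) = (\<lambda>w. 0)"
  using cas_scale[of N n c 0 "\<lambda>w. 0"] by simp

lemma cas_commute: "cas N n c (cas N n d f) = cas N n d (cas N n c f)"
proof -
  have "cas N n c f = (\<lambda>w. cas N n 0 f w + (- c) * f w)" for c f
    by (simp add: cas_def algebra_simps)
  then have 1: "cas N n c f = (\<lambda>w. cas N n 0 f w + (- c) * f w)" for c f .
  have eq: "cas N n c (cas N n d f) = (\<lambda>w. cas N n 0 (cas N n 0 f) w + (- d) * cas N n 0 f w + (- c) * (cas N n 0 f w + (- d) * f w))"
    for c d
    unfolding 1[of c] 1[of d] cas_add cas_scale by (simp add: fun_eq_iff algebra_simps)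
  show ?thesis by (simp only: eq[of c d] eq[of d c]) (simp add: algebra_simps)
qed

lemma cas_poly_add: "cas_poly N n cs (\<lambda>w. f w + g w) = (\<lambda>w. cas_poly N n cs f w + cas_poly N n cs g w)"
  by (induction cs) (simp_all add: cas_add)

lemma cas_poly_scale: "cas_poly N n cs (\<lambda>w. a * f w) = (\<lambda>w. a * cas_poly N n cs f w)"
  by (induction cs) (simp_all add: cas_scale)

lemma cas_poly_0: "cas_poly N n cs (\<lambda>w. 0) = (\<lambda>w. 0)"
  by (induction cs) (simp_all add: cas_0)

lemma cas_poly_sum: "cas_poly N n cs (\<lambda>w. \<Sum>x\<in>A. f x w) = (\<lambda>w. \<Sum>x\<in>A. cas_poly N n cs (f x) w)"
  by (induction A rule: infinite_finite_induct) (simp_all add: cas_poly_0 cas_poly_add)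

lemma cas_poly_cas: "cas_poly N n cs (cas N n c f) = cas N n c (cas_poly N n cs f)"
  by (induction cs) (simp_all add: cas_commute)

lemma cas_poly_append: "cas_poly N n (cs @ ds) f = cas_poly N n cs (cas_poly N n ds f)"
  by (induction cs) simp_all

lemma cas_cong:
  assumes "\<And>w. w \<in> words N n \<Longrightarrow> f w = g w" "w \<in> words N n"
  shows "cas N n c f w = cas N n c g w"
  unfolding cas_def using assms words_comp[OF transpose_permutes, of _ _ n w N]
  by (intro arg_cong2[where f="(+)"] sum.cong) auto

lemma cas_poly_cong:
  assumes "\<And>w. w \<in> words N n \<Longrightarrow> f w = g w" "w \<in> words N n"
  shows "cas_poly N n cs f w = cas_poly N n cs g w"
  using assms(2)
proof (induction cs arbitrary: w)
  case (Cons c cs)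
  then show ?case unfolding cas_poly.simps by (intro cas_cong) auto
qed (simp add: assms(1))

definition inner :: "(nat \<Rightarrow> nat) set \<Rightarrow> ((nat \<Rightarrow> nat) \<Rightarrow> real) \<Rightarrow> ((nat \<Rightarrow> nat) \<Rightarrow> real) \<Rightarrow> real" where
  "inner A f g = (\<Sum>w\<in>A. f w * g w)"

text \<open>Transpositions are involutions that preserve the content, hence symmetric operators on
  each weight space.\<close>

lemma cas_self_adjoint: "inner (words_of N n \<kappa>) (cas N n c f) g = inner (words_of N n \<kappa>) f (cas N n c g)"
proof -
  let ?W = "words_of N n \<kappa>"
  have tr: "(\<Sum>w\<in>?W. f (w \<circ> transpose i j) * g w) = (\<Sum>w\<in>?W. f w * g (w \<circ> transpose i j))"
    if "(i, j) \<in> offdiag n" for i j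
  proof -
    have "(\<Sum>w\<in>?W. f w * g (w \<circ> transpose i j)) = (\<Sum>w\<in>?W. f (w \<circ> transpose i j) * g ((w \<circ> transpose i j) \<circ> transpose i j))"
      by (rule sum_words_of_comp[OF transpose_permutes[OF that], symmetric, where f="\<lambda>w. f w * g (w \<circ> transpose i j)"])
    then show ?thesis by (simp add: comp_assoc)
  qed
  define K where "K = real_of_int (casimir_const N n) - c"
  have "inner ?W (cas N n c f) g =
    (\<Sum>(i, j)\<in>offdiag n. \<Sum>w\<in>?W. f (w \<circ> transpose i j) * g w) + K * (\<Sum>w\<in>?W. f w * g w)"
    unfolding inner_def cas_def K_def[symmetric]
    by (simp add: case_prod_beta algebra_simps sum.distrib sum_distrib_left sum_distrib_right sum.swap[of _ "offdiag n"])
  also have "\<dots> = (\<Sum>(i, j)\<in>offdiag n. \<Sum>w\<in>?W. f w * g (w \<circ> transpose i j)) + K * (\<Sum>w\<in>?W. f w * g w)"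
    by (intro arg_cong2[where f="(+)"] sum.cong) (auto simp: tr)
  also have "\<dots> = inner ?W f (cas N n c g)"
    unfolding inner_def cas_def K_def[symmetric]
    by (simp add: case_prod_beta algebra_simps sum.distrib sum_distrib_left sum_distrib_right sum.swap[of _ "offdiag n"])
  finally show ?thesis .
qed

lemma cas_poly_self_adjoint:
  "inner (words_of N n \<kappa>) (cas_poly N n cs f) g = inner (words_of N n \<kappa>) f (cas_poly N n cs g)"
  by (induction cs arbitrary: f g) (simp_all add: cas_self_adjoint flip: cas_poly_cas)

lemma cas_poly_support:
  assumes "\<And>w. w \<notin> words_of N n \<kappa> \<Longrightarrow> f w = 0" "w \<notin> words_of N n \<kappa>"
  shows "cas_poly N n cs f w = 0"
  using assms(2)
proof (induction cs arbitrary: w)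
  case (Cons c cs)
  have "cas_poly N n cs f (w \<circ> transpose i j) = 0" if "(i, j) \<in> offdiag n" for i j
    using Cons words_of_comp_iff[OF transpose_permutes[OF that]] by blast
  then show ?case using Cons by (simp add: cas_def case_prod_beta)
qed (simp add: assms(1))

definition point :: "(nat \<Rightarrow> nat) \<Rightarrow> (nat \<Rightarrow> nat) \<Rightarrow> real" where
  "point w v = (if v = w then 1 else 0)"

text \<open>The trace, on functions on the words of content \<open>\<kappa>\<close>, of a polynomial
  in the Casimir operator composed with the place permutation \<open>h\<close>.\<close>

definition cas_trace :: "nat \<Rightarrow> nat \<Rightarrow> (nat \<Rightarrow> nat) \<Rightarrow> real list \<Rightarrow> (nat \<Rightarrow> nat) \<Rightarrow> real" where
  "cas_trace N n \<kappa> cs h = (\<Sum>w\<in>words_of N n \<kappa>. cas_poly N n cs (\<lambda>v. point w (v \<circ> h)) w)"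

lemma point_comp: "h permutes {..<n} \<Longrightarrow> (\<lambda>v. point w (v \<circ> h)) = point (w \<circ> inv h)"
proof
  fix v assume h: "h permutes {..<n}"
  have "v \<circ> h = w \<longleftrightarrow> v = w \<circ> inv h" using comp_permutes_cancel[OF h, of v] comp_permutes_cancel[OF h, of w] by auto
  then show "point w (v \<circ> h) = point (w \<circ> inv h) v" by (simp add: point_def)
qed

lemma cas_trace_Nil: "cas_trace N n \<kappa> [] h = Poly_Mapping.lookup (fixpoly N n h) (expo N \<kappa>)"
proof -
  have "Poly_Mapping.lookup (fixpoly N n h) (expo N \<kappa>) =
    (\<Sum>w\<in>words N n. if w \<circ> h = w then (if \<forall>a<N. content n w a = \<kappa> a then 1 else 0) else 0)"
    unfolding fixpoly_def lookup_sum lookup_mon by (rule sum.inter_filter) simp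
  also have "\<dots> = (\<Sum>w\<in>words N n. if \<forall>a<N. content n w a = \<kappa> a then (if w \<circ> h = w then 1 else 0) else 0)"
    by (rule sum.cong) auto
  also have "\<dots> = (\<Sum>w\<in>words_of N n \<kappa>. if w \<circ> h = w then 1 else 0)"
    unfolding words_of_def by (rule sum.inter_filter[symmetric]) simp
  finally show ?thesis by (simp add: cas_trace_def point_def of_int_sum if_distrib cong: if_cong)
qed

lemma cas_trace_Cons:
  "cas_trace N n \<kappa> (c # cs) h =
    (\<Sum>(i, j)\<in>offdiag n. cas_trace N n \<kappa> cs (transpose i j \<circ> h)) + (real_of_int (casimir_const N n) - c) * cas_trace N n \<kappa> cs h"
proof -
  have "cas_poly N n (c # cs) (\<lambda>v. point w (v \<circ> h)) =
    (\<lambda>u. (\<Sum>p\<in>offdiag n. cas_poly N n cs (\<lambda>v. point w (v \<circ> (transpose (fst p) (snd p) \<circ> h))) u) +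
      (real_of_int (casimir_const N n) - c) * cas_poly N n cs (\<lambda>v. point w (v \<circ> h)) u)" for w
    unfolding cas_poly.simps cas_poly_cas[symmetric]
    unfolding cas_def cas_poly_add cas_poly_scale case_prod_beta cas_poly_sum comp_assoc ..
  then show ?thesis
    unfolding cas_trace_def
    by (simp add: sum.distrib sum_distrib_left case_prod_beta sum.swap[of _ "offdiag n"])
qed

definition cas_killed :: "nat \<Rightarrow> nat \<Rightarrow> real list \<Rightarrow> (nat \<Rightarrow> nat) \<Rightarrow> bool" where
  "cas_killed N n cs \<kappa> \<longleftrightarrow> (\<forall>w\<in>words_of N n \<kappa>. \<forall>v\<in>words N n. cas_poly N n cs (point w) v = 0)"

lemma cas_killed_append: "cas_killed N n cs \<kappa> \<Longrightarrow> cas_killed N n (ds @ cs) \<kappa>"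
  unfolding cas_killed_def cas_poly_append
proof (intro ballI)
  fix w v assume *: "\<forall>w\<in>words_of N n \<kappa>. \<forall>v\<in>words N n. cas_poly N n cs (point w) v = 0"
    and w: "w \<in> words_of N n \<kappa>" and v: "v \<in> words N n"
  have "cas_poly N n ds (cas_poly N n cs (point w)) v = cas_poly N n ds (\<lambda>_. 0) v"
    by (rule cas_poly_cong[OF _ v]) (use * w in auto)
  then show "cas_poly N n ds (cas_poly N n cs (point w)) v = 0" by (simp add: cas_poly_0)
qed

lemma cas_trace_killed:
  assumes "cas_killed N n cs \<kappa>" "h permutes {..<n}"
  shows "cas_trace N n \<kappa> cs h = 0"
  unfolding cas_trace_def point_comp[OF assms(2)]
proof (rule sum.neutral, rule ballI)
  fix w assume w: "w \<in> words_of N n \<kappa>"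
  then have "w \<circ> inv h \<in> words_of N n \<kappa>" "w \<in> words N n"
    using words_of_comp[OF permutes_inv[OF assms(2)]] by (auto simp: words_of_def)
  then show "cas_poly N n cs (point (w \<circ> inv h)) w = 0" using assms(1) by (auto simp: cas_killed_def)
qed

text \<open>The list \<open>cs @ cs\<close> stands for the square of a self-adjoint operator, one
  factor of which moves to the other side of the inner product.\<close>

lemma cas_trace_square:
  assumes "h permutes {..<n}"
  shows "cas_trace N n \<kappa> (cs @ cs) h =
    (\<Sum>w\<in>words_of N n \<kappa>. inner (words_of N n \<kappa>) (cas_poly N n cs (point (w \<circ> inv h))) (cas_poly N n cs (point w)))"
  unfolding cas_trace_def point_comp[OF assms]
proof (rule sum.cong[OF refl])
  fix w assume w: "w \<in> words_of N n \<kappa>"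
  have "inner (words_of N n \<kappa>) (cas_poly N n cs (point (w \<circ> inv h))) (cas_poly N n cs (point w)) =
    inner (words_of N n \<kappa>) (cas_poly N n (cs @ cs) (point (w \<circ> inv h))) (point w)"
    by (simp add: cas_poly_self_adjoint cas_poly_append)
  also have "\<dots> = cas_poly N n (cs @ cs) (point (w \<circ> inv h)) w"
    using w by (simp add: inner_def point_def if_distrib cong: if_cong)
  finally show "cas_poly N n (cs @ cs) (point (w \<circ> inv h)) w =
    inner (words_of N n \<kappa>) (cas_poly N n cs (point (w \<circ> inv h))) (cas_poly N n cs (point w))" by simp
qed

text \<open>At the identity the trace of the square is the sum of the squared norms of the images of
  all point functions. The vanishing of one number thus annihilates the weight space.\<close>

lemma cas_killed_if_trace_0:
  assumes "cas_trace N n \<kappa> (cs @ cs) id = 0"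
  shows "cas_killed N n cs \<kappa>"
proof -
  let ?W = "words_of N n \<kappa>"
  have "(\<Sum>w\<in>?W. inner ?W (cas_poly N n cs (point w)) (cas_poly N n cs (point w))) = 0"
    using assms by (simp add: cas_trace_square permutes_id)
  then have *: "cas_poly N n cs (point w) v = 0" if "w \<in> ?W" "v \<in> ?W" for w v
    using that by (simp add: inner_def sum_nonneg_eq_0_iff sum_nonneg)
  have "cas_poly N n cs (point w) v = 0" if "w \<in> ?W" for w v
  proof (cases "v \<in> ?W")
    case False
    then show ?thesis by (rule cas_poly_support[rotated]) (use that in \<open>auto simp: point_def\<close>)
  qed (use * that in auto)
  then show ?thesis by (simp add: cas_killed_def)
qed

text \<open>After multiplication by \<open>card H\<close> the sum runs over pairs \<open>h\<close>,
  \<open>h'\<close> standing for \<open>inv h \<circ> h'\<close>, and becomes the sum of the squares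
  of the sums of \<open>g (w \<circ> h) v\<close> over \<open>h\<close> in \<open>H\<close>.\<close>

lemma sum_cas_trace_nonneg:
  assumes H: "finite H" "\<And>h. h \<in> H \<Longrightarrow> h permutes {..<n}" "id \<in> H"
    "\<And>g h. g \<in> H \<Longrightarrow> h \<in> H \<Longrightarrow> g \<circ> h \<in> H" "\<And>h. h \<in> H \<Longrightarrow> inv h \<in> H"
  shows "0 \<le> (\<Sum>h\<in>H. cas_trace N n \<kappa> (cs @ cs) h)"
proof -
  let ?W = "words_of N n \<kappa>"
  define g where "g w = cas_poly N n cs (point w)" for w
  have tr: "(\<Sum>w\<in>?W. inner ?W (g (w \<circ> h)) (g (w \<circ> h'))) = cas_trace N n \<kappa> (cs @ cs) (inv h \<circ> h')"
    if "h \<in> H" "h' \<in> H" for h h'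
  proof -
    have p: "h permutes {..<n}" "h' permutes {..<n}" using H that by auto
    have "inv (inv h \<circ> h') = inv h' \<circ> h"
      using o_inv_distrib[OF permutes_bij[OF permutes_inv[OF p(1)]] permutes_bij[OF p(2)]] permutes_inv_inv[OF p(1)] by simp
    then have "cas_trace N n \<kappa> (cs @ cs) (inv h \<circ> h') = (\<Sum>w\<in>?W. inner ?W (g (w \<circ> (inv h' \<circ> h))) (g w))"
      using cas_trace_square[of "inv h \<circ> h'" n N \<kappa> cs] p by (simp add: g_def permutes_compose permutes_inv)
    also have "\<dots> = (\<Sum>w\<in>?W. inner ?W (g ((w \<circ> h') \<circ> (inv h' \<circ> h))) (g (w \<circ> h')))"
      by (rule sum_words_of_comp[OF p(2), symmetric, where f="\<lambda>w. inner ?W (g (w \<circ> (inv h' \<circ> h))) (g w)"])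
    also have "\<dots> = (\<Sum>w\<in>?W. inner ?W (g (w \<circ> h)) (g (w \<circ> h')))"
    proof -
      have "(w \<circ> h') \<circ> (inv h' \<circ> h) = w \<circ> h" for w :: "nat \<Rightarrow> nat"
        using comp_permutes_cancel(1)[OF p(2), of w] by (simp only: comp_assoc[symmetric])
      then show ?thesis by simp
    qed
    finally show ?thesis by simp
  qed
  have shift: "(\<Sum>h'\<in>H. cas_trace N n \<kappa> (cs @ cs) (inv h \<circ> h')) = (\<Sum>h\<in>H. cas_trace N n \<kappa> (cs @ cs) h)" if h: "h \<in> H" for h
  proof -
    have p: "h permutes {..<n}" using H h by auto
    have 1: "h \<circ> (inv h \<circ> f) = f" "inv h \<circ> (h \<circ> f) = f" for f :: "nat \<Rightarrow> nat"
      using permutes_inv_o[OF p] by (simp_all add: comp_assoc[symmetric])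
    show ?thesis
      by (rule sum.reindex_bij_witness[of _ "\<lambda>k. h \<circ> k" "\<lambda>k. inv h \<circ> k"]) (use H(4,5) h in \<open>auto simp: 1\<close>)
  qed
  have "real (card H) * (\<Sum>h\<in>H. cas_trace N n \<kappa> (cs @ cs) h) =
    (\<Sum>h\<in>H. \<Sum>h'\<in>H. \<Sum>w\<in>?W. inner ?W (g (w \<circ> h)) (g (w \<circ> h')))"
    by (simp add: tr shift)
  also have "\<dots> = (\<Sum>w\<in>?W. \<Sum>h\<in>H. \<Sum>h'\<in>H. inner ?W (g (w \<circ> h)) (g (w \<circ> h')))"
    by (subst sum.swap[of _ ?W]) (intro sum.cong[OF refl] sum.swap)
  also have "\<dots> = (\<Sum>w\<in>?W. \<Sum>v\<in>?W. (\<Sum>h\<in>H. g (w \<circ> h) v)\<^sup>2)"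
  proof (rule sum.cong[OF refl])
    fix w
    have "(\<Sum>h\<in>H. \<Sum>h'\<in>H. inner ?W (g (w \<circ> h)) (g (w \<circ> h'))) =
      (\<Sum>h\<in>H. \<Sum>v\<in>?W. \<Sum>h'\<in>H. g (w \<circ> h) v * g (w \<circ> h') v)"
      unfolding inner_def by (intro sum.cong[OF refl] sum.swap)
    also have "\<dots> = (\<Sum>v\<in>?W. \<Sum>h\<in>H. \<Sum>h'\<in>H. g (w \<circ> h) v * g (w \<circ> h') v)"
      by (rule sum.swap)
    finally show "(\<Sum>h\<in>H. \<Sum>h'\<in>H. inner ?W (g (w \<circ> h)) (g (w \<circ> h'))) = (\<Sum>v\<in>?W. (\<Sum>h\<in>H. g (w \<circ> h) v)\<^sup>2)"
      by (simp add: power2_eq_square sum_product)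
  qed
  also have "\<dots> \<ge> 0" by (intro sum_nonneg) auto
  finally have "0 \<le> real (card H) * (\<Sum>h\<in>H. cas_trace N n \<kappa> (cs @ cs) h)" .
  moreover have "0 < card H" using H(1,3) by (auto simp: card_gt_0_iff)
  ultimately show ?thesis by (simp add: zero_le_mult_iff)
qed

section \<open>Levels and the isolation of a single Schur function\<close>

lemma sdec_SucI: "(\<And>i. Suc i < N \<Longrightarrow> k (Suc i) < k i) \<Longrightarrow> sdec N k"
  unfolding sdec_def
proof (intro allI impI)
  fix i j assume step: "\<And>i. Suc i < N \<Longrightarrow> k (Suc i) < k i" and "i < j" "j < N"
  have "k (Suc i + d) < k i" if "Suc i + d < N" for d
    using that
  proof (induction d)
    case (Suc d)
    then have "k (Suc i + d) < k i" "k (Suc (Suc i + d)) < k (Suc i + d)" by (auto intro: step)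
    then show ?case by simp
  qed (simp add: step)
  from this[of "j - Suc i"] show "k j < k i" using \<open>i < j\<close> \<open>j < N\<close> by simp
qed

lemma sum_lessThan_card_le: "finite A \<Longrightarrow> (\<Sum>i<card A. i) \<le> \<Sum>A" for A :: "nat set"
proof (induction A rule: finite_linorder_max_induct)
  case (insert b A)
  have "A \<subseteq> {..<b}" using insert by auto
  then have "card A \<le> card {..<b}" by (intro card_mono) auto
  then show ?case using insert by auto
qed simp

text \<open>Abel summation: the partial sums of \<open>\<tau> i - i\<close> are nonnegative, because
  distinct naturals sum to at least as much as the first ones. Unless \<open>\<tau> = id\<close>
  there is a descent, where both the partial sum and the drop of \<open>a\<close> are
  positive.\<close>

lemma rearrangement_strict:
  fixes a :: "nat \<Rightarrow> int"
  assumes \<tau>: "\<tau> permutes {..<N}" "\<tau> \<noteq> id"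
    and a: "\<And>i. Suc i < N \<Longrightarrow> a (Suc i) \<le> a i"
    and strict: "\<And>i. Suc i < N \<Longrightarrow> \<tau> (Suc i) < \<tau> i \<Longrightarrow> a (Suc i) < a i"
  shows "0 < (\<Sum>i<N. a i * (int (\<tau> i) - int i))"
proof -
  define S where "S t = (\<Sum>i<t. int (\<tau> i) - int i)" for t
  have inj: "inj \<tau>" using \<tau>(1) by (rule permutes_inj)
  have S_eq: "S t = int (\<Sum>(\<tau> ` {..<t})) - int (\<Sum>i<t. i)" for t
  proof -
    have "inj_on \<tau> {..<t}" using inj by (rule inj_on_subset) simp
    then have "\<Sum>(\<tau> ` {..<t}) = (\<Sum>i<t. \<tau> i)" by (simp add: sum.reindex)
    then show ?thesis by (simp add: S_def sum_subtractf)
  qed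
  have card: "card (\<tau> ` {..<t}) = t" for t
    using card_image[OF inj_on_subset[OF inj subset_UNIV], of "{..<t}"] by simp
  have S_nonneg: "0 \<le> S t" for t
    using sum_lessThan_card_le[OF finite_imageI[OF finite_lessThan[of t]], of \<tau>] unfolding S_eq card
    by (simp del: of_nat_sum)
  have S_N: "S N = 0"
    using sum.permute[OF \<tau>(1), of int] by (simp add: S_def sum_subtractf comp_def)
  have abel: "(\<Sum>i<m. a i * (int (\<tau> i) - int i)) = a m * S m + (\<Sum>t<m. (a t - a (Suc t)) * S (Suc t))" for m
    by (induction m) (simp_all add: S_def algebra_simps)
  have "\<exists>i. Suc i < N \<and> \<tau> (Suc i) < \<tau> i"
  proof (rule ccontr)
    assume no: "\<nexists>i. Suc i < N \<and> \<tau> (Suc i) < \<tau> i"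
    have "sdec N (stair N \<circ> \<tau>)"
    proof (rule sdec_SucI)
      fix i assume i: "Suc i < N"
      have "\<tau> (Suc i) \<noteq> \<tau> i" using inj by (simp add: inj_eq)
      then have "\<tau> i < \<tau> (Suc i)" using no i by (metis linorder_neqE_nat)
      moreover have "\<tau> (Suc i) < N" using permutes_in_image[OF \<tau>(1), of "Suc i"] i by simp
      ultimately show "(stair N \<circ> \<tau>) (Suc i) < (stair N \<circ> \<tau>) i" by (simp add: stair_def)
    qed
    then show False using sdec_permute_id[OF sdec_stair _ \<tau>(1)] \<tau>(2) by blast
  qed
  then obtain i where i: "Suc i < N" "\<tau> (Suc i) < \<tau> i" by blast
  have "0 < S (Suc i)"
  proof -
    let ?A = "\<tau> ` {..<Suc i}"
    have notin: "\<tau> (Suc i) \<notin> ?A" using inj by (auto simp: inj_eq)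
    have mem: "\<tau> i \<in> ?A" by simp
    have "\<Sum>?A = \<tau> i + \<Sum>(?A - {\<tau> i})" using sum.remove[OF _ mem, of "\<lambda>x. x"] by simp
    moreover have "\<Sum>(insert (\<tau> (Suc i)) (?A - {\<tau> i})) = \<tau> (Suc i) + \<Sum>(?A - {\<tau> i})"
      using notin by (subst sum.insert) auto
    moreover have "(\<Sum>i<Suc i. i) \<le> \<Sum>(insert (\<tau> (Suc i)) (?A - {\<tau> i}))"
    proof -
      have "card (insert (\<tau> (Suc i)) (?A - {\<tau> i})) = Suc (card (?A - {\<tau> i}))"
        using notin by (subst card_insert_disjoint) auto
      also have "\<dots> = Suc i" using card_Diff_singleton[OF mem] card[of "Suc i"] by simp
      finally show ?thesis using sum_lessThan_card_le[of "insert (\<tau> (Suc i)) (?A - {\<tau> i})"] by simp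
    qed
    ultimately show ?thesis unfolding S_eq using i(2) by linarith
  qed
  then have pos: "0 < (a i - a (Suc i)) * S (Suc i)" using strict[OF i] by simp
  have "0 \<le> (a t - a (Suc t)) * S (Suc t)" if "t < N" for t
  proof (cases "Suc t < N")
    case True
    then show ?thesis using a[OF True] S_nonneg by simp
  next
    case False
    then have "Suc t = N" using that by simp
    then show ?thesis using S_N by simp
  qed
  then have "0 < (\<Sum>t<N. (a t - a (Suc t)) * S (Suc t))"
    using pos i(1) by (intro sum_pos2[of _ i]) auto
  then show ?thesis unfolding abel S_N by simp
qed

text \<open>The eigenvalue of the shifted Casimir operator at \<open>nu\<close>; it orders the
  partitions for a downward induction.\<close>

definition level :: "nat \<Rightarrow> nat list \<Rightarrow> nat" where
  "level N nu = (\<Sum>i<N. (beta N nu i)\<^sup>2)"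

text \<open>The vector \<open>beta - stair \<circ> \<sigma>\<close> is the weight of the term
  \<open>\<sigma>\<close> in the expansion of \<open>mult\<close>. Once it is sorted, the difference
  of the levels is twice a sum to which \<open>rearrangement_strict\<close> applies.\<close>

lemma level_increase:
  assumes nu: "is_partition n nu" "length nu \<le> N" and \<sigma>: "\<sigma> permutes {..<N}" "\<sigma> \<noteq> id"
    and le: "\<And>i. i < N \<Longrightarrow> stair N (\<sigma> i) \<le> beta N nu i"
  obtains nu' \<pi> where "is_partition n nu'" "length nu' \<le> N" "\<pi> permutes {..<N}"
    "\<And>i. i < N \<Longrightarrow> part nu' i = beta N nu (\<pi> i) - stair N (\<sigma> (\<pi> i))" "level N nu < level N nu'"
proof -
  define \<kappa> where "\<kappa> i = beta N nu i - stair N (\<sigma> i)" for i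
  \<comment> \<open>A lexicographic key: \<open>\<kappa>\<close> first, ties broken by the staircase
    value, which is below \<open>N\<close>. With ties broken this way, \<open>a\<close> drops
    strictly at each descent of \<open>\<tau>\<close>, as \<open>rearrangement_strict\<close>
    demands.\<close>
  define \<gamma> where "\<gamma> i = \<kappa> i * N + stair N (\<sigma> i)" for i
  have sN: "stair N i < N" if "i < N" for i using that by (simp add: stair_def)
  have \<sigma>N: "\<sigma> i < N" if "i < N" for i using permutes_in_image[OF \<sigma>(1), of i] that by simp
  have "inj_on \<gamma> {..<N}"
  proof (rule inj_onI)
    fix i j assume ij: "i \<in> {..<N}" "j \<in> {..<N}" "\<gamma> i = \<gamma> j"
    then have "\<gamma> i mod N = \<gamma> j mod N" by simp
    then have "stair N (\<sigma> i) = stair N (\<sigma> j)" using ij sN \<sigma>N by (simp add: \<gamma>_def)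
    then have "\<sigma> i = \<sigma> j" using ij \<sigma>N[of i] \<sigma>N[of j] by (simp add: stair_def)
    then show "i = j" using permutes_inj[OF \<sigma>(1)] by (simp add: inj_eq)
  qed
  then obtain \<pi> where \<pi>: "\<pi> permutes {..<N}" "sdec N (\<gamma> \<circ> \<pi>)" by (rule sorting_permutation)
  have \<pi>N: "\<pi> i < N" if "i < N" for i using permutes_in_image[OF \<pi>(1), of i] that by simp
  define a where "a i = \<kappa> (\<pi> i)" for i
  define \<tau> where "\<tau> = \<sigma> \<circ> \<pi>"
  have \<tau>: "\<tau> permutes {..<N}" unfolding \<tau>_def using \<pi>(1) \<sigma>(1) by (rule permutes_compose)
  have \<tau>N: "\<tau> i < N" if "i < N" for i using permutes_in_image[OF \<tau>, of i] that by simp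
  have step: "a (Suc i) \<le> a i \<and> (a (Suc i) = a i \<longrightarrow> \<tau> i < \<tau> (Suc i))" if i: "Suc i < N" for i
  proof -
    have "\<gamma> (\<pi> (Suc i)) < \<gamma> (\<pi> i)" using \<pi>(2) i by (auto simp: sdec_def)
    then have lt: "a (Suc i) * N + stair N (\<tau> (Suc i)) < a i * N + stair N (\<tau> i)" by (simp add: \<gamma>_def a_def \<tau>_def)
    have b: "stair N (\<tau> i) < N" "stair N (\<tau> (Suc i)) < N" using i \<tau>N sN by auto
    have "a (Suc i) \<le> a i"
    proof (rule ccontr)
      assume "\<not> a (Suc i) \<le> a i"
      then have "Suc (a i) * N \<le> a (Suc i) * N" by (intro mult_le_mono1) simp
      then show False using lt b by simp
    qed
    moreover have "\<tau> i < \<tau> (Suc i)" if "a (Suc i) = a i"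
      using lt that \<tau>N[of i] \<tau>N[of "Suc i"] i by (simp add: stair_def)
    ultimately show ?thesis by blast
  qed
  then have anti: "a (Suc i) \<le> a i" if "Suc i < N" for i using that by blast
  obtain nu' where nu': "is_partition (\<Sum>i<N. a i) nu'" "length nu' \<le> N" "\<And>i. i < N \<Longrightarrow> part nu' i = a i"
    using partition_of_function[of N a, OF anti] by blast
  have \<kappa>: "beta N nu i = \<kappa> i + stair N (\<sigma> i)" if "i < N" for i using le[OF that] by (simp add: \<kappa>_def)
  have stair_sum: "(\<Sum>i<N. g (stair N (\<rho> i))) = (\<Sum>i<N. g (stair N i))" if "\<rho> permutes {..<N}" for \<rho> and g :: "nat \<Rightarrow> nat"
    using sum.permute[OF that, of "\<lambda>i. g (stair N i)"] by (simp add: comp_def)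
  have "(\<Sum>i<N. a i) = n"
  proof -
    have "(\<Sum>i<N. a i) = (\<Sum>i<N. \<kappa> i)" using sum.permute[OF \<pi>(1), of \<kappa>] by (simp add: a_def comp_def)
    moreover have "(\<Sum>i<N. beta N nu i) = (\<Sum>i<N. \<kappa> i) + (\<Sum>i<N. stair N i)"
      using stair_sum[OF \<sigma>(1), of "\<lambda>x. x"] by (simp add: \<kappa> sum.distrib)
    moreover have "(\<Sum>i<N. beta N nu i) = n + (\<Sum>i<N. stair N i)"
      using is_partitionD(3)[OF nu(1)] by (simp add: beta_def sum.distrib sum_part[OF nu(2)])
    ultimately show ?thesis by simp
  qed
  have b\<pi>: "beta N nu (\<pi> i) = a i + stair N (\<tau> i)" if "i < N" for i
    using \<kappa>[OF \<pi>N[OF that]] by (simp add: a_def \<tau>_def)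
  have b': "beta N nu' i = a i + stair N i" if "i < N" for i using nu'(3)[OF that] by (simp add: beta_def)
  \<comment> \<open>Otherwise the beta numbers of \<open>nu\<close> would still decrease after
    composition with \<open>\<pi>\<close>, which forces \<open>\<pi> = id\<close> and then
    \<open>\<sigma> = id\<close>.\<close>
  have "\<tau> \<noteq> id"
  proof
    assume id: "\<tau> = id"
    have "sdec N (beta N nu \<circ> \<pi>)"
      using sdec_beta[OF is_partitionD(1)[OF nu'(1)], of N] b' b\<pi> unfolding sdec_def id by auto
    then have "\<pi> = id" using sdec_permute_id[OF sdec_beta[OF is_partitionD(1)[OF nu(1)]] _ \<pi>(1)] by blast
    then show False using id \<sigma>(2) by (simp add: \<tau>_def)
  qed
  have "0 < (\<Sum>i<N. int (a i) * (int (\<tau> i) - int i))"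
  proof (rule rearrangement_strict[OF \<tau> \<open>\<tau> \<noteq> id\<close>])
    fix i assume "Suc i < N" "\<tau> (Suc i) < \<tau> i"
    then show "int (a (Suc i)) < int (a i)" using step[of i] by auto
  qed (use anti in simp)
  also have "\<dots> = (\<Sum>i<N. int (a i) * (int (stair N i) - int (stair N (\<tau> i))))"
    by (rule sum.cong) (use \<tau>N in \<open>auto simp: stair_def of_nat_diff Suc_le_eq\<close>)
  finally have pos: "0 < (\<Sum>i<N. int (a i) * (int (stair N i) - int (stair N (\<tau> i))))" .
  have "int (level N nu') - int (level N nu) = 2 * (\<Sum>i<N. int (a i) * (int (stair N i) - int (stair N (\<tau> i))))"
  proof -
    have "level N nu = (\<Sum>i<N. (beta N nu (\<pi> i))\<^sup>2)"
      using sum.permute[OF \<pi>(1), of "\<lambda>i. (beta N nu i)\<^sup>2"] by (simp add: level_def comp_def)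
    then have 1: "int (level N nu) = (\<Sum>i<N. (int (a i) + int (stair N (\<tau> i)))\<^sup>2)"
      by (simp add: b\<pi>)
    have 2: "int (level N nu') = (\<Sum>i<N. (int (a i) + int (stair N i))\<^sup>2)"
      by (simp add: level_def b')
    have "(\<Sum>i<N. (stair N (\<tau> i))\<^sup>2) = (\<Sum>i<N. (stair N i)\<^sup>2)" by (rule stair_sum[OF \<tau>])
    then have "int (\<Sum>i<N. (stair N (\<tau> i))\<^sup>2) = int (\<Sum>i<N. (stair N i)\<^sup>2)" by (rule arg_cong)
    then have 3: "(\<Sum>i<N. (int (stair N (\<tau> i)))\<^sup>2) = (\<Sum>i<N. (int (stair N i))\<^sup>2)" by simp
    show ?thesis unfolding 1 2 power2_sum sum.distrib 3
      by (simp add: sum_distrib_left sum_subtractf right_diff_distrib mult.assoc)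
  qed
  then have less: "level N nu < level N nu'" using pos by linarith
  have part: "part nu' i = beta N nu (\<pi> i) - stair N (\<sigma> (\<pi> i))" if "i < N" for i
    using nu'(3)[OF that] by (simp add: a_def \<kappa>_def)
  have "is_partition n nu'" using nu'(1) \<open>(\<Sum>i<N. a i) = n\<close> by simp
  then show ?thesis by (rule that[OF _ nu'(2) \<pi>(1) part less])
qed

definition relabel :: "nat \<Rightarrow> (nat \<Rightarrow> nat) \<Rightarrow> (nat \<Rightarrow> nat) \<Rightarrow> nat \<Rightarrow> nat" where
  "relabel n \<rho> w = (\<lambda>i. if i < n then \<rho> (w i) else undefined)"

lemma relabel_comp: "h permutes {..<n} \<Longrightarrow> relabel n \<rho> (w \<circ> h) = relabel n \<rho> w \<circ> h"
proof
  fix i assume "h permutes {..<n}"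
  then have "h i < n \<longleftrightarrow> i < n" using permutes_in_image[of h "{..<n}" i] by simp
  then show "relabel n \<rho> (w \<circ> h) i = (relabel n \<rho> w \<circ> h) i" by (simp add: relabel_def)
qed

lemma cas_poly_relabel: "cas_poly N n cs (\<lambda>v. f (relabel n \<rho> v)) = (\<lambda>v. cas_poly N n cs f (relabel n \<rho> v))"
proof (induction cs)
  case (Cons c cs)
  have "(\<Sum>(i, j)\<in>offdiag n. cas_poly N n cs f (relabel n \<rho> (w \<circ> transpose i j))) =
    (\<Sum>(i, j)\<in>offdiag n. cas_poly N n cs f (relabel n \<rho> w \<circ> transpose i j))" for w
    by (rule sum.cong) (auto simp: relabel_comp[OF transpose_permutes])
  then show ?case by (simp add: Cons cas_def)
qed simp

text \<open>Renaming letters commutes with permuting places, so weight spaces whose contents differ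
  by a permutation of the letters behave alike.\<close>

lemma cas_killed_relabel:
  assumes \<pi>: "\<pi> permutes {..<N}" and \<kappa>: "\<And>i. i < N \<Longrightarrow> \<kappa>' i = \<kappa> (\<pi> i)" and killed: "cas_killed N n cs \<kappa>'"
  shows "cas_killed N n cs \<kappa>"
  unfolding cas_killed_def
proof (intro ballI)
  fix w v assume w: "w \<in> words_of N n \<kappa>" and v: "v \<in> words N n"
  let ?r = "relabel n (inv \<pi>)"
  have inv: "inv \<pi> a < N" if "a < N" for a using permutes_in_image[OF permutes_inv[OF \<pi>], of a] that by simp
  have r: "?r u \<in> words N n" if "u \<in> words N n" for u
    using that inv by (auto simp: words_def PiE_iff relabel_def extensional_def)
  have "content n (?r w) a = \<kappa>' a" if "a < N" for a
  proof -
    have "{i. i < n \<and> ?r w i = a} = {i. i < n \<and> w i = \<pi> a}"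
      using permutes_inverses[OF \<pi>] by (auto simp: relabel_def)
    moreover have "\<pi> a < N" using permutes_in_image[OF \<pi>, of a] that by simp
    ultimately show ?thesis using w \<kappa>[OF that] by (simp add: content_def words_of_def)
  qed
  then have rw: "?r w \<in> words_of N n \<kappa>'" using w r by (simp add: words_of_def)
  have "u = w" if "u \<in> words N n" "?r u = ?r w" for u
  proof
    fix i
    show "u i = w i"
    proof (cases "i < n")
      case True
      then have "inv \<pi> (u i) = inv \<pi> (w i)" using fun_cong[OF that(2), of i] by (simp add: relabel_def)
      then show ?thesis using permutes_inj[OF permutes_inv[OF \<pi>]] by (simp add: inj_eq)
    next
      case False
      then show ?thesis using that(1) w by (auto simp: words_def words_of_def PiE_iff extensional_def)
    qed
  qed
  then have "cas_poly N n cs (point w) v = cas_poly N n cs (\<lambda>u. point (?r w) (?r u)) v"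
    by (intro cas_poly_cong[OF _ v]) (auto simp: point_def)
  also have "\<dots> = cas_poly N n cs (point (?r w)) (?r v)" by (simp add: cas_poly_relabel)
  also have "\<dots> = 0" using killed rw r[OF v] by (auto simp: cas_killed_def)
  finally show "cas_poly N n cs (point w) v = 0" .
qed

text \<open>The monomial with exponents \<open>beta N nu\<close> is an eigenvector of
  \<open>sq_op N\<close> with eigenvalue \<open>level N nu\<close>; its coefficient is read on both
  sides of \<open>sq_op_alt_fixpoly\<close>.\<close>

lemma mult_casimir:
  assumes "h permutes {..<n}"
  shows "(\<Sum>(i, j)\<in>offdiag n. mult N nu (fixpoly N n (transpose i j \<circ> h))) + casimir_const N n * mult N nu (fixpoly N n h) =
    int (level N nu) * mult N nu (fixpoly N n h)"
proof -
  have "int (level N nu) * mult N nu (fixpoly N n h) =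
    Poly_Mapping.lookup (sq_op N (alt N (stair N) * fixpoly N n h)) (expo N (beta N nu))"
    by (simp add: sq_op_def lookup_weight_op lookup_expo mult_def level_def)
  also have "\<dots> = mult N nu ((\<Sum>(i, j)\<in>offdiag n. fixpoly N n (transpose i j \<circ> h)) + of_int (casimir_const N n) * fixpoly N n h)"
    unfolding sq_op_alt_fixpoly[OF assms] mult_def ..
  finally show ?thesis by (simp add: mult_add mult_of_int mult_sum case_prod_beta)
qed

text \<open>The expansion of \<open>mult\<close> along the terms of the staircase alternant, with a
  polynomial in the Casimir operator inserted into each weight space trace. Weights with a negative
  entry contribute zero.\<close>

definition cas_sum :: "nat \<Rightarrow> nat \<Rightarrow> nat list \<Rightarrow> real list \<Rightarrow> (nat \<Rightarrow> nat) \<Rightarrow> real" where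
  "cas_sum N n nu cs h = (\<Sum>\<sigma> | \<sigma> permutes {..<N}. real_of_int (sign \<sigma>) *
     (if \<forall>i<N. stair N (\<sigma> i) \<le> beta N nu i
      then cas_trace N n (\<lambda>i. beta N nu i - stair N (\<sigma> i)) cs h else 0))"

lemma cas_sum_Nil: "cas_sum N n nu [] h = mult N nu (fixpoly N n h)"
proof -
  have "mult N nu (fixpoly N n h) = (\<Sum>\<sigma> | \<sigma> permutes {..<N}. sign \<sigma> *
     (if \<forall>i<N. stair N (\<sigma> i) \<le> beta N nu i
      then Poly_Mapping.lookup (fixpoly N n h) (expo N (\<lambda>i. beta N nu i - stair N (\<sigma> i))) else 0))"
    unfolding mult_def alt_def sum_distrib_right lookup_sum mult.assoc lookup_of_int_mult lookup_mon_mult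
    by (simp add: comp_def cong: if_cong)
  then show ?thesis by (simp add: cas_sum_def cas_trace_Nil if_distrib cong: if_cong)
qed

lemma cas_sum_Cons:
  "cas_sum N n nu (c # cs) h =
    (\<Sum>(i, j)\<in>offdiag n. cas_sum N n nu cs (transpose i j \<circ> h)) + (real_of_int (casimir_const N n) - c) * cas_sum N n nu cs h"
proof -
  define K where "K = real_of_int (casimir_const N n) - c"
  define ok where "ok \<sigma> \<longleftrightarrow> (\<forall>i<N. stair N (\<sigma> i) \<le> beta N nu i)" for \<sigma>
  have "cas_sum N n nu (c # cs) h = (\<Sum>\<sigma> | \<sigma> permutes {..<N}.
      (\<Sum>p\<in>offdiag n. real_of_int (sign \<sigma>) * (if ok \<sigma>
        then cas_trace N n (\<lambda>i. beta N nu i - stair N (\<sigma> i)) cs (transpose (fst p) (snd p) \<circ> h) else 0)) +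
      K * (real_of_int (sign \<sigma>) * (if ok \<sigma> then cas_trace N n (\<lambda>i. beta N nu i - stair N (\<sigma> i)) cs h else 0)))"
    unfolding cas_sum_def cas_trace_Cons K_def[symmetric] ok_def[symmetric]
    by (rule sum.cong) (simp_all add: case_prod_beta sum_distrib_left algebra_simps)
  then show ?thesis
    unfolding cas_sum_def K_def[symmetric] ok_def[symmetric]
    by (simp add: case_prod_beta sum.distrib sum_distrib_left sum.swap[of _ "offdiag n"])
qed

text \<open>Each root \<open>c\<close> inserts the Casimir operator minus \<open>c\<close>, which by
  \<open>mult_casimir\<close> acts as the scalar \<open>level N nu - c\<close>.\<close>

lemma cas_sum_eq:
  assumes "h permutes {..<n}"
  shows "cas_sum N n nu cs h = prod_list (map (\<lambda>c. real (level N nu) - c) cs) * mult N nu (fixpoly N n h)"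
  using assms
proof (induction cs arbitrary: h)
  case (Cons c cs)
  let ?E = "prod_list (map (\<lambda>c. real (level N nu) - c) cs)"
  let ?\<chi> = "\<lambda>h. real_of_int (mult N nu (fixpoly N n h))"
  have IH: "cas_sum N n nu cs (transpose i j \<circ> h) = ?E * ?\<chi> (transpose i j \<circ> h)" if "(i, j) \<in> offdiag n" for i j
    by (rule Cons.IH[OF permutes_compose[OF Cons.prems transpose_permutes[OF that]]])
  have "real_of_int ((\<Sum>(i, j)\<in>offdiag n. mult N nu (fixpoly N n (transpose i j \<circ> h))) + casimir_const N n * mult N nu (fixpoly N n h)) =
    real_of_int (int (level N nu) * mult N nu (fixpoly N n h))"
    unfolding mult_casimir[OF Cons.prems] ..
  then have c: "(\<Sum>(i, j)\<in>offdiag n. ?\<chi> (transpose i j \<circ> h)) = real (level N nu) * ?\<chi> h - casimir_const N n * ?\<chi> h"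
    by (simp add: case_prod_beta)
  have "cas_sum N n nu (c # cs) h = (\<Sum>(i, j)\<in>offdiag n. ?E * ?\<chi> (transpose i j \<circ> h)) + (casimir_const N n - c) * (?E * ?\<chi> h)"
    unfolding cas_sum_Cons Cons.IH[OF Cons.prems] by (intro arg_cong2[where f="(+)"] sum.cong) (auto simp: IH)
  also have "(\<Sum>(i, j)\<in>offdiag n. ?E * ?\<chi> (transpose i j \<circ> h)) = ?E * (\<Sum>(i, j)\<in>offdiag n. ?\<chi> (transpose i j \<circ> h))"
    by (simp add: sum_distrib_left case_prod_beta)
  finally show ?case unfolding c by (simp add: algebra_simps)
qed (simp add: cas_sum_Nil)

lemma cas_sum_isolated:
  assumes h: "h permutes {..<n}" and killed: "\<And>\<sigma>. \<sigma> permutes {..<N} \<Longrightarrow> \<sigma> \<noteq> id \<Longrightarrow> (\<And>i. i < N \<Longrightarrow> stair N (\<sigma> i) \<le> beta N nu i) \<Longrightarrow>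
      cas_killed N n cs (\<lambda>i. beta N nu i - stair N (\<sigma> i))"
  shows "cas_sum N n nu cs h = cas_trace N n (part nu) cs h"
proof -
  have "cas_sum N n nu cs h = (\<Sum>\<sigma> | \<sigma> permutes {..<N}. if \<sigma> = id then cas_trace N n (part nu) cs h else 0)"
    unfolding cas_sum_def
  proof (rule sum.cong[OF refl])
    fix \<sigma> assume "\<sigma> \<in> {\<sigma>. \<sigma> permutes {..<N}}"
    then show "real_of_int (sign \<sigma>) * (if \<forall>i<N. stair N (\<sigma> i) \<le> beta N nu i
      then cas_trace N n (\<lambda>i. beta N nu i - stair N (\<sigma> i)) cs h else 0) = (if \<sigma> = id then cas_trace N n (part nu) cs h else 0)"
      using cas_trace_killed[OF killed h] by (cases "\<sigma> = id") (auto simp: beta_def)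
  qed
  then show ?thesis by (simp add: finite_permutations permutes_id)
qed

text \<open>Downward induction on the level. For a partition of level exactly \<open>c\<close> all
  terms but the identity belong to higher levels and are annihilated, so the trace of the square
  equals a product with the factor \<open>level N nu - c = 0\<close>; then
  \<open>cas_killed_if_trace_0\<close> applies.\<close>

lemma cas_killed_levels:
  assumes bound: "\<And>nu. is_partition n nu \<Longrightarrow> level N nu < C"
    and "c \<le> C" "is_partition n nu" "length nu \<le> N" "c \<le> level N nu"
  shows "cas_killed N n (map real [c..<C]) (part nu)"
  using assms(2-)
proof (induction c arbitrary: nu rule: inc_induct)
  case base
  then show ?case using bound[of nu] by simp
next
  case (step c)
  let ?cs = "map real [c..<C]"
  have cs: "?cs = [real c] @ map real [Suc c..<C]" using step(1,2) by (simp add: upt_conv_Cons)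
  show ?case
  proof (cases "Suc c \<le> level N nu")
    case True
    then show ?thesis unfolding cs using step by (intro cas_killed_append) auto
  next
    case False
    then have level: "level N nu = c" using step.prems by simp
    have "cas_trace N n (part nu) (?cs @ ?cs) id = cas_sum N n nu (?cs @ ?cs) id"
    proof (rule cas_sum_isolated[symmetric])
      fix \<sigma> assume "\<sigma> permutes {..<N}" "\<sigma> \<noteq> id" "\<And>i. i < N \<Longrightarrow> stair N (\<sigma> i) \<le> beta N nu i"
      then obtain nu' \<pi> where nu': "is_partition n nu'" "length nu' \<le> N" "\<pi> permutes {..<N}"
        "\<And>i. i < N \<Longrightarrow> part nu' i = beta N nu (\<pi> i) - stair N (\<sigma> (\<pi> i))" "level N nu < level N nu'"
        using level_increase[OF step.prems(1,2)] by blast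
      have "cas_killed N n (map real [Suc c..<C]) (part nu')"
        using step.IH[OF nu'(1,2)] nu'(5) level by simp
      then have "cas_killed N n (map real [Suc c..<C]) (\<lambda>i. beta N nu i - stair N (\<sigma> i))"
        by (rule cas_killed_relabel[OF nu'(3), rotated]) (simp add: nu'(4))
      then show "cas_killed N n (?cs @ ?cs) (\<lambda>i. beta N nu i - stair N (\<sigma> i))"
        unfolding cs append_assoc[symmetric] by (rule cas_killed_append)
    qed (rule permutes_id)
    also have "\<dots> = 0"
      unfolding cas_sum_eq[OF permutes_id] using cs level by simp
    finally show ?thesis by (rule cas_killed_if_trace_0)
  qed
qed

text \<open>With all levels above that of \<open>nu\<close> as roots, the multiplicity of
  \<open>nu\<close> is isolated: up to the positive factor \<open>?E * ?E\<close> the sum is a sum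
  of traces of squares on the weight \<open>part nu\<close>. For characters it is
  \<open>card H\<close> times the multiplicity of \<open>nu\<close> in the trivial character induced
  from \<open>H\<close>.\<close>

theorem sum_mult_fixpoly_nonneg:
  assumes H: "finite H" "\<And>h. h \<in> H \<Longrightarrow> h permutes {..<n}" "id \<in> H"
    "\<And>g h. g \<in> H \<Longrightarrow> h \<in> H \<Longrightarrow> g \<circ> h \<in> H" "\<And>h. h \<in> H \<Longrightarrow> inv h \<in> H"
    and nu: "is_partition n nu" "length nu \<le> N"
  shows "0 \<le> (\<Sum>h\<in>H. mult N nu (fixpoly N n h))"
proof -
  define C where "C = Suc (Max (level N ` {nu. is_partition n nu}))"
  have bound: "level N nu < C" if "is_partition n nu" for nu
    unfolding C_def less_Suc_eq_le by (rule Max_ge) (use that in auto)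
  let ?cs = "map real [Suc (level N nu)..<C]"
  let ?E = "prod_list (map (\<lambda>c. real (level N nu) - c) ?cs)"
  have tr: "cas_trace N n (part nu) (?cs @ ?cs) h = ?E * ?E * mult N nu (fixpoly N n h)" if "h \<in> H" for h
  proof -
    have h: "h permutes {..<n}" using H(2) that .
    have "cas_trace N n (part nu) (?cs @ ?cs) h = cas_sum N n nu (?cs @ ?cs) h"
    proof (rule cas_sum_isolated[OF h, symmetric])
      fix \<sigma> assume "\<sigma> permutes {..<N}" "\<sigma> \<noteq> id" "\<And>i. i < N \<Longrightarrow> stair N (\<sigma> i) \<le> beta N nu i"
      then obtain nu' \<pi> where nu': "is_partition n nu'" "length nu' \<le> N" "\<pi> permutes {..<N}"
        "\<And>i. i < N \<Longrightarrow> part nu' i = beta N nu (\<pi> i) - stair N (\<sigma> (\<pi> i))" "level N nu < level N nu'"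
        using level_increase[OF nu] by blast
      have "cas_killed N n ?cs (part nu')"
        by (rule cas_killed_levels[OF bound _ nu'(1,2)]) (use nu'(5) bound[OF nu(1)] in auto)
      then have "cas_killed N n ?cs (\<lambda>i. beta N nu i - stair N (\<sigma> i))"
        by (rule cas_killed_relabel[OF nu'(3), rotated]) (simp add: nu'(4))
      then show "cas_killed N n (?cs @ ?cs) (\<lambda>i. beta N nu i - stair N (\<sigma> i))" by (rule cas_killed_append)
    qed
    then show ?thesis unfolding cas_sum_eq[OF h] by simp
  qed
  have "0 \<le> (\<Sum>h\<in>H. cas_trace N n (part nu) (?cs @ ?cs) h)" by (rule sum_cas_trace_nonneg[OF H]) auto
  also have "\<dots> = ?E * ?E * real_of_int (\<Sum>h\<in>H. mult N nu (fixpoly N n h))"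
    by (simp add: tr sum_distrib_left)
  finally have nonneg: "0 \<le> ?E * ?E * real_of_int (\<Sum>h\<in>H. mult N nu (fixpoly N n h))" .
  have "?E \<noteq> 0" by (auto simp: prod_list_zero_iff)
  then have pos: "0 < ?E * ?E" using not_real_square_gt_zero[of ?E] by blast
  show ?thesis
  proof (rule ccontr)
    assume "\<not> 0 \<le> (\<Sum>h\<in>H. mult N nu (fixpoly N n h))"
    then have "real_of_int (\<Sum>h\<in>H. mult N nu (fixpoly N n h)) < 0" by (simp only: not_le of_int_less_0_iff)
    from mult_pos_neg[OF pos this] nonneg show False by linarith
  qed
qed

section \<open>Centralizers of permutations\<close>

text \<open>One construction for two purposes: with \<open>i = 1\<close> it adds a cycle to a
  permutation, with general \<open>i\<close> it describes the centralizer of the result.\<close>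

definition glue :: "nat \<Rightarrow> (nat \<Rightarrow> nat) \<Rightarrow> nat \<Rightarrow> nat \<Rightarrow> nat \<Rightarrow> nat" where
  "glue k h j i x = (if x < k then h x else if x < k + j then k + (x - k + i) mod j else x)"

abbreviation rot :: "nat \<Rightarrow> nat \<Rightarrow> nat \<Rightarrow> nat" where
  "rot j i \<equiv> glue 0 id j i"

lemma mod_add_inj:
  assumes "(a + i) mod j = (b + i) mod j" "a < j" "b < j"
  shows "a = (b :: nat)"
proof -
  have "a \<le> b \<Longrightarrow> (a + i) mod j = (b + i) mod j \<Longrightarrow> a < j \<Longrightarrow> b < j \<Longrightarrow> a = b" for a b :: nat
  proof -
    assume le: "a \<le> b" and eq: "(a + i) mod j = (b + i) mod j" and "a < j" "b < j"
    have "(b + i) mod j = (a + i) mod j \<longleftrightarrow> j dvd (b + i) - (a + i)" using le by (intro mod_eq_dvd_iff_nat) simp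
    then have "j dvd b - a" using eq by simp
    moreover have "b - a < j" using \<open>b < j\<close> by simp
    ultimately show "a = b" using le by (auto dest: nat_dvd_not_less)
  qed
  from this[of a b] this[of b a] show ?thesis using assms by (cases "a \<le> b") auto
qed

lemma glue_permutes:
  assumes "h permutes {..<k}" "0 < j"
  shows "glue k h j i permutes {..<k + j}"
proof (rule inj_imp_permutes)
  have hk: "h x < k \<longleftrightarrow> x < k" for x using permutes_in_image[OF assms(1), of x] by simp
  show "inj_on (glue k h j i) {..<k + j}"
  proof (rule inj_onI)
    fix x y assume xy: "x \<in> {..<k + j}" "y \<in> {..<k + j}" "glue k h j i x = glue k h j i y"
    have c: "glue k h j i z < k \<longleftrightarrow> z < k" if "z \<in> {..<k + j}" for z using that hk by (auto simp: glue_def)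
    show "x = y"
    proof (cases "x < k")
      case True
      then have "y < k" using c xy by metis
      then have "h x = h y" using True xy(3) by (simp add: glue_def)
      then show ?thesis using permutes_inj[OF assms(1)] by (simp add: inj_eq)
    next
      case False
      then have y: "\<not> y < k" using c xy by metis
      then have "(x - k + i) mod j = (y - k + i) mod j" using False xy by (simp add: glue_def)
      then have "x - k = y - k" by (rule mod_add_inj) (use False y xy in auto)
      then show ?thesis using False y by simp
    qed
  qed
  show "glue k h j i x \<in> {..<k + j}" if "x \<in> {..<k + j}" for x
    using that assms(2) hk[of x] by (auto simp: glue_def)
qed (auto simp: glue_def)

lemma mon_content: "w \<in> words N n \<Longrightarrow> mon N (content n w) = (\<Prod>i<n. var (w i))"
proof -
  assume w: "w \<in> words N n"
  have "(\<Prod>i<n. var (w i)) = (\<Prod>v\<in>{..<N}. \<Prod>i\<in>{i \<in> {..<n}. w i = v}. var (w i))"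
    by (rule prod.group[symmetric]) (use w in \<open>auto simp: words_def PiE_iff\<close>)
  also have "\<dots> = mon N (content n w)"
    unfolding mon_def content_def by (rule prod.cong) (auto simp: prod_constant[symmetric] simp del: prod_constant)
  finally show ?thesis by simp
qed

lemma fixpoly_eq_sum_prod: "fixpoly N n h = (\<Sum>w | w \<in> words N n \<and> w \<circ> h = w. \<Prod>i<n. var (w i))"
  unfolding fixpoly_def by (rule sum.cong) (auto simp: mon_content)

lemma comp_eq_self_iff:
  assumes "h permutes {..<n}"
  shows "w \<circ> h = w \<longleftrightarrow> (\<forall>x<n. w (h x) = w x)"
proof
  assume "\<forall>x<n. w (h x) = w x"
  then have "w (h x) = w x" for x using permutes_not_in[OF assms, of x] by (cases "x < n") auto
  then show "w \<circ> h = w" by auto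
next
  assume "w \<circ> h = w"
  then show "\<forall>x<n. w (h x) = w x" by (metis comp_apply)
qed

text \<open>A word fixed by the glued permutation is a pair of fixed words on the two blocks, and
  its monomial is the product of theirs.\<close>

lemma fixpoly_glue:
  assumes h: "h permutes {..<k}" and j: "0 < j"
  shows "fixpoly N (k + j) (glue k h j i) = fixpoly N k h * fixpoly N j (rot j i)"
proof -
  let ?join = "\<lambda>(u :: nat \<Rightarrow> nat, v :: nat \<Rightarrow> nat) x. if x < k then u x else if x < k + j then v (x - k) else undefined"
  let ?left = "\<lambda>(w :: nat \<Rightarrow> nat) x. if x < k then w x else undefined"
  let ?right = "\<lambda>(w :: nat \<Rightarrow> nat) x. if x < j then w (k + x) else undefined"
  let ?A = "{w. w \<in> words N (k + j) \<and> w \<circ> glue k h j i = w}"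
  let ?B = "{u. u \<in> words N k \<and> u \<circ> h = u}" and ?C = "{v. v \<in> words N j \<and> v \<circ> rot j i = v}"
  have hk: "h x < k \<longleftrightarrow> x < k" for x using permutes_in_image[OF h, of x] by simp
  have rot: "rot j i permutes {..<j}" using glue_permutes[of id 0 j i] j by (simp add: permutes_id)
  have rx: "rot j i x = (x + i) mod j" if "x < j" for x using that by (simp add: glue_def)
  have g1: "glue k h j i x = h x" if "x < k" for x using that by (simp add: glue_def)
  have g2: "glue k h j i (k + x) = k + (x + i) mod j" if "x < j" for x using that by (simp add: glue_def)
  have split: "(\<forall>x<k + j. Q x) \<longleftrightarrow> (\<forall>x<k. Q x) \<and> (\<forall>x<j. Q (k + x))" for Q
  proof (intro iffI conjI allI impI)
    fix x assume A: "(\<forall>x<k. Q x) \<and> (\<forall>x<j. Q (k + x))" "x < k + j"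
    show "Q x"
    proof (cases "x < k")
      case False
      then have "x - k < j" "x = k + (x - k)" using A by auto
      then show ?thesis using A by metis
    qed (use A in auto)
  qed auto
  have fix_iff: "w \<circ> glue k h j i = w \<longleftrightarrow> (\<forall>x<k. w (h x) = w x) \<and> (\<forall>x<j. w (k + (x + i) mod j) = w (k + x))" for w :: "nat \<Rightarrow> nat"
    unfolding comp_eq_self_iff[OF glue_permutes[OF h j]] split using g1 g2 by auto
  have fix_h: "u \<circ> h = u \<longleftrightarrow> (\<forall>x<k. u (h x) = u x)" for u :: "nat \<Rightarrow> nat" by (rule comp_eq_self_iff[OF h])
  have fix_r: "v \<circ> rot j i = v \<longleftrightarrow> (\<forall>x<j. v ((x + i) mod j) = v x)" for v :: "nat \<Rightarrow> nat"
    unfolding comp_eq_self_iff[OF rot] using rx by auto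
  have prod_split: "(\<Prod>x<k + j. f x) = (\<Prod>x<k. f x) * (\<Prod>x<j. f (k + x))" for f :: "nat \<Rightarrow> mpoly"
    by (induction j) (simp_all add: mult.assoc)
  have mj: "(x + i) mod j < j" for x using j by simp
  have "fixpoly N k h * fixpoly N j (rot j i) = (\<Sum>u\<in>?B. \<Sum>v\<in>?C. (\<Prod>x<k. var (u x)) * (\<Prod>x<j. var (v x)))"
    unfolding fixpoly_eq_sum_prod sum_product ..
  also have "\<dots> = (\<Sum>p\<in>?B \<times> ?C. (\<Prod>x<k. var (fst p x)) * (\<Prod>x<j. var (snd p x)))"
    by (simp add: sum.cartesian_product case_prod_beta)
  also have "\<dots> = (\<Sum>w\<in>?A. \<Prod>x<k + j. var (w x))"
  proof (rule sum.reindex_bij_witness[of _ "\<lambda>w. (?left w, ?right w)" ?join])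
    fix p assume "p \<in> ?B \<times> ?C"
    then obtain u v where p: "p = (u, v)" "u \<in> words N k" "u \<circ> h = u" "v \<in> words N j" "v \<circ> rot j i = v" by auto
    have u: "u x = undefined" if "\<not> x < k" for x using p(2) that by (auto simp: words_def PiE_iff extensional_def)
    have v: "v x = undefined" if "\<not> x < j" for x using p(4) that by (auto simp: words_def PiE_iff extensional_def)
    show "(?left (?join p), ?right (?join p)) = p" using u v by (auto simp: p(1) fun_eq_iff)
    have uN: "u x < N" if "x < k" for x using p(2) that by (auto simp: words_def PiE_iff)
    have vN: "v x < N" if "x < j" for x using p(4) that by (auto simp: words_def PiE_iff)
    have "?join p \<in> words N (k + j)"
      using uN vN by (auto simp: p(1) words_def PiE_iff extensional_def)
    moreover have "?join p \<circ> glue k h j i = ?join p"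
      unfolding fix_iff using p(3,5) mj unfolding fix_h fix_r by (simp add: p(1) hk)
    ultimately show "?join p \<in> ?A" by blast
    show "(\<Prod>x<k + j. var (?join p x)) = (\<Prod>x<k. var (fst p x)) * (\<Prod>x<j. var (snd p x))"
      unfolding prod_split by (simp add: p(1))
  next
    fix w assume "w \<in> ?A"
    then have w: "w \<in> words N (k + j)" "w \<circ> glue k h j i = w" by auto
    have wu: "w x = undefined" if "\<not> x < k + j" for x using w(1) that by (auto simp: words_def PiE_iff extensional_def)
    have wN: "w x < N" if "x < k + j" for x using w(1) that by (auto simp: words_def PiE_iff)
    show "?join (?left w, ?right w) = w" using wu by (auto simp: fun_eq_iff)
    have "?left w \<in> words N k" "?right w \<in> words N j" using wN by (auto simp: words_def PiE_iff extensional_def)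
    moreover have "?left w \<circ> h = ?left w" "?right w \<circ> rot j i = ?right w"
      using w(2) mj unfolding fix_iff fix_h fix_r by (auto simp: hk)
    ultimately show "(?left w, ?right w) \<in> ?B \<times> ?C" by blast
  qed
  finally show ?thesis unfolding fixpoly_eq_sum_prod by simp
qed

text \<open>A word on the \<open>j\<close> points is fixed iff it has period \<open>gcd i j\<close>,
  so each letter of a period occurs \<open>j div gcd i j\<close> times.\<close>

lemma fixpoly_rot:
  assumes j: "0 < j"
  shows "fixpoly N j (rot j i) = power_sum N (j div gcd i j) ^ gcd i j"
proof -
  define g where "g = gcd i j"
  have g: "0 < g" "g dvd i" "g dvd j" using j by (auto simp: g_def)
  have gj: "g \<le> j" using g(3) j by (rule dvd_imp_le)
  have rot: "rot j i permutes {..<j}" using glue_permutes[of id 0 j i] j by (simp add: permutes_id)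
  have fix_r: "v \<circ> rot j i = v \<longleftrightarrow> (\<forall>x<j. v ((x + i) mod j) = v x)" for v :: "nat \<Rightarrow> nat"
    unfolding comp_eq_self_iff[OF rot] by (auto simp: glue_def)
  have mod_g: "x mod g < g" for x using g by simp
  \<comment> \<open>By Bezout a multiple of \<open>i\<close> is the gcd modulo \<open>j\<close>, so
    some power of the rotation shifts by the gcd.\<close>
  obtain a where a: "(a * i) mod j = g mod j"
  proof (cases "i = 0")
    case True
    then show ?thesis using that[of 0] by (simp add: g_def)
  next
    case False
    then obtain x y where "i * x = j * y + gcd i j" using bezout_nat by blast
    then show ?thesis using that[of x] by (simp add: g_def mult.commute)
  qed
  have periodic: "v \<circ> rot j i = v \<longleftrightarrow> (\<forall>x<j. v x = v (x mod g))" for v :: "nat \<Rightarrow> nat"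
  proof
    assume fx: "v \<circ> rot j i = v"
    have 1: "v ((x + b * i) mod j) = v (x mod j)" for x b
    proof (induction b)
      case (Suc b)
      have "v ((x + Suc b * i) mod j) = v (((x + b * i) mod j + i) mod j)" by (simp add: mod_simps algebra_simps)
      also have "\<dots> = v ((x + b * i) mod j)" using fx j unfolding fix_r by simp
      finally show ?case using Suc by simp
    qed simp
    have 2: "v ((x + g) mod j) = v (x mod j)" for x
    proof -
      have "(x + g) mod j = (x + a * i) mod j" using a by (metis mod_add_right_eq)
      then show ?thesis using 1 by simp
    qed
    have 3: "v ((x + m * g) mod j) = v (x mod j)" for x m
    proof (induction m)
      case (Suc m)
      then show ?case using 2[of "x + m * g"] by (simp add: algebra_simps)
    qed simp
    show "\<forall>x<j. v x = v (x mod g)"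
    proof (intro allI impI)
      fix x assume "x < j"
      moreover have "x mod g < j" using mod_g[of x] gj by simp
      ultimately show "v x = v (x mod g)" using 3[of "x mod g" "x div g"] by simp
    qed
  next
    assume A: "\<forall>x<j. v x = v (x mod g)"
    show "v \<circ> rot j i = v"
      unfolding fix_r
    proof (intro allI impI)
      fix x assume "x < j"
      have "((x + i) mod j) mod g = (x + i) mod g" using g(3) by (rule mod_mod_cancel)
      also have "\<dots> = x mod g" using g(2) by (auto elim!: dvdE)
      finally show "v ((x + i) mod j) = v x" using A \<open>x < j\<close> j by (metis mod_less_divisor)
    qed
  qed
  let ?ext = "\<lambda>(u :: nat \<Rightarrow> nat) x. if x < j then u (x mod g) else undefined"
  let ?res = "\<lambda>(v :: nat \<Rightarrow> nat) x. if x < g then v x else undefined"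
  have prod: "(\<Prod>x<j. f (x mod g)) = (\<Prod>x<g. f x ^ (j div g))" for f :: "nat \<Rightarrow> mpoly"
  proof -
    have "(\<Prod>x<g * m. f (x mod g)) = (\<Prod>x<g. f x ^ m)" for m
    proof (induction m)
      case (Suc m)
      have "(\<Prod>x<g * m + b. f (x mod g)) = (\<Prod>x<g * m. f (x mod g)) * (\<Prod>x<b. f x)" if "b \<le> g" for b
        using that by (induction b) (simp_all add: mult.assoc)
      from this[of g] Suc show ?case by (simp add: prod.distrib mult.commute add.commute)
    qed simp
    from this[of "j div g"] show ?thesis using g(3) by simp
  qed
  have "fixpoly N j (rot j i) = (\<Sum>v | v \<in> words N j \<and> (\<forall>x<j. v x = v (x mod g)). \<Prod>x<j. var (v x))"
    unfolding fixpoly_eq_sum_prod periodic ..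
  also have "\<dots> = (\<Sum>u\<in>words N g. \<Prod>x<g. var (u x) ^ (j div g))"
  proof (rule sum.reindex_bij_witness[of _ ?ext ?res])
    fix v assume v: "v \<in> {v. v \<in> words N j \<and> (\<forall>x<j. v x = v (x mod g))}"
    then have vw: "v \<in> words N j" and vm: "\<And>x. x < j \<Longrightarrow> v (x mod g) = v x" by auto
    have "v x = undefined" if "\<not> x < j" for x using vw that by (auto simp: words_def PiE_iff extensional_def)
    then show "?ext (?res v) = v" using vm mod_g by (simp add: fun_eq_iff)
    have "v x < N" if "x < j" for x using vw that by (simp add: words_def PiE_iff)
    then show "?res v \<in> words N g" using gj by (simp add: words_def PiE_iff extensional_def)
    have "(\<Prod>x<j. var (v x)) = (\<Prod>x<j. var (v (x mod g)))" using vm by (intro prod.cong) auto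
    then show "(\<Prod>x<g. var (?res v x) ^ (j div g)) = (\<Prod>x<j. var (v x))"
      using prod[of "\<lambda>x. var (v x)"] by simp
  next
    fix u assume u: "u \<in> words N g"
    then have "u x = undefined" if "\<not> x < g" for x using that by (auto simp: words_def PiE_iff extensional_def)
    then show "?res (?ext u) = u" using gj by (auto simp: fun_eq_iff)
    have "x mod g < j" for x using mod_g[of x] gj by simp
    then show "?ext u \<in> {v. v \<in> words N j \<and> (\<forall>x<j. v x = v (x mod g))}"
      using u mod_g by (auto simp: words_def PiE_iff extensional_def)
  qed
  also have "\<dots> = (\<Prod>x<g. \<Sum>a<N. var a ^ (j div g))"
    unfolding words_def by (rule prod_sum_PiE[symmetric]) simp_all
  also have "\<dots> = power_sum N (j div g) ^ g" by (simp add: power_sum_def)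
  finally show ?thesis unfolding g_def .
qed

section \<open>Cycle types, conjugacy classes and centralizers\<close>

primrec canon :: "nat list \<Rightarrow> nat \<Rightarrow> nat" where
  "canon [] = id"
| "canon (j # la) = glue (sum_list la) (canon la) j 1"

lemma canon_permutes: "(\<And>a. a \<in> set la \<Longrightarrow> 0 < a) \<Longrightarrow> canon la permutes {..<sum_list la}"
proof (induction la)
  case (Cons j la)
  then show ?case using glue_permutes[of "canon la" "sum_list la" j 1] by (simp add: add.commute)
qed (simp add: permutes_id)

lemma fixpoly_canon: "(\<And>a. a \<in> set la \<Longrightarrow> 0 < a) \<Longrightarrow> fixpoly N (sum_list la) (canon la) = power_sum_part N la"
proof (induction la)
  case Nil
  have "words N 0 = {\<lambda>_. undefined}" by (simp add: words_def)
  then have eq: "{w. w \<in> words N 0 \<and> w \<circ> id = w} = {\<lambda>_. undefined}" by auto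
  show ?case unfolding fixpoly_eq_sum_prod canon.simps sum_list.Nil eq by simp
next
  case (Cons j la)
  then have "fixpoly N (sum_list la + j) (canon (j # la)) = power_sum_part N la * power_sum N j"
    using fixpoly_glue[OF canon_permutes, of la j N 1] fixpoly_rot[of j N 1] by simp
  then show ?case by (simp add: mult.commute add.commute)
qed

lemma fixpoly_conj:
  assumes "f permutes {..<n}" "h permutes {..<n}"
  shows "fixpoly N n (f \<circ> h \<circ> inv f) = fixpoly N n h"
proof -
  have eq: "w \<circ> (f \<circ> h \<circ> inv f) = w \<longleftrightarrow> (w \<circ> f) \<circ> h = w \<circ> f" for w :: "nat \<Rightarrow> nat"
  proof
    assume "w \<circ> (f \<circ> h \<circ> inv f) = w"
    then have "w \<circ> (f \<circ> h \<circ> inv f) \<circ> f = w \<circ> f" by simp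
    then show "(w \<circ> f) \<circ> h = w \<circ> f" using permutes_inv_o(2)[OF assms(1)] by (simp add: comp_assoc)
  next
    assume "(w \<circ> f) \<circ> h = w \<circ> f"
    then have "(w \<circ> f) \<circ> h \<circ> inv f = w \<circ> f \<circ> inv f" by simp
    then show "w \<circ> (f \<circ> h \<circ> inv f) = w" using permutes_inv_o(1)[OF assms(1)] by (simp add: comp_assoc)
  qed
  have content: "content n (w \<circ> f) = content n w" for w using content_comp[OF assms(1)] by auto
  show ?thesis
    unfolding fixpoly_def eq
    by (rule sum.reindex_bij_witness[of _ "\<lambda>w. w \<circ> inv f" "\<lambda>w. w \<circ> f"])
      (auto simp: comp_permutes_cancel[OF assms(1)] words_comp assms(1) permutes_inv content)
qed

text \<open>A longest cycle is split off as the first part, and induction handles the rest. That all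
  parts are orbit sizes is carried along because it shows that the new part is the largest.\<close>

lemma permutation_canonical_form:
  assumes "finite A" "h permutes A"
  shows "\<exists>la f. is_partition (card A) la \<and> bij_betw f {..<card A} A \<and>
    (\<forall>i<card A. h (f i) = f (canon la i)) \<and> (\<forall>a\<in>set la. \<exists>y\<in>A. card (orbit h y) = a)"
  using assms
proof (induction "card A" arbitrary: A h rule: less_induct)
  case less
  note fin = less.prems(1) and h = less.prems(2)
  have perm: "permutation h" using h fin permutation_permutes by blast
  show ?case
  proof (cases "A = {}")
    case True
    then show ?thesis by (intro exI[of _ "[]"]) (simp add: is_partition_def bij_betw_def)
  next
    case False
    define M where "M = Max ((\<lambda>y. card (orbit h y)) ` A)"
    have "M \<in> (\<lambda>y. card (orbit h y)) ` A" unfolding M_def using fin False by (intro Max_in) auto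
    then obtain x where x: "x \<in> A" "M = card (orbit h x)" by auto
    have max: "card (orbit h y) \<le> card (orbit h x)" if "y \<in> A" for y
      unfolding x(2)[symmetric] M_def using fin that by (intro Max_ge) auto
    let ?O = "orbit h x"
    have self: "x \<in> ?O" by (rule permutation_self_in_orbit[OF perm])
    have OA: "?O \<subseteq> A" by (rule permutes_orbit_subset[OF h x(1)])
    define j where "j = card ?O"
    define d where "d = funpow_dist1 h x x"
    have O: "?O = (\<lambda>n. (h ^^ n) x) ` {0..<d}" unfolding d_def by (rule orbit_conv_funpow_dist1[OF self])
    have inj: "inj_on (\<lambda>n. (h ^^ n) x) {0..<d}" unfolding d_def by (rule inj_on_funpow_dist1[OF self])
    have dj: "d = j" unfolding j_def O by (simp add: card_image[OF inj])
    have hd: "(h ^^ j) x = x" unfolding dj[symmetric] d_def by (rule funpow_dist1_prop[OF self])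
    have jpos: "0 < j" unfolding dj[symmetric] d_def by simp
    define B where "B = A - ?O"
    have cyc: "cyclic_on h ?O" by (rule cyclic_on_orbit[OF h fin])
    define h' where "h' = perm_restrict h B"
    have h': "h' permutes B" unfolding h'_def B_def by (rule perm_restrict_diff_cyclic[OF h cyc])
    have finB: "finite B" using fin by (simp add: B_def)
    have cardA: "card A = card B + j"
      unfolding B_def j_def using card_Diff_subset[OF finite_subset[OF OA fin] OA] card_mono[OF fin OA] by simp
    have "card B < card A" using cardA jpos by simp
    from less.hyps[OF this finB h'] obtain la f' where la: "is_partition (card B) la"
      and f': "bij_betw f' {..<card B} B" "\<And>i. i < card B \<Longrightarrow> h' (f' i) = f' (canon la i)"
      and orb: "\<And>a. a \<in> set la \<Longrightarrow> \<exists>y\<in>B. card (orbit h' y) = a" by blast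
    have h'h: "h' y = h y" if "y \<in> B" for y using that by (simp add: h'_def perm_restrict_def)
    have orbit_eq: "orbit h' y = orbit h y" if "y \<in> B" for y
      by (rule orbit_cong0[OF that]) (use permutes_in_image[OF h'] h'h in auto)
    have canonB: "canon la permutes {..<card B}"
      using canon_permutes[of la] is_partitionD(2,3)[OF la] by simp
    define f where "f i = (if i < card B then f' i else (h ^^ (i - card B)) x)" for i
    have orb': "\<exists>y\<in>A. card (orbit h y) = a" if "a \<in> set (j # la)" for a
      using that orb[of a] orbit_eq x(1) by (auto simp: B_def j_def)
    have "a \<le> j" if "a \<in> set la" for a
      using orb'[of a] that max by (auto simp: j_def)
    then have part: "is_partition (card A) (j # la)"
      using la jpos by (auto simp: is_partition_def cardA)
    have bij: "bij_betw f {..<card A} A"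
    proof -
      have 1: "bij_betw f {..<card B} B"
        using f'(1) by (rule iffD1[OF bij_betw_cong, rotated]) (auto simp: f_def)
      have "inj_on f {card B..<card A}"
      proof (rule inj_onI)
        fix a b assume ab: "a \<in> {card B..<card A}" "b \<in> {card B..<card A}" "f a = f b"
        then have "a - card B = b - card B"
          by (intro inj_onD[OF inj]) (auto simp: f_def dj cardA)
        then show "a = b" using ab by auto
      qed
      moreover have "f ` {card B..<card A} = ?O"
      proof
        show "f ` {card B..<card A} \<subseteq> ?O" unfolding O by (auto simp: f_def dj cardA)
        show "?O \<subseteq> f ` {card B..<card A}"
        proof
          fix y assume "y \<in> ?O"
          then obtain n where "n < j" "y = (h ^^ n) x" unfolding O dj by auto
          then show "y \<in> f ` {card B..<card A}"
            by (intro image_eqI[of _ _ "card B + n"]) (auto simp: f_def cardA)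
        qed
      qed
      ultimately have "bij_betw f {card B..<card A} ?O" by (simp add: bij_betw_def)
      with 1 have "bij_betw f ({..<card B} \<union> {card B..<card A}) (B \<union> ?O)"
        by (rule bij_betw_combine) (auto simp: B_def)
      moreover have "{..<card B} \<union> {card B..<card A} = {..<card A}" using cardA by auto
      moreover have "B \<union> ?O = A" using OA by (auto simp: B_def)
      ultimately show ?thesis by simp
    qed
    have sum_la: "sum_list la = card B" using is_partitionD(3)[OF la] .
    have eq: "h (f i) = f (canon (j # la) i)" if "i < card A" for i
    proof (cases "i < card B")
      case True
      then have "canon la i < card B" using permutes_in_image[OF canonB, of i] by simp
      moreover have "f' i \<in> B" using f'(1) True by (auto simp: bij_betw_def)
      ultimately show ?thesis using True f'(2)[OF True] h'h by (simp add: f_def glue_def sum_la)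
    next
      case False
      define t where "t = i - card B"
      have t: "i = card B + t" "t < j" using False that cardA by (auto simp: t_def)
      have "h (f i) = (h ^^ Suc t) x" by (simp add: f_def t)
      also have "\<dots> = (h ^^ (Suc t mod j)) x"
        using t(2) hd by (cases "Suc t = j") auto
      also have "\<dots> = f (canon (j # la) i)" using t(2) by (simp add: f_def glue_def sum_la t(1))
      finally show ?thesis .
    qed
    show ?thesis using part bij eq orb' by blast
  qed
qed

lemma permutation_conj_canon:
  assumes h: "h permutes {..<n::nat}"
  shows "\<exists>la f. is_partition n la \<and> f permutes {..<n} \<and> h = f \<circ> canon la \<circ> inv f"
proof -
  obtain la f where la: "is_partition n la" and f: "bij_betw f {..<n} {..<n}" "\<And>i. i < n \<Longrightarrow> h (f i) = f (canon la i)"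
    using permutation_canonical_form[OF finite_lessThan h] by auto
  define g where "g i = (if i < n then f i else i)" for i
  have "bij_betw g {..<n} {..<n}" using f(1) by (rule iffD1[OF bij_betw_cong, rotated]) (auto simp: g_def)
  then have g: "g permutes {..<n}" by (rule bij_imp_permutes) (auto simp: g_def)
  have c: "canon la permutes {..<n}" using canon_permutes[of la] is_partitionD(2,3)[OF la] by simp
  have "h (g i) = g (canon la i)" for i
  proof (cases "i < n")
    case True
    then show ?thesis using f(2) permutes_in_image[OF c, of i] by (simp add: g_def)
  next
    case False
    then show ?thesis using permutes_not_in[OF c, of i] permutes_not_in[OF h, of i] by (simp add: g_def)
  qed
  then have "h \<circ> g = g \<circ> canon la" by auto
  then have "h \<circ> g \<circ> inv g = g \<circ> canon la \<circ> inv g" by simp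
  then have "h = g \<circ> canon la \<circ> inv g" using permutes_inv_o(1)[OF g] by (simp add: comp_assoc)
  then show ?thesis using la g by blast
qed

lemma glue_funpow:
  assumes "h permutes {..<k}" "0 < j"
  shows "x < k \<Longrightarrow> (glue k h j i ^^ d) x = (h ^^ d) x"
    "x < j \<Longrightarrow> (glue k h j i ^^ d) (k + x) = k + (x + d * i) mod j"
proof -
  have in_k: "(h ^^ d) x < k" if "x < k" for x d
    using permutes_in_funpow_image[OF assms(1), of x d] that by auto
  show "(glue k h j i ^^ d) x = (h ^^ d) x" if "x < k" for x
    using in_k[OF that] by (induction d) (simp_all add: glue_def)
  show "(glue k h j i ^^ d) (k + x) = k + (x + d * i) mod j" if "x < j" for x
    using that assms(2) by (induction d) (simp_all add: glue_def mod_simps algebra_simps)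
qed

definition fix_count :: "nat \<Rightarrow> (nat \<Rightarrow> nat) \<Rightarrow> nat \<Rightarrow> nat" where
  "fix_count n g d = card {i. i < n \<and> (g ^^ d) i = i}"

lemma fix_count_canon:
  "(\<And>a. a \<in> set la \<Longrightarrow> 0 < a) \<Longrightarrow> fix_count (sum_list la) (canon la) d = sum_list (filter (\<lambda>a. a dvd d) la)"
proof (induction la)
  case (Cons j la)
  let ?k = "sum_list la"
  have j: "0 < j" and c: "canon la permutes {..<?k}" using Cons.prems canon_permutes by auto
  note g = glue_funpow[OF c j, where i=1 and d=d]
  have e: "(x + d) mod j = x \<longleftrightarrow> j dvd d" if "x < j" for x
  proof -
    have "(x + d) mod j = (x + 0) mod j \<longleftrightarrow> j dvd (x + d) - (x + 0)" by (rule mod_eq_dvd_iff_nat) simp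
    then show ?thesis using that by simp
  qed
  have "{i. i < ?k + j \<and> (canon (j # la) ^^ d) i = i} =
    {i. i < ?k \<and> (canon la ^^ d) i = i} \<union> (if j dvd d then {?k..<?k + j} else {})" (is "?L = ?A \<union> ?B")
  proof (intro equalityI subsetI)
    fix i assume i: "i \<in> ?L"
    show "i \<in> ?A \<union> ?B"
    proof (cases "i < ?k")
      case True
      then show ?thesis using i g(1)[OF True] by simp
    next
      case False
      then have t: "i = ?k + (i - ?k)" "i - ?k < j" using i by auto
      then have "(canon (j # la) ^^ d) (?k + (i - ?k)) = ?k + (i - ?k)" using i by simp
      then have "(i - ?k + d) mod j = i - ?k" using g(2)[OF t(2)] by simp
      then have "j dvd d" using e[OF t(2)] by simp
      then show ?thesis using False i by simp
    qed
  next
    fix i assume i: "i \<in> ?A \<union> ?B"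
    show "i \<in> ?L"
    proof (cases "i < ?k")
      case True
      then show ?thesis using i g(1)[OF True] by (auto split: if_splits)
    next
      case False
      then have t: "i = ?k + (i - ?k)" "i - ?k < j" "j dvd d" using i by (auto split: if_splits)
      then have "(canon (j # la) ^^ d) (?k + (i - ?k)) = ?k + (i - ?k)" using g(2)[OF t(2)] e[OF t(2)] by simp
      then show ?thesis using t by simp
    qed
  qed
  moreover have "card (?A \<union> ?B) = card ?A + card ?B" by (rule card_Un_disjoint) (auto split: if_splits)
  ultimately have "fix_count (?k + j) (canon (j # la)) d = fix_count ?k (canon la) d + (if j dvd d then j else 0)"
    by (simp add: fix_count_def)
  then show ?case using Cons by (simp add: add.commute)
qed (simp add: fix_count_def)

text \<open>A divisor sum at \<open>d\<close> determines its term at \<open>d\<close> once the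
  smaller terms are known. Hence the numbers of fixed points of all powers determine the cycle
  type.\<close>

lemma partition_eq_if_divisor_sums_eq:
  assumes la: "is_partition n la" and mu: "is_partition m mu"
    and eq: "\<And>d. 0 < d \<Longrightarrow> sum_list (filter (\<lambda>a. a dvd d) la) = sum_list (filter (\<lambda>a. a dvd d) mu)"
  shows "la = mu"
proof -
  have sum_count: "sum_list (filter (\<lambda>a. a dvd d) xs) = (\<Sum>a | a dvd d. a * count (mset xs) a)" if "0 < d" for d xs
  proof (induction xs)
    case (Cons b xs)
    have "(\<Sum>a | a dvd d. a * count (mset (b # xs)) a) = (\<Sum>a | a dvd d. a * count (mset xs) a + (if a = b then b else 0))"
      by (rule sum.cong) auto
    then show ?case using Cons that by (simp add: sum.distrib finite_divisors_nat)
  qed simp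
  have "count (mset la) d = count (mset mu) d" for d
  proof (induction d rule: less_induct)
    case (less d)
    show ?case
    proof (cases "d = 0")
      case True
      have c0: "count (mset xs) 0 = 0" if "0 \<notin> set xs" for xs :: "nat list" using that by (induction xs) auto
      have n0: "0 \<notin> set la" "0 \<notin> set mu" using is_partitionD(2)[OF la, of 0] is_partitionD(2)[OF mu, of 0] by auto
      show ?thesis unfolding True by (rule trans[OF c0[OF n0(1)] c0[OF n0(2), symmetric]])
    next
      case False
      then have fin: "finite {a. a dvd d}" by (simp add: finite_divisors_nat)
      have split: "(\<Sum>a | a dvd d. a * count X a) = d * count X d + (\<Sum>a\<in>{a. a dvd d} - {d}. a * count X a)" for X
        by (rule sum.remove[OF fin]) simp
      have "(\<Sum>a | a dvd d. a * count (mset la) a) = (\<Sum>a | a dvd d. a * count (mset mu) a)"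
        using eq[of d] False by (simp add: sum_count)
      moreover have "(\<Sum>a\<in>{a. a dvd d} - {d}. a * count (mset la) a) = (\<Sum>a\<in>{a. a dvd d} - {d}. a * count (mset mu) a)"
      proof (rule sum.cong[OF refl])
        fix a assume "a \<in> {a. a dvd d} - {d}"
        then have "a < d" using False dvd_imp_le[of a d] by auto
        then show "a * count (mset la) a = a * count (mset mu) a" using less by simp
      qed
      ultimately have "d * count (mset la) d = d * count (mset mu) d" unfolding split by linarith
      then show ?thesis using False by simp
    qed
  qed
  then have "mset la = mset mu" by (rule multiset_eqI)
  then have "mset (rev la) = mset (rev mu)" by simp
  moreover have "sorted (rev la)" "sorted (rev mu)"
    using is_partitionD(1)[OF la] is_partitionD(1)[OF mu] by (simp_all add: sorted_wrt_rev)
  ultimately have "rev la = rev mu" using properties_for_sort sorted_sort_id by metis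
  then show ?thesis by simp
qed

lemma canon_conj_unique:
  assumes la: "is_partition n la" and mu: "is_partition n mu" and f: "f permutes {..<n}"
    and eq: "canon la = f \<circ> canon mu \<circ> inv f"
  shows "la = mu"
proof (rule partition_eq_if_divisor_sums_eq[OF la mu])
  fix d :: nat
  have pow: "((f \<circ> g \<circ> inv f) ^^ d) i = f ((g ^^ d) (inv f i))" for g i
    by (induction d arbitrary: i) (simp_all add: permutes_inverses[OF f])
  have fe: "f y = x \<longleftrightarrow> y = inv f x" for x y using permutes_inverses[OF f] by auto
  have "bij_betw f {i. i < n \<and> (canon mu ^^ d) i = i} {i. i < n \<and> (canon la ^^ d) i = i}"
    unfolding eq pow
    using fe permutes_in_image[OF f] permutes_in_image[OF permutes_inv[OF f]] permutes_inverses[OF f]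
    by (intro bij_betw_byWitness[where f'="inv f"]) (auto simp: image_subset_iff)
  then have "fix_count n (canon la) d = fix_count n (canon mu) d"
    unfolding fix_count_def by (rule bij_betw_same_card[symmetric])
  then show "sum_list (filter (\<lambda>a. a dvd d) la) = sum_list (filter (\<lambda>a. a dvd d) mu)"
    using fix_count_canon[of la d] fix_count_canon[of mu d] is_partitionD(2,3)[OF la] is_partitionD(2,3)[OF mu] by simp
qed

definition centralizer :: "nat \<Rightarrow> (nat \<Rightarrow> nat) \<Rightarrow> (nat \<Rightarrow> nat) set" where
  "centralizer n g = {h. h permutes {..<n} \<and> h \<circ> g = g \<circ> h}"

lemma finite_centralizer [simp]: "finite (centralizer n g)"
  by (rule finite_subset[OF _ finite_permutations[OF finite_lessThan[of n]]]) (auto simp: centralizer_def)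

lemma id_in_centralizer: "id \<in> centralizer n g"
  by (simp add: centralizer_def permutes_id)

lemma centralizer_comp: "g \<in> centralizer n c \<Longrightarrow> h \<in> centralizer n c \<Longrightarrow> g \<circ> h \<in> centralizer n c"
  unfolding centralizer_def
proof (clarify, intro conjI)
  assume "g \<circ> c = c \<circ> g" "h \<circ> c = c \<circ> h"
  then show "g \<circ> h \<circ> c = c \<circ> (g \<circ> h)" by (simp add: fun_eq_iff)
qed (simp add: permutes_compose)

lemma centralizer_inv:
  assumes "h \<in> centralizer n c"
  shows "inv h \<in> centralizer n c"
proof -
  have h: "h permutes {..<n}" "h \<circ> c = c \<circ> h" using assms by (auto simp: centralizer_def)
  have "inv h (c x) = c (inv h x)" for x
    using fun_cong[OF h(2), of "inv h x"] permutes_inverses[OF h(1)] by (metis comp_apply)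
  then show ?thesis using permutes_inv[OF h(1)] by (auto simp: centralizer_def)
qed

lemma card_centralizer_pos: "0 < card (centralizer n g)"
  using id_in_centralizer by (auto simp: card_gt_0_iff)

text \<open>Orbit and stabilizer: the conjugators that lead from \<open>canon la\<close> to a given
  element form a coset of the centralizer of \<open>canon la\<close>.\<close>

lemma sum_over_class:
  fixes \<Phi> :: "(nat \<Rightarrow> nat) \<Rightarrow> real"
  assumes conj: "\<And>f g. f permutes {..<n} \<Longrightarrow> g permutes {..<n} \<Longrightarrow> \<Phi> (f \<circ> g \<circ> inv f) = \<Phi> g"
  shows "(\<Sum>g | g permutes {..<n}. \<Phi> g) =
    (\<Sum>la | is_partition n la. fact n / card (centralizer n (canon la)) * \<Phi> (canon la))"
proof -
  let ?S = "{g. g permutes {..<n}}"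
  let ?cl = "\<lambda>la. (\<lambda>f. f \<circ> canon la \<circ> inv f) ` ?S"
  have finS: "finite ?S" by (rule finite_permutations) simp
  have c: "canon la permutes {..<n}" if "is_partition n la" for la
    using canon_permutes[of la] is_partitionD(2,3)[OF that] by simp
  have S: "?S = (\<Union>la\<in>{la. is_partition n la}. ?cl la)"
  proof
    show "?S \<subseteq> (\<Union>la\<in>{la. is_partition n la}. ?cl la)"
      using permutation_conj_canon by blast
    show "(\<Union>la\<in>{la. is_partition n la}. ?cl la) \<subseteq> ?S"
      using c by (auto intro!: permutes_compose permutes_inv)
  qed
  have disj: "?cl la \<inter> ?cl mu = {}" if "is_partition n la" "is_partition n mu" "la \<noteq> mu" for la mu
  proof (rule ccontr)
    assume "?cl la \<inter> ?cl mu \<noteq> {}"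
    then obtain f g where fg: "f permutes {..<n}" "g permutes {..<n}" "f \<circ> canon la \<circ> inv f = g \<circ> canon mu \<circ> inv g"
      by auto
    have "canon la x = (inv f \<circ> g \<circ> canon mu \<circ> inv (inv f \<circ> g)) x" for x
    proof -
      have i: "inv (inv f \<circ> g) = inv g \<circ> f"
        using o_inv_distrib[OF permutes_bij[OF permutes_inv[OF fg(1)]] permutes_bij[OF fg(2)]] permutes_inv_inv[OF fg(1)] by simp
      show ?thesis
        using fun_cong[OF fg(3), of "f x"] permutes_inverses[OF fg(1)] unfolding i by (simp) (metis)
    qed
    then have "canon la = (inv f \<circ> g) \<circ> canon mu \<circ> inv (inv f \<circ> g)" by auto
    then show False
      using canon_conj_unique[OF that(1,2) permutes_compose[OF fg(2) permutes_inv[OF fg(1)]]] that(3) by simp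
  qed
  have fiber: "card {f \<in> ?S. f \<circ> canon la \<circ> inv f = g} = card (centralizer n (canon la))" if g: "g \<in> ?cl la" for g la
  proof -
    obtain f0 where f0: "f0 permutes {..<n}" "g = f0 \<circ> canon la \<circ> inv f0" using g by auto
    have iff: "f \<circ> canon la \<circ> inv f = g \<longleftrightarrow> (inv f0 \<circ> f) \<circ> canon la = canon la \<circ> (inv f0 \<circ> f)"
      if f: "f permutes {..<n}" for f
    proof
      assume "f \<circ> canon la \<circ> inv f = g"
      then have "f (canon la (inv f x)) = f0 (canon la (inv f0 x))" for x unfolding f0(2) by (simp add: fun_eq_iff)
      from this[of "f _"] have "f (canon la x) = f0 (canon la (inv f0 (f x)))" for x using permutes_inverses[OF f] by simp
      then show "(inv f0 \<circ> f) \<circ> canon la = canon la \<circ> (inv f0 \<circ> f)"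
        using permutes_inverses[OF f0(1)] by (simp add: fun_eq_iff)
    next
      assume "(inv f0 \<circ> f) \<circ> canon la = canon la \<circ> (inv f0 \<circ> f)"
      then have "inv f0 (f (canon la x)) = canon la (inv f0 (f x))" for x by (simp add: fun_eq_iff)
      then have "f0 (inv f0 (f (canon la x))) = f0 (canon la (inv f0 (f x)))" for x by simp
      then have "f (canon la x) = f0 (canon la (inv f0 (f x)))" for x using permutes_inverses[OF f0(1)] by simp
      then show "f \<circ> canon la \<circ> inv f = g" unfolding f0(2) using permutes_inverses[OF f] by (simp add: fun_eq_iff)
    qed
    have cancel: "inv f0 \<circ> (f0 \<circ> z) = z" "f0 \<circ> (inv f0 \<circ> z) = z" for z :: "nat \<Rightarrow> nat"
      using permutes_inv_o[OF f0(1)] by (simp_all add: comp_assoc[symmetric])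
    have "bij_betw (\<lambda>z. f0 \<circ> z) (centralizer n (canon la)) {f \<in> ?S. f \<circ> canon la \<circ> inv f = g}"
    proof (rule bij_betw_byWitness[where f'="\<lambda>f. inv f0 \<circ> f"])
      show "(\<lambda>z. f0 \<circ> z) ` centralizer n (canon la) \<subseteq> {f \<in> ?S. f \<circ> canon la \<circ> inv f = g}"
      proof (rule image_subsetI)
        fix z assume "z \<in> centralizer n (canon la)"
        then have z: "z permutes {..<n}" "z \<circ> canon la = canon la \<circ> z" by (auto simp: centralizer_def)
        then have p: "f0 \<circ> z permutes {..<n}" using f0(1) by (simp add: permutes_compose)
        then show "f0 \<circ> z \<in> {f \<in> ?S. f \<circ> canon la \<circ> inv f = g}"
          using iff[OF p] z(2) cancel(1) by simp
      qed
      show "(\<lambda>f. inv f0 \<circ> f) ` {f \<in> ?S. f \<circ> canon la \<circ> inv f = g} \<subseteq> centralizer n (canon la)"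
      proof (rule image_subsetI)
        fix f assume "f \<in> {f \<in> ?S. f \<circ> canon la \<circ> inv f = g}"
        then have f: "f permutes {..<n}" "f \<circ> canon la \<circ> inv f = g" by auto
        then show "inv f0 \<circ> f \<in> centralizer n (canon la)"
          using iff[OF f(1)] f0(1) by (simp add: centralizer_def permutes_compose permutes_inv)
      qed
    qed (use cancel in auto)
    then show ?thesis by (rule bij_betw_same_card[symmetric])
  qed
  have class_sum: "(\<Sum>g\<in>?cl la. \<Phi> g) = fact n / card (centralizer n (canon la)) * \<Phi> (canon la)" if la: "is_partition n la" for la
  proof -
    have "real (card ?S) = (\<Sum>g\<in>?cl la. \<Sum>f\<in>{f \<in> ?S. f \<circ> canon la \<circ> inv f = g}. 1)"
      by (subst sum.group) (use finS in auto)
    also have "\<dots> = (\<Sum>g\<in>?cl la. real (card (centralizer n (canon la))))"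
    proof (rule sum.cong[OF refl])
      fix g assume "g \<in> ?cl la"
      from fiber[OF this] show "(\<Sum>f\<in>{f \<in> ?S. f \<circ> canon la \<circ> inv f = g}. 1) = real (card (centralizer n (canon la)))"
        by simp
    qed
    also have "\<dots> = real (card (?cl la)) * real (card (centralizer n (canon la)))" by simp
    finally have card_S: "real (card ?S) = real (card (?cl la)) * real (card (centralizer n (canon la)))" .
    have "real (card (centralizer n (canon la))) \<noteq> 0"
      unfolding of_nat_eq_0_iff by (rule gr_implies_not0[OF card_centralizer_pos])
    then have "real (card (?cl la)) = fact n / card (centralizer n (canon la))"
      using card_S card_permutations[OF refl finite_lessThan[of n]] by (simp add: nonzero_eq_divide_eq)
    moreover have "(\<Sum>g\<in>?cl la. \<Phi> g) = (\<Sum>g\<in>?cl la. \<Phi> (canon la))"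
      by (rule sum.cong) (use conj c[OF la] in auto)
    ultimately show ?thesis by simp
  qed
  have "(\<Sum>g\<in>?S. \<Phi> g) = (\<Sum>g\<in>(\<Union>la\<in>{la. is_partition n la}. ?cl la). \<Phi> g)"
    by (rule arg_cong[OF S])
  also have "\<dots> = (\<Sum>la | is_partition n la. \<Sum>g\<in>?cl la. \<Phi> g)"
  proof (rule sum.UNION_disjoint)
    show "\<forall>la\<in>{la. is_partition n la}. \<forall>mu\<in>{la. is_partition n la}. la \<noteq> mu \<longrightarrow> ?cl la \<inter> ?cl mu = {}"
      using disj by blast
  qed (use finS in simp_all)
  also have "\<dots> = (\<Sum>la | is_partition n la. fact n / card (centralizer n (canon la)) * \<Phi> (canon la))"
    by (rule sum.cong) (simp_all add: class_sum)
  finally show ?thesis .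
qed

lemma centralizer_conj:
  assumes f: "f permutes {..<n}" and g: "g permutes {..<n}"
  shows "bij_betw (\<lambda>h. f \<circ> h \<circ> inv f) (centralizer n g) (centralizer n (f \<circ> g \<circ> inv f))"
proof (rule bij_betw_byWitness[where f'="\<lambda>h. inv f \<circ> h \<circ> f"])
  have i: "inv f (f x) = x" "f (inv f x) = x" for x using permutes_inverses[OF f] by auto
  show "\<forall>a\<in>centralizer n g. inv f \<circ> (f \<circ> a \<circ> inv f) \<circ> f = a" by (auto simp: fun_eq_iff i)
  show "\<forall>a\<in>centralizer n (f \<circ> g \<circ> inv f). f \<circ> (inv f \<circ> a \<circ> f) \<circ> inv f = a" by (auto simp: fun_eq_iff i)
  show "(\<lambda>h. f \<circ> h \<circ> inv f) ` centralizer n g \<subseteq> centralizer n (f \<circ> g \<circ> inv f)"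
    using f by (auto simp: centralizer_def fun_eq_iff i intro!: permutes_compose permutes_inv)
  show "(\<lambda>h. inv f \<circ> h \<circ> f) ` centralizer n (f \<circ> g \<circ> inv f) \<subseteq> centralizer n g"
  proof clarify
    fix h assume "h \<in> centralizer n (f \<circ> g \<circ> inv f)"
    then have h: "h permutes {..<n}" "h (f (g (inv f x))) = f (g (inv f (h x)))" for x
      by (auto simp: centralizer_def fun_eq_iff)
    have "inv f (h (f (g x))) = g (inv f (h (f x)))" for x using h(2)[of "f x"] by (simp add: i)
    then show "inv f \<circ> h \<circ> f \<in> centralizer n g"
      using f h(1) by (auto simp: centralizer_def fun_eq_iff intro!: permutes_compose permutes_inv)
  qed
qed

text \<open>Counting commuting pairs of permutations by either component.\<close>

theorem sum_power_sum_part_eq_sum_centralizers: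
  fixes \<phi> :: "mpoly \<Rightarrow> real"
  shows "(\<Sum>la | is_partition n la. \<phi> (power_sum_part N la)) =
    (\<Sum>la | is_partition n la. (\<Sum>h\<in>centralizer n (canon la). \<phi> (fixpoly N n h)) / card (centralizer n (canon la)))"
proof -
  let ?S = "{g. g permutes {..<n}}"
  have finS: "finite ?S" by (rule finite_permutations) simp
  let ?\<Phi> = "\<lambda>g. \<Sum>h\<in>centralizer n g. \<phi> (fixpoly N n h)"
  let ?\<Psi> = "\<lambda>h. card (centralizer n h) * \<phi> (fixpoly N n h)"
  have conj_card: "card (centralizer n (f \<circ> g \<circ> inv f)) = card (centralizer n g)"
    if "f permutes {..<n}" "g permutes {..<n}" for f g
    using bij_betw_same_card[OF centralizer_conj[OF that]] by simp
  have conj\<Phi>: "?\<Phi> (f \<circ> g \<circ> inv f) = ?\<Phi> g" if fg: "f permutes {..<n}" "g permutes {..<n}" for f g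
  proof -
    have "?\<Phi> (f \<circ> g \<circ> inv f) = (\<Sum>h\<in>centralizer n g. \<phi> (fixpoly N n (f \<circ> h \<circ> inv f)))"
      by (rule sum.reindex_bij_betw[OF centralizer_conj[OF fg], symmetric])
    also have "\<dots> = ?\<Phi> g"
      by (rule sum.cong) (auto simp: fixpoly_conj[OF fg(1)] centralizer_def)
    finally show ?thesis .
  qed
  have "(\<Sum>g\<in>?S. ?\<Phi> g) = (\<Sum>g\<in>?S. \<Sum>h\<in>?S. if h \<circ> g = g \<circ> h then \<phi> (fixpoly N n h) else 0)"
  proof (rule sum.cong[OF refl])
    fix g
    have "centralizer n g = {h \<in> ?S. h \<circ> g = g \<circ> h}" by (auto simp: centralizer_def)
    then show "?\<Phi> g = (\<Sum>h\<in>?S. if h \<circ> g = g \<circ> h then \<phi> (fixpoly N n h) else 0)"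
      using sum.inter_filter[OF finS, of "\<lambda>h. \<phi> (fixpoly N n h)" "\<lambda>h. h \<circ> g = g \<circ> h"] by simp
  qed
  also have "\<dots> = (\<Sum>h\<in>?S. \<Sum>g\<in>?S. if g \<circ> h = h \<circ> g then \<phi> (fixpoly N n h) else 0)"
    by (subst sum.swap) (intro sum.cong refl, auto)
  also have "\<dots> = (\<Sum>h\<in>?S. ?\<Psi> h)"
  proof (rule sum.cong[OF refl])
    fix h
    have "centralizer n h = {g \<in> ?S. g \<circ> h = h \<circ> g}" by (auto simp: centralizer_def)
    then show "(\<Sum>g\<in>?S. if g \<circ> h = h \<circ> g then \<phi> (fixpoly N n h) else 0) = ?\<Psi> h"
      using sum.inter_filter[OF finS, of "\<lambda>g. \<phi> (fixpoly N n h)" "\<lambda>g. g \<circ> h = h \<circ> g"] by simp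
  qed
  finally have "(\<Sum>g\<in>?S. ?\<Phi> g) = (\<Sum>h\<in>?S. ?\<Psi> h)" .
  moreover have "(\<Sum>g\<in>?S. ?\<Phi> g) = (\<Sum>la | is_partition n la. fact n / card (centralizer n (canon la)) * ?\<Phi> (canon la))"
    by (rule sum_over_class) (rule conj\<Phi>)
  moreover have "(\<Sum>h\<in>?S. ?\<Psi> h) = (\<Sum>la | is_partition n la. fact n / card (centralizer n (canon la)) * ?\<Psi> (canon la))"
    by (rule sum_over_class) (simp add: conj_card fixpoly_conj)
  ultimately have "(\<Sum>la | is_partition n la. fact n / card (centralizer n (canon la)) * ?\<Psi> (canon la)) =
    (\<Sum>la | is_partition n la. fact n / card (centralizer n (canon la)) * ?\<Phi> (canon la))" by simp
  moreover have "fact n / card (centralizer n (canon la)) * ?\<Psi> (canon la) = fact n * \<phi> (power_sum_part N la)"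
    if "is_partition n la" for la
  proof -
    have "centralizer n (canon la) \<noteq> {}" using id_in_centralizer by blast
    then show ?thesis using fixpoly_canon[of la N] is_partitionD(2,3)[OF that] by simp
  qed
  then have "(\<Sum>la | is_partition n la. fact n / card (centralizer n (canon la)) * ?\<Psi> (canon la)) =
    fact n * (\<Sum>la | is_partition n la. \<phi> (power_sum_part N la))"
    by (simp add: sum_distrib_left)
  moreover have "(\<Sum>la | is_partition n la. fact n / card (centralizer n (canon la)) * ?\<Phi> (canon la)) =
    fact n * (\<Sum>la | is_partition n la. ?\<Phi> (canon la) / card (centralizer n (canon la)))"
    unfolding sum_distrib_left[of "fact n"]
    by (rule sum.cong[OF refl]) (simp only: times_divide_eq_left times_divide_eq_right)
  ultimately have "fact n * (\<Sum>la | is_partition n la. \<phi> (power_sum_part N la)) =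
    fact n * (\<Sum>la | is_partition n la. ?\<Phi> (canon la) / card (centralizer n (canon la)))"
    by (simp only:)
  then show ?thesis by simp
qed

lemma canon_block_return:
  "(\<And>a. a \<in> set la \<Longrightarrow> 0 < a) \<Longrightarrow> y < sum_list la \<Longrightarrow> \<exists>a\<in>set la. (canon la ^^ a) y = y"
proof (induction la)
  case (Cons j la)
  have c: "canon la permutes {..<sum_list la}" and j: "0 < j" using Cons.prems canon_permutes by auto
  show ?case
  proof (cases "y < sum_list la")
    case True
    then obtain a where a: "a \<in> set la" "(canon la ^^ a) y = y" using Cons by auto
    then show ?thesis using glue_funpow(1)[OF c j True, where i=1 and d=a] by auto
  next
    case False
    then obtain t where t: "y = sum_list la + t" "t < j"
      using Cons.prems(2) that[of "y - sum_list la"] by auto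
    then have "(canon (j # la) ^^ j) y = y" using glue_funpow(2)[OF c j t(2), where i=1 and d=j] by simp
    then show ?thesis by auto
  qed
qed simp

text \<open>A commuting permutation preserves return times under the canonical permutation. Points
  of the block of length \<open>j\<close> return only after multiples of \<open>j\<close> steps, all
  other points after some smaller positive number. So the block is mapped to itself, and commuting
  with its cycle leaves only rotations.\<close>

lemma centralizer_canon_Cons:
  assumes la: "is_partition k la" and less: "\<And>a. a \<in> set la \<Longrightarrow> a < j" and j: "0 < j"
  shows "bij_betw (\<lambda>(h, i). glue k h j i) (centralizer k (canon la) \<times> {..<j}) (centralizer (k + j) (canon (j # la)))"
proof -
  have k: "sum_list la = k" using is_partitionD(3)[OF la] .
  have c: "canon la permutes {..<k}" using canon_permutes[of la] is_partitionD(2,3)[OF la] by simp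
  have ck: "canon la x < k \<longleftrightarrow> x < k" for x using permutes_in_image[OF c, of x] by simp
  let ?g = "canon (j # la)"
  have g1: "?g x = canon la x" if "x < k" for x using that by (simp add: glue_def k)
  have g2: "?g (k + t) = k + (t + 1) mod j" if "t < j" for t using that by (simp add: glue_def k)
  have g: "?g permutes {..<k + j}" using glue_permutes[OF c j, of 1] by (simp add: k)
  have g3: "?g x = x" if "k + j \<le> x" for x using permutes_not_in[OF g, of x] that by simp
  have gl1: "glue k h j i x = h x" if "x < k" for h i x using that by (simp add: glue_def)
  have gl2: "glue k h j i (k + t) = k + (t + i) mod j" if "t < j" for h i t using that by (simp add: glue_def)
  have mj: "t mod j < j" for t using j by simp
  have cases3: "x < k \<or> (\<exists>t<j. x = k + t) \<or> k + j \<le> x" for x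
    using le_Suc_ex[of k x] by (cases "x < k") auto
  have inj: "inj_on (\<lambda>(h, i). glue k h j i) (centralizer k (canon la) \<times> {..<j})"
  proof (rule inj_onI, clarify)
    fix h i h' i' assume hi: "h \<in> centralizer k (canon la)" "i < j" "h' \<in> centralizer k (canon la)" "i' < j"
      "glue k h j i = glue k h' j i'"
    have "h x = h' x" for x
    proof (cases "x < k")
      case True
      then show ?thesis using fun_cong[OF hi(5), of x] by (simp add: glue_def)
    next
      case False
      then have "h x = x" "h' x = x"
        using hi(1,3) permutes_not_in[of h "{..<k}" x] permutes_not_in[of h' "{..<k}" x] by (auto simp: centralizer_def)
      then show ?thesis by simp
    qed
    moreover have "i = i'" using fun_cong[OF hi(5), of k] hi(2,4) j by (simp add: glue_def)
    ultimately show "h = h' \<and> i = i'" by auto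
  qed
  have into: "glue k h j i \<in> centralizer (k + j) ?g" if h: "h \<in> centralizer k (canon la)" for h i
  proof -
    have p: "h permutes {..<k}" and comm: "h (canon la x) = canon la (h x)" for x
      using h by (auto simp: centralizer_def fun_eq_iff)
    have hk: "h x < k \<longleftrightarrow> x < k" for x using permutes_in_image[OF p, of x] by simp
    have "glue k h j i (?g x) = ?g (glue k h j i x)" for x
    proof -
      consider "x < k" | t where "t < j" "x = k + t" | "k + j \<le> x" using cases3 by blast
      then show ?thesis
      proof cases
        case 1
        then show ?thesis using g1 gl1 ck hk comm by simp
      next
        case 2
        show ?thesis
          unfolding 2(2) g2[OF 2(1)] gl2[OF 2(1)] g2[OF mj] gl2[OF mj] by (simp add: mod_simps add_ac)
      next
        case 3
        then show ?thesis using g3 by (simp add: glue_def)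
      qed
    qed
    then show ?thesis using glue_permutes[OF p j] by (auto simp: centralizer_def)
  qed
  have onto: "\<exists>h'\<in>centralizer k (canon la). \<exists>i<j. h = glue k h' j i" if h: "h \<in> centralizer (k + j) ?g" for h
  proof -
    have p: "h permutes {..<k + j}" and comm: "h (?g x) = ?g (h x)" for x
      using h by (auto simp: centralizer_def fun_eq_iff)
    have comm': "h ((?g ^^ d) x) = (?g ^^ d) (h x)" for d x by (induction d) (simp_all add: comm del: canon.simps)
    have lt: "h x < k + j \<longleftrightarrow> x < k + j" for x using permutes_in_image[OF p, of x] by simp
    have ge: "k \<le> h (k + t)" if t: "t < j" for t
    proof (rule ccontr)
      assume "\<not> k \<le> h (k + t)"
      then have y: "h (k + t) < k" by simp
      then obtain a where a: "a \<in> set la" "(canon la ^^ a) (h (k + t)) = h (k + t)"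
        using canon_block_return[of la "h (k + t)"] is_partitionD(2)[OF la] k by auto
      then have "(?g ^^ a) (h (k + t)) = h (k + t)" using glue_funpow(1)[OF c j y, where i=1 and d=a] by (simp add: k)
      then have "h ((?g ^^ a) (k + t)) = h (k + t)" using comm' by simp
      then have "(?g ^^ a) (k + t) = k + t" using permutes_inj[OF p] by (simp add: inj_eq)
      then have "(t + a) mod j = (t + 0) mod j" using glue_funpow(2)[OF c j t, where i=1 and d=a] t by (simp add: k)
      then have "j dvd (t + a) - (t + 0)" by (subst (asm) mod_eq_dvd_iff_nat) simp_all
      then show False using less[OF a(1)] is_partitionD(2)[OF la a(1)] by (auto dest: dvd_imp_le)
    qed
    define i where "i = h k - k"
    have i: "h k = k + i" "i < j" using ge[of 0] lt[of k] j by (auto simp: i_def)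
    have block: "h (k + t) = k + (t + i) mod j" if t: "t < j" for t
    proof -
      have "h (k + t) = h ((?g ^^ t) (k + 0))" using glue_funpow(2)[OF c j j, where i=1 and d=t] t by (simp add: k)
      also have "\<dots> = (?g ^^ t) (k + i)" using comm' i by simp
      also have "\<dots> = k + (t + i) mod j" using glue_funpow(2)[OF c j i(2), where i=1 and d=t] by (simp add: k add.commute)
      finally show ?thesis .
    qed
    define h' where "h' x = (if x < k then h x else x)" for x
    have hk: "h x < k" if x: "x < k" for x
    proof (rule ccontr)
      assume "\<not> h x < k"
      moreover have "h x < k + j" using lt x by simp
      ultimately obtain s where s: "h x = k + s" "s < j" by (metis add_less_cancel_left le_Suc_ex not_less)
      \<comment> \<open>The point of the block that \<open>h\<close> already maps to
        \<open>k + s\<close>; injectivity then excludes \<open>x\<close>.\<close>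
      define t where "t = (s + (j - i)) mod j"
      have "(t + i) mod j = s" using s(2) i(2) by (simp add: t_def mod_simps)
      then have "h (k + t) = h x" using block[of t] s(1) mj by (simp add: t_def)
      then have "k + t = x" using permutes_inj[OF p] by (simp add: inj_eq)
      then show False using x by simp
    qed
    have h'p: "h' permutes {..<k}"
    proof (rule inj_imp_permutes)
      have "inj_on h {..<k}" using permutes_inj[OF p] by (rule inj_on_subset) simp
      then show "inj_on h' {..<k}" by (rule iffD1[OF inj_on_cong, rotated]) (simp add: h'_def)
    qed (auto simp: h'_def hk)
    have "h' (canon la x) = canon la (h' x)" for x
    proof (cases "x < k")
      case True
      then show ?thesis using comm[of x] g1 hk ck by (simp add: h'_def)
    next
      case False
      then show ?thesis using ck permutes_not_in[OF c, of x] by (simp add: h'_def)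
    qed
    then have "h' \<in> centralizer k (canon la)" using h'p by (auto simp: centralizer_def)
    moreover have "h x = glue k h' j i x" for x
    proof -
      consider "x < k" | t where "t < j" "x = k + t" | "k + j \<le> x" using cases3 by blast
      then show ?thesis
      proof cases
        case 3
        then show ?thesis using permutes_not_in[OF p, of x] by (simp add: glue_def)
      qed (simp_all add: gl1 gl2 block h'_def)
    qed
    then have "h = glue k h' j i" by auto
    ultimately show ?thesis using i(2) by blast
  qed
  show ?thesis
    unfolding bij_betw_def
  proof (intro conjI inj equalityI subsetI)
    fix h assume "h \<in> (\<lambda>(h, i). glue k h j i) ` (centralizer k (canon la) \<times> {..<j})"
    then show "h \<in> centralizer (k + j) ?g" using into by auto
  next
    fix h assume "h \<in> centralizer (k + j) ?g"
    then show "h \<in> (\<lambda>(h, i). glue k h j i) ` (centralizer k (canon la) \<times> {..<j})"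
      using onto by (force simp: image_iff)
  qed
qed

text \<open>The Frobenius image of the trivial character induced from the cyclic group of order \<open>j\<close>, times \<open>j\<close>.\<close>

definition cyc :: "nat \<Rightarrow> nat \<Rightarrow> mpoly" where
  "cyc N j = (\<Sum>i<j. fixpoly N j (rot j i))"

definition psi_full :: "nat \<Rightarrow> nat \<Rightarrow> mpoly" where
  "psi_full N n = (\<Sum>la | is_partition n la. power_sum_part N la)"

section \<open>Contributions of the centralizers to the full sum\<close>

lemma sum_centralizer_canon_Cons:
  assumes la: "is_partition k la" and less: "\<And>a. a \<in> set la \<Longrightarrow> a < j" and j: "0 < j"
  shows "(\<Sum>h\<in>centralizer (k + j) (canon (j # la)). F (fixpoly N (k + j) h)) =
     (\<Sum>h\<in>centralizer k (canon la). \<Sum>i<j. F (fixpoly N k h * fixpoly N j (rot j i)))"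
    "card (centralizer (k + j) (canon (j # la))) = j * card (centralizer k (canon la))"
proof -
  note bij = centralizer_canon_Cons[OF assms]
  have "(\<Sum>h\<in>centralizer (k + j) (canon (j # la)). F (fixpoly N (k + j) h)) =
    (\<Sum>p\<in>centralizer k (canon la) \<times> {..<j}. F (fixpoly N (k + j) (case p of (h, i) \<Rightarrow> glue k h j i)))"
    by (rule sum.reindex_bij_betw[OF bij, symmetric])
  also have "\<dots> = (\<Sum>p\<in>centralizer k (canon la) \<times> {..<j}. F (fixpoly N k (fst p) * fixpoly N j (rot j (snd p))))"
    by (rule sum.cong) (auto simp: fixpoly_glue[OF _ j] centralizer_def)
  also have "\<dots> = (\<Sum>h\<in>centralizer k (canon la). \<Sum>i<j. F (fixpoly N k h * fixpoly N j (rot j i)))"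
    by (simp add: sum.cartesian_product case_prod_beta)
  finally show "(\<Sum>h\<in>centralizer (k + j) (canon (j # la)). F (fixpoly N (k + j) h)) =
     (\<Sum>h\<in>centralizer k (canon la). \<Sum>i<j. F (fixpoly N k h * fixpoly N j (rot j i)))" .
  show "card (centralizer (k + j) (canon (j # la))) = j * card (centralizer k (canon la))"
    using bij_betw_same_card[OF bij] by (simp add: card_cartesian_product mult.commute)
qed

lemma sum_centralizer_mult_nonneg:
  assumes "is_partition n la" "is_partition n nu" "n \<le> N"
  shows "0 \<le> (\<Sum>h\<in>centralizer n (canon la). mult N nu (fixpoly N n h))"
proof (rule sum_mult_fixpoly_nonneg)
  show "h permutes {..<n}" if "h \<in> centralizer n (canon la)" for h
    using that by (simp add: centralizer_def)
qed (use assms is_partitionD(4)[OF assms(2)] in \<open>simp_all add: id_in_centralizer centralizer_comp centralizer_inv\<close>)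

lemma schur_span_psi_full: "n \<le> N \<Longrightarrow> schur_span N n (psi_full N n)"
  unfolding psi_full_def
  using schur_span_power_sum_part is_partitionD(3) by (intro schur_span_sum) fastforce

lemma schur_positive_psi_full:
  assumes "n \<le> N"
  shows "schur_positive N n (psi_full N n)"
proof (rule schur_positiveI[OF schur_span_psi_full[OF assms] assms])
  fix nu assume nu: "is_partition n nu"
  have "real_of_int (mult N nu (psi_full N n)) = (\<Sum>la | is_partition n la. real_of_int (mult N nu (power_sum_part N la)))"
    by (simp add: psi_full_def mult_sum)
  also have "\<dots> = (\<Sum>la | is_partition n la. (\<Sum>h\<in>centralizer n (canon la). real_of_int (mult N nu (fixpoly N n h))) / card (centralizer n (canon la)))"
    by (rule sum_power_sum_part_eq_sum_centralizers)
  also have "\<dots> \<ge> 0"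
  proof (rule sum_nonneg)
    fix la assume "la \<in> {la. is_partition n la}"
    then have "0 \<le> (\<Sum>h\<in>centralizer n (canon la). mult N nu (fixpoly N n h))"
      using sum_centralizer_mult_nonneg nu assms by auto
    then have "0 \<le> real_of_int (\<Sum>h\<in>centralizer n (canon la). mult N nu (fixpoly N n h))" by (rule of_int_nonneg)
    then show "0 \<le> (\<Sum>h\<in>centralizer n (canon la). real_of_int (mult N nu (fixpoly N n h))) / card (centralizer n (canon la))"
      by simp
  qed
  finally show "0 \<le> mult N nu (psi_full N n)" by simp
qed

lemma schur_span_cyc:
  assumes "j \<le> N" "0 < j"
  shows "schur_span N j (cyc N j)"
  unfolding cyc_def
proof (rule schur_span_sum)
  fix i assume "i \<in> {..<j}"
  let ?g = "gcd i j"
  have "power_sum_part N (replicate g a) = power_sum N a ^ g" for g a by (induction g) simp_all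
  then have "fixpoly N j (rot j i) = power_sum_part N (replicate ?g (j div ?g))" using fixpoly_rot[OF assms(2)] by simp
  moreover have "sum_list (replicate ?g (j div ?g)) = j" by (simp add: sum_list_replicate)
  ultimately show "schur_span N j (fixpoly N j (rot j i))"
    using schur_span_power_sum_part[of "replicate ?g (j div ?g)" N] assms(1) by simp
qed

lemma schur_positive_cyc:
  assumes "j \<le> N" "0 < j"
  shows "schur_positive N j (cyc N j)"
proof (rule schur_positiveI[OF schur_span_cyc[OF assms] assms(1)])
  fix nu assume nu: "is_partition j nu"
  have "centralizer 0 (canon []) = {id}" by (auto simp: centralizer_def)
  moreover have "fixpoly N 0 id = 1" using fixpoly_canon[of "[]" N] by simp
  ultimately have "(\<Sum>h\<in>centralizer (0 + j) (canon [j]). mult N nu (fixpoly N (0 + j) h)) = mult N nu (cyc N j)"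
    by (subst sum_centralizer_canon_Cons) (use assms(2) in \<open>simp_all add: is_partition_def cyc_def mult_sum\<close>)
  moreover have "0 \<le> (\<Sum>h\<in>centralizer j (canon [j]). mult N nu (fixpoly N j h))"
    by (rule sum_centralizer_mult_nonneg[OF _ nu assms(1)]) (use assms in \<open>simp add: is_partition_def\<close>)
  ultimately show "0 \<le> mult N nu (cyc N j)" by simp
qed

text \<open>Each partition contributes a nonnegative average \<open>t\<close>, so those with largest
  part below \<open>l\<close> may be dropped. If the largest part is \<open>j \<ge> l\<close>, the
  rest \<open>n - j\<close> is smaller than \<open>j\<close>, the centralizer has a cyclic factor,
  and counting commuting pairs backwards turns the remaining averages into
  \<open>psi_full N (n - j)\<close>.\<close>

theorem mult_psi_full_ge:
  assumes nu: "is_partition n nu" and n: "n \<le> N" "n < 2 * l" "0 < l"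
  shows "(\<Sum>j\<in>{l..n}. mult N nu (cyc N j * psi_full N (n - j)) / j) \<le> mult N nu (psi_full N n)"
proof -
  let ?Z = "\<lambda>n la. centralizer n (canon la)"
  let ?\<phi> = "\<lambda>f. real_of_int (mult N nu f)"
  define t where "t la = (\<Sum>h\<in>?Z n la. ?\<phi> (fixpoly N n h)) / card (?Z n la)" for la
  have nonneg: "0 \<le> t la" if "is_partition n la" for la
  proof -
    have "0 \<le> (\<Sum>h\<in>?Z n la. mult N nu (fixpoly N n h))" by (rule sum_centralizer_mult_nonneg[OF that nu n(1)])
    then have "0 \<le> real_of_int (\<Sum>h\<in>?Z n la. mult N nu (fixpoly N n h))" by (rule of_int_nonneg)
    then show ?thesis by (simp add: t_def)
  qed
  have "?\<phi> (psi_full N n) = (\<Sum>la | is_partition n la. ?\<phi> (power_sum_part N la))"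
    by (simp add: psi_full_def mult_sum)
  also have "\<dots> = (\<Sum>la | is_partition n la. t la)"
    unfolding t_def by (rule sum_power_sum_part_eq_sum_centralizers)
  finally have psi: "?\<phi> (psi_full N n) = (\<Sum>la | is_partition n la. t la)" .
  let ?X = "\<lambda>j. (\<lambda>la. j # la) ` {la. is_partition (n - j) la}"
  have small: "a < j" if "l \<le> j" "is_partition (n - j) la" "a \<in> set la" for a j la
    using member_le_sum_list[of a la] that is_partitionD(3)[OF that(2)] n by simp
  have X: "is_partition n (j # la)" if "l \<le> j" "j \<le> n" "is_partition (n - j) la" for j la
    using that small[OF that(1,3)] n(3) by (auto simp: is_partition_def less_imp_le)
  have tj: "(\<Sum>la\<in>?X j. t la) = ?\<phi> (cyc N j * psi_full N (n - j)) / j" if j: "l \<le> j" "j \<le> n" for j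
  proof -
    let ?k = "n - j"
    let ?F = "\<lambda>f. (\<Sum>i<j. ?\<phi> (f * fixpoly N j (rot j i))) / real j"
    have j0: "0 < j" using j n(3) by simp
    have kj: "?k + j = n" using j by simp
    have "t (j # la) = (\<Sum>h\<in>?Z ?k la. ?F (fixpoly N ?k h)) / card (?Z ?k la)" if la: "is_partition ?k la" for la
    proof -
      have "t (j # la) = (\<Sum>h\<in>?Z ?k la. \<Sum>i<j. ?\<phi> (fixpoly N ?k h * fixpoly N j (rot j i))) / (j * card (?Z ?k la))"
        using sum_centralizer_canon_Cons(1)[OF la small[OF j(1) la] j0, where F="?\<phi>" and N=N]
          sum_centralizer_canon_Cons(2)[OF la small[OF j(1) la] j0] unfolding t_def kj by simp
      also have "\<dots> = (\<Sum>h\<in>?Z ?k la. ?F (fixpoly N ?k h)) / card (?Z ?k la)"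
        unfolding sum_divide_distrib[symmetric] by simp
      finally show ?thesis .
    qed
    then have "(\<Sum>la\<in>?X j. t la) = (\<Sum>la | is_partition ?k la. (\<Sum>h\<in>?Z ?k la. ?F (fixpoly N ?k h)) / card (?Z ?k la))"
      by (subst sum.reindex) (auto simp: inj_on_def)
    also have "\<dots> = (\<Sum>la | is_partition ?k la. ?F (power_sum_part N la))"
      by (rule sum_power_sum_part_eq_sum_centralizers[symmetric])
    also have "\<dots> = (\<Sum>i<j. \<Sum>la | is_partition ?k la. ?\<phi> (power_sum_part N la * fixpoly N j (rot j i))) / j"
      unfolding sum_divide_distrib[symmetric] by (subst sum.swap) simp
    also have "(\<Sum>i<j. \<Sum>la | is_partition ?k la. ?\<phi> (power_sum_part N la * fixpoly N j (rot j i))) = ?\<phi> (cyc N j * psi_full N ?k)"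
      unfolding cyc_def psi_full_def sum_distrib_left sum_distrib_right mult_sum of_int_sum by (simp only: mult.commute) (rule sum.swap)
    finally show ?thesis .
  qed
  have "(\<Sum>j\<in>{l..n}. ?\<phi> (cyc N j * psi_full N (n - j)) / j) = (\<Sum>j\<in>{l..n}. \<Sum>la\<in>?X j. t la)"
    by (rule sum.cong) (simp_all add: tj)
  also have "\<dots> = (\<Sum>la\<in>(\<Union>j\<in>{l..n}. ?X j). t la)"
    by (rule sum.UNION_disjoint[symmetric]) auto
  also have "\<dots> \<le> (\<Sum>la | is_partition n la. t la)"
    by (rule sum_mono2) (use X nonneg in auto)
  finally show ?thesis using psi by simp
qed

section \<open>Hooks\<close>

text \<open>Extends \<open>mult\<close> to arbitrary exponent vectors, since lowering a beta number
  leaves vectors that are no longer decreasing.\<close>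

definition alt_coeff :: "nat \<Rightarrow> mpoly \<Rightarrow> (nat \<Rightarrow> nat) \<Rightarrow> int" where
  "alt_coeff N f b = Poly_Mapping.lookup (alt N (stair N) * f) (expo N b)"

lemma mult_eq_alt_coeff: "mult N nu f = alt_coeff N f (beta N nu)"
  by (simp add: mult_def alt_coeff_def)

lemma alt_coeff_cong: "(\<And>i. i < N \<Longrightarrow> b i = b' i) \<Longrightarrow> alt_coeff N f b = alt_coeff N f b'"
  unfolding alt_coeff_def by (simp add: expo_eq_iff[of N b b', THEN iffD2])

lemma alt_coeff_permute:
  assumes f: "schur_span N n f" "n \<le> N" and \<tau>: "\<tau> permutes {..<N}"
  shows "alt_coeff N f (b \<circ> \<tau>) = sign \<tau> * alt_coeff N f b"
proof -
  obtain c :: "nat list \<Rightarrow> int" where c: "f = (\<Sum>nu | is_partition n nu. of_int (c nu) * schur N nu)"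
    using f(1) by (auto simp: schur_span_def)
  have "alt N (stair N) * f = (\<Sum>nu | is_partition n nu. of_int (c nu) * alt N (beta N nu))"
    unfolding c sum_distrib_left
  proof (rule sum.cong[OF refl])
    fix nu assume "nu \<in> {nu. is_partition n nu}"
    then have nu: "is_partition n nu" "length nu \<le> N" using is_partitionD(4)[of n nu] f(2) by auto
    show "alt N (stair N) * (of_int (c nu) * schur N nu) = of_int (c nu) * alt N (beta N nu)"
      unfolding alt_stair_schur[OF nu, symmetric] by (simp add: mult_ac)
  qed
  then show ?thesis
    by (simp add: alt_coeff_def lookup_sum lookup_of_int_mult lookup_alt_permute[OF \<tau>] sum_distrib_left mult_ac)
qed

lemma alt_coeff_swap:
  assumes f: "schur_span N n f" "n \<le> N" and "i < N" "j < N" "i \<noteq> j"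
  shows "alt_coeff N f (b \<circ> transpose i j) = - alt_coeff N f b"
  using alt_coeff_permute[OF f permutes_swap_id, of i j b] assms(3-) by (simp add: sign_swap_id)

lemma alt_coeff_eq_0:
  assumes f: "schur_span N n f" "n \<le> N" and ij: "i < N" "j < N" "i \<noteq> j" "b i = b j"
  shows "alt_coeff N f b = 0"
proof -
  have "b \<circ> transpose i j = b" using ij(4) by (auto simp: fun_eq_iff transpose_def)
  then show ?thesis using alt_coeff_swap[OF f ij(1-3), of b] by simp
qed

text \<open>Moving one entry by \<open>d\<close> positions takes \<open>d\<close> adjacent swaps;
  this is the origin of the sign of a border strip.\<close>

lemma alt_coeff_cycle:
  assumes f: "schur_span N n f" "n \<le> N"
  shows "i + d < N \<Longrightarrow> alt_coeff N f (\<lambda>l. if l = i then b (i + d) else if i < l \<and> l \<le> i + d then b (l - 1) else b l) = (- 1) ^ d * alt_coeff N f b"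
proof (induction d arbitrary: b)
  case 0
  have "(\<lambda>l. if l = i then b (i + 0) else if i < l \<and> l \<le> i + 0 then b (l - 1) else b l) = b" by auto
  then show ?case by simp
next
  case (Suc d)
  let ?s = "transpose (i + d) (Suc (i + d))"
  have "(\<lambda>l. if l = i then b (i + Suc d) else if i < l \<and> l \<le> i + Suc d then b (l - 1) else b l) =
    (\<lambda>l. if l = i then (b \<circ> ?s) (i + d) else if i < l \<and> l \<le> i + d then (b \<circ> ?s) (l - 1) else (b \<circ> ?s) l)"
    by (auto simp: fun_eq_iff transpose_def)
  then show ?case using Suc alt_coeff_swap[OF f, of "i + d" "Suc (i + d)" b] by simp
qed

lemma alt_coeff_power_sum_mult:
  "alt_coeff N (power_sum N a * f) b = (\<Sum>i<N. if a \<le> b i then alt_coeff N f (b(i := b i - a)) else 0)"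
proof -
  have "alt_coeff N (power_sum N a * f) b = (\<Sum>i<N. Poly_Mapping.lookup (var i ^ a * (alt N (stair N) * f)) (expo N b))"
    unfolding alt_coeff_def power_sum_def sum_distrib_right sum_distrib_left lookup_sum[symmetric]
    by (simp add: mult_ac)
  also have "\<dots> = (\<Sum>i<N. if a \<le> b i then alt_coeff N f (b(i := b i - a)) else 0)"
  proof (rule sum.cong[OF refl])
    fix i assume i: "i \<in> {..<N}"
    have v: "var i ^ a = mon N (\<lambda>v. if v = i then a else 0)"
      using i by (simp add: mon_def if_distrib[of "(^) _"] cong: if_cong)
    have "(\<forall>v<N. (if v = i then a else 0) \<le> b v) \<longleftrightarrow> a \<le> b i" using i by auto
    moreover have "expo N (\<lambda>v. b v - (if v = i then a else 0)) = expo N (b(i := b i - a))"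
      by (simp add: expo_eq_iff)
    ultimately show "Poly_Mapping.lookup (var i ^ a * (alt N (stair N) * f)) (expo N b) = (if a \<le> b i then alt_coeff N f (b(i := b i - a)) else 0)"
      unfolding v lookup_mon_mult by (simp add: alt_coeff_def)
  qed
  finally show ?thesis .
qed

definition hook :: "nat \<Rightarrow> nat \<Rightarrow> nat list" where
  "hook s r = (s - r) # replicate r 1"

lemma hook_partition: "r < s \<Longrightarrow> is_partition s (hook s r)"
proof -
  have "sorted_wrt (\<ge>) (replicate r (1 :: nat))" by (induction r) auto
  then show "r < s \<Longrightarrow> is_partition s (hook s r)" by (auto simp: is_partition_def hook_def sum_list_replicate)
qed

lemma beta_hook:
  assumes "r < s" "s \<le> N" "i < N"
  shows "beta N (hook s r) i = (if i = 0 then s - r + N - 1 else if i \<le> r then N - i else N - 1 - i)"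
proof -
  have "part (hook s r) i = (if i = 0 then s - r else if i \<le> r then 1 else 0)"
    by (cases i) (auto simp: part_def hook_def)
  then show ?thesis using assms by (auto simp: beta_def stair_def)
qed

text \<open>Apart from the first entry and the entry \<open>r + 1 - a\<close>, lowering a beta
  number of the hook by \<open>a\<close> is impossible or makes two of them equal. So a border strip
  is taken from the arm or from the leg, or is the whole hook.\<close>

lemma mult_hook_power_sum_mult:
  assumes f: "schur_span N (s - a) f" and a: "0 < a" "a \<le> s" and r: "r < s" "s \<le> N"
  shows "mult N (hook s r) (power_sum N a * f) =
    (if a = s then (- 1) ^ r * mult N [] f
     else (if a < s - r then mult N (hook (s - a) r) f else 0) +
          (if a \<le> r then (- 1) ^ (a - 1) * mult N (hook (s - a) (r - a)) f else 0))"
proof -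
  let ?b = "beta N (hook s r)"
  have sN: "s - a \<le> N" using r by simp
  note eq0 = alt_coeff_eq_0[OF f sN]
  note b = beta_hook[OF r]
  define T where "T i = (if a \<le> ?b i then alt_coeff N f (?b(i := ?b i - a)) else 0)" for i
  have N0: "0 < N" using a r by simp
  have zero: "T i = 0" if i: "0 < i" "i < N" "\<not> (i \<le> r \<and> i + a = r + 1)" for i
  proof (cases "a \<le> ?b i")
    case True
    consider "i \<le> r" "i + a \<le> r" | "i \<le> r" "r + 2 \<le> i + a" | "r < i" using i by linarith
    then have "alt_coeff N f (?b(i := ?b i - a)) = 0"
    proof cases
      case 1
      then show ?thesis by (intro eq0[of i "i + a"]) (use i a r b in auto)
    next
      case 2
      then show ?thesis by (intro eq0[of i "i + a - 1"]) (use i a r b True in auto)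
    next
      case 3
      then show ?thesis by (intro eq0[of i "i + a"]) (use i a r b True in auto)
    qed
    then show ?thesis by (simp add: T_def)
  qed (simp add: T_def)
  have "mult N (hook s r) (power_sum N a * f) = (\<Sum>i<N. T i)"
    unfolding mult_eq_alt_coeff alt_coeff_power_sum_mult T_def ..
  also have "\<dots> = T 0 + (if a \<le> r then T (r + 1 - a) else 0)"
  proof (cases "a \<le> r")
    case True
    have "(\<Sum>i<N. T i) = (\<Sum>i\<in>{0, r + 1 - a}. T i)"
    proof (rule sum.mono_neutral_right)
      show "\<forall>i\<in>{..<N} - {0, r + 1 - a}. T i = 0"
      proof
        fix i assume "i \<in> {..<N} - {0, r + 1 - a}"
        then have "0 < i" "i < N" "\<not> (i \<le> r \<and> i + a = r + 1)" by auto
        then show "T i = 0" by (rule zero)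
      qed
    qed (use True a r N0 in auto)
    also have "\<dots> = T 0 + T (r + 1 - a)" using True by simp
    finally show ?thesis using True by simp
  next
    case False
    have "(\<Sum>i<N. T i) = (\<Sum>i\<in>{0}. T i)"
    proof (rule sum.mono_neutral_right)
      show "\<forall>i\<in>{..<N} - {0}. T i = 0"
      proof
        fix i assume "i \<in> {..<N} - {0}"
        then have "0 < i" "i < N" "\<not> (i \<le> r \<and> i + a = r + 1)" using False by auto
        then show "T i = 0" by (rule zero)
      qed
    qed (use N0 in auto)
    then show ?thesis using False by simp
  qed
  also have "T 0 = (if a = s then (- 1) ^ r * mult N [] f else if a < s - r then mult N (hook (s - a) r) f else 0)"
  proof -
    have b0: "?b 0 = s - r + N - 1" using b N0 by simp
    have T0: "T 0 = alt_coeff N f (?b(0 := s - r + N - 1 - a))" using a r by (simp add: T_def b0)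
    consider "a = s" | "a < s" "a < s - r" | "a < s" "s - r \<le> a" using a by linarith
    then show ?thesis
    proof cases
      case 1
      let ?c = "\<lambda>l. if l = 0 then beta N [] (0 + r) else if 0 < l \<and> l \<le> 0 + r then beta N [] (l - 1) else beta N [] l"
      have nil: "beta N [] l = N - 1 - l" for l by (simp add: beta_def part_def stair_def)
      have "alt_coeff N f (?b(0 := s - r + N - 1 - a)) = alt_coeff N f ?c"
        by (rule alt_coeff_cong) (use 1 r in \<open>auto simp: b nil\<close>)
      also have "\<dots> = (- 1) ^ r * alt_coeff N f (beta N [])"
        by (rule alt_coeff_cycle[OF f sN]) (use r in simp)
      finally show ?thesis using 1 T0 by (simp add: mult_eq_alt_coeff)
    next
      case 2
      have "alt_coeff N f (?b(0 := s - r + N - 1 - a)) = alt_coeff N f (beta N (hook (s - a) r))"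
        by (rule alt_coeff_cong) (use 2 r a in \<open>auto simp: b beta_hook\<close>)
      then show ?thesis using 2 T0 by (simp add: mult_eq_alt_coeff)
    next
      case 3
      have "alt_coeff N f (?b(0 := s - r + N - 1 - a)) = 0"
        by (rule eq0[of 0 "1 + a + r - s"]) (use 3 r a b in auto)
      then show ?thesis using 3 T0 by simp
    qed
  qed
  also have "(if a \<le> r then T (r + 1 - a) else 0) =
    (if a = s then 0 else if a \<le> r then (- 1) ^ (a - 1) * mult N (hook (s - a) (r - a)) f else 0)"
  proof (cases "a \<le> r")
    case True
    define i where "i = r + 1 - a"
    have i: "0 < i" "i \<le> r" "i < N" "i + a = r + 1" "i + (a - 1) = r" using True a r by (auto simp: i_def)
    have bi: "?b i = N - i" using b i by simp
    let ?h = "beta N (hook (s - a) (r - a))"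
    let ?c = "\<lambda>l. if l = i then ?h (i + (a - 1)) else if i < l \<and> l \<le> i + (a - 1) then ?h (l - 1) else ?h l"
    have h: "?h l = (if l = 0 then s - r + N - 1 else if l \<le> r - a then N - l else N - 1 - l)" if "l < N" for l
      using beta_hook[of "r - a" "s - a" N l] that True r by auto
    have "T i = alt_coeff N f (?b(i := N - i - a))" using i r by (simp add: T_def bi)
    also have "\<dots> = alt_coeff N f ?c"
      by (rule alt_coeff_cong) (use i True r in \<open>auto simp: b h\<close>)
    also have "\<dots> = (- 1) ^ (a - 1) * alt_coeff N f ?h"
      by (rule alt_coeff_cycle[OF f sN]) (use i r in simp)
    finally show ?thesis using True r unfolding i_def by (simp add: mult_eq_alt_coeff)
  qed simp
  finally show ?thesis by auto
qed

text \<open>The generating function of the hook multiplicities by leg length. A power sum acts on it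
  as the factor \<open>1 - neg_X ^ a\<close>; complex coefficients allow this to be split by roots
  of unity.\<close>

definition hook_poly :: "nat \<Rightarrow> nat \<Rightarrow> mpoly \<Rightarrow> complex poly" where
  "hook_poly N s f = (\<Sum>r<s. Polynomial.monom (of_int (mult N (hook s r) f)) r)"

lemma coeff_hook_poly: "poly.coeff (hook_poly N s f) r = (if r < s then of_int (mult N (hook s r) f) else 0)"
  by (simp add: hook_poly_def coeff_sum)

abbreviation neg_X :: "complex poly" where "neg_X \<equiv> Polynomial.monom (- 1) 1"

lemma neg_X_power: "neg_X ^ a = Polynomial.monom ((- 1) ^ a) a"
  by (simp add: monom_power)

lemma hook_poly_power_sum_mult:
  assumes f: "schur_span N (s - a) f" and a: "0 < a" "a < s" and r: "s \<le> N"
  shows "hook_poly N s (power_sum N a * f) = (1 - neg_X ^ a) * hook_poly N (s - a) f"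
proof (rule poly_eqI)
  fix r
  have e: "- ((- 1) ^ a) = ((- 1) ^ (a - 1) :: complex)" using a by (cases a) auto
  have "poly.coeff ((1 - neg_X ^ a) * hook_poly N (s - a) f) r =
    poly.coeff (hook_poly N (s - a) f) r + (if a \<le> r then (- 1) ^ (a - 1) * poly.coeff (hook_poly N (s - a) f) (r - a) else 0)"
    unfolding left_diff_distrib neg_X_power coeff_diff coeff_monom_mult e[symmetric] by simp
  then show "poly.coeff (hook_poly N s (power_sum N a * f)) r = poly.coeff ((1 - neg_X ^ a) * hook_poly N (s - a) f) r"
    using mult_hook_power_sum_mult[OF f, of r] a r unfolding coeff_hook_poly by (auto simp: less_diff_conv)
qed

text \<open>The multiplicities alternate in sign, which gives a geometric series in
  \<open>neg_X\<close>; the factor \<open>1 - neg_X\<close> avoids a division.\<close>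

lemma hook_poly_power_sum:
  assumes "0 < a" "a \<le> N"
  shows "(1 - neg_X) * hook_poly N a (power_sum N a) = 1 - neg_X ^ a"
proof -
  have "mult N [] 1 = 1"
    using mult_schur[of 0 "[]" 0 "[]" N] by (simp add: schur_Nil is_partition_def)
  then have "mult N (hook a r) (power_sum N a) = (- 1) ^ r" if "r < a" for r
    using mult_hook_power_sum_mult[of N a a 1 r] schur_span_1 that assms by simp
  then have "hook_poly N a (power_sum N a) = (\<Sum>r<a. neg_X ^ r)"
    unfolding hook_poly_def neg_X_power by (intro sum.cong) auto
  then show ?thesis by (simp add: one_diff_power_eq)
qed

lemma hook_poly_power_sum_power:
  assumes "0 < a"
  shows "a * Suc g \<le> N \<Longrightarrow> (1 - neg_X) * hook_poly N (a * Suc g) (power_sum N a ^ Suc g) = (1 - neg_X ^ a) ^ Suc g"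
proof (induction g)
  case 0
  then show ?case using hook_poly_power_sum[OF assms] by simp
next
  case (Suc g)
  have "power_sum_part N (replicate m a) = power_sum N a ^ m" for m by (induction m) simp_all
  then have "schur_span N (a * Suc g) (power_sum N a ^ Suc g)"
    using schur_span_power_sum_part[of "replicate (Suc g) a" N] Suc.prems
    by (simp only: sum_list_replicate) (simp add: mult.commute)
  then have "hook_poly N (a * Suc (Suc g)) (power_sum N a * power_sum N a ^ Suc g) = (1 - neg_X ^ a) * hook_poly N (a * Suc g) (power_sum N a ^ Suc g)"
    using hook_poly_power_sum_mult[of N "a * Suc (Suc g)" a "power_sum N a ^ Suc g"] assms Suc.prems by simp
  then have "(1 - neg_X) * hook_poly N (a * Suc (Suc g)) (power_sum N a ^ Suc (Suc g)) =
    (1 - neg_X ^ a) * ((1 - neg_X) * hook_poly N (a * Suc g) (power_sum N a ^ Suc g))"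
    by (simp add: mult_ac)
  also have "(1 - neg_X) * hook_poly N (a * Suc g) (power_sum N a ^ Suc g) = (1 - neg_X ^ a) ^ Suc g"
    using Suc by simp
  finally show ?case by (simp only: power_Suc[symmetric])
qed

section \<open>Roots of unity and the hooks in the induced cyclic character\<close>

definition root1 :: "nat \<Rightarrow> nat \<Rightarrow> complex" where
  "root1 j k = cis (2 * pi * real k / real j)"

lemma root1_add: "root1 j (a + b) = root1 j a * root1 j b"
  by (simp add: root1_def cis_mult add_divide_distrib distrib_left)

lemma root1_power: "root1 j a ^ b = root1 j (b * a)"
  by (simp add: root1_def Complex.DeMoivre mult_ac)

lemma root1_eq_1_iff:
  assumes "0 < j"
  shows "root1 j k = 1 \<longleftrightarrow> j dvd k"
proof -
  have multiple: "root1 j (j * q) = 1" for q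
  proof -
    have "2 * pi * real (j * q) / real j = 2 * pi * real q" using assms by simp
    then show ?thesis unfolding root1_def by (simp only:) (rule cis_multiple_2pi, simp)
  qed
  have "root1 j k = root1 j (k mod j)"
    using root1_add[of j "j * (k div j)" "k mod j"] multiple by simp
  moreover have "root1 j (k mod j) = 1 \<longleftrightarrow> k mod j = 0"
  proof
    assume "root1 j (k mod j) = 1"
    then have "root1 j (k mod j) = root1 j 0" by (simp add: root1_def)
    moreover have "inj_on (root1 j) {..<j}"
      using bij_betw_roots_unity[OF assms] by (simp add: root1_def[abs_def] bij_betw_def)
    ultimately show "k mod j = 0" using assms by (auto dest: inj_onD)
  qed (simp add: root1_def)
  ultimately show ?thesis by (simp add: dvd_eq_mod_eq_0)
qed

text \<open>Both sides have degree at most \<open>d\<close> and agree at 0 and at the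
  \<open>d\<close> distinct common zeros \<open>- inverse (q ^ l)\<close>, one point more than the
  degree.\<close>

lemma prod_roots_of_unity:
  fixes q :: complex
  assumes d: "0 < d" and q: "\<And>l. q ^ l = 1 \<longleftrightarrow> d dvd l" "q \<noteq> 0"
  shows "(\<Prod>l<d. 1 - Polynomial.smult (q ^ l) neg_X) = 1 - neg_X ^ d"
proof (rule poly_eqI_degree[where A="insert 0 ((\<lambda>l. - inverse (q ^ l)) ` {..<d})"])
  have inj: "inj_on (\<lambda>l. - inverse (q ^ l)) {..<d}"
  proof -
    have "l = m" if "l \<le> m" "m < d" "q ^ l = q ^ m" for l m
    proof -
      have "q ^ l * q ^ (m - l) = q ^ m" using that(1) by (simp only: power_add[symmetric] le_add_diff_inverse)
      then have "q ^ (m - l) = 1" using that q(2) by simp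
      then have "d dvd m - l" using q(1) by simp
      moreover have "m - l < d" using that by simp
      ultimately show ?thesis using that by (auto dest: nat_dvd_not_less)
    qed
    then show ?thesis by (intro inj_onI) (metis lessThan_iff inverse_eq_iff_eq neg_equal_iff_equal nat_le_linear)
  qed
  have card: "card (insert 0 ((\<lambda>l. - inverse (q ^ l)) ` {..<d})) = Suc d"
    using q(2) by (subst card_insert_disjoint) (auto simp: card_image[OF inj])
  have "degree (\<Prod>l<d. 1 - Polynomial.smult (q ^ l) neg_X) \<le> (\<Sum>l<d. 1)"
  proof (rule order_trans[OF degree_prod_sum_le sum_mono])
    fix l
    have "degree (Polynomial.smult (q ^ l) neg_X) \<le> 1"
      by (rule order_trans[OF degree_smult_le degree_monom_le])
    then show "(degree \<circ> (\<lambda>l. 1 - Polynomial.smult (q ^ l) neg_X)) l \<le> 1" by (simp add: degree_diff_le)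
  qed simp
  then show "degree (\<Prod>l<d. 1 - Polynomial.smult (q ^ l) neg_X) < card (insert 0 ((\<lambda>l. - inverse (q ^ l)) ` {..<d}))"
    unfolding card by simp
  have "degree (1 - neg_X ^ d) \<le> d" unfolding neg_X_power by (intro degree_diff_le degree_monom_le) simp
  then show "degree (1 - neg_X ^ d) < card (insert 0 ((\<lambda>l. - inverse (q ^ l)) ` {..<d}))"
    unfolding card by simp
  fix x assume "x \<in> insert 0 ((\<lambda>l. - inverse (q ^ l)) ` {..<d})"
  then consider "x = 0" | l where "l < d" "x = - inverse (q ^ l)" by auto
  then show "poly (\<Prod>l<d. 1 - Polynomial.smult (q ^ l) neg_X) x = poly (1 - neg_X ^ d) x"
  proof cases
    case 1
    then show ?thesis using d by (simp add: poly_prod poly_monom)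
  next
    case 2
    have "poly (1 - Polynomial.smult (q ^ l) neg_X) x = 0" using q(2) by (simp add: 2 poly_monom)
    then have "poly (\<Prod>l<d. 1 - Polynomial.smult (q ^ l) neg_X) x = 0"
      unfolding poly_prod using 2(1) by (intro prod_zero) auto
    moreover have "(- x) ^ d = inverse ((q ^ l) ^ d)" by (simp add: 2 power_inverse)
    then have "(- x) ^ d = 1" using q(1)[of "l * d"] by (simp add: power_mult)
    then have "poly (1 - neg_X ^ d) x = 0" by (simp add: poly_monom)
    ultimately show ?thesis by simp
  qed
qed

text \<open>The cycle type gives \<open>(1 - neg_X ^ d) ^ g\<close> divided by
  \<open>1 - neg_X\<close>. As \<open>l\<close> runs below \<open>j\<close>, the powers of
  \<open>root1 j i\<close> run \<open>g\<close> times through the \<open>d\<close>-th roots of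
  unity, and the factor for \<open>l = 0\<close> cancels the denominator.\<close>

lemma hook_poly_fixpoly_rot:
  assumes j: "0 < j" "j \<le> N"
  shows "hook_poly N j (fixpoly N j (rot j i)) = (\<Prod>l\<in>{1..<j}. 1 - Polynomial.smult (root1 j (i * l)) neg_X)"
proof -
  define g where "g = gcd i j"
  define d where "d = j div g"
  have g: "0 < g" "g dvd i" "g dvd j" using j by (auto simp: g_def)
  have jd: "j = d * g" using g(3) by (simp add: d_def)
  have d: "0 < d" using jd j(1) by (cases d) auto
  define q where "q = root1 j i"
  have "j dvd l * i \<longleftrightarrow> d dvd l" for l
  proof -
    obtain i' where "i = g * i'" using g(2) by (rule dvdE)
    then have i': "i = i' * g" by simp
    have "coprime (i div g) (j div g)" unfolding g_def by (rule div_gcd_coprime) (use j in simp)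
    then have "coprime i' d" using g(1) by (simp add: i' d_def)
    then show ?thesis using g(1) by (simp add: jd i' mult.assoc[symmetric] coprime_dvd_mult_left_iff coprime_commute)
  qed
  then have q1: "q ^ l = 1 \<longleftrightarrow> d dvd l" for l
    unfolding q_def root1_power root1_eq_1_iff[OF j(1)] .
  have q0: "q \<noteq> 0" by (simp add: q_def root1_def)
  have qd: "q ^ (d * b + l) = q ^ l" for b l using q1[of "d * b"] by (simp add: power_add)
  have "(\<Prod>l<d * b. 1 - Polynomial.smult (q ^ l) neg_X) = (1 - neg_X ^ d) ^ b" for b
  proof (induction b)
    case (Suc b)
    have "(\<Prod>l<d * b + m. 1 - Polynomial.smult (q ^ l) neg_X) =
      (\<Prod>l<d * b. 1 - Polynomial.smult (q ^ l) neg_X) * (\<Prod>l<m. 1 - Polynomial.smult (q ^ l) neg_X)" for m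
      by (induction m) (simp_all add: qd mult.assoc)
    from this[of d] Suc show ?case using prod_roots_of_unity[OF d q1 q0] by (simp add: mult.commute add.commute)
  qed simp
  from this[of g] have "(\<Prod>l<j. 1 - Polynomial.smult (q ^ l) neg_X) = (1 - neg_X ^ d) ^ g" by (simp add: jd)
  moreover have "(\<Prod>l<j. 1 - Polynomial.smult (q ^ l) neg_X) = (1 - neg_X) * (\<Prod>l\<in>{1..<j}. 1 - Polynomial.smult (q ^ l) neg_X)"
  proof -
    have "{..<j} = insert 0 {1..<j}" using j by auto
    then show ?thesis by simp
  qed
  moreover have "(1 - neg_X) * hook_poly N j (fixpoly N j (rot j i)) = (1 - neg_X ^ d) ^ g"
  proof -
    have fr: "fixpoly N j (rot j i) = power_sum N d ^ g"
      unfolding d_def g_def by (rule fixpoly_rot[OF j(1)])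
    have g': "Suc (g - 1) = g" using g(1) by simp
    show ?thesis
      using hook_poly_power_sum_power[OF d, of "g - 1" N] j(2) unfolding g' jd[symmetric] fr by blast
  qed
  ultimately have "(1 - neg_X) * hook_poly N j (fixpoly N j (rot j i)) = (1 - neg_X) * (\<Prod>l\<in>{1..<j}. 1 - Polynomial.smult (q ^ l) neg_X)"
    by simp
  moreover have "1 - neg_X \<noteq> 0"
  proof
    assume "1 - neg_X = 0"
    then have "poly.coeff (1 - neg_X) 0 = 0" by simp
    then show False by simp
  qed
  ultimately show ?thesis by (simp add: q_def root1_power mult.commute)
qed

text \<open>Since \<open>- neg_X\<close> is the variable X, the factors are 1 + c_l X, and the
  coefficients are elementary symmetric functions of the c_l.\<close>

lemma coeff_prod_linear:
  assumes "finite A"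
  shows "poly.coeff (\<Prod>l\<in>A. 1 - Polynomial.smult (c l) neg_X) r = (\<Sum>D | D \<subseteq> A \<and> card D = r. \<Prod>l\<in>D. c l)"
proof -
  have "(\<Prod>l\<in>A. 1 - Polynomial.smult (c l) neg_X) = (\<Prod>l\<in>A. Polynomial.monom (c l) 1 + 1)"
    by (rule prod.cong) (simp_all add: smult_monom minus_monom[symmetric])
  also have "\<dots> = (\<Sum>D\<in>Pow A. \<Prod>l\<in>D. Polynomial.monom (c l) 1)"
    unfolding prod_add[OF assms] by simp
  also have "\<dots> = (\<Sum>D\<in>Pow A. Polynomial.monom (\<Prod>l\<in>D. c l) (card D))"
  proof (rule sum.cong[OF refl])
    fix D assume "D \<in> Pow A"
    then have "finite D" using assms finite_subset by auto
    then show "(\<Prod>l\<in>D. Polynomial.monom (c l) 1) = Polynomial.monom (\<Prod>l\<in>D. c l) (card D)"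
      by (induction D rule: finite_induct) (simp_all add: mult_monom)
  qed
  also have "poly.coeff \<dots> r = (\<Sum>D\<in>Pow A. if card D = r then \<Prod>l\<in>D. c l else 0)"
    by (simp add: coeff_sum)
  also have "\<dots> = (\<Sum>D | D \<in> Pow A \<and> card D = r. \<Prod>l\<in>D. c l)"
    by (rule sum.inter_filter[symmetric]) (use assms in simp)
  finally show ?thesis by simp
qed

lemma root1_0 [simp]: "root1 j 0 = 1"
  by (simp add: root1_def)

lemma root1_sum: "finite D \<Longrightarrow> (\<Prod>l\<in>D. root1 j (i * l)) = root1 j (i * \<Sum>D)"
  by (induction D rule: finite_induct) (simp_all add: root1_add distrib_left)

lemma sum_root1:
  assumes "0 < j"
  shows "(\<Sum>i<j. root1 j (i * m)) = (if j dvd m then of_nat j else 0)"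
proof (cases "j dvd m")
  case True
  then have "root1 j (i * m) = 1" for i using root1_eq_1_iff[OF assms, of "i * m"] by simp
  then show ?thesis using True by simp
next
  case False
  then have ne: "root1 j m \<noteq> 1" using root1_eq_1_iff[OF assms] by simp
  have "(\<Sum>i<j. root1 j (i * m)) = (\<Sum>i<j. root1 j m ^ i)" by (simp add: root1_power)
  also have "\<dots> = (root1 j m ^ j - 1) / (root1 j m - 1)" by (rule geometric_sum[OF ne])
  also have "root1 j m ^ j = 1" unfolding root1_power root1_eq_1_iff[OF assms] by simp
  finally show ?thesis using False by simp
qed

text \<open>Summing over all rotations is a root of unity filter: it keeps the subsets whose sum is
  divisible by \<open>j\<close>, each with weight \<open>j\<close>.\<close>

theorem mult_hook_cyc:
  assumes j: "0 < j" "j \<le> N" and r: "r < j"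
  shows "mult N (hook j r) (cyc N j) = int (j * card {D. D \<subseteq> {1..<j} \<and> card D = r \<and> j dvd \<Sum>D})"
proof -
  let ?S = "{D. D \<subseteq> {1..<j} \<and> card D = r}"
  have finS: "finite ?S" by (rule finite_subset[of _ "Pow {1..<j}"]) auto
  have "of_int (mult N (hook j r) (cyc N j)) = (\<Sum>i<j. poly.coeff (hook_poly N j (fixpoly N j (rot j i))) r)"
    using r by (simp add: cyc_def mult_sum coeff_hook_poly)
  also have "\<dots> = (\<Sum>i<j. \<Sum>D\<in>?S. root1 j (i * \<Sum>D))"
    unfolding hook_poly_fixpoly_rot[OF j] coeff_prod_linear[OF finite_atLeastLessThan]
    by (intro sum.cong refl root1_sum) (auto intro: finite_subset)
  also have "\<dots> = (\<Sum>D\<in>?S. if j dvd \<Sum>D then of_nat j else 0)"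
    by (subst sum.swap) (simp add: sum_root1[OF j(1)])
  also have "\<dots> = (\<Sum>D\<in>{D \<in> ?S. j dvd \<Sum>D}. of_nat j)" by (rule sum.inter_filter[symmetric, OF finS])
  also have "\<dots> = of_int (int (j * card {D. D \<subseteq> {1..<j} \<and> card D = r \<and> j dvd \<Sum>D}))"
    by (simp add: mult.commute conj_assoc)
  finally show ?thesis by (simp only: of_int_eq_iff)
qed

lemma mult_even_hook_cyc_ge:
  assumes j: "0 < j" "j \<le> N" and r: "r < j" "even r"
  shows "int j \<le> mult N (hook j r) (cyc N j)"
proof -
  let ?C = "{D. D \<subseteq> {1..<j} \<and> card D = r \<and> j dvd \<Sum>D}"
  obtain m where m: "r = 2 * m" using r(2) by (auto elim: evenE)
  have mj: "2 * m < j" using r(1) m by simp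
  \<comment> \<open>Each pair \<open>{l, j - l}\<close> has sum \<open>j\<close>, and
    \<open>2 * m < j\<close> keeps all \<open>2 * m\<close> members distinct.\<close>
  define D where "D = {1..m} \<union> (\<lambda>l. j - l) ` {1..m}"
  have inj: "inj_on (\<lambda>l. j - l) {1..m}" using mj by (auto simp: inj_on_def)
  have disj: "{1..m} \<inter> (\<lambda>l. j - l) ` {1..m} = {}" using mj by auto
  have "card D = r" unfolding D_def using m by (subst card_Un_disjoint) (simp_all add: disj card_image[OF inj] del: One_nat_def)
  moreover have "D \<subseteq> {1..<j}" using mj by (auto simp: D_def)
  moreover have "\<Sum>D = j * m"
  proof -
    have "\<Sum>D = (\<Sum>l\<in>{1..m}. l) + (\<Sum>l\<in>{1..m}. j - l)"
      unfolding D_def by (subst sum.union_disjoint) (simp_all add: disj sum.reindex[OF inj] del: One_nat_def)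
    also have "\<dots> = (\<Sum>l\<in>{1..m}. j)" unfolding sum.distrib[symmetric] by (rule sum.cong) (use mj in auto)
    finally show ?thesis by (simp add: mult.commute)
  qed
  ultimately have "D \<in> ?C" by simp
  moreover have "finite ?C" by (rule finite_subset[of _ "Pow {1..<j}"]) auto
  ultimately have "0 < card ?C" by (auto simp: card_gt_0_iff)
  then have "j * 1 \<le> j * card ?C" by (intro mult_le_mono2) simp
  then show ?thesis unfolding mult_hook_cyc[OF j r(1)] by (simp del: of_nat_mult)
qed

lemma alt_cycle:
  "i + d < N \<Longrightarrow> alt N (\<lambda>l. if l = i then b (i + d) else if i < l \<and> l \<le> i + d then b (l - 1) else b l) = (- 1) ^ d * alt N b"
proof (induction d arbitrary: b)
  case 0
  have "(\<lambda>l. if l = i then b (i + 0) else if i < l \<and> l \<le> i + 0 then b (l - 1) else b l) = b" by auto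
  then show ?case by simp
next
  case (Suc d)
  let ?s = "transpose (i + d) (Suc (i + d))"
  have "(\<lambda>l. if l = i then b (i + Suc d) else if i < l \<and> l \<le> i + Suc d then b (l - 1) else b l) =
    (\<lambda>l. if l = i then (b \<circ> ?s) (i + d) else if i < l \<and> l \<le> i + d then (b \<circ> ?s) (l - 1) else (b \<circ> ?s) l)"
    by (auto simp: fun_eq_iff transpose_def)
  then show ?case using Suc alt_swap[of "i + d" N "Suc (i + d)" b] by simp
qed

section \<open>Hook sums and the estimate for a large first part\<close>

lemma schur_positive_minusI:
  assumes "schur_span N n f" "schur_span N n g" "n \<le> N" "\<And>nu. is_partition n nu \<Longrightarrow> mult N nu g \<le> mult N nu f"
  shows "schur_positive N n (f - g)"
  using assms by (intro schur_positiveI schur_span_minus) (auto simp: mult_diff)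

definition hook_sum :: "nat \<Rightarrow> nat \<Rightarrow> (nat \<Rightarrow> bool) \<Rightarrow> mpoly" where
  "hook_sum N j P = (\<Sum>r | r < j \<and> P r. schur N (hook j r))"

lemma schur_positive_hook_sum: "schur_positive N j (hook_sum N j P)"
  unfolding hook_sum_def by (intro schur_positive_sum schur_positive_schur hook_partition) simp

lemma inj_hook: "hook j r = hook j r' \<Longrightarrow> r = r'"
  by (auto simp: hook_def dest: arg_cong[of "replicate _ _" _ length])

lemma mult_hook_sum:
  assumes "is_partition j nu" "j \<le> N"
  shows "mult N nu (hook_sum N j P) = (if \<exists>r<j. P r \<and> nu = hook j r then 1 else 0)"
proof -
  have len: "length nu \<le> N" using is_partitionD(4)[OF assms(1)] assms(2) by simp
  have "mult N nu (hook_sum N j P) = (\<Sum>r | r < j \<and> P r. if hook j r = nu then 1 else 0)"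
    unfolding hook_sum_def mult_sum
  proof (rule sum.cong[OF refl])
    fix r assume "r \<in> {r. r < j \<and> P r}"
    then have r: "is_partition j (hook j r)" using hook_partition by simp
    show "mult N nu (schur N (hook j r)) = (if hook j r = nu then 1 else 0)"
      using mult_schur[OF r assms(1) _ len] is_partitionD(4)[OF r] assms(2) by simp
  qed
  also have "\<dots> = (if \<exists>r<j. P r \<and> nu = hook j r then 1 else 0)"
  proof (cases "\<exists>r<j. P r \<and> nu = hook j r")
    case True
    then obtain r where r: "r < j" "P r" "nu = hook j r" by blast
    have "(\<Sum>r | r < j \<and> P r. if hook j r = nu then 1 else 0) = (\<Sum>r' | r' < j \<and> P r'. if r' = r then 1 else 0 :: int)"
      by (rule sum.cong) (auto simp: r dest: inj_hook)
    then show ?thesis using True r by simp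
  next
    case False
    then have "(if hook j r = nu then 1 else 0) = (0 :: int)" if "r \<in> {r. r < j \<and> P r}" for r using that by auto
    then show ?thesis using False by simp
  qed
  finally show ?thesis .
qed

text \<open>Raising the staircase entry \<open>i\<close> by \<open>j\<close> makes it equal to the
  entry \<open>i - j\<close> when \<open>i \<ge> j\<close>. For \<open>i < j\<close>, moving it to
  the front gives the beta numbers of the hook with leg \<open>i\<close> and the sign
  \<open>(- 1) ^ i\<close>.\<close>

lemma power_sum_eq_hooks:
  assumes j: "0 < j" "j \<le> N"
  shows "power_sum N j = hook_sum N j even - hook_sum N j odd"
proof -
  let ?V = "alt N (stair N)"
  let ?b = "\<lambda>i. (stair N)(i := stair N i + j)"
  have "?V * power_sum N j = (\<Sum>i<N. alt N (?b i))" by (rule alt_mult_power_sum)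
  also have "\<dots> = (\<Sum>i<j. alt N (?b i))"
  proof (rule sum.mono_neutral_right)
    show "\<forall>i\<in>{..<N} - {..<j}. alt N (?b i) = 0"
    proof
      fix i assume "i \<in> {..<N} - {..<j}"
      then show "alt N (?b i) = 0" using j by (intro alt_eq_0[of i N "i - j"]) (auto simp: stair_def)
    qed
  qed (use j in auto)
  also have "\<dots> = (\<Sum>i<j. ?V * ((- 1) ^ i * schur N (hook j i)))"
  proof (rule sum.cong[OF refl])
    fix i assume "i \<in> {..<j}"
    then have i: "i < j" by simp
    have part: "is_partition j (hook j i)" using hook_partition[OF i] .
    have "beta N (hook j i) l = (if l = 0 then ?b i (0 + i) else if 0 < l \<and> l \<le> 0 + i then ?b i (l - 1) else ?b i l)"
      if "l < N" for l
      using i j that by (auto simp: beta_hook stair_def)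
    then have "alt N (beta N (hook j i)) = alt N (\<lambda>l. if l = 0 then ?b i (0 + i) else if 0 < l \<and> l \<le> 0 + i then ?b i (l - 1) else ?b i l)"
      by (rule alt_cong)
    also have "\<dots> = (- 1) ^ i * alt N (?b i)" by (rule alt_cycle) (use i j in simp)
    finally have eq: "alt N (?b i) = (- 1) ^ i * alt N (beta N (hook j i))"
      by (simp add: mult.assoc[symmetric] power_add[symmetric])
    have "length (hook j i) \<le> N" using is_partitionD(4)[OF part] j by simp
    then show "alt N (?b i) = ?V * ((- 1) ^ i * schur N (hook j i))"
      unfolding eq by (simp add: alt_stair_schur[OF part, symmetric] mult.left_commute)
  qed
  finally have "power_sum N j = (\<Sum>i<j. (- 1) ^ i * schur N (hook j i))"
    unfolding sum_distrib_left[symmetric] using alt_stair_nonzero by simp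
  also have "\<dots> = (\<Sum>i<j. (if even i then schur N (hook j i) else 0) - (if odd i then schur N (hook j i) else 0))"
    by (rule sum.cong) auto
  also have "\<dots> = hook_sum N j even - hook_sum N j odd"
    unfolding sum_subtractf hook_sum_def
    by (intro arg_cong2[where f="(-)"]; subst sum.inter_filter[symmetric]) auto
  finally show ?thesis .
qed

lemma schur_positive_cyc_minus_hooks:
  assumes j: "0 < j" "j \<le> N"
  shows "schur_positive N j (cyc N j - of_int (int j) * hook_sum N j even)"
proof (rule schur_positive_minusI[OF schur_span_cyc[OF j(2,1)] _ j(2)])
  show "schur_span N j (of_int (int j) * hook_sum N j even)"
    by (intro schur_span_of_int schur_positive_span schur_positive_hook_sum)
  fix nu assume nu: "is_partition j nu"
  show "mult N nu (of_int (int j) * hook_sum N j even) \<le> mult N nu (cyc N j)"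
    unfolding mult_of_int mult_hook_sum[OF nu j(2)]
    using mult_even_hook_cyc_ge[OF j] schur_positive_mult_ge_0[OF schur_positive_cyc[OF j(2,1)] j(2) nu] by auto
qed

lemma schur_positive_power_sum_1: "1 \<le> N \<Longrightarrow> schur_positive N 1 (power_sum N 1)"
proof -
  have "hook_sum N 1 odd = 0"
    unfolding hook_sum_def by (rule sum.neutral) auto
  then show "1 \<le> N \<Longrightarrow> schur_positive N 1 (power_sum N 1)"
    using power_sum_eq_hooks[of 1 N] schur_positive_hook_sum[of N 1 even] by simp
qed

text \<open>Every hook of size \<open>m\<close> with odd leg arises from one of size
  \<open>m - 1\<close> with even leg by adding a cell to the leg. This is what allows odd hooks to
  be covered although the lower bound for \<open>psi_full\<close> provides even ones only.\<close>

lemma schur_positive_even_hooks_minus_odd_hooks: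
  assumes m: "2 \<le> m" "m \<le> N"
  shows "schur_positive N m (power_sum N 1 * hook_sum N (m - 1) even - hook_sum N m odd)"
proof -
  let ?E = "hook_sum N (m - 1) even"
  have "schur_positive N (1 + (m - 1)) (power_sum N 1 * ?E)"
    using m by (intro schur_positive_mult schur_positive_power_sum_1 schur_positive_hook_sum) auto
  then have E: "schur_positive N m (power_sum N 1 * ?E)" using m by simp
  show ?thesis
  proof (rule schur_positive_minusI[OF schur_positive_span[OF E] _ m(2)])
    show "schur_span N m (hook_sum N m odd)" by (intro schur_positive_span schur_positive_hook_sum)
    fix nu assume nu: "is_partition m nu"
    have "1 \<le> mult N (hook m r) (power_sum N 1 * ?E)" if r: "r < m" "odd r" for r
    proof -
      have span: "schur_span N (m - 1) ?E" by (intro schur_positive_span schur_positive_hook_sum)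
      have r1: "r - 1 < m - 1" "even (r - 1)" "1 \<le> r" using r by (auto elim!: oddE)
      have le: "m - 1 \<le> N" using m by simp
      have "mult N (hook (m - 1) (r - 1)) ?E = 1"
        unfolding mult_hook_sum[OF hook_partition[OF r1(1)] le] by (rule if_P) (use r1 in blast)
      moreover have "0 \<le> mult N (hook (m - 1) r) ?E" if "1 < m - r"
        using that by (intro schur_positive_mult_ge_0[OF schur_positive_hook_sum le] hook_partition) simp
      ultimately show ?thesis
        using mult_hook_power_sum_mult[OF span, of r] r1(3) r m by simp
    qed
    then show "mult N nu (hook_sum N m odd) \<le> mult N nu (power_sum N 1 * ?E)"
      using mult_hook_sum[OF nu m(2)] schur_positive_mult_ge_0[OF E m(2) nu] by auto
  qed
qed

text \<open>The factor \<open>j\<close> by which \<open>cyc N j\<close> dominates the even hooks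
  cancels the denominator in \<open>mult_psi_full_ge\<close>, so each even hook sum enters with
  coefficient one.\<close>

lemma schur_positive_psi_full_minus_even_hooks:
  assumes n: "n \<le> N" "n < 2 * l" "0 < l" "l \<le> n"
  shows "schur_positive N n (psi_full N n - (\<Sum>j\<in>{l..n}. hook_sum N j even * psi_full N (n - j)))"
proof (rule schur_positive_minusI[OF schur_span_psi_full[OF n(1)] _ n(1)])
  let ?E = "\<lambda>j. hook_sum N j even * psi_full N (n - j)"
  have jn: "j + (n - j) = n" "0 < j" "j \<le> N" "n - j \<le> N" if "j \<in> {l..n}" for j using that n by auto
  have E: "schur_positive N n (?E j)" if j: "j \<in> {l..n}" for j
    using schur_positive_mult[OF schur_positive_hook_sum[of N j even] schur_positive_psi_full[of "n - j" N]] jn[OF j] n(1) by simp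
  then show "schur_span N n (\<Sum>j\<in>{l..n}. ?E j)" by (intro schur_span_sum schur_positive_span) simp
  fix nu assume nu: "is_partition n nu"
  have le: "real_of_int (mult N nu (?E j)) \<le> mult N nu (cyc N j * psi_full N (n - j)) / j" if j: "j \<in> {l..n}" for j
  proof -
    have "schur_positive N n ((cyc N j - of_int (int j) * hook_sum N j even) * psi_full N (n - j))"
      using schur_positive_mult[OF schur_positive_cyc_minus_hooks[of j N] schur_positive_psi_full[of "n - j" N]] jn[OF j] n(1) by simp
    from schur_positive_mult_ge_0[OF this n(1) nu]
    have "int j * mult N nu (?E j) \<le> mult N nu (cyc N j * psi_full N (n - j))"
      unfolding left_diff_distrib mult_diff mult.assoc mult_of_int by simp
    then have "real_of_int (int j * mult N nu (?E j)) \<le> mult N nu (cyc N j * psi_full N (n - j))"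
      by (simp only: of_int_le_iff)
    then show ?thesis using jn[OF j] by (simp add: pos_le_divide_eq mult.commute)
  qed
  have "real_of_int (mult N nu (\<Sum>j\<in>{l..n}. ?E j)) = (\<Sum>j\<in>{l..n}. real_of_int (mult N nu (?E j)))"
    by (simp add: mult_sum)
  also have "\<dots> \<le> (\<Sum>j\<in>{l..n}. mult N nu (cyc N j * psi_full N (n - j)) / j)" by (rule sum_mono) (rule le)
  also have "\<dots> \<le> mult N nu (psi_full N n)" by (rule mult_psi_full_ge[OF nu n(1,2,3)])
  finally show "mult N nu (\<Sum>j\<in>{l..n}. ?E j) \<le> mult N nu (psi_full N n)" by simp
qed

text \<open>With power sums written as even minus odd hooks, the terms to be covered are E_(n-j)
  psi_j for j < k, E_m A and O_m B. The terms of the lower bound with remainder at most k cover the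
  first two kinds, as A is dominated by psi_k. For the last, O_m is dominated by p_1 E_(m-1) and p_1
  B by psi_(k+1), which uses up the term E_(m-1) psi_(k+1).\<close>

theorem schur_positive_psi_full_minus:
  assumes n: "m + k = n" "n \<le> N" "n < 2 * (m - 1)" "2 \<le> m"
    and A: "schur_positive N k A" "schur_positive N k (psi_full N k - A)"
    and B: "schur_positive N k B" "schur_positive N (k + 1) (psi_full N (k + 1) - power_sum N 1 * B)"
  shows "schur_positive N n (psi_full N n - (\<Sum>j<k. power_sum N (n - j) * psi_full N j) - power_sum N m * (A - B))"
proof -
  let ?E = "\<lambda>j. hook_sum N j even" and ?O = "\<lambda>j. hook_sum N j odd" and ?p = "power_sum N" and ?\<psi> = "psi_full N"
  define f where "f = ?\<psi> n - (\<Sum>j\<in>{m - 1..n}. ?E j * ?\<psi> (n - j))"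
  have f: "schur_positive N n f"
    unfolding f_def by (rule schur_positive_psi_full_minus_even_hooks) (use n in auto)
  have "(\<Sum>j\<in>{m - 1..n}. ?E j * ?\<psi> (n - j)) = (\<Sum>j\<le>k + 1. ?E (n - j) * ?\<psi> j)"
    by (rule sum.reindex_bij_witness[of _ "\<lambda>j. n - j" "\<lambda>j. n - j"]) (use n in auto)
  also have "\<dots> = (\<Sum>j<k. ?E (n - j) * ?\<psi> j) + ?E m * ?\<psi> k + ?E (m - 1) * ?\<psi> (k + 1)"
  proof -
    have "n - k = m" "n - (k + 1) = m - 1" using n by auto
    then show ?thesis by (simp add: lessThan_Suc_atMost[symmetric])
  qed
  finally have f_eq: "f = ?\<psi> n - ((\<Sum>j<k. ?E (n - j) * ?\<psi> j) + ?E m * ?\<psi> k + ?E (m - 1) * ?\<psi> (k + 1))" by (simp add: f_def)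
  have p: "?p j = ?E j - ?O j" if "0 < j" "j \<le> n" for j using power_sum_eq_hooks[of j N] that n by simp
  have S: "(\<Sum>j<k. ?p (n - j) * ?\<psi> j) = (\<Sum>j<k. ?E (n - j) * ?\<psi> j) - (\<Sum>j<k. ?O (n - j) * ?\<psi> j)"
    unfolding sum_subtractf[symmetric] by (rule sum.cong) (use n in \<open>simp_all add: p left_diff_distrib\<close>)
  have pm: "?p m = ?E m - ?O m" using p n by simp
  \<comment> \<open>The right-hand side consists of Schur-positive summands: \<open>f\<close> is
    what the lower bound leaves over, and the others are products that enter with a plus sign or
    contain one of the differences assumed or shown to be positive.\<close>
  have eq: "?\<psi> n - (\<Sum>j<k. ?p (n - j) * ?\<psi> j) - ?p m * (A - B) =
    f + (\<Sum>j<k. ?O (n - j) * ?\<psi> j) + ?E m * (?\<psi> k - A) + ?O m * A + ?E m * B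
      + ?E (m - 1) * (?\<psi> (k + 1) - ?p 1 * B) + (?p 1 * ?E (m - 1) - ?O m) * B"
    unfolding f_eq S pm by (simp add: algebra_simps)
  have pos: "schur_positive N n (x * y)" if "schur_positive N a x" "schur_positive N b y" "a + b = n" for a b x y
    using schur_positive_mult[OF that(1,2)] that(3) n(2) by simp
  have O: "schur_positive N n (?O (n - j) * ?\<psi> j)" if "j < k" for j
    using that n by (intro pos[OF schur_positive_hook_sum schur_positive_psi_full]) auto
  have D: "schur_positive N m (?p 1 * ?E (m - 1) - ?O m)"
    by (rule schur_positive_even_hooks_minus_odd_hooks) (use n in auto)
  have k1: "m - 1 + (k + 1) = n" using n by simp
  note h = schur_positive_hook_sum
  show ?thesis
    unfolding eq
    by (intro schur_positive_add f schur_positive_sum pos[OF h A(2) n(1)] pos[OF h A(1) n(1)]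
        pos[OF h B(1) n(1)] pos[OF h B(2) k1] pos[OF D B(1) n(1)]) (simp add: O)
qed

section \<open>The Murnaghan-Nakayama rule\<close>

text \<open>The Murnaghan-Nakayama rule on decreasing lists of beta numbers: removing a border strip of size \<open>a\<close>
  lowers one of them by \<open>a\<close>, and \<open>sink\<close> restores the order, with the resulting sign.\<close>

fun sink :: "(nat list \<Rightarrow> int) \<Rightarrow> nat list \<Rightarrow> nat \<Rightarrow> nat list \<Rightarrow> int" where
  "sink F pre v [] = F (rev pre @ [v])"
| "sink F pre v (y # ys) = (if y < v then F (rev pre @ v # y # ys) else if y = v then 0 else - sink F (y # pre) v ys)"

fun remove_strips :: "(nat list \<Rightarrow> int) \<Rightarrow> nat \<Rightarrow> nat list \<Rightarrow> nat list \<Rightarrow> int" where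
  "remove_strips F a pre [] = 0"
| "remove_strips F a pre (x # xs) = (if a \<le> x then sink F pre (x - a) xs else 0) + remove_strips F a (x # pre) xs"

fun murnaghan :: "(nat list \<Rightarrow> int) \<Rightarrow> nat list \<Rightarrow> nat list \<Rightarrow> int" where
  "murnaghan F [] b = F b"
| "murnaghan F (a # la) b = remove_strips (murnaghan F la) a [] b"

text \<open>The coefficient function of a sum of Schur functions given by the beta lists of their
  shapes; this is where strip removal ends.\<close>

fun count_in :: "nat list list \<Rightarrow> nat list \<Rightarrow> int" where
  "count_in [] b = 0"
| "count_in (t # ts) b = (if t = b then 1 else 0) + count_in ts b"

definition beta_list :: "nat \<Rightarrow> nat list \<Rightarrow> nat list" where
  "beta_list L la = map (\<lambda>i. part la i + (L - 1 - i)) [0..<L]"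

text \<open>Beta numbers of a partition, known from its first \<open>length b\<close> rows, with respect to \<open>N\<close> rows.\<close>

definition beta_of_list :: "nat \<Rightarrow> nat list \<Rightarrow> nat \<Rightarrow> nat" where
  "beta_of_list N b i = (if i < length b then b ! i + (N - length b) else N - 1 - i)"

text \<open>\<open>F\<close> is trusted only on strictly decreasing lists, and \<open>A\<close>
  extends it antisymmetrically. Each step of \<open>sink\<close> is one swap of neighbours, and
  equal neighbours give zero.\<close>

lemma sink_eq:
  assumes anti: "\<And>xs y v zs. length xs + length zs + 2 = L \<Longrightarrow> A (xs @ y # v # zs) = - A (xs @ v # y # zs)"
    and F: "\<And>b. sorted_wrt (>) b \<Longrightarrow> length b = L \<Longrightarrow> F b = A b"
  shows "length pre + length ys + 1 = L \<Longrightarrow> sorted_wrt (>) (rev pre @ ys) \<Longrightarrow> (\<And>x. x \<in> set pre \<Longrightarrow> v < x) \<Longrightarrow>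
    sink F pre v ys = A (rev pre @ v # ys)"
proof (induction ys arbitrary: pre)
  case (Cons y ys)
  consider "y < v" | "y = v" | "v < y" by linarith
  then show ?case
  proof cases
    case 1
    then have "F (rev pre @ v # y # ys) = A (rev pre @ v # y # ys)"
      using Cons.prems by (intro F) (auto simp: sorted_wrt_append)
    then show ?thesis using 1 by simp
  next
    case 2
    then show ?thesis using anti[of "rev pre" ys v v] Cons.prems(1) by simp
  next
    case 3
    then have "sink F (y # pre) v ys = A (rev (y # pre) @ v # ys)"
      using Cons.prems by (intro Cons.IH) auto
    then show ?thesis using 3 anti[of "rev pre" ys y v] Cons.prems(1) by simp
  qed
qed (simp add: F sorted_wrt_append)

lemma remove_strips_eq:
  assumes anti: "\<And>xs y v zs. length xs + length zs + 2 = L \<Longrightarrow> A (xs @ y # v # zs) = - A (xs @ v # y # zs)"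
    and F: "\<And>b. sorted_wrt (>) b \<Longrightarrow> length b = L \<Longrightarrow> F b = A b"
  shows "length pre + length xs = L \<Longrightarrow> sorted_wrt (>) (rev pre @ xs) \<Longrightarrow>
    remove_strips F a pre xs = (\<Sum>i<length xs. if a \<le> xs ! i then A (rev pre @ xs[i := xs ! i - a]) else 0)"
proof (induction xs arbitrary: pre)
  case (Cons x xs)
  have "sink F pre (x - a) xs = A (rev pre @ (x - a) # xs)"
    using Cons.prems by (intro sink_eq[where L=L] anti F) (fastforce simp: sorted_wrt_append)+
  moreover have "remove_strips F a (x # pre) xs = (\<Sum>i<length xs. if a \<le> xs ! i then A (rev (x # pre) @ xs[i := xs ! i - a]) else 0)"
    using Cons.prems by (intro Cons.IH) auto
  ultimately show ?case by (simp add: sum.lessThan_Suc_shift del: sum.lessThan_Suc cong: if_cong)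
qed simp

text \<open>Lowering the beta number of an empty row behind the list, or lowering a listed one by
  more than its entry, hits the beta number of another empty row. So lists of fixed length
  suffice.\<close>

lemma alt_coeff_beta_of_list_power_sum_mult:
  assumes f: "schur_span N n f" "n \<le> N" and a: "0 < a" and L: "length b \<le> N"
  shows "alt_coeff N (power_sum N a * f) (beta_of_list N b) = (\<Sum>i<length b. if a \<le> b ! i then alt_coeff N f (beta_of_list N (b[i := b ! i - a])) else 0)"
proof -
  let ?L = "length b" and ?b = "beta_of_list N b"
  have "alt_coeff N (power_sum N a * f) ?b = (\<Sum>i<N. if a \<le> ?b i then alt_coeff N f (?b(i := ?b i - a)) else 0)"
    by (rule alt_coeff_power_sum_mult)
  also have "\<dots> = (\<Sum>i<?L. if a \<le> ?b i then alt_coeff N f (?b(i := ?b i - a)) else 0)"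
  proof (rule sum.mono_neutral_right)
    show "\<forall>i\<in>{..<N} - {..<?L}. (if a \<le> ?b i then alt_coeff N f (?b(i := ?b i - a)) else 0) = 0"
    proof
      fix i assume i: "i \<in> {..<N} - {..<?L}"
      have "alt_coeff N f (?b(i := ?b i - a)) = 0" if "a \<le> ?b i"
        by (rule alt_coeff_eq_0[OF f, of i "i + a"]) (use i a that in \<open>auto simp: beta_of_list_def\<close>)
      then show "(if a \<le> ?b i then alt_coeff N f (?b(i := ?b i - a)) else 0) = 0" by simp
    qed
  qed (use L in auto)
  also have "\<dots> = (\<Sum>i<?L. if a \<le> b ! i then alt_coeff N f (beta_of_list N (b[i := b ! i - a])) else 0)"
  proof (rule sum.cong[OF refl])
    fix i assume i: "i \<in> {..<?L}"
    show "(if a \<le> ?b i then alt_coeff N f (?b(i := ?b i - a)) else 0) = (if a \<le> b ! i then alt_coeff N f (beta_of_list N (b[i := b ! i - a])) else 0)"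
    proof (cases "a \<le> b ! i")
      case True
      have "?b(i := ?b i - a) = beta_of_list N (b[i := b ! i - a])" using i True by (auto simp: beta_of_list_def fun_eq_iff nth_list_update)
      then show ?thesis using True i by (simp add: beta_of_list_def)
    next
      case False
      \<comment> \<open>The lowered number falls below the listed range and equals the beta number
        of the empty row \<open>?L + (a - b ! i) - 1\<close>.\<close>
      have "alt_coeff N f (?b(i := ?b i - a)) = 0" if "a \<le> ?b i"
        by (rule alt_coeff_eq_0[OF f, of i "?L + (a - b ! i) - 1"]) (use i a that False L in \<open>auto simp: beta_of_list_def\<close>)
      then show ?thesis using False by simp
    qed
  qed
  finally show ?thesis .
qed

lemma alt_coeff_beta_of_list_swap:
  assumes f: "schur_span N n f" "n \<le> N" and L: "length xs + length zs + 2 \<le> N"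
  shows "alt_coeff N f (beta_of_list N (xs @ y # v # zs)) = - alt_coeff N f (beta_of_list N (xs @ v # y # zs))"
proof -
  let ?i = "length xs"
  have "beta_of_list N (xs @ y # v # zs) = beta_of_list N (xs @ v # y # zs) \<circ> transpose ?i (Suc ?i)"
  proof
    fix i
    consider "i < ?i" | "i = ?i" | "i = Suc ?i" | k where "i = ?i + Suc (Suc k)" 
      using that(4)[of "i - Suc (Suc ?i)"] by linarith
    then show "beta_of_list N (xs @ y # v # zs) i = (beta_of_list N (xs @ v # y # zs) \<circ> transpose ?i (Suc ?i)) i"
      by cases (simp_all add: beta_of_list_def nth_append)
  qed
  then show ?thesis using alt_coeff_swap[OF f, of ?i "Suc ?i"] L by simp
qed

lemma murnaghan_eq:
  assumes f: "schur_span N d f" and L: "L \<le> N"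
    and F: "\<And>b. sorted_wrt (>) b \<Longrightarrow> length b = L \<Longrightarrow> F b = alt_coeff N f (beta_of_list N b)"
  shows "sum_list la + d \<le> N \<Longrightarrow> (\<And>a. a \<in> set la \<Longrightarrow> 0 < a) \<Longrightarrow>
    schur_span N (sum_list la + d) (power_sum_part N la * f) \<and>
    (\<forall>b. sorted_wrt (>) b \<longrightarrow> length b = L \<longrightarrow> murnaghan F la b = alt_coeff N (power_sum_part N la * f) (beta_of_list N b))"
proof (induction la)
  case Nil
  then show ?case using f F by simp
next
  case (Cons a la)
  let ?g = "power_sum_part N la * f"
  have IH: "schur_span N (sum_list la + d) ?g"
    "\<And>b. sorted_wrt (>) b \<Longrightarrow> length b = L \<Longrightarrow> murnaghan F la b = alt_coeff N ?g (beta_of_list N b)"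
    using Cons by auto
  have le: "sum_list la + d \<le> N" and a: "0 < a" using Cons.prems by auto
  have eq: "sum_list (a # la) + d = sum_list la + d + a" "power_sum_part N (a # la) * f = power_sum N a * ?g"
    by (simp, simp only: power_sum_part_simps mult.assoc)
  have "schur_span N (sum_list (a # la) + d) (power_sum_part N (a # la) * f)"
    unfolding eq by (rule schur_span_mult_power_sum[OF IH(1) le])
  moreover have "murnaghan F (a # la) b = alt_coeff N (power_sum_part N (a # la) * f) (beta_of_list N b)"
    if b: "sorted_wrt (>) b" "length b = L" for b
  proof -
    have "murnaghan F (a # la) b = (\<Sum>i<length b. if a \<le> b ! i then alt_coeff N ?g (beta_of_list N (rev [] @ b[i := b ! i - a])) else 0)"
      unfolding murnaghan.simps
    proof (rule remove_strips_eq[where L=L and A="\<lambda>b. alt_coeff N ?g (beta_of_list N b)"])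
      show "alt_coeff N ?g (beta_of_list N (xs @ y # v # zs)) = - alt_coeff N ?g (beta_of_list N (xs @ v # y # zs))" if "length xs + length zs + 2 = L" for xs y v zs
        by (rule alt_coeff_beta_of_list_swap[OF IH(1) le]) (use that L in simp)
    qed (use b IH(2) in auto)
    also have "\<dots> = alt_coeff N (power_sum_part N (a # la) * f) (beta_of_list N b)"
      unfolding eq rev.simps append_Nil by (rule alt_coeff_beta_of_list_power_sum_mult[OF IH(1) le a, symmetric]) (use b L in simp)
    finally show ?thesis .
  qed
  ultimately show ?case by blast
qed

lemma length_beta_list [simp]: "length (beta_list L la) = L"
  by (simp add: beta_list_def)

lemma beta_of_list_beta_list: "length la \<le> L \<Longrightarrow> L \<le> N \<Longrightarrow> i < N \<Longrightarrow> beta_of_list N (beta_list L la) i = beta N la i"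
  by (auto simp: beta_of_list_def beta_list_def beta_def stair_def part_def)

lemma sorted_beta_list: "sorted_wrt (\<ge>) la \<Longrightarrow> sorted_wrt (>) (beta_list L la)"
  unfolding sorted_wrt_iff_nth_less[of "(>)"]
proof (intro allI impI)
  fix i j assume "sorted_wrt (\<ge>) la" "i < j" "j < length (beta_list L la)"
  then show "beta_list L la ! j < beta_list L la ! i" using part_antimono[of la i j] by (simp add: beta_list_def)
qed

lemma sdec_beta_of_list:
  assumes "sorted_wrt (>) b" "length b \<le> N"
  shows "sdec N (beta_of_list N b)"
  unfolding sdec_def
proof (intro allI impI)
  fix i j assume ij: "i < j" "j < N"
  then show "beta_of_list N b j < beta_of_list N b i"
    using assms sorted_wrt_nth_less[OF assms(1), of i j] by (auto simp: beta_of_list_def)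
qed

lemma alt_coeff_schur:
  assumes al: "is_partition d al" "length al \<le> L" and b: "sorted_wrt (>) b" "length b = L" "L \<le> N"
  shows "alt_coeff N (schur N al) (beta_of_list N b) = (if beta_list L al = b then 1 else 0)"
proof -
  have "alt_coeff N (schur N al) (beta_of_list N b) = (if \<forall>i<N. beta N al i = beta_of_list N b i then 1 else 0)"
    using lookup_alt_sdec[OF sdec_beta[OF is_partitionD(1)[OF al(1)]] sdec_beta_of_list[OF b(1)], of N]
      alt_stair_schur[OF al(1), of N] al(2) b by (simp add: alt_coeff_def)
  moreover have "(\<forall>i<N. beta N al i = beta_of_list N b i) \<longleftrightarrow> beta_list L al = b"
  proof
    assume eq: "\<forall>i<N. beta N al i = beta_of_list N b i"
    show "beta_list L al = b"
    proof (rule nth_equalityI)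
      fix i assume "i < length (beta_list L al)"
      then have i: "i < L" by simp
      then have "beta_of_list N (beta_list L al) i = beta_of_list N b i" using eq beta_of_list_beta_list[OF al(2) b(3), of i] b(3) by simp
      then show "beta_list L al ! i = b ! i" using i b(2) by (simp add: beta_of_list_def)
    qed (simp add: b)
  qed (use beta_of_list_beta_list[OF al(2) b(3)] in auto)
  ultimately show ?thesis by simp
qed

text \<open>Reduces a multiplicity in \<open>N\<close> variables to a computation on lists of length
  \<open>L\<close>, so that results do not depend on the number of variables.\<close>

theorem mult_power_sum_part_mult_schurs:
  assumes als: "\<And>al. al \<in> set als \<Longrightarrow> is_partition d al \<and> length al \<le> L" and la: "\<And>a. a \<in> set la \<Longrightarrow> 0 < a"
    and N: "sum_list la + d \<le> N" "L \<le> N" and nu: "is_partition e nu" "length nu \<le> L"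
  shows "mult N nu (power_sum_part N la * (\<Sum>al\<leftarrow>als. schur N al)) = murnaghan (count_in (map (beta_list L) als)) la (beta_list L nu)"
proof -
  let ?f = "\<Sum>al\<leftarrow>als. schur N al"
  have span: "schur_span N d ?f"
    using als by (induction als) (auto intro: schur_span_add schur_span_schur)
  have F: "count_in (map (beta_list L) als) b = alt_coeff N ?f (beta_of_list N b)" if b: "sorted_wrt (>) b" "length b = L" for b
    using als
  proof (induction als)
    case (Cons al als)
    have al: "is_partition d al" using Cons.prems by simp
    have "length al \<le> L" using Cons.prems by simp
    moreover have "alt_coeff N (x + y) c = alt_coeff N x c + alt_coeff N y c" for x y c by (simp add: alt_coeff_def distrib_left lookup_add)
    ultimately show ?case using Cons alt_coeff_schur[OF al _ b N(2)] by simp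
  qed (simp add: alt_coeff_def)
  have "murnaghan (count_in (map (beta_list L) als)) la (beta_list L nu) = alt_coeff N (power_sum_part N la * ?f) (beta_of_list N (beta_list L nu))"
    using murnaghan_eq[OF span N(2) F, of la] la N sorted_beta_list[OF is_partitionD(1)[OF nu(1)]] by simp
  also have "\<dots> = alt_coeff N (power_sum_part N la * ?f) (beta N nu)"
    by (rule alt_coeff_cong) (rule beta_of_list_beta_list[OF nu(2) N(2)])
  finally show ?thesis by (simp add: mult_eq_alt_coeff)
qed

text \<open>The recursion on the bound for the parts lists the partitions in increasing reverse
  lexicographic order, so initial segments of the order are prefixes of the list.\<close>

fun partition_list :: "nat \<Rightarrow> nat \<Rightarrow> nat list list" where
  "partition_list 0 n = (if n = 0 then [[]] else [])"
| "partition_list (Suc M) n = partition_list M n @ (if Suc M \<le> n then map ((#) (Suc M)) (partition_list (Suc M) (n - Suc M)) else [])"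

section \<open>Initial segments of the reverse lexicographic order\<close>

lemma is_partition_Nil [simp]: "is_partition n [] \<longleftrightarrow> n = 0"
  by (auto simp: is_partition_def)

lemma is_partition_Cons:
  "is_partition n (a # la) \<longleftrightarrow> 0 < a \<and> a \<le> n \<and> is_partition (n - a) la \<and> (\<forall>b\<in>set la. b \<le> a)"
  by (auto simp: is_partition_def)

lemma is_partition_parts_le: "is_partition n la \<Longrightarrow> a \<in> set la \<Longrightarrow> a \<le> n"
  using member_le_sum_list[of a la] is_partitionD(3)[of n la] by simp

declare partition_list.simps(2) [simp del]

lemma set_partition_list: "set (partition_list M n) = {la. is_partition n la \<and> (\<forall>a\<in>set la. a \<le> M)}"
proof (induction M n rule: partition_list.induct)
  case (1 n)
  have "is_partition n la \<and> (\<forall>a\<in>set la. a \<le> 0) \<longleftrightarrow> n = 0 \<and> la = []" for la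
    by (cases la) (auto simp: is_partition_Cons)
  then show ?case by auto
next
  case (2 M n)
  show ?case
  proof (intro equalityI subsetI CollectI)
    fix la assume "la \<in> {la. is_partition n la \<and> (\<forall>a\<in>set la. a \<le> Suc M)}"
    then have la: "is_partition n la" "\<forall>a\<in>set la. a \<le> Suc M" by auto
    show "la \<in> set (partition_list (Suc M) n)"
    proof (cases "\<forall>a\<in>set la. a \<le> M")
      case True
      then show ?thesis using la 2(1) by (simp add: partition_list.simps(2)[of M n])
    next
      case False
      then obtain a where a: "a \<in> set la" "M < a" by auto
      then obtain b la' where b: "la = b # la'" by (cases la) auto
      then have "a \<le> b" using la(1) a(1) by (auto simp: is_partition_Cons)
      then have "b = Suc M" using la(2) a b by auto
      then show ?thesis using la b 2(2) by (auto simp: is_partition_Cons partition_list.simps(2)[of M n])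
    qed
  next
    fix la assume "la \<in> set (partition_list (Suc M) n)"
    then show "is_partition n la \<and> (\<forall>a\<in>set la. a \<le> Suc M)"
      using 2 by (auto simp: is_partition_Cons partition_list.simps(2)[of M n] split: if_splits)
  qed
qed

lemma set_partition_list_full: "set (partition_list n n) = {la. is_partition n la}"
  using is_partition_parts_le by (auto simp: set_partition_list)

lemma rlex_le_simps [simp]:
  "rlex_le [] la \<longleftrightarrow> la = []" "rlex_le la [] \<longleftrightarrow> la = []"
  by (auto simp: rlex_le_def)

lemma rlex_le_Cons: "rlex_le (a # la) (b # mu) \<longleftrightarrow> a < b \<or> a = b \<and> rlex_le la mu"
proof -
  have "(\<exists>j<min (length (a # la)) (length (b # mu)). take j (a # la) = take j (b # mu) \<and> (a # la) ! j < (b # mu) ! j) \<longleftrightarrow>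
    a < b \<or> a = b \<and> (\<exists>j<min (length la) (length mu). take j la = take j mu \<and> la ! j < mu ! j)"
    (is "?l \<longleftrightarrow> ?r")
  proof
    assume ?l
    then obtain j where j: "j < min (length (a # la)) (length (b # mu))" "take j (a # la) = take j (b # mu)" "(a # la) ! j < (b # mu) ! j" by blast
    then show ?r by (cases j) auto
  next
    assume ?r
    then show ?l
    proof (elim disjE conjE exE)
      assume "a < b"
      then show ?l by (intro exI[of _ 0]) simp
    next
      fix j assume "a = b" "j < min (length la) (length mu)" "take j la = take j mu" "la ! j < mu ! j"
      then show ?l by (intro exI[of _ "Suc j"]) simp
    qed
  qed
  then show ?thesis by (auto simp: rlex_le_def)
qed

lemma rlex_le_refl: "rlex_le la la"
  by (simp add: rlex_le_def)

lemma sorted_partition_list: "sorted_wrt (\<lambda>x y. rlex_le x y \<and> \<not> rlex_le y x) (partition_list M n)"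
proof (induction M n rule: partition_list.induct)
  case (2 M n)
  have "rlex_le x (Suc M # y) \<and> \<not> rlex_le (Suc M # y) x" if "Suc M \<le> n" "x \<in> set (partition_list M n)" for x y
    using that by (cases x) (auto simp: set_partition_list rlex_le_Cons)
  then show ?case using 2 by (auto simp: partition_list.simps(2)[of M n] sorted_wrt_append sorted_wrt_map rlex_le_Cons)
qed simp

lemma distinct_sorted_rlex: "sorted_wrt (\<lambda>x y. rlex_le x y \<and> \<not> rlex_le y x) las \<Longrightarrow> distinct las"
  using rlex_le_refl by (induction las) auto

lemma partition_list_split:
  assumes "partition_list n n = xs @ mu # ys"
  shows "{la. is_partition n la \<and> rlex_le la mu} = set (xs @ [mu])" "{la. is_partition n la \<and> \<not> rlex_le la mu} = set ys"
    "distinct xs" "mu \<notin> set xs" "distinct ys"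
proof -
  let ?R = "\<lambda>x y. rlex_le x y \<and> \<not> rlex_le y x"
  have s: "sorted_wrt ?R (xs @ mu # ys)" using sorted_partition_list[of n n] assms by simp
  have part: "is_partition n la \<longleftrightarrow> la \<in> set (xs @ mu # ys)" for la using set_partition_list_full[of n] assms by auto
  show "{la. is_partition n la \<and> rlex_le la mu} = set (xs @ [mu])" "{la. is_partition n la \<and> \<not> rlex_le la mu} = set ys"
    using s rlex_le_refl[of mu] unfolding part by (auto simp: sorted_wrt_append)
  show "distinct xs" "mu \<notin> set xs" "distinct ys" using distinct_sorted_rlex[OF s] by auto
qed

lemma rlex_le_replicate_1: "(\<And>a. a \<in> set la \<Longrightarrow> 0 < a) \<Longrightarrow> rlex_le (replicate (sum_list la) 1) la"
proof (induction la)
  case (Cons a la)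
  have a: "0 < a" using Cons.prems by simp
  have "rlex_le (replicate (sum_list la) 1) la" using Cons by simp
  moreover obtain c where "a = Suc c" using a by (cases a) auto
  ultimately show ?case by (cases c) (simp_all add: rlex_le_Cons)
qed simp

lemma psi_eq: "psi N n mu = (\<Sum>la | is_partition n la \<and> rlex_le la mu. power_sum_part N la)"
proof -
  have "rlex_le (replicate n 1) la" if "is_partition n la" for la
    using rlex_le_replicate_1[of la] is_partitionD(2,3)[OF that] by simp
  then show ?thesis unfolding psi_def by (intro sum.cong) auto
qed

lemma psi_partition_list_split:
  assumes "partition_list n n = xs @ mu # ys"
  shows "psi N n mu = (\<Sum>la\<leftarrow>xs @ [mu]. power_sum_part N la)"
  using partition_list_split[OF assms] unfolding psi_eq by (simp add: sum_list_distinct_conv_sum_set)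

lemma psi_full_eq: "psi_full N n = (\<Sum>la\<leftarrow>partition_list n n. power_sum_part N la)"
proof -
  have "distinct (partition_list n n)" by (rule distinct_sorted_rlex[OF sorted_partition_list])
  then show ?thesis by (simp add: psi_full_def set_partition_list_full[symmetric] sum_list_distinct_conv_sum_set)
qed

section \<open>Verification in small degrees\<close>

fun char_sum :: "(nat list \<Rightarrow> int) \<Rightarrow> nat list \<Rightarrow> nat list list \<Rightarrow> int" where
  "char_sum F b [] = 0"
| "char_sum F b (la # las) = murnaghan F la b + char_sum F b las"

fun chars :: "(nat list \<Rightarrow> int) \<Rightarrow> nat list \<Rightarrow> nat list list \<Rightarrow> int list" where
  "chars F b [] = []"
| "chars F b (la # las) = murnaghan F la b # chars F b las"

text \<open>One pass over the character values at a fixed shape treats all \<open>mu\<close> of the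
  range at once.\<close>

fun partial_sums_nonneg :: "int \<Rightarrow> int list \<Rightarrow> bool" where
  "partial_sums_nonneg s [] = True"
| "partial_sums_nonneg s (c # cs) = (0 \<le> s + c \<and> partial_sums_nonneg (s + c) cs)"

text \<open>The length of \<open>nu\<close> is enough for the beta lists, as removing strips creates
  no rows.\<close>

definition partition_sums_nonneg :: "nat list list \<Rightarrow> nat list list \<Rightarrow> nat list \<Rightarrow> bool" where
  "partition_sums_nonneg low high nu =
    partial_sums_nonneg (char_sum (count_in [beta_list (length nu) []]) (beta_list (length nu) nu) low) (chars (count_in [beta_list (length nu) []]) (beta_list (length nu) nu) high)"

text \<open>The partitions with parts at most \<open>n - 5\<close> are those before (n-4, 1^4).
  Their sum is only the starting value; the partial sums from (n-4, 1^4) on are tested.\<close>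

definition small_check :: "nat \<Rightarrow> bool" where
  "small_check n = list_all (partition_sums_nonneg (partition_list (n - 5) n) (drop (length (partition_list (n - 5) n)) (partition_list n n))) (partition_list n n)"

lemma murnaghan_eq_mult:
  assumes "is_partition n la" "n \<le> N" "is_partition e nu" "length nu \<le> L" "L \<le> N"
  shows "murnaghan (count_in [beta_list L []]) la (beta_list L nu) = mult N nu (power_sum_part N la)"
  using mult_power_sum_part_mult_schurs[where als="[[]]" and d=0 and la=la and L=L and N=N and e=e and nu=nu] assms is_partitionD(2,3)[OF assms(1)]
  by (simp add: schur_Nil)

lemma char_sum_eq_mult:
  assumes "\<And>la. la \<in> set las \<Longrightarrow> is_partition n la" "n \<le> N" "is_partition e nu" "length nu \<le> L" "L \<le> N"
  shows "char_sum (count_in [beta_list L []]) (beta_list L nu) las = mult N nu (\<Sum>la\<leftarrow>las. power_sum_part N la)"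
  using assms(1)
proof (induction las)
  case (Cons la las)
  then show ?case using murnaghan_eq_mult[of n la N e nu L] assms(2-) by (simp add: mult_add del: count_in.simps)
qed simp

lemma schur_span_sum_list_power_sum_part:
  assumes "\<And>la. la \<in> set las \<Longrightarrow> is_partition n la" "n \<le> N"
  shows "schur_span N n (\<Sum>la\<leftarrow>las. power_sum_part N la)"
  using assms(1)
proof (induction las)
  case (Cons la las)
  then have "schur_span N n (power_sum_part N la)"
    using schur_span_power_sum_part[of la N] is_partitionD(3)[of n la] assms(2) by simp
  then show ?case using Cons by (simp add: schur_span_add)
qed simp

lemma partial_sums_nonnegD: "partial_sums_nonneg s (xs @ c # ys) \<Longrightarrow> 0 \<le> s + sum_list (xs @ [c])"
proof (induction xs arbitrary: s)
  case (Cons x xs)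
  then show ?case using Cons.IH[of "s + x"] by (simp add: add.assoc)
qed simp

lemma sum_list_chars: "sum_list (chars F b las) = char_sum F b las"
  by (induction las) simp_all

lemma chars_append: "chars F b (xs @ ys) = chars F b xs @ chars F b ys"
  and char_sum_append: "char_sum F b (xs @ ys) = char_sum F b xs + char_sum F b ys"
  by (induction xs) simp_all

lemma partition_list_prefix: "M \<le> M' \<Longrightarrow> \<exists>ys. partition_list M' n = partition_list M n @ ys"
proof (induction M' rule: dec_induct)
  case (step m)
  then show ?case by (auto simp: partition_list.simps(2)[of m n])
qed simp

theorem schur_positive_psi_small:
  assumes check: "small_check n" and mu: "is_partition n (m # rho)" "n - 4 \<le> m" "5 \<le> n"
  shows "schur_positive n n (psi n n (m # rho))"
proof -
  let ?mu = "m # rho"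
  define low high where "low = partition_list (n - 5) n" and "high = drop (length (partition_list (n - 5) n)) (partition_list n n)"
  have lh: "partition_list n n = low @ high" using partition_list_prefix[of "n - 5" n n] by (auto simp: low_def high_def)
  have "?mu \<in> set (partition_list n n)" "?mu \<notin> set low" using mu by (auto simp: set_partition_list_full set_partition_list low_def)
  then obtain xs ys where h: "high = xs @ ?mu # ys" using lh by (auto dest: split_list)
  have psi: "psi n n ?mu = (\<Sum>la\<leftarrow>low @ xs @ [?mu]. power_sum_part n la)"
    using psi_partition_list_split[of n "low @ xs" ?mu ys] lh h by simp
  have part: "is_partition n la" if "la \<in> set (low @ xs @ [?mu])" for la
    using that lh h set_partition_list_full[of n] by auto
  show ?thesis
  proof (rule schur_positiveI)
    show "schur_span n n (psi n n ?mu)" unfolding psi by (rule schur_span_sum_list_power_sum_part[OF part]) simp_all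
    fix nu assume nu: "is_partition n nu"
    let ?F = "count_in [beta_list (length nu) []]" and ?b = "beta_list (length nu) nu"
    have "partition_sums_nonneg low high nu"
      using check nu set_partition_list_full[of n] by (auto simp: small_check_def list_all_iff low_def high_def)
    then have "partial_sums_nonneg (char_sum ?F ?b low) (chars ?F ?b xs @ murnaghan ?F ?mu ?b # chars ?F ?b ys)"
      by (simp add: partition_sums_nonneg_def h chars_append)
    then have "0 \<le> char_sum ?F ?b low + sum_list (chars ?F ?b xs @ [murnaghan ?F ?mu ?b])"
      by (rule partial_sums_nonnegD)
    also have "\<dots> = char_sum ?F ?b (low @ xs @ [?mu])" by (simp add: char_sum_append sum_list_chars)
    also have "\<dots> = mult n nu (psi n n ?mu)"
      unfolding psi by (rule char_sum_eq_mult[OF part]) (use nu is_partitionD(4)[OF nu] in auto)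
    finally show "0 \<le> mult n nu (psi n n ?mu)" .
  qed simp
qed

section \<open>Domination conditions behind a large first part\<close>

fun neg_sum :: "nat \<Rightarrow> nat list list \<Rightarrow> nat list \<Rightarrow> nat list list \<Rightarrow> int" where
  "neg_sum L us b [] = 0"
| "neg_sum L us b (al # als) =
    max 0 (- char_sum (count_in [beta_list L []]) (beta_list L al) us) * murnaghan (count_in [beta_list L al]) [1] b + neg_sum L us b als"

text \<open>The condition on \<open>A\<close> in \<open>schur_positive_psi_full_minus\<close> at one
  shape, \<open>A\<close> being the positive part of the sum of the power sums over
  \<open>us\<close>.\<close>

definition pos_dominated :: "nat \<Rightarrow> nat list list \<Rightarrow> nat list list \<Rightarrow> nat list \<Rightarrow> bool" where
  "pos_dominated L us las al \<longleftrightarrow> max 0 (char_sum (count_in [beta_list L []]) (beta_list L al) us) \<le> char_sum (count_in [beta_list L []]) (beta_list L al) las"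

text \<open>The condition on \<open>B\<close> at one shape: \<open>B\<close> collects the negative
  multiplicities with reversed sign, and \<open>neg_sum\<close> is the multiplicity in p_1 B, where
  \<open>murnaghan\<close> with \<open>[1]\<close> multiplies a Schur function by p_1.\<close>

definition neg_dominated :: "nat \<Rightarrow> nat list list \<Rightarrow> nat list list \<Rightarrow> nat list list \<Rightarrow> nat list \<Rightarrow> bool" where
  "neg_dominated L us als las nu \<longleftrightarrow> neg_sum L us (beta_list L nu) als \<le> char_sum (count_in [beta_list L []]) (beta_list L nu) las"

text \<open>Applied to the ordered list of all partitions of \<open>k\<close>, it meets each
  \<open>rho\<close> together with the list \<open>us\<close> of the partitions above it. Beta lists
  of length \<open>Suc k\<close> have room for the shapes of size \<open>k + 1\<close>.\<close>

fun tail_check :: "nat \<Rightarrow> nat list list \<Rightarrow> bool" where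
  "tail_check k [] = True"
| "tail_check k (rho # us) = (list_all (pos_dominated (Suc k) us (partition_list k k)) (partition_list k k) \<and>
    list_all (neg_dominated (Suc k) us (partition_list k k) (partition_list (Suc k) (Suc k))) (partition_list (Suc k) (Suc k)) \<and> tail_check k us)"

text \<open>The conditions depend on \<open>rho\<close> but not on \<open>n\<close>, so evaluations
  in degrees at most 5 serve infinitely many cases.\<close>

lemma tail_checks: "tail_check 0 (partition_list 0 0)" "tail_check 1 (partition_list 1 1)" "tail_check 2 (partition_list 2 2)" "tail_check 3 (partition_list 3 3)" "tail_check 4 (partition_list 4 4)"
  by code_simp+

lemma tail_checkD:
  "tail_check k (xs @ rho # us) \<Longrightarrow> list_all (pos_dominated (Suc k) us (partition_list k k)) (partition_list k k) \<and>
    list_all (neg_dominated (Suc k) us (partition_list k k) (partition_list (Suc k) (Suc k))) (partition_list (Suc k) (Suc k))"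
  by (induction xs) simp_all

lemma neg_sum_eq:
  "neg_sum L us b als = (\<Sum>al\<leftarrow>als. max 0 (- char_sum (count_in [beta_list L []]) (beta_list L al) us) * murnaghan (count_in [beta_list L al]) [1] b)"
  by (induction als) (simp_all del: count_in.simps murnaghan.simps)

lemma schur_positive_of_int: "0 \<le> c \<Longrightarrow> schur_positive N n f \<Longrightarrow> schur_positive N n (of_int c * f)"
  using schur_positive_of_nat[of N n f "nat c"] by simp

lemma mult_combination:
  assumes nu: "is_partition n nu" and n: "n \<le> N"
  shows "mult N nu (\<Sum>la | is_partition n la. of_int (c la) * schur N la) = c nu"
proof -
  have "mult N nu (schur N la) = (if la = nu then 1 else 0)" if "is_partition n la" for la
    using mult_schur[OF that nu] is_partitionD(4)[OF that] is_partitionD(4)[OF nu] n by simp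
  then have "mult N nu (\<Sum>la | is_partition n la. of_int (c la) * schur N la) = (\<Sum>la | is_partition n la. c la * (if la = nu then 1 else 0))"
    by (simp add: mult_sum mult_of_int)
  then show ?thesis using nu by (simp add: if_distrib[of "(*) _"] cong: if_cong)
qed

text \<open>A partition above \<open>m # rho\<close> has a first part \<open>n - j\<close> with
  \<open>j < k\<close> and any remainder, or the first part \<open>m\<close> and a remainder above
  \<open>rho\<close>. The bound \<open>2 * k < n\<close> keeps \<open>n - j\<close> at least as
  large as every part of a partition of \<open>j \<le> k\<close>.\<close>

lemma psi_Cons_eq:
  assumes mu: "m + k = n" "2 * k < n" and rho: "is_partition k rho"
  shows "psi N n (m # rho) = psi_full N n - (\<Sum>j<k. power_sum N (n - j) * psi_full N j)
    - power_sum N m * (\<Sum>la | is_partition k la \<and> \<not> rlex_le la rho. power_sum_part N la)"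
proof -
  let ?mu = "m # rho"
  define T where "T j = {la. is_partition j la \<and> (j < k \<or> \<not> rlex_le la rho)}" for j
  let ?S = "{la. is_partition n la \<and> \<not> rlex_le la ?mu}"
  have mk: "n - k = m" using mu by simp
  have fin: "finite (T j)" for j by (rule finite_subset[OF _ finite_partitions[of j]]) (auto simp: T_def)
  have S: "?S = (\<Union>j\<in>{..k}. (#) (n - j) ` T j)"
  proof (intro equalityI subsetI)
    fix la assume "la \<in> ?S"
    then have la: "is_partition n la" "\<not> rlex_le la ?mu" by auto
    then obtain a la' where a: "la = a # la'" using mu by (cases la) auto
    then have "n - a \<le> k" "a \<le> n" "la' \<in> T (n - a)" using la mu by (auto simp: T_def is_partition_Cons rlex_le_Cons)
    then show "la \<in> (\<Union>j\<in>{..k}. (#) (n - j) ` T j)" unfolding a by (intro UN_I[of "n - a"]) auto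
  next
    fix la assume "la \<in> (\<Union>j\<in>{..k}. (#) (n - j) ` T j)"
    then obtain j la' where j: "j \<le> k" "la = (n - j) # la'" "la' \<in> T j" by auto
    have "b \<le> n - j" if "b \<in> set la'" for b
      using is_partition_parts_le[of j la' b] that j mu by (simp add: T_def)
    then show "la \<in> ?S" using j mu by (auto simp: T_def is_partition_Cons rlex_le_Cons)
  qed
  have "(\<Sum>la\<in>?S. power_sum_part N la) = (\<Sum>j\<in>{..k}. \<Sum>la\<in>(#) (n - j) ` T j. power_sum_part N la)"
    unfolding S by (rule sum.UNION_disjoint) (use fin mu in auto)
  also have "\<dots> = (\<Sum>j\<in>{..k}. power_sum N (n - j) * (\<Sum>la\<in>T j. power_sum_part N la))"
    by (rule sum.cong[OF refl]) (simp add: sum.reindex sum_distrib_left)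
  also have "\<dots> = (\<Sum>j<k. power_sum N (n - j) * (\<Sum>la\<in>T j. power_sum_part N la)) + power_sum N (n - k) * (\<Sum>la\<in>T k. power_sum_part N la)"
    by (simp add: lessThan_Suc_atMost[symmetric])
  also have "(\<Sum>j<k. power_sum N (n - j) * (\<Sum>la\<in>T j. power_sum_part N la)) = (\<Sum>j<k. power_sum N (n - j) * psi_full N j)"
    by (rule sum.cong) (simp_all add: T_def psi_full_def)
  finally have "(\<Sum>la\<in>?S. power_sum_part N la) = (\<Sum>j<k. power_sum N (n - j) * psi_full N j) +
    power_sum N m * (\<Sum>la | is_partition k la \<and> \<not> rlex_le la rho. power_sum_part N la)"
    by (simp add: T_def mk)
  moreover have "psi_full N n = psi N n ?mu + (\<Sum>la\<in>?S. power_sum_part N la)"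
    unfolding psi_full_def psi_eq
    by (subst sum.union_disjoint[symmetric]) (auto intro: sum.cong finite_subset[OF _ finite_partitions[of n]])
  ultimately show ?thesis by simp
qed

text \<open>The sum \<open>U\<close> of the power sums above \<open>rho\<close> has multiplicities
  of both signs in general. It is split into its positive part \<open>A\<close> and negative part
  \<open>B\<close>, since these are absorbed by different terms of the lower bound.\<close>

theorem schur_positive_psi_large:
  assumes check: "tail_check k (partition_list k k)" and mu: "m + k = n" "k + 2 < m" and rho: "is_partition k rho"
  shows "schur_positive n n (psi n n (m # rho))"
proof -
  let ?L = "Suc k"
  obtain xs us where xs: "partition_list k k = xs @ rho # us" using rho set_partition_list_full[of k] by (metis mem_Collect_eq split_list)
  note split = partition_list_split[OF xs]
  have kn: "k \<le> n" "Suc k \<le> n" using mu by auto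
  have us: "is_partition k la" if "la \<in> set us" for la using that split(2) by blast
  define U where "U = (\<Sum>la\<leftarrow>us. power_sum_part n la)"
  define A where "A = (\<Sum>al | is_partition k al. of_int (max 0 (mult n al U)) * schur n al)"
  define B where "B = (\<Sum>al | is_partition k al. of_int (max 0 (- mult n al U)) * schur n al)"
  have len: "length al \<le> ?L" if "is_partition k al" for al using is_partitionD(4)[OF that] by simp
  have char_sum_U: "char_sum (count_in [beta_list ?L []]) (beta_list ?L al) us = mult n al U" if "is_partition k al" for al
    unfolding U_def by (rule char_sum_eq_mult[OF us kn(1) that len[OF that] kn(2)])
  have char_sum_psi: "char_sum (count_in [beta_list ?L []]) (beta_list ?L nu) (partition_list d d) = mult n nu (psi_full n d)"
    if "is_partition e nu" "length nu \<le> ?L" "d \<le> n" for d e nu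
    unfolding psi_full_eq by (rule char_sum_eq_mult) (use that set_partition_list_full[of d] kn in auto)
  have AB: "schur_positive n k A" "schur_positive n k B"
    unfolding A_def B_def by (intro schur_positive_sum schur_positive_of_int schur_positive_schur; simp)+
  have "U = A - B"
  proof -
    have "schur_span n k U" unfolding U_def by (rule schur_span_sum_list_power_sum_part[OF us kn(1)])
    moreover have pos_neg: "max 0 x - max 0 (- x) = x" for x :: int by simp
    ultimately have "U = (\<Sum>al | is_partition k al. of_int (max 0 (mult n al U) - max 0 (- mult n al U)) * schur n al)"
      unfolding pos_neg by (intro schur_span_expand kn(1))
    then show ?thesis unfolding A_def B_def by (simp only: sum_subtractf left_diff_distrib of_int_diff)
  qed
  moreover have "U = (\<Sum>la | is_partition k la \<and> \<not> rlex_le la rho. power_sum_part n la)"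
    unfolding U_def split(2) using split(5) by (simp add: sum_list_distinct_conv_sum_set)
  ultimately have psi: "psi n n (m # rho) = psi_full n n - (\<Sum>j<k. power_sum n (n - j) * psi_full n j) - power_sum n m * (A - B)"
    using psi_Cons_eq[OF mu(1) _ rho, of n] mu by simp
  have pos: "schur_positive n k (psi_full n k - A)"
  proof (rule schur_positive_minusI[OF schur_span_psi_full[OF kn(1)] schur_positive_span[OF AB(1)] kn(1)])
    fix nu assume nu: "is_partition k nu"
    then have "pos_dominated ?L us (partition_list k k) nu"
      using tail_checkD[of k xs rho us] check xs set_partition_list_full[of k] by (auto simp: list_all_iff)
    then show "mult n nu A \<le> mult n nu (psi_full n k)"
      unfolding A_def mult_combination[OF nu kn(1)] pos_dominated_def char_sum_U[OF nu] char_sum_psi[OF nu len[OF nu] kn(1)] .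
  qed
  have neg: "schur_positive n (Suc k) (psi_full n (Suc k) - power_sum n 1 * B)"
  proof (rule schur_positive_minusI[OF schur_span_psi_full[OF kn(2)] _ kn(2)])
    show "schur_span n (Suc k) (power_sum n 1 * B)"
      using schur_span_mult_power_sum[OF schur_positive_span[OF AB(2)] kn(1), of 1] by simp
    fix nu assume nu: "is_partition (Suc k) nu"
    have lnu: "length nu \<le> ?L" using is_partitionD(4)[OF nu] .
    have "neg_dominated ?L us (partition_list k k) (partition_list ?L ?L) nu"
      using tail_checkD[of k xs rho us] check xs nu set_partition_list_full[of "Suc k"] by (auto simp: list_all_iff)
    then have le: "neg_sum ?L us (beta_list ?L nu) (partition_list k k) \<le> mult n nu (psi_full n (Suc k))"
      unfolding neg_dominated_def char_sum_psi[OF nu lnu kn(2)] .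
    have "murnaghan (count_in [beta_list ?L al]) [1] (beta_list ?L nu) = mult n nu (power_sum n 1 * schur n al)" if "is_partition k al" for al
      using mult_power_sum_part_mult_schurs[where als="[al]" and d=k and la="[1]" and L="?L" and N=n and e="?L" and nu=nu]
        that len[OF that] nu lnu kn by simp
    then have "neg_sum ?L us (beta_list ?L nu) (partition_list k k) = (\<Sum>al\<leftarrow>partition_list k k. max 0 (- mult n al U) * mult n nu (power_sum n 1 * schur n al))"
      unfolding neg_sum_eq using set_partition_list_full[of k] by (intro arg_cong[where f=sum_list] map_cong) (simp_all add: char_sum_U)
    also have "\<dots> = (\<Sum>al | is_partition k al. max 0 (- mult n al U) * mult n nu (power_sum n 1 * schur n al))"
      by (simp add: set_partition_list_full[symmetric] sum_list_distinct_conv_sum_set distinct_sorted_rlex[OF sorted_partition_list])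
    also have "\<dots> = mult n nu (power_sum n 1 * B)"
      unfolding B_def sum_distrib_left mult_sum by (simp only: mult.left_commute[of "power_sum n 1"] mult_of_int)
    finally show "mult n nu (power_sum n 1 * B) \<le> mult n nu (psi_full n (Suc k))" using le by simp
  qed
  \<comment> \<open>The assumption \<open>k + 2 < m\<close> is the condition
    \<open>n < 2 * (m - 1)\<close> of the estimate.\<close>
  show ?thesis
    unfolding psi by (rule schur_positive_psi_full_minus) (use mu AB pos neg in auto)
qed

lemma small_checks_8: "small_check 6" "small_check 7" "small_check 8"
  by code_simp+

lemma small_check_9: "small_check 9"
  by code_simp

lemma small_check_10: "small_check 10"
  by code_simp

theorem theorem2p16:
  fixes n :: nat and mu :: "nat list"
  assumes "n \<ge> 6"
    and "is_partition n mu"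
    and "rlex_le ((n - 4) # replicate 4 1) mu"
    and "rlex_le mu [n]"
  shows "schur_positive n n (psi n n mu)"
proof -
  obtain m rho where mu: "mu = m # rho" using assms(1,2) by (cases mu) auto
  have m: "n - 4 \<le> m" using assms(3) by (auto simp: mu rlex_le_Cons)
  have rho: "m \<le> n" "is_partition (n - m) rho" using assms(2) by (auto simp: mu is_partition_Cons)
  show ?thesis
  proof (cases "n \<le> 10")
    case True
    then have "n \<in> {6, 7, 8, 9, 10}" using assms(1) by auto
    then have "small_check n" using small_checks_8 small_check_9 small_check_10 by auto
    then show ?thesis unfolding mu by (rule schur_positive_psi_small) (use assms m mu in auto)
  next
    case False
    \<comment> \<open>Now \<open>n \<ge> 11\<close> and \<open>m \<ge> n - 4\<close> give
      \<open>k \<le> 4\<close> and \<open>m \<ge> 7\<close>, so \<open>k + 2 < m\<close>. For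
      \<open>n = 10\<close> and \<open>m = 6\<close> this just fails, hence the separate computation
      up to 10.\<close>
    define k where "k = n - m"
    have "k \<in> {0, 1, 2, 3, 4}" using m by (auto simp: k_def)
    then have "tail_check k (partition_list k k)" using tail_checks by auto
    then show ?thesis unfolding mu
      by (rule schur_positive_psi_large) (use False m rho in \<open>auto simp: k_def\<close>)
  qed
qed

end
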